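(* Let $\Lambda=(R,\mathbf x,k,u)$ be an object with Lefschetz hull $\mathfrak D(R)$. If $R$ is regular, then every ideal $\mathfrak a$ of $R$ is non-standard tightly closed, i.e. $\operatorname{cl}(\mathfrak a)=\mathfrak a$.
   Context: Ultraproducts. An ultraset is an infinite set with a non-principal ultrafilter; "almost all" means on a set in the ultrafilter. The ultraproduct of rings $(A_w)_{w\in\mathcal W}$ is $\prod_wA_w$ modulo the ideal of sequences almost all of whose entries are $0$; the image of $(a_w)$ is called the ultraproduct of the $a_w$; similarly for maps. The ultrapower $A^{\mathcal U}$ is the ultraproduct of copies of $A$ indexed by $\mathcal U$. Fixed data. $K$ is an uncountable field of characteristic $0$ which is the ultraproduct, over an ultraset with underlying set the primes, of algebraically closed fields $K_p$ of characteristic $p$ ($K$ is taken as large as necessary, e.g. $|K|>2^{|R|}$). For a field $L$ put $L[[n]]:=L[[X_1,\dots,X_n]]$; $K[[n]]_\infty$ is the ultraproduct of the $K_p[[n]]$. Fix an ultraset $\mathcal U$ and, for every $n$, a $K[X_1,\dots,X_n]$-algebra homomorphism $\eta_n\colon K[[n]]\to\mathfrak D(n):=(K[[n]]_\infty)^{\mathcal U}$ such that $\eta_m$ extends $\eta_n$ for $n\le m$ (such data exist). There are an ultraset $\mathcal W$ and primes $p(w)$ such that, with $K_w:=K_{p(w)}$, $\mathfrak D(n)$ is the ultraproduct over $\mathcal W$ of the $K_w[[n]]$, for all $n$, compatibly with the inclusions. Objects. $\Lambda=(R,\mathbf x,k,u)$ consists of: a Noetherian local ring $(R,\mathfrak m)$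 containing $\mathbb Q$; a subfield $k$ of $R$ such that $R/\mathfrak m$ is algebraic over the image of $k$; a ring homomorphism $u\colon R\to K$ with kernel $\mathfrak m$; and a tuple $\mathbf x=(x_1,\dots,x_n)$ generating the maximal ideal of $\widehat R_{(k,u)}$. Here $k^*$ is the algebraic closure of $k$ in the completion $\widehat R$ (the unique coefficient field of $\widehat R$ containing $k$), $K$ is a $k^*$-algebra via the completion $\widehat u\colon\widehat R\to K$, and $\widehat R_{(k,u)}$ is the completion of the local ring $\widehat R\otimes_{k^*}K$ at its maximal ideal $\mathfrak m(\widehat R\otimes_{k^*}K)$. Hull and approximations. Let $\widehat\theta_\Lambda\colon K[[n]]\to\widehat R_{(k,u)}$ be the (surjective) $K$-algebra homomorphism $X_i\mapsto x_i$, and $\widehat I_\Lambda=(a_1,\dots,a_r)$ its kernel. Choose $b_{iw}\in K_w[[n]]$ with ultraproduct $\eta_n(a_i)$ and put $R_w:=K_w[[n]]/(b_{1w},\dots,b_{rw})$ (the approximations of $R$). The Lefschetz hull $\mathfrak D(R)=\mathfrak D(\Lambda)$ is the ultraproduct of the $R_w$, equal to $\mathfrak D(n)/\widehat I_\Lambda\mathfrak D(n)$; it is an $R$-algebra via the faithfully flat map $\eta_\Lambda\colon R\to\widehat R_{(k,u)}\cong K[[n]]/\widehat I_\Lambda\to\mathfrak D(R)$ induced by $\eta_n$. Non-standard tight closure. The non-standard Frobenius $\mathbf F_\infty\colon\mathfrak D(R)\to\mathfrak D(R)$ is the ultraproduct of the Frobenius maps $x\mapsto x^{p(w)}$ on $R_w$.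 For an ideal $\mathfrak a$ of $R$, $\mathbf F_\infty^m(\mathfrak a)\mathfrak D(R)$ is the ideal of $\mathfrak D(R)$ generated by all $\mathbf F_\infty^m(a)$, $a\in\mathfrak a$. The non-standard tight closure $\operatorname{cl}(\mathfrak a)$ is the set of $z\in R$ for which there exists $c\in R$, not contained in any minimal prime of $R$, with $c\,\mathbf F_\infty^m(z)\in\mathbf F_\infty^m(\mathfrak a)\mathfrak D(R)$ for all sufficiently large $m$. *)

theory Defs
  imports
    "HOL-Algebra.Algebra"
    "HOL-Library.Poly_Mapping"
    "HOL-Library.Countable_Set"
    "HOL-Library.Extended_Nat"
begin

section \<open>Ultraproducts\<close>

definition ultraset :: "'w set \<Rightarrow> 'w filter \<Rightarrow> bool" where
  "ultraset W F \<longleftrightarrow> infinite W \<and> (\<forall>\<^sub>F w in F. w \<in> W) \<and> F \<noteq> bot \<and>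
     (\<forall>P. (\<forall>\<^sub>F w in F. P w) \<or> (\<forall>\<^sub>F w in F. \<not> P w)) \<and>
     (\<forall>v\<in>W. \<not> (\<forall>\<^sub>F w in F. w = v))"

definition product_ring :: "'w set \<Rightarrow> ('w \<Rightarrow> 'a ring) \<Rightarrow> ('w \<Rightarrow> 'a) ring" where
  "product_ring W A =
     \<lparr>carrier = (\<Pi>\<^sub>E w\<in>W. carrier (A w)),
      monoid.mult = (\<lambda>f g. \<lambda>w\<in>W. f w \<otimes>\<^bsub>A w\<^esub> g w),
      one = (\<lambda>w\<in>W. \<one>\<^bsub>A w\<^esub>),
      ring.zero = (\<lambda>w\<in>W. \<zero>\<^bsub>A w\<^esub>),
      add = (\<lambda>f g. \<lambda>w\<in>W. f w \<oplus>\<^bsub>A w\<^esub> g w)\<rparr>"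

definition ultra_null :: "'w set \<Rightarrow> 'w filter \<Rightarrow> ('w \<Rightarrow> 'a ring) \<Rightarrow> ('w \<Rightarrow> 'a) set" where
  "ultra_null W F A = {f \<in> carrier (product_ring W A). \<forall>\<^sub>F w in F. f w = \<zero>\<^bsub>A w\<^esub>}"

definition ultraproduct :: "'w set \<Rightarrow> 'w filter \<Rightarrow> ('w \<Rightarrow> 'a ring) \<Rightarrow> ('w \<Rightarrow> 'a) set ring" where
  "ultraproduct W F A = product_ring W A Quot ultra_null W F A"

definition ultra_elem ::
    "'w set \<Rightarrow> 'w filter \<Rightarrow> ('w \<Rightarrow> 'a ring) \<Rightarrow> ('w \<Rightarrow> 'a) \<Rightarrow> ('w \<Rightarrow> 'a) set" where
  "ultra_elem W F A a = ultra_null W F A +>\<^bsub>product_ring W A\<^esub> restrict a W"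

text \<open>The ultraproduct of maps \<open>h w : A w \<rightarrow> B w\<close>, evaluated through a representing sequence;
  the result does not depend on the representative. Only the target family is a parameter.\<close>
definition ultra_map ::
    "'w set \<Rightarrow> 'w filter \<Rightarrow> ('w \<Rightarrow> 'b ring) \<Rightarrow> ('w \<Rightarrow> 'a \<Rightarrow> 'b) \<Rightarrow> ('w \<Rightarrow> 'a) set \<Rightarrow> ('w \<Rightarrow> 'b) set" where
  "ultra_map W F B h x = ultra_elem W F B (\<lambda>w. h w ((SOME f. f \<in> x) w))"


section \<open>Formal power series in finitely many variables\<close>

text \<open>As in \<open>HOL-Algebra.Indexed_Polynomials\<close>, monomials are multisets of variable indices.
  The variables are numbered \<open>0, \<dots>, n - 1\<close>, so \<open>L[[n]]\<close> is literally a subset of \<open>L[[m]]\<close>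
  for \<open>n \<le> m\<close>.\<close>
type_synonym 'a series = "nat multiset \<Rightarrow> 'a"

definition power_series_ring :: "'a ring \<Rightarrow> nat \<Rightarrow> 'a series ring" where
  "power_series_ring L n =
     \<lparr>carrier = {f. (\<forall>m. f m \<in> carrier L) \<and> (\<forall>m. \<not> set_mset m \<subseteq> {..<n} \<longrightarrow> f m = \<zero>\<^bsub>L\<^esub>)},
      monoid.mult = (\<lambda>f g m. \<Oplus>\<^bsub>L\<^esub>a\<in>{a. a \<subseteq># m}. f a \<otimes>\<^bsub>L\<^esub> g (m - a)),
      one = ring.indexed_const L \<one>\<^bsub>L\<^esub>,
      ring.zero = (\<lambda>m. \<zero>\<^bsub>L\<^esub>),
      add = (\<lambda>f g m. f m \<oplus>\<^bsub>L\<^esub> g m)\<rparr>"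


section \<open>Commutative algebra\<close>

definition has_char :: "'a ring \<Rightarrow> nat \<Rightarrow> bool" where
  "has_char R p \<longleftrightarrow> (\<forall>n::nat. [n] \<cdot>\<^bsub>R\<^esub> \<one>\<^bsub>R\<^esub> = \<zero>\<^bsub>R\<^esub> \<longleftrightarrow> p dvd n)"

definition rat_ring :: "rat ring" where
  "rat_ring = \<lparr>carrier = UNIV, monoid.mult = (*), one = 1, ring.zero = 0, add = (+)\<rparr>"

definition contains_rationals :: "'a ring \<Rightarrow> bool" where
  "contains_rationals R \<longleftrightarrow> (\<exists>f \<in> ring_hom rat_ring R. inj f)"

definition local_ring :: "'a ring \<Rightarrow> bool" where
  "local_ring R \<longleftrightarrow> cring R \<and> (\<exists>!M. maximalideal M R)"

definition max_ideal :: "'a ring \<Rightarrow> 'a set" where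
  "max_ideal R = (THE M. maximalideal M R)"

definition minimal_prime :: "'a set \<Rightarrow> 'a ring \<Rightarrow> bool" where
  "minimal_prime P R \<longleftrightarrow> primeideal P R \<and> (\<forall>Q. primeideal Q R \<longrightarrow> Q \<subseteq> P \<longrightarrow> Q = P)"

definition krull_dim :: "'a ring \<Rightarrow> enat" where
  "krull_dim R = (SUP n \<in> {n. \<exists>P :: nat \<Rightarrow> 'a set.
      (\<forall>i\<le>n. primeideal (P i) R) \<and> (\<forall>i<n. P i \<subset> P (Suc i))}. enat n)"

definition embedding_dim :: "'a ring \<Rightarrow> nat" where
  "embedding_dim R = (LEAST d. \<exists>A \<subseteq> carrier R. finite A \<and> card A = d \<and> genideal R A = max_ideal R)"

definition regular_local_ring :: "'a ring \<Rightarrow> bool" where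
  "regular_local_ring R \<longleftrightarrow>
     noetherian_ring R \<and> local_ring R \<and> krull_dim R = enat (embedding_dim R)"

abbreviation ideal_power :: "'a ring \<Rightarrow> 'a set \<Rightarrow> nat \<Rightarrow> 'a set" where
  "ideal_power R I n \<equiv> I [^]\<^bsub>ideals_set R\<^esub> n"

text \<open>The \<open>I\<close>-adic completion, i.e. the inverse limit of the rings \<open>R / I\<^sup>n\<close>. Its elements are
  the sequences of cosets with \<open>f (Suc n) \<subseteq> f n\<close>; this inclusion says that the transition map
  \<open>R / I\<^sup>n\<^sup>+\<^sup>1 \<rightarrow> R / I\<^sup>n\<close> sends \<open>f (Suc n)\<close> to \<open>f n\<close>.\<close>
definition completion :: "'a ring \<Rightarrow> 'a set \<Rightarrow> (nat \<Rightarrow> 'a set) ring" where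
  "completion R I =
     \<lparr>carrier = {f. (\<forall>n. f n \<in> carrier (R Quot ideal_power R I n)) \<and> (\<forall>n. f (Suc n) \<subseteq> f n)},
      monoid.mult = (\<lambda>f g n. f n \<otimes>\<^bsub>R Quot ideal_power R I n\<^esub> g n),
      one = (\<lambda>n. \<one>\<^bsub>R Quot ideal_power R I n\<^esub>),
      ring.zero = (\<lambda>n. \<zero>\<^bsub>R Quot ideal_power R I n\<^esub>),
      add = (\<lambda>f g n. f n \<oplus>\<^bsub>R Quot ideal_power R I n\<^esub> g n)\<rparr>"

definition to_completion :: "'a ring \<Rightarrow> 'a set \<Rightarrow> 'a \<Rightarrow> nat \<Rightarrow> 'a set" where
  "to_completion R I a = (\<lambda>n. ideal_power R I n +>\<^bsub>R\<^esub> a)"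

text \<open>The integral monoid ring of the multiplicative monoid of \<open>A \<times> B\<close>, on the free abelian
  group with basis \<open>carrier A \<times> carrier B\<close>. The tensor product of two algebras is its quotient
  by the usual relations.\<close>
definition pair_monoid_ring :: "'a ring \<Rightarrow> 'b ring \<Rightarrow> ('a \<times> 'b \<Rightarrow>\<^sub>0 int) ring" where
  "pair_monoid_ring A B =
     \<lparr>carrier = {c. Poly_Mapping.keys c \<subseteq> carrier A \<times> carrier B},
      monoid.mult = (\<lambda>c d. frag_extend (\<lambda>(a, b). frag_extend (\<lambda>(a', b').
                frag_of (a \<otimes>\<^bsub>A\<^esub> a', b \<otimes>\<^bsub>B\<^esub> b')) d) c),
      one = frag_of (\<one>\<^bsub>A\<^esub>, \<one>\<^bsub>B\<^esub>),
      ring.zero = 0,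
      add = (+)\<rparr>"

text \<open>\<open>C\<close> is the set of scalars, which act on \<open>A\<close> through \<open>f\<close> and on \<open>B\<close> through \<open>g\<close>.\<close>
definition tensor_relations ::
    "'c set \<Rightarrow> ('c \<Rightarrow> 'a) \<Rightarrow> ('c \<Rightarrow> 'b) \<Rightarrow> 'a ring \<Rightarrow> 'b ring \<Rightarrow> ('a \<times> 'b \<Rightarrow>\<^sub>0 int) set" where
  "tensor_relations C f g A B =
     {frag_of (a \<oplus>\<^bsub>A\<^esub> a', b) - frag_of (a, b) - frag_of (a', b) | a a' b.
        a \<in> carrier A \<and> a' \<in> carrier A \<and> b \<in> carrier B} \<union>
     {frag_of (a, b \<oplus>\<^bsub>B\<^esub> b') - frag_of (a, b) - frag_of (a, b') | a b b'.
        a \<in> carrier A \<and> b \<in> carrier B \<and> b' \<in> carrier B} \<union>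
     {frag_of (f c \<otimes>\<^bsub>A\<^esub> a, b) - frag_of (a, g c \<otimes>\<^bsub>B\<^esub> b) | a b c.
        a \<in> carrier A \<and> b \<in> carrier B \<and> c \<in> C}"

definition tensor_ideal ::
    "'c set \<Rightarrow> ('c \<Rightarrow> 'a) \<Rightarrow> ('c \<Rightarrow> 'b) \<Rightarrow> 'a ring \<Rightarrow> 'b ring \<Rightarrow> ('a \<times> 'b \<Rightarrow>\<^sub>0 int) set" where
  "tensor_ideal C f g A B = genideal (pair_monoid_ring A B) (tensor_relations C f g A B)"

definition tensor_ring ::
    "'c set \<Rightarrow> ('c \<Rightarrow> 'a) \<Rightarrow> ('c \<Rightarrow> 'b) \<Rightarrow> 'a ring \<Rightarrow> 'b ring \<Rightarrow> ('a \<times> 'b \<Rightarrow>\<^sub>0 int) set ring" where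
  "tensor_ring C f g A B = pair_monoid_ring A B Quot tensor_ideal C f g A B"

definition tensor_elem ::
    "'c set \<Rightarrow> ('c \<Rightarrow> 'a) \<Rightarrow> ('c \<Rightarrow> 'b) \<Rightarrow> 'a ring \<Rightarrow> 'b ring \<Rightarrow> 'a \<Rightarrow> 'b \<Rightarrow> ('a \<times> 'b \<Rightarrow>\<^sub>0 int) set" where
  "tensor_elem C f g A B a b = tensor_ideal C f g A B +>\<^bsub>pair_monoid_ring A B\<^esub> frag_of (a, b)"


section \<open>The fixed data\<close>

text \<open>\<open>Kp D p\<close> is the algebraically closed field of characteristic \<open>p\<close> (used for prime \<open>p\<close> only);
  \<open>ident D n\<close> is the identification of \<open>\<DD>(n)\<close> (\<open>Dn D n\<close> below) with the ultraproduct over \<open>Wset D\<close>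
  of the rings \<open>Kp D (pw D w)[[n]]\<close>.\<close>
record ('a, 'u, 'w) lefschetz_data =
  Pfilter :: "nat filter"
  Kp :: "nat \<Rightarrow> 'a ring"
  Uset :: "'u set"
  Ufilter :: "'u filter"
  eta :: "nat \<Rightarrow> (nat \<Rightarrow> 'a) set series \<Rightarrow> ('u \<Rightarrow> (nat \<Rightarrow> 'a series) set) set"
  Wset :: "'w set"
  Wfilter :: "'w filter"
  pw :: "'w \<Rightarrow> nat"
  ident :: "nat \<Rightarrow> ('u \<Rightarrow> (nat \<Rightarrow> 'a series) set) set \<Rightarrow> ('w \<Rightarrow> 'a series) set"

abbreviation primes :: "nat set" where
  "primes \<equiv> {p. Factorial_Ring.prime p}"

definition KK :: "('a, 'u, 'w) lefschetz_data \<Rightarrow> (nat \<Rightarrow> 'a) set ring" where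
  "KK D = ultraproduct primes (Pfilter D) (Kp D)"

definition Kser :: "('a, 'u, 'w) lefschetz_data \<Rightarrow> nat \<Rightarrow> (nat \<Rightarrow> 'a) set series ring" where
  "Kser D n = power_series_ring (KK D) n"

definition Kser_inf :: "('a, 'u, 'w) lefschetz_data \<Rightarrow> nat \<Rightarrow> (nat \<Rightarrow> 'a series) set ring" where
  "Kser_inf D n = ultraproduct primes (Pfilter D) (\<lambda>p. power_series_ring (Kp D p) n)"

definition Dn ::
    "('a, 'u, 'w) lefschetz_data \<Rightarrow> nat \<Rightarrow> ('u \<Rightarrow> (nat \<Rightarrow> 'a series) set) set ring" where
  "Dn D n = ultraproduct (Uset D) (Ufilter D) (\<lambda>_. Kser_inf D n)"

definition Dn_diag ::
    "('a, 'u, 'w) lefschetz_data \<Rightarrow> nat \<Rightarrow> (nat \<Rightarrow> 'a series) set \<Rightarrow> ('u \<Rightarrow> (nat \<Rightarrow> 'a series) set) set" where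
  "Dn_diag D n x = ultra_elem (Uset D) (Ufilter D) (\<lambda>_. Kser_inf D n) (\<lambda>_. x)"

text \<open>The structure map of \<open>\<DD>(n)\<close> over \<open>K[X\<^sub>1, \<dots>, X\<^sub>n]\<close>, on constants and on variables.
  A ring homomorphism defined on \<open>K[[n]]\<close> that agrees with it on these agrees with it on all
  polynomials, so it is a \<open>K[X\<^sub>1, \<dots>, X\<^sub>n]\<close>-algebra homomorphism.\<close>
definition Dn_const ::
    "('a, 'u, 'w) lefschetz_data \<Rightarrow> nat \<Rightarrow> (nat \<Rightarrow> 'a) set \<Rightarrow> ('u \<Rightarrow> (nat \<Rightarrow> 'a series) set) set" where
  "Dn_const D n c = Dn_diag D n (ultra_map primes (Pfilter D) (\<lambda>p. power_series_ring (Kp D p) n)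
     (\<lambda>p. ring.indexed_const (Kp D p)) c)"

definition Dn_var ::
    "('a, 'u, 'w) lefschetz_data \<Rightarrow> nat \<Rightarrow> nat \<Rightarrow> ('u \<Rightarrow> (nat \<Rightarrow> 'a series) set) set" where
  "Dn_var D n i = Dn_diag D n (ultra_elem primes (Pfilter D) (\<lambda>p. power_series_ring (Kp D p) n)
     (\<lambda>p. ring.indexed_var (Kp D p) i))"

text \<open>The natural map \<open>\<DD>(n) \<rightarrow> \<DD>(m)\<close> for \<open>n \<le> m\<close>, induced by the inclusions
  of \<open>K\<^sub>p[[n]]\<close> in \<open>K\<^sub>p[[m]]\<close>.\<close>
definition Dn_incl :: "('a, 'u, 'w) lefschetz_data \<Rightarrow> nat \<Rightarrow>
    ('u \<Rightarrow> (nat \<Rightarrow> 'a series) set) set \<Rightarrow> ('u \<Rightarrow> (nat \<Rightarrow> 'a series) set) set" where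
  "Dn_incl D m = ultra_map (Uset D) (Ufilter D) (\<lambda>_. Kser_inf D m)
     (\<lambda>_. ultra_map primes (Pfilter D) (\<lambda>p. power_series_ring (Kp D p) m) (\<lambda>_ f. f))"

definition Wser :: "('a, 'u, 'w) lefschetz_data \<Rightarrow> nat \<Rightarrow> 'w \<Rightarrow> 'a series ring" where
  "Wser D n w = power_series_ring (Kp D (pw D w)) n"

definition lefschetz_data :: "('a, 'u, 'w) lefschetz_data \<Rightarrow> bool" where
  "lefschetz_data D \<longleftrightarrow>
     ultraset primes (Pfilter D) \<and>
     (\<forall>p\<in>primes. algebraically_closed (Kp D p) \<and> has_char (Kp D p) p) \<and>
     field (KK D) \<and> has_char (KK D) 0 \<and> uncountable (carrier (KK D)) \<and>
     ultraset (Uset D) (Ufilter D) \<and>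
     (\<forall>n. eta D n \<in> ring_hom (Kser D n) (Dn D n) \<and>
          (\<forall>c \<in> carrier (KK D). eta D n (ring.indexed_const (KK D) c) = Dn_const D n c) \<and>
          (\<forall>i<n. eta D n (ring.indexed_var (KK D) i) = Dn_var D n i)) \<and>
     (\<forall>n m. n \<le> m \<longrightarrow> (\<forall>f \<in> carrier (Kser D n). eta D m f = Dn_incl D m (eta D n f))) \<and>
     ultraset (Wset D) (Wfilter D) \<and>
     (\<forall>w \<in> Wset D. Factorial_Ring.prime (pw D w)) \<and>
     (\<forall>n. ident D n \<in> ring_iso (Dn D n) (ultraproduct (Wset D) (Wfilter D) (Wser D n))) \<and>
     (\<forall>n m. n \<le> m \<longrightarrow> (\<forall>x \<in> carrier (Dn D n). ident D m (Dn_incl D m x) =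
        ultra_map (Wset D) (Wfilter D) (Wser D m) (\<lambda>_ f. f) (ident D n x)))"


section \<open>The objects\<close>

type_synonym ('r, 'a) scalar_ext = "((nat \<Rightarrow> 'r set) \<times> (nat \<Rightarrow> 'a) set \<Rightarrow>\<^sub>0 int) set"

record ('r, 'a) lefschetz_object =
  base :: "'r ring"
  gens :: "(nat \<Rightarrow> ('r, 'a) scalar_ext set) list"
  subf :: "'r set"
  umap :: "'r \<Rightarrow> (nat \<Rightarrow> 'a) set"

definition Rhat :: "('r, 'a) lefschetz_object \<Rightarrow> (nat \<Rightarrow> 'r set) ring" where
  "Rhat \<Lambda> = completion (base \<Lambda>) (max_ideal (base \<Lambda>))"

definition to_Rhat :: "('r, 'a) lefschetz_object \<Rightarrow> 'r \<Rightarrow> nat \<Rightarrow> 'r set" where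
  "to_Rhat \<Lambda> = to_completion (base \<Lambda>) (max_ideal (base \<Lambda>))"

text \<open>The algebraic closure of \<open>k\<close> in the completion, as a coefficient field: an algebraic element
  is only counted if it lies in a subfield containing \<open>k\<close>. Without this condition nilpotent
  elements, which are algebraic over \<open>k\<close>, would be included.\<close>
definition kstar :: "('r, 'a) lefschetz_object \<Rightarrow> (nat \<Rightarrow> 'r set) set" where
  "kstar \<Lambda> = {x. ring.algebraic (Rhat \<Lambda>) (to_Rhat \<Lambda> ` subf \<Lambda>) x \<and>
     (\<exists>L. subfield L (Rhat \<Lambda>) \<and> to_Rhat \<Lambda> ` subf \<Lambda> \<subseteq> L \<and> x \<in> L)}"

text \<open>Since \<open>u\<close> vanishes on the maximal ideal, its completion takes the value of \<open>u\<close> on the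
  component of \<open>f\<close> in the residue field.\<close>
definition uhat :: "('r, 'a) lefschetz_object \<Rightarrow> (nat \<Rightarrow> 'r set) \<Rightarrow> (nat \<Rightarrow> 'a) set" where
  "uhat \<Lambda> f = the_elem (umap \<Lambda> ` f 1)"

definition Rtensor ::
    "('a, 'u, 'w) lefschetz_data \<Rightarrow> ('r, 'a) lefschetz_object \<Rightarrow> ('r, 'a) scalar_ext ring" where
  "Rtensor D \<Lambda> = tensor_ring (kstar \<Lambda>) (\<lambda>c. c) (uhat \<Lambda>) (Rhat \<Lambda>) (KK D)"

definition Rtensor_elem :: "('a, 'u, 'w) lefschetz_data \<Rightarrow> ('r, 'a) lefschetz_object \<Rightarrow>
    (nat \<Rightarrow> 'r set) \<Rightarrow> (nat \<Rightarrow> 'a) set \<Rightarrow> ('r, 'a) scalar_ext" where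
  "Rtensor_elem D \<Lambda> = tensor_elem (kstar \<Lambda>) (\<lambda>c. c) (uhat \<Lambda>) (Rhat \<Lambda>) (KK D)"

definition Rtensor_ideal ::
    "('a, 'u, 'w) lefschetz_data \<Rightarrow> ('r, 'a) lefschetz_object \<Rightarrow> ('r, 'a) scalar_ext set" where
  "Rtensor_ideal D \<Lambda> = genideal (Rtensor D \<Lambda>)
     ((\<lambda>a. Rtensor_elem D \<Lambda> (to_Rhat \<Lambda> a) \<one>\<^bsub>KK D\<^esub>) ` max_ideal (base \<Lambda>))"

definition Rhat_ku :: "('a, 'u, 'w) lefschetz_data \<Rightarrow> ('r, 'a) lefschetz_object \<Rightarrow>
    (nat \<Rightarrow> ('r, 'a) scalar_ext set) ring" where
  "Rhat_ku D \<Lambda> = completion (Rtensor D \<Lambda>) (Rtensor_ideal D \<Lambda>)"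

definition R_to_Rhat_ku :: "('a, 'u, 'w) lefschetz_data \<Rightarrow> ('r, 'a) lefschetz_object \<Rightarrow>
    'r \<Rightarrow> nat \<Rightarrow> ('r, 'a) scalar_ext set" where
  "R_to_Rhat_ku D \<Lambda> a = to_completion (Rtensor D \<Lambda>) (Rtensor_ideal D \<Lambda>)
     (Rtensor_elem D \<Lambda> (to_Rhat \<Lambda> a) \<one>\<^bsub>KK D\<^esub>)"

definition K_to_Rhat_ku :: "('a, 'u, 'w) lefschetz_data \<Rightarrow> ('r, 'a) lefschetz_object \<Rightarrow>
    (nat \<Rightarrow> 'a) set \<Rightarrow> nat \<Rightarrow> ('r, 'a) scalar_ext set" where
  "K_to_Rhat_ku D \<Lambda> c = to_completion (Rtensor D \<Lambda>) (Rtensor_ideal D \<Lambda>)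
     (Rtensor_elem D \<Lambda> \<one>\<^bsub>Rhat \<Lambda>\<^esub> c)"

definition lefschetz_object ::
    "('a, 'u, 'w) lefschetz_data \<Rightarrow> ('r, 'a) lefschetz_object \<Rightarrow> bool" where
  "lefschetz_object D \<Lambda> \<longleftrightarrow>
     (let R = base \<Lambda>; M = max_ideal R in
      noetherian_ring R \<and> local_ring R \<and> contains_rationals R \<and>
      subfield (subf \<Lambda>) R \<and>
      (\<forall>x \<in> carrier (R Quot M). ring.algebraic (R Quot M) ((\<lambda>a. M +>\<^bsub>R\<^esub> a) ` subf \<Lambda>) x) \<and>
      umap \<Lambda> \<in> ring_hom R (KK D) \<and> a_kernel R (KK D) (umap \<Lambda>) = M \<and>
      set (gens \<Lambda>) \<subseteq> carrier (Rhat_ku D \<Lambda>) \<and>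
      genideal (Rhat_ku D \<Lambda>) (set (gens \<Lambda>)) = max_ideal (Rhat_ku D \<Lambda>))"

abbreviation nvars :: "('r, 'a) lefschetz_object \<Rightarrow> nat" where
  "nvars \<Lambda> \<equiv> length (gens \<Lambda>)"


section \<open>The Lefschetz hull\<close>

text \<open>\<open>\<theta>\<close> is the \<open>K\<close>-algebra homomorphism from \<open>K[[n]]\<close> with \<open>X\<^sub>i \<mapsto> x\<^sub>i\<close>. It is uniquely determined
  on \<open>K[[n]]\<close>: any ring homomorphism with these properties is continuous for the adic topologies.\<close>
definition is_theta_hat :: "('a, 'u, 'w) lefschetz_data \<Rightarrow> ('r, 'a) lefschetz_object \<Rightarrow>
    ((nat \<Rightarrow> 'a) set series \<Rightarrow> nat \<Rightarrow> ('r, 'a) scalar_ext set) \<Rightarrow> bool" where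
  "is_theta_hat D \<Lambda> \<theta> \<longleftrightarrow>
     \<theta> \<in> ring_hom (Kser D (nvars \<Lambda>)) (Rhat_ku D \<Lambda>) \<and>
     (\<forall>c \<in> carrier (KK D). \<theta> (ring.indexed_const (KK D) c) = K_to_Rhat_ku D \<Lambda> c) \<and>
     (\<forall>i < nvars \<Lambda>. \<theta> (ring.indexed_var (KK D) i) = gens \<Lambda> ! i)"

text \<open>The choices made in the construction of the hull: generators \<open>as\<close> of the kernel of \<open>\<theta>\<close>, and
  for each \<open>w\<close> the list \<open>bs w\<close> of the elements \<open>b\<^sub>i\<^sub>w\<close>, where the ultraproduct
  of the \<open>b\<^sub>i\<^sub>w\<close> is the image of the \<open>i\<close>-th entry of \<open>as\<close>.\<close>
definition hull_presentation :: "('a, 'u, 'w) lefschetz_data \<Rightarrow> ('r, 'a) lefschetz_object \<Rightarrow>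
    ((nat \<Rightarrow> 'a) set series \<Rightarrow> nat \<Rightarrow> ('r, 'a) scalar_ext set) \<Rightarrow>
    (nat \<Rightarrow> 'a) set series list \<Rightarrow> ('w \<Rightarrow> 'a series list) \<Rightarrow> bool" where
  "hull_presentation D \<Lambda> \<theta> as bs \<longleftrightarrow>
     (let n = nvars \<Lambda> in
      is_theta_hat D \<Lambda> \<theta> \<and>
      set as \<subseteq> carrier (Kser D n) \<and>
      genideal (Kser D n) (set as) = a_kernel (Kser D n) (Rhat_ku D \<Lambda>) \<theta> \<and>
      (\<forall>w \<in> Wset D. length (bs w) = length as \<and> set (bs w) \<subseteq> carrier (Wser D n w)) \<and>
      (\<forall>i < length as. ultra_elem (Wset D) (Wfilter D) (Wser D n) (\<lambda>w. bs w ! i) =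
          ident D n (eta D n (as ! i))))"

definition approx :: "('a, 'u, 'w) lefschetz_data \<Rightarrow> ('r, 'a) lefschetz_object \<Rightarrow>
    ('w \<Rightarrow> 'a series list) \<Rightarrow> 'w \<Rightarrow> 'a series set ring" where
  "approx D \<Lambda> bs w = Wser D (nvars \<Lambda>) w Quot genideal (Wser D (nvars \<Lambda>) w) (set (bs w))"

definition lefschetz_hull :: "('a, 'u, 'w) lefschetz_data \<Rightarrow> ('r, 'a) lefschetz_object \<Rightarrow>
    ('w \<Rightarrow> 'a series list) \<Rightarrow> ('w \<Rightarrow> 'a series set) set ring" where
  "lefschetz_hull D \<Lambda> bs = ultraproduct (Wset D) (Wfilter D) (approx D \<Lambda> bs)"

definition hull_proj :: "('a, 'u, 'w) lefschetz_data \<Rightarrow> ('r, 'a) lefschetz_object \<Rightarrow>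
    ('w \<Rightarrow> 'a series list) \<Rightarrow> ('u \<Rightarrow> (nat \<Rightarrow> 'a series) set) set \<Rightarrow> ('w \<Rightarrow> 'a series set) set" where
  "hull_proj D \<Lambda> bs x = ultra_map (Wset D) (Wfilter D) (approx D \<Lambda> bs)
     (\<lambda>w f. genideal (Wser D (nvars \<Lambda>) w) (set (bs w)) +>\<^bsub>Wser D (nvars \<Lambda>) w\<^esub> f)
     (ident D (nvars \<Lambda>) x)"

text \<open>The structure map \<open>R \<rightarrow> \<DD>(R)\<close>: lift the image of \<open>z\<close> along \<open>\<theta>\<close> to a power series
  (this is the inverse of the isomorphism induced by \<open>\<theta>\<close>), and apply \<open>\<eta>\<^sub>n\<close>.\<close>
definition eta_obj :: "('a, 'u, 'w) lefschetz_data \<Rightarrow> ('r, 'a) lefschetz_object \<Rightarrow>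
    ((nat \<Rightarrow> 'a) set series \<Rightarrow> nat \<Rightarrow> ('r, 'a) scalar_ext set) \<Rightarrow>
    ('w \<Rightarrow> 'a series list) \<Rightarrow> 'r \<Rightarrow> ('w \<Rightarrow> 'a series set) set" where
  "eta_obj D \<Lambda> \<theta> bs z = hull_proj D \<Lambda> bs (eta D (nvars \<Lambda>)
     (SOME f. f \<in> carrier (Kser D (nvars \<Lambda>)) \<and> \<theta> f = R_to_Rhat_ku D \<Lambda> z))"


section \<open>Non-standard tight closure\<close>

definition F_inf :: "('a, 'u, 'w) lefschetz_data \<Rightarrow> ('r, 'a) lefschetz_object \<Rightarrow>
    ('w \<Rightarrow> 'a series list) \<Rightarrow> ('w \<Rightarrow> 'a series set) set \<Rightarrow> ('w \<Rightarrow> 'a series set) set" where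
  "F_inf D \<Lambda> bs = ultra_map (Wset D) (Wfilter D) (approx D \<Lambda> bs)
     (\<lambda>w x. x [^]\<^bsub>approx D \<Lambda> bs w\<^esub> pw D w)"

definition nonstandard_tight_closure ::
    "('a, 'u, 'w) lefschetz_data \<Rightarrow> ('r, 'a) lefschetz_object \<Rightarrow>
     ((nat \<Rightarrow> 'a) set series \<Rightarrow> nat \<Rightarrow> ('r, 'a) scalar_ext set) \<Rightarrow>
     ('w \<Rightarrow> 'a series list) \<Rightarrow> 'r set \<Rightarrow> 'r set" where
  "nonstandard_tight_closure D \<Lambda> \<theta> bs \<aa> =
     (let R = base \<Lambda>; H = lefschetz_hull D \<Lambda> bs; \<eta> = eta_obj D \<Lambda> \<theta> bs; F = F_inf D \<Lambda> bs in
      {z \<in> carrier R. \<exists>c \<in> carrier R. (\<forall>P. minimal_prime P R \<longrightarrow> c \<notin> P) \<and>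
         (\<exists>m0. \<forall>m\<ge>m0. \<eta> c \<otimes>\<^bsub>H\<^esub> (F ^^ m) (\<eta> z) \<in> genideal H ((\<lambda>a. (F ^^ m) (\<eta> a)) ` \<aa>))})"

end

(* R regular of dimension d: a minimal generating system of the maximal ideal m is quasi-regular
   (a longer chain of primes would otherwise be needed for the growth of the lengths R/m^s), and
   this survives in the scalar extension T, because membership in T descends to R along
   functionals over the coefficient field. Hence the kernel of K[[n]] -> T is generated by part of
   a regular system of parameters h of K[[n]]. By Los, the same holds for the approximations, where
   the Frobenius of K_w[[n]] is free on the monomials in h of exponents < q; so c z^q in (a^q, b)
   forces z in (a, b) or c in (b) + m^N for N <= q. One alternative holds for almost all w.
   Memberships in the ultraproduct descend to K[[n]] modulo each power of the maximal ideal, as any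
   two homomorphisms from K[[n]] that agree on constants and variables agree there. So either z
   lies in a + m^N for all N, or c lies in m^N for all N, which by Krull would give c = 0. *)
theory Submission
  imports Defs "HOL-Library.Multiset_Order"
begin

text \<open>The maps \<open>eta D n\<close> are controlled on constants and variables only, and for
  n > 0 the ring \<DD>(n) contains nonzero elements of infinite order. Hence neither equality nor
  vanishing passes back from the ultraproduct; what passes back is membership in a finitely
  generated ideal modulo a fixed power of the maximal ideal. This dictates the form of the
  dichotomy: its alternative for c carries a precision N that is the same for all w, and such an N
  is affordable because the iterate m of Frobenius may be taken at least N, while q = p(w)^m >= 2^m
  > m. Regularity is available as a chain of primes as long as the number of generators. The lengths
  it is compared with are measured by chains of ideals and bounded by counting leading monomials, so
  that everything stays inside the ideals of R. The identification \<open>ident\<close> is not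
  assumed to send variables to variables; parameters reach the factors through the ideal of
  nonunits. The hypothesis on c excludes c = 0, since a longest chain of primes starts at a minimal
  prime.\<close>

abbreviation (input) mult_in ("(_/ *{_} _)" [70, 0, 71] 70) where "mult_in x R y \<equiv> x \<otimes>\<^bsub>R\<^esub> y"
abbreviation (input) add_in ("(_/ +{_} _)" [65, 0, 66] 65) where "add_in x R y \<equiv> x \<oplus>\<^bsub>R\<^esub> y"
abbreviation (input) minus_in ("(_/ -{_} _)" [65, 0, 66] 65) where "minus_in x R y \<equiv> x \<ominus>\<^bsub>R\<^esub> y"
abbreviation (input) pow_in ("(_/ ^{_} _)" [75, 0, 76] 75) where "pow_in x R k \<equiv> x [^]\<^bsub>R\<^esub> k"
abbreviation (input) zero_in ("0{_}") where "zero_in R \<equiv> \<zero>\<^bsub>R\<^esub>"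
abbreviation (input) one_in ("1{_}") where "one_in R \<equiv> \<one>\<^bsub>R\<^esub>"
abbreviation (input) set_add_in ("(_/ <+{_} _)" [60, 0, 61] 60) where "set_add_in A R B \<equiv> A <+>\<^bsub>R\<^esub> B"
abbreviation (input) coset_in ("(_/ +>{_} _)" [60, 0, 61] 60) where "coset_in I R a \<equiv> I +>\<^bsub>R\<^esub> a"
abbreviation (input) idl where "idl R A \<equiv> genideal R A"

section \<open>Ideals and monomials\<close>

no_notation Sum_Type.Plus (infixr \<open><+>\<close> 65)

lemma (in cring) minus_zero_right [simp]: "x \<in> carrier R ==> x \<ominus> \<zero> = x"
 by (simp add: minus_eq)

lemma mem_set_add_iff: "x : A <+{R} B \<longleftrightarrow> (\<exists>a\<in>A. \<exists>b\<in>B. x = a +{R} b)"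
 by (auto simp: set_add_def')

section \<open>Calculus of ideals given by generators\<close>

context cring
begin

text \<open>Numbered bundle of closure properties; later proofs pick the clauses by position, such
  as (8) for membership in the carrier and (4) for differences.\<close>

lemma ideal_closed:
 assumes "ideal I R"
 shows "I <= carrier R" "\<zero> : I"
 "x : I ==> y : I ==> x \<oplus> y : I" "x : I ==> y : I ==> x \<ominus> y : I" "x : I ==> \<ominus> x : I"
 "x : I ==> y : carrier R ==> x \<otimes> y : I" "x : I ==> y : carrier R ==> y \<otimes> x : I"
 "x : I ==> x : carrier R"
proof -
 interpret I: ideal I R by fact
 show "I <= carrier R" "\<zero> : I"
 "x : I ==> y : I ==> x \<oplus> y : I" "x : I ==> y : I ==> x \<ominus> y : I" "x : I ==> \<ominus> x : I"
 "x : I ==> y : carrier R ==> x \<otimes> y : I" "x : I ==> y : carrier R ==> y \<otimes> x : I"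
 "x : I ==> x : carrier R"
 by (auto simp: I.I_l_closed I.I_r_closed I.a_closed I.a_inv_closed minus_eq)
qed

text \<open>Closure under negation comes from multiplication by -1, so only sums and multiples have
  to be checked.\<close>

lemma idealI':
 assumes "I <= carrier R" "\<zero> : I" "!!x y. x : I ==> y : I ==> x \<oplus> y : I"
 "!!x y. x : I ==> y : carrier R ==> y \<otimes> x : I"
 shows "ideal I R"
proof (rule idealI)
 show "ring R" by (rule ring_axioms)
 show "subgroup I (add_monoid R)"
 proof
 fix x assume x: "x : I"
 then have "(\<ominus> \<one>) \<otimes> x : I" using assms(4) by auto
 moreover have "(\<ominus> \<one>) \<otimes> x = \<ominus> x" using x assms(1) l_minus by auto
 ultimately show "inv\<^bsub>add_monoid R\<^esub> x : I" by (simp add: a_inv_def)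
 qed (use assms in auto)
 show "x \<otimes> a : I" "a \<otimes> x : I" if "a : I" "x : carrier R" for a x
 using assms that m_comm by (auto simp: subset_eq)
qed

lemma idl_ideal: "A <= carrier R ==> ideal (Idl A) R"
 by (rule genideal_ideal)

lemma idl_empty: "Idl {} = {\<zero>}"
proof
 show "Idl {} <= {\<zero>}" by (rule genideal_minimal) (auto simp: zeroideal)
 show "{\<zero>} <= Idl {}" using ideal_closed(2)[OF idl_ideal[of "{}"]] by auto
qed

lemma idl_mem: "A <= carrier R ==> a : A ==> a : Idl A"
 using genideal_self by auto

lemma idl_carrier: "A <= carrier R ==> Idl A <= carrier R"
 by (rule ideal_closed(1)[OF idl_ideal])

lemma idl_mono: "A <= B ==> B <= carrier R ==> Idl A <= Idl B"
 by (rule subset_Idl_subset)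

lemma idl_eqI:
 assumes "A <= carrier R" "B <= carrier R" "A <= Idl B" "B <= Idl A"
 shows "Idl A = Idl B"
 using assms genideal_minimal idl_ideal by (meson subset_antisym)

lemma add_ideals_sub:
 assumes "ideal I R" "ideal J R"
 shows "I <= I <+> J" "J <= I <+> J"
proof -
 note I = ideal_closed[OF assms(1)] and J = ideal_closed[OF assms(2)]
 show "I <= I <+> J"
 proof
 fix x assume x: "x : I"
 then have "x = x \<oplus> \<zero>" using I(8) by simp
 with x J(2) show "x : I <+> J" unfolding mem_set_add_iff by blast
 qed
 show "J <= I <+> J"
 proof
 fix x assume x: "x : J"
 then have "x = \<zero> \<oplus> x" using J(8) by simp
 with x I(2) show "x : I <+> J" unfolding mem_set_add_iff by blast
 qed
qed

lemma add_ideals_minimal: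
 assumes "ideal Q R" "I <= Q" "J <= Q" shows "I <+> J <= Q"
proof
 fix x assume "x : I <+> J"
 then obtain a b where "a : I" "b : J" "x = a \<oplus> b" unfolding mem_set_add_iff by blast
 then show "x : Q" using assms ideal_closed(3)[OF assms(1)] by blast
qed

lemma set_add_mono: "A <= A' ==> B <= B' ==> A <+> B <= A' <+> B'"
proof
 fix x assume *: "x : A <+> B" "A <= A'" "B <= B'"
 then obtain a b where "a : A" "b : B" "x = a \<oplus> b" unfolding mem_set_add_iff by blast
 with * show "x : A' <+> B'" unfolding mem_set_add_iff by blast
qed

lemma idl_union:
 assumes "A <= carrier R" "B <= carrier R"
 shows "Idl (A Un B) = Idl A <+> Idl B"
proof
 have i: "ideal (Idl A) R" "ideal (Idl B) R" using assms idl_ideal by auto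
 have "A <= Idl A <+> Idl B" "B <= Idl A <+> Idl B"
 using add_ideals_sub[OF i] genideal_self[OF assms(1)] genideal_self[OF assms(2)] by (meson subset_trans)+
 then show "Idl (A Un B) <= Idl A <+> Idl B"
 by (intro genideal_minimal add_ideals i) blast
 show "Idl A <+> Idl B <= Idl (A Un B)"
 using assms by (intro add_ideals_minimal idl_ideal idl_mono) auto
qed

text \<open>Splits off one generator; this is the step of the inductions over finite generating
  sets, including the transfer of membership to ultraproducts.\<close>

lemma idl_insert:
 assumes "a : carrier R" "A <= carrier R"
 shows "x : Idl (insert a A) \<longleftrightarrow> (\<exists>r\<in>carrier R. \<exists>y\<in>Idl A. x = a \<otimes> r \<oplus> y)"
proof -
 have "Idl (insert a A) = Idl {a} <+> Idl A"
 using idl_union[of "{a}" A] assms by simp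
 also have "Idl {a} = PIdl a" using cgenideal_eq_genideal assms by simp
 also have "PIdl a = {a \<otimes> r |r. r : carrier R}"
 unfolding cgenideal_def using m_comm assms(1) by blast
 finally have "Idl (insert a A) = {a \<otimes> r |r. r : carrier R} <+> Idl A" .
 then have "x : Idl (insert a A) \<longleftrightarrow> (\<exists>b\<in>{a \<otimes> r |r. r : carrier R}. \<exists>y\<in>Idl A. x = b \<oplus> y)"
 by (simp only: mem_set_add_iff)
 then show ?thesis by blast
qed

lemma colon_ideal:
 assumes "ideal I R" "a : carrier R"
 shows "ideal {x : carrier R. a \<otimes> x : I} R"
proof (rule idealI')
 show "y \<otimes> x : {x : carrier R. a \<otimes> x : I}" if "x : {x : carrier R. a \<otimes> x : I}" "y : carrier R" for x y
 using that assms ideal_closed(7)[OF assms(1), of "a \<otimes> x" y] m_lcomm[of y a x] by auto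
qed (use assms ideal_closed[OF assms(1)] in \<open>auto simp: r_distr\<close>)

text \<open>The elements that \<open>a\<close> multiplies into \<open>I\<close> form the colon ideal
  (I : a), so it is enough to test generators.\<close>

lemma idl_mult_mem:
 assumes "ideal I R" "A <= carrier R" "a : carrier R" "!!x. x : A ==> a \<otimes> x : I" "x : Idl A"
 shows "a \<otimes> x : I"
 using genideal_minimal[OF colon_ideal[OF assms(1,3)], of A] assms by auto

lemma idl_mult_mem2:
 assumes "ideal I R" "A <= carrier R" "B <= carrier R"
 "!!x y. x : A ==> y : B ==> x \<otimes> y : I" "x : Idl A" "y : Idl B"
 shows "x \<otimes> y : I"
proof (rule idl_mult_mem[OF assms(1) assms(3) _ _ assms(6)])
 show x: "x : carrier R" using assms(5) idl_carrier[OF assms(2)] by auto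
 fix b assume b: "b : B"
 have "b \<otimes> x : I"
 using assms b m_comm by (intro idl_mult_mem[OF assms(1,2) _ _ assms(5)]) (auto simp: subset_eq)
 then show "x \<otimes> b : I" using m_comm x b assms by (auto simp: subset_eq)
qed

lemma ideal_prod_minimal:
 assumes "ideal Q R" "!!x y. x : I ==> y : J ==> x \<otimes> y : Q"
 shows "I \<cdot> J <= Q"
proof
 fix x assume "x : I \<cdot> J" then show "x : Q"
 by (induct rule: ideal_prod.induct) (use assms ideal_closed in auto)
qed

lemma idl_prod:
 assumes "A <= carrier R" "B <= carrier R"
 shows "(Idl A) \<cdot> (Idl B) = Idl {a \<otimes> b | a b. a : A & b : B}" (is "_ = Idl ?C")
proof
 have C: "?C <= carrier R" using assms by auto
 show "(Idl A) \<cdot> (Idl B) <= Idl ?C"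
 proof (rule ideal_prod_minimal)
 show "ideal (Idl ?C) R" using C by (rule idl_ideal)
 fix x y assume "x : Idl A" "y : Idl B"
 then show "x \<otimes> y : Idl ?C"
 by (rule idl_mult_mem2[OF idl_ideal[OF C] assms, rotated]) (auto intro: idl_mem[OF C])
 qed
 show "Idl ?C <= (Idl A) \<cdot> (Idl B)"
 using assms idl_mem by (intro genideal_minimal ideal_prod_is_ideal idl_ideal)
 (auto intro!: ideal_prod.prod)
qed

lemma ideal_prod_mono: "I <= I' ==> J <= J' ==> I \<cdot> J <= I' \<cdot> J'"
proof
 fix x assume "x : I \<cdot> J" "I <= I'" "J <= J'" then show "x : I' \<cdot> J'"
 by (induct rule: ideal_prod.induct) (auto intro: ideal_prod.intros)
qed

end

section \<open>Powers of an ideal\<close>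

locale pcring = cring R for R :: "'a ring" (structure)
begin

lemma ideals_set_simps [simp]:
 "1{ideals_set R} = carrier R" "I *{ideals_set R} J = I \<cdot> J"
 by (simp_all add: ideals_set_def)

lemma ipow_0: "ideal_power R I 0 = carrier R"
 by (simp add: ideals_set_def nat_pow_def)

lemma ipow_Suc: "ideal_power R I (Suc n) = ideal_power R I n \<cdot> I"
 by (simp add: ideals_set_def nat_pow_def)

lemma ipow_ideal: "ideal I R ==> ideal (ideal_power R I n) R"
 by (induct n) (auto simp: ipow_0 ipow_Suc oneideal ideal_prod_is_ideal)

lemma ipow_1: "ideal I R ==> ideal_power R I (Suc 0) = I"
 using ideal_prod_commute[of "carrier R" I] ideal_prod_one[of I] oneideal by (simp add: ipow_Suc ipow_0)

lemma ipow_mult: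
 assumes "ideal I R"
 shows "ideal_power R I a \<cdot> ideal_power R I b = ideal_power R I (a + b)"
proof -
 interpret M: comm_monoid "ideals_set R" by (rule ideals_set_is_comm_monoid)
 show ?thesis using M.nat_pow_mult[of I a b] assms by (simp add: ideals_set_def)
qed

lemma ipow_mult_mem:
 assumes "ideal I R" "x : ideal_power R I a" "y : ideal_power R I b"
 shows "x \<otimes> y : ideal_power R I (a + b)"
 using ideal_prod.prod[OF assms(2,3), of R] ipow_mult[OF assms(1)] by simp

lemma ipow_antimono:
 assumes "ideal I R" "a <= b"
 shows "ideal_power R I b <= ideal_power R I a"
proof -
 have "ideal_power R I (a + (b - a)) <= ideal_power R I a"
 using ideal_prod_inter[OF ipow_ideal[OF assms(1)] ipow_ideal[OF assms(1)], of a "b - a"]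
 by (auto simp: ipow_mult[OF assms(1)])
 then show ?thesis using assms by simp
qed

text \<open>A product of a + b factors from I + J expands into terms with at least a factors from I
  or at least b factors from J. The induction on a + b strips the last factor.\<close>

lemma ipow_add_le:
 assumes I: "ideal I R" and J: "ideal J R"
 shows "ideal_power R (I <+> J) (a + b) <= ideal_power R I a <+> ideal_power R J b"
proof (induct "a + b" arbitrary: a b)
 case 0
 then show ?case using add_ideals_sub[of "carrier R" "carrier R"] oneideal by (auto simp: ipow_0)
next
 case (Suc n)
 let ?P = "ideal_power R"
 note id = ipow_ideal[OF I] ipow_ideal[OF J] add_ideals[OF ipow_ideal[OF I] ipow_ideal[OF J]]
 show ?case
 proof (cases "a = 0 \<or> b = 0")
 case True
 have "?P (I <+> J) (a + b) <= carrier R"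
 by (rule ideal_closed(1)[OF ipow_ideal[OF add_ideals[OF I J]]])
 also have "carrier R <= ?P I a <+> ?P J b"
 using True add_ideals_sub[OF id(1)[of a] id(2)[of b]] by (elim disjE) (simp_all only: ipow_0)
 finally show ?thesis .
 next
 case False
 then obtain a' b' where ab: "a = Suc a'" "b = Suc b'" by (meson not0_implies_Suc)
 have n: "n = a' + b" "n = a + b'" using Suc(2) ab by auto
 have "?P (I <+> J) (Suc n) <= ?P I a <+> ?P J b"
 unfolding ipow_Suc
 proof (rule ideal_prod_minimal[OF id(3)])
 fix x z assume x: "x : ?P (I <+> J) n" and "z : I <+> J"
 then obtain i j where ij: "i : I" "j : J" "z = i \<oplus> j" by (auto simp: mem_set_add_iff)
 have c: "x : carrier R" "i : carrier R" "j : carrier R"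
 using x ideal_closed(1)[OF ipow_ideal[OF add_ideals[OF I J]]] ij ideal_closed(8)[OF I] ideal_closed(8)[OF J] by auto
 \<comment> \<open>The factor from I is charged to the exponent a, so the hypothesis for
   \<open>(a', b)\<close> applies; the factor from J is treated symmetrically with
   \<open>(a, b')\<close>.\<close>
 have "x \<otimes> i : ?P I a <+> ?P J b"
 proof -
 obtain u v where uv: "u : ?P I a'" "v : ?P J b" "x = u \<oplus> v"
 using Suc(1)[OF n(1)] x unfolding n(1) mem_set_add_iff subset_eq by blast
 have "u \<otimes> i : ?P I a" unfolding ab ipow_Suc using uv ij by (auto intro: ideal_prod.prod)
 moreover have "v \<otimes> i : ?P J b" using uv c ideal_closed(6)[OF id(2)] by auto
 ultimately show ?thesis using uv ideal_closed(8)[OF id(1)] ideal_closed(8)[OF id(2)] c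
 by (auto simp: l_distr mem_set_add_iff)
 qed
 moreover have "x \<otimes> j : ?P I a <+> ?P J b"
 proof -
 obtain u v where uv: "u : ?P I a" "v : ?P J b'" "x = u \<oplus> v"
 using Suc(1)[OF n(2)] x unfolding n(2) mem_set_add_iff subset_eq by blast
 have "v \<otimes> j : ?P J b" unfolding ab ipow_Suc using uv ij by (auto intro: ideal_prod.prod)
 moreover have "u \<otimes> j : ?P I a" using uv c ideal_closed(6)[OF id(1)] by auto
 ultimately show ?thesis using uv ideal_closed(8)[OF id(1)] ideal_closed(8)[OF id(2)] c
 by (auto simp: l_distr mem_set_add_iff)
 qed
 ultimately show "x \<otimes> z : ?P I a <+> ?P J b"
 using ideal_closed(3)[OF id(3)] c ij by (simp add: r_distr)
 qed
 then show ?thesis using Suc(2) by simp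
 qed
qed

end

text \<open>The monomial y^al, with the exponent vector stored as a multiset to match the exponents
  of \<open>series\<close>.\<close>

definition mon :: "('a, 'b) ring_scheme => (nat => 'a) => nat multiset => 'a" where
 "mon R y al = (\<Otimes>\<^bsub>R\<^esub>i\<in>set_mset al. y i ^{R} count al i)"

context cring
begin

lemma mon_empty [simp]: "mon R y {#} = \<one>"
 by (simp add: mon_def)

lemma mon_closed [simp]:
 "(!!i. i \<in># al ==> y i : carrier R) ==> mon R y al : carrier R"
 unfolding mon_def by (rule finprod_closed) auto

lemma mon_add_mset:
 assumes "!!j. j \<in># add_mset i al ==> y j : carrier R"
 shows "mon R y (add_mset i al) = y i \<otimes> mon R y al"
proof -
 let ?A = "set_mset al - {i}"
 have c: "(%j. y j [^] count al j) : ?A \<rightarrow> carrier R" "y i : carrier R"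
 "(%j. y j [^] count (add_mset i al) j) : ?A \<rightarrow> carrier R"
 using assms by (auto intro!: nat_pow_closed)
 have "mon R y (add_mset i al) = (\<Otimes>j\<in>insert i ?A. y j [^] count (add_mset i al) j)"
 unfolding mon_def by (rule finprod_cong) (use assms in \<open>auto simp: simp_implies_def\<close>)
 also have "... = y i [^] Suc (count al i) \<otimes> (\<Otimes>j\<in>?A. y j [^] count (add_mset i al) j)"
 using c by (subst finprod_insert) auto
 also have "(\<Otimes>j\<in>?A. y j [^] count (add_mset i al) j) = (\<Otimes>j\<in>?A. y j [^] count al j)"
 by (rule finprod_cong) (use assms in \<open>auto simp: simp_implies_def\<close>)
 finally have 1: "mon R y (add_mset i al) = y i [^] Suc (count al i) \<otimes> (\<Otimes>j\<in>?A. y j [^] count al j)" .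
 have "mon R y al = (\<Otimes>j\<in>insert i ?A. y j [^] count al j)"
 unfolding mon_def
 by (rule finprod_mono_neutral_cong_left) (use assms in \<open>auto simp: not_in_iff\<close>)
 also have "... = y i [^] count al i \<otimes> (\<Otimes>j\<in>?A. y j [^] count al j)"
 using c by (subst finprod_insert) auto
 finally show ?thesis unfolding 1 using c by (simp add: m_ac finprod_closed nat_pow_Suc)
qed

lemma mon_add:
 assumes "!!j. j \<in># al + bt ==> y j : carrier R"
 shows "mon R y (al + bt) = mon R y al \<otimes> mon R y bt"
 using assms
proof (induct al)
 case empty
 then show ?case by simp
next
 case (add i al)
 then have c: "y i : carrier R" "mon R y al : carrier R" "mon R y bt : carrier R" by auto
 have "mon R y (add_mset i (al + bt)) = y i \<otimes> mon R y (al + bt)"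
 using add(2) by (intro mon_add_mset) auto
 also have "mon R y (al + bt) = mon R y al \<otimes> mon R y bt" using add by auto
 also have "y i \<otimes> (mon R y al \<otimes> mon R y bt) = mon R y (add_mset i al) \<otimes> mon R y bt"
 using c add(2) by (subst mon_add_mset) (auto simp: m_assoc)
 finally show ?case by simp
qed

lemma mon_single: "y i : carrier R ==> mon R y {#i#} = y i"
 by (subst mon_add_mset) auto

lemma mon_cong: "(!!i. i \<in># al ==> y i = z i) ==> (!!i. i \<in># al ==> z i : carrier R) ==> mon R y al = mon R z al"
 unfolding mon_def by (rule finprod_cong) (auto simp: simp_implies_def)

lemma mon_image_carrier:
 "y ` Y <= carrier R ==> A <= {al. set_mset al <= Y} ==> mon R y ` A <= carrier R"
 by (auto intro!: mon_closed)

end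

context pcring
begin

lemma ipow_idl:
 assumes "y ` Y <= carrier R"
 shows "ideal_power R (Idl (y ` Y)) n = Idl (mon R y ` multisets_of_size Y n)"
proof (induct n)
 case 0
 have "multisets_of_size Y 0 = {{#}}" by (auto simp: multisets_of_size_def)
 then show ?case by (simp add: ipow_0 genideal_one)
next
 case (Suc n)
 have c: "mon R y ` multisets_of_size Y k <= carrier R" for k
 by (rule mon_image_carrier[OF assms]) (auto simp: multisets_of_size_def)
 have "{a \<otimes> b |a b. a : mon R y ` multisets_of_size Y n & b : y ` Y} = mon R y ` multisets_of_size Y (Suc n)"
 (is "?L = ?R")
 proof
 show "?L <= ?R"
 proof
 fix x assume "x : ?L"
 then obtain al i where *: "al : multisets_of_size Y n" "i : Y" "x = mon R y al \<otimes> y i" by auto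
 moreover have "y i : carrier R" "mon R y al : carrier R" using * assms c by auto
 moreover have "mon R y (add_mset i al) = y i \<otimes> mon R y al"
 using * assms by (intro mon_add_mset) (auto simp: multisets_of_size_def)
 ultimately have "x = mon R y (add_mset i al)" "add_mset i al : multisets_of_size Y (Suc n)"
 by (auto simp: m_comm multisets_of_size_def)
 then show "x : ?R" by auto
 qed
 show "?R <= ?L"
 proof
 fix x assume "x : ?R"
 then obtain gm where g: "gm : multisets_of_size Y (Suc n)" "x = mon R y gm" by auto
 then obtain i al where ia: "gm = add_mset i al" by (auto simp: multisets_of_size_def size_eq_Suc_imp_eq_union dest!: size_eq_Suc_imp_eq_union)
 then have "al : multisets_of_size Y n" "i : Y" using g by (auto simp: multisets_of_size_def)
 moreover have "mon R y (add_mset i al) = y i \<otimes> mon R y al"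
 using g ia assms by (intro mon_add_mset) (auto simp: multisets_of_size_def)
 moreover have "y i : carrier R" "mon R y al : carrier R" using calculation assms c by auto
 ultimately show "x : ?L" using g ia m_comm by auto
 qed
 qed
 then show ?case unfolding ipow_Suc Suc using idl_prod[OF c assms] by simp
qed

end

section \<open>Noetherian local rings\<close>

text \<open>Zorn's lemma applies because in a Noetherian ring the union of a nonempty chain of
  ideals is a member of the chain.\<close>

lemma (in noetherian_ring) noetherian_maximal:
 assumes "P I" "!!I. P I ==> ideal I R"
 shows "EX M. P M & I <= M & (ALL J. P J --> M <= J --> J = M)"
proof -
 let ?T = "{J. P J & I <= J}"
 have "\<exists>M\<in>?T. \<forall>J\<in>?T. M <= J --> J = M"
 proof (rule subset_Zorn_nonempty)
 show "?T ~= {}" using assms(1) by auto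
 fix C assume C: "C ~= {}" "subset.chain ?T C"
 then have sub: "C <= ?T" by (simp add: subset_chain_def)
 then have "C <= {I. ideal I R}" using assms(2) by auto
 then have "subset.chain {I. ideal I R} C" using C(2) by (simp add: subset_chain_def)
 then have "\<Union>C \<in> C" by (rule ideal_chain_is_trivial[OF C(1)])
 then show "\<Union>C \<in> ?T" by (rule set_mp[OF sub])
 qed
 then obtain M where M: "P M" "I <= M" "\<forall>J\<in>?T. M <= J --> J = M" by auto
 have "J = M" if "P J" "M <= J" for J using M that by auto
 then show ?thesis using M by blast
qed

lemma (in noetherian_ring) exists_maximalideal:
 assumes "ideal I R" "I ~= carrier R"
 obtains M where "maximalideal M R" "I <= M"
proof -
 obtain M where M: "ideal M R" "M ~= carrier R" "I <= M"
 "!!J. ideal J R & J ~= carrier R ==> M <= J ==> J = M"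
 using noetherian_maximal[of "%J. ideal J R & J ~= carrier R" I] assms by auto
 have "maximalideal M R"
 proof (rule maximalidealI)
 show "ideal M R" "carrier R ~= M" using M by auto
 fix J assume J: "ideal J R" "M <= J" "J <= carrier R"
 show "J = M \<or> J = carrier R" using M(4)[of J] J by (cases "J = carrier R") simp_all
 qed
 then show ?thesis using M that by blast
qed

text \<open>The maximal ideal is a parameter, characterised as a proper ideal whose complement
  consists of units; the arguments use locality in this form.\<close>

locale noeth_local = noetherian_ring R + pcring R for R :: "'a ring" (structure) +
 fixes mI
 assumes m_ideal: "ideal mI R" and one_notin: "\<one> ~: mI"
 and unitI: "x : carrier R ==> x ~: mI ==> x : Units R"

lemma noeth_localI:
 assumes "noetherian_ring R" "local_ring R"
 shows "noeth_local R (max_ideal R)"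
proof -
 interpret noetherian_ring R by fact
 interpret pcring R using assms(2) by (simp add: local_ring_def pcring_def)
 have ex1: "\<exists>!M. maximalideal M R" using assms(2) by (simp add: local_ring_def)
 have M: "maximalideal (max_ideal R) R" unfolding max_ideal_def by (rule theI'[OF ex1])
 have uniq: "M = max_ideal R" if "maximalideal M R" for M using ex1 M that by blast
 interpret M: maximalideal "max_ideal R" R by (rule M)
 show ?thesis
 proof (intro noeth_local.intro noeth_local_axioms.intro noetherian_ring_axioms pcring_axioms)
 show "ideal (max_ideal R) R" by (rule M.is_ideal)
 show "1{R} ~: max_ideal R" using M.one_imp_carrier M.I_notcarr by blast
 fix x assume x: "x : carrier R" "x ~: max_ideal R"
 have "PIdl\<^bsub>R\<^esub> x = carrier R"
 proof (rule ccontr)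
 assume "PIdl\<^bsub>R\<^esub> x ~= carrier R"
 then obtain M where "maximalideal M R" "PIdl\<^bsub>R\<^esub> x <= M"
 using exists_maximalideal cgenideal_ideal[OF x(1)] by blast
 then show False using uniq x cgenideal_self by blast
 qed
 then have "1{R} : PIdl\<^bsub>R\<^esub> x" by simp
 then obtain r where "r : carrier R" "1{R} = r *{R} x" unfolding cgenideal_def by blast
 then show "x : Units R" using x m_comm unfolding Units_def by auto
 qed
qed

context noeth_local
begin

abbreviation mp :: "nat => 'a set" where "mp n \<equiv> ideal_power R mI n"

lemmas m_closed_rules = ideal_closed[OF m_ideal]
lemmas mp_ideal = ipow_ideal[OF m_ideal]
lemmas mp_closed = ideal_closed[OF mp_ideal]

lemma nonunit: "x : mI ==> x ~: Units R"
 using m_closed_rules(6)[of x "inv x"] one_notin Units_r_inv[of x] Units_inv_closed[of x] by auto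

lemma unit_one_minus:
 assumes "x : mI" shows "\<one> \<ominus> x : Units R"
proof (rule unitI)
 have x: "x : carrier R" using assms m_closed_rules by auto
 then show "\<one> \<ominus> x : carrier R" by simp
 have "\<one> = (\<one> \<ominus> x) \<oplus> x" using x by algebra
 then show "\<one> \<ominus> x ~: mI" using assms m_closed_rules(3) one_notin by metis
qed

lemma unit_mult_mem:
 assumes "ideal I R" "u : Units R" "x : carrier R" "u \<otimes> x : I" shows "x : I"
proof -
 have "inv u \<otimes> (u \<otimes> x) : I" using assms ideal_closed(7) Units_inv_closed by blast
 moreover have "inv u \<otimes> (u \<otimes> x) = x" using assms Units_closed
 by (simp add: m_assoc[symmetric])
 ultimately show ?thesis by simp
qed

text \<open>Suppose N is not in Q and enlarge Q to an ideal Q' maximal among those not containing N.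
  For x in N outside Q', N lies in Q' + xR, hence mI N lies in Q' + mI x. So x = q + mu x with mu in
  mI, and 1 - mu is a unit.\<close>

lemma nakayama:
 assumes N: "ideal N R" and Q: "ideal Q R" and sub: "N <= Q <+> mI \<cdot> N"
 shows "N <= Q"
proof (rule ccontr)
 assume "\<not> N <= Q"
 then obtain Q' where Q': "ideal Q' R" "\<not> N <= Q'" "Q <= Q'"
 "!!J. ideal J R & \<not> N <= J ==> Q' <= J ==> J = Q'"
 using noetherian_maximal[of "%J. ideal J R & \<not> N <= J" Q] Q \<open>\<not> N <= Q\<close> by auto
 obtain x where x: "x : N" "x ~: Q'" using Q'(2) by blast
 have xc: "x : carrier R" using x ideal_closed(8)[OF N] by auto
 have Px: "ideal (PIdl x) R" using cgenideal_ideal xc by auto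
 have id: "ideal (Q' <+> PIdl x) R" by (rule add_ideals[OF Q'(1) Px])
 have "N <= Q' <+> PIdl x"
 proof (rule ccontr)
 assume "\<not> N <= Q' <+> PIdl x"
 then have "Q' <+> PIdl x = Q'" using Q'(4)[of "Q' <+> PIdl x"] id add_ideals_sub[OF Q'(1) Px] by auto
 then show False using x add_ideals_sub[OF Q'(1) Px] cgenideal_self[OF xc] by auto
 qed
 \<comment> \<open>This set is the ideal Q' + mI x, which absorbs both Q and the product
   \<open>mI \<cdot> N\<close>.\<close>
 let ?Z = "{z : carrier R. \<exists>q\<in>Q'. \<exists>\<mu>\<in>mI. z = q \<oplus> \<mu> \<otimes> x}"
 have Z: "ideal ?Z R"
 proof (rule idealI')
 show "\<zero> : ?Z" using ideal_closed(2)[OF Q'(1)] m_closed_rules(2) xc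
 by (auto intro!: bexI[of _ \<zero>])
 fix a b assume a: "a : ?Z"
 then obtain q \<mu> where q: "q : Q'" "\<mu> : mI" "a = q \<oplus> \<mu> \<otimes> x" by auto
 have qc: "q : carrier R" "\<mu> : carrier R" using q ideal_closed(8)[OF Q'(1)] m_closed_rules(8) by auto
 { assume "b : ?Z"
 then obtain q' \<mu>' where q': "q' : Q'" "\<mu>' : mI" "b = q' \<oplus> \<mu>' \<otimes> x" by auto
 have qc': "q' : carrier R" "\<mu>' : carrier R" using q' ideal_closed(8)[OF Q'(1)] m_closed_rules(8) by auto
 have "a \<oplus> b = (q \<oplus> q') \<oplus> (\<mu> \<oplus> \<mu>') \<otimes> x" unfolding q q' using qc qc' xc by algebra
 moreover have "q \<oplus> q' : Q'" "\<mu> \<oplus> \<mu>' : mI" using q q' ideal_closed(3)[OF Q'(1)] m_closed_rules(3) by auto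
 ultimately show "a \<oplus> b : ?Z" using qc qc' xc by auto }
 { assume b: "b : carrier R"
 have "b \<otimes> a = (b \<otimes> q) \<oplus> (b \<otimes> \<mu>) \<otimes> x" unfolding q using qc b xc by algebra
 moreover have "b \<otimes> q : Q'" "b \<otimes> \<mu> : mI" using q b ideal_closed(7)[OF Q'(1)] m_closed_rules(7) by auto
 ultimately show "b \<otimes> a : ?Z" using qc b xc by auto }
 qed auto
 have "mI \<cdot> N <= ?Z"
 proof (rule ideal_prod_minimal[OF Z])
 fix \<mu> n assume mn: "\<mu> : mI" "n : N"
 then obtain q p where qp: "q : Q'" "p : PIdl x" "n = q \<oplus> p" using \<open>N <= Q' <+> PIdl x\<close>
 unfolding mem_set_add_iff subset_eq by blast
 then obtain r where r: "r : carrier R" "p = r \<otimes> x" unfolding cgenideal_def by blast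
 have c: "\<mu> : carrier R" "q : carrier R" using mn qp ideal_closed(8)[OF Q'(1)] m_closed_rules(8) by auto
 have "\<mu> \<otimes> n = \<mu> \<otimes> q \<oplus> (\<mu> \<otimes> r) \<otimes> x" unfolding qp r using c r xc by algebra
 moreover have "\<mu> \<otimes> q : Q'" "\<mu> \<otimes> r : mI" using qp mn r c ideal_closed(7)[OF Q'(1)] m_closed_rules(6) by auto
 ultimately show "\<mu> \<otimes> n : ?Z" using c r xc by auto
 qed
 moreover have "Q <= ?Z"
 proof
 fix q assume "q : Q"
 then have "q : Q'" "q : carrier R" using Q'(3) ideal_closed(8)[OF Q'(1)] by auto
 moreover have "q = q \<oplus> \<zero> \<otimes> x" using calculation xc by simp
 ultimately show "q : ?Z" using m_closed_rules(2) by blast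
 qed
 ultimately have "N <= ?Z" using sub add_ideals_minimal[OF Z] by blast
 then obtain q \<mu> where q: "q : Q'" "\<mu> : mI" "x = q \<oplus> \<mu> \<otimes> x" using x by auto
 have c: "q : carrier R" "\<mu> : carrier R" using q ideal_closed(8)[OF Q'(1)] m_closed_rules(8) by auto
 have "(\<one> \<ominus> \<mu>) \<otimes> x = x \<ominus> \<mu> \<otimes> x" using c xc by algebra
 also have "... = (q \<oplus> \<mu> \<otimes> x) \<ominus> \<mu> \<otimes> x" using q(3) by simp
 also have "... = q" using c xc by algebra
 finally have "(\<one> \<ominus> \<mu>) \<otimes> x : Q'" using q by simp
 then show False using unit_mult_mem[OF Q'(1) unit_one_minus[OF q(2)] xc] x by blast
qed

section \<open>Krull's intersection theorem\<close>

lemma add_mp_ideal: "ideal I R ==> ideal (I <+> mp n) R"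
 by (rule add_ideals[OF _ mp_ideal])

text \<open>Every ideal strictly above Q contains x, in particular Q + aR.\<close>

lemma maximal_avoiding_colon:
 assumes Q: "ideal Q R" "x : carrier R" "x ~: Q"
 and mx: "!!J. ideal J R ==> Q <= J ==> x ~: J ==> J = Q" and a: "a : carrier R" "a ~: Q"
 shows "\<exists>q\<in>Q. \<exists>r\<in>carrier R. x = q \<oplus> r \<otimes> a"
proof -
 have Px: "ideal (PIdl a) R" using cgenideal_ideal a by auto
 note id = add_ideals[OF Q(1) Px]
 have "x : Q <+> PIdl a"
 proof (rule ccontr)
 assume "x ~: Q <+> PIdl a"
 then have "Q <+> PIdl a = Q" using mx id add_ideals_sub[OF Q(1) Px] by auto
 then show False using a add_ideals_sub[OF Q(1) Px] cgenideal_self[OF a(1)] by auto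
 qed
 then obtain q p where "q : Q" "p : PIdl a" "x = q \<oplus> p" unfolding mem_set_add_iff by blast
 then show ?thesis unfolding cgenideal_def by blast
qed

text \<open>For one generator this is a power of that generator; generators are then added by
  \<open>ipow_add_le\<close>, with the exponents adding up.\<close>

lemma ipow_nilpotent:
 assumes "finite A" "A <= carrier R" "ideal Q R" "!!a. a : A ==> EX k. a [^] (k::nat) : Q"
 shows "EX k. ideal_power R (Idl A) k <= Q"
 using assms
proof (induct A)
 case empty
 have "ideal_power R (Idl {}) (Suc 0) = {\<zero>}" using ipow_1[OF zeroideal] by (simp add: idl_empty)
 then show ?case using ideal_closed(2)[OF \<open>ideal Q R\<close>] by (metis empty_subsetI insert_subset)
next
 case (insert a A)
 obtain k where k: "ideal_power R (Idl A) k <= Q" using insert by auto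
 have "EX l. a [^] (l::nat) : Q" by (rule insert(6)) simp
 then obtain l where l: "a [^] (l::nat) : Q" by blast
 have ac: "a : carrier R" "A <= carrier R" using insert by auto
 have "ideal_power R (Idl {a}) l <= Q"
 proof -
 have 1: "ideal_power R (Idl {a}) n = Idl {a [^] n}" for n
 proof (induct n)
 case (Suc n)
 have "{aa \<otimes> b |aa b. aa : {a [^] n} & b : {a}} = {a [^] Suc n}" by (auto simp: nat_pow_Suc)
 then show ?case using ac idl_prod[of "{a [^] n}" "{a}"] by (simp only: ipow_Suc Suc) simp
 qed (simp add: genideal_one)
 show ?thesis unfolding 1 using l insert by (intro genideal_minimal) auto
 qed
 moreover have "Idl (insert a A) = Idl {a} <+> Idl A" using idl_union[of "{a}" A] ac by auto
 ultimately have "ideal_power R (Idl (insert a A)) (l + k) <= Q"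
 using ipow_add_le[of "Idl {a}" "Idl A" l k] ac k add_ideals_minimal[OF \<open>ideal Q R\<close>]
 by (metis (no_types, lifting) empty_subsetI idl_ideal insert_subset subset_trans)
 then show ?case by blast
qed

text \<open>Enlarge \<bb> to Q maximal among the ideals that omit x. Then mI x lies in Q and each
  element of mI has a power in Q, so some mI^k lies in Q; this puts x, an element of \<bb> + mI^k,
  into Q.\<close>

lemma krull:
 assumes b: "ideal \<bb> R" and x: "x : carrier R" and sub: "!!s. x : \<bb> <+> mp s"
 shows "x : \<bb>"
proof (rule ccontr)
 assume "x ~: \<bb>"
 then obtain Q where Q: "ideal Q R" "x ~: Q" "\<bb> <= Q"
 "!!J. ideal J R & x ~: J ==> Q <= J ==> J = Q"
 using noetherian_maximal[of "%J. ideal J R & x ~: J" \<bb>] b \<open>x ~: \<bb>\<close> by auto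
 note Qc = ideal_closed[OF Q(1)]
 have Qmax: "!!J. ideal J R ==> Q <= J ==> x ~: J ==> J = Q" using Q(4) by simp
 note av = maximal_avoiding_colon[OF Q(1) x Q(2) Qmax]
 have mx: "\<mu> \<otimes> x : Q" if mu: "\<mu> : mI" for \<mu>
 proof (rule ccontr)
 assume n: "\<mu> \<otimes> x ~: Q"
 have muc: "\<mu> : carrier R" using mu m_closed_rules by auto
 then obtain q r where q: "q : Q" "r : carrier R" "x = q \<oplus> r \<otimes> (\<mu> \<otimes> x)"
 using av[of "\<mu> \<otimes> x"] x n by auto
 have qc: "q : carrier R" using q Qc by auto
 have "(\<one> \<ominus> r \<otimes> \<mu>) \<otimes> x = x \<ominus> r \<otimes> (\<mu> \<otimes> x)" using qc q(2) x muc by algebra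
 also have "... = (q \<oplus> r \<otimes> (\<mu> \<otimes> x)) \<ominus> r \<otimes> (\<mu> \<otimes> x)" using q(3) by simp
 also have "... = q" using qc q(2) x muc by algebra
 finally have "(\<one> \<ominus> r \<otimes> \<mu>) \<otimes> x : Q" using q by simp
 moreover have "\<one> \<ominus> r \<otimes> \<mu> : Units R" using unit_one_minus m_closed_rules(7) mu q(2) by auto
 ultimately show False using unit_mult_mem[OF Q(1)] x Q(2) by blast
 qed
 have nil: "EX k. y [^] (k::nat) : Q" if y: "y : mI" for y
 proof -
 have yc: "y : carrier R" using y m_closed_rules by auto
 \<comment> \<open>The colon ideals (Q : y^k) increase with k; a maximal member of the family marks
   where they stabilise.\<close>
 let ?C = "%k::nat. {r : carrier R. y [^] k \<otimes> r : Q}"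
 have id: "ideal (?C k) R" for k by (rule colon_ideal[OF Q(1)]) (use yc in auto)
 obtain k where k: "!!l. ?C k <= ?C l ==> ?C l = ?C k"
 proof -
 have "EX M. (EX k. M = ?C k) & ?C 0 <= M & (ALL J. (EX k. J = ?C k) --> M <= J --> J = M)"
 by (rule noetherian_maximal) (use id in blast)+
 then obtain k where "ALL J. (EX k. J = ?C k) --> ?C k <= J --> J = ?C k" by auto
 then have "!!l. ?C k <= ?C l ==> ?C l = ?C k" by blast
 then show ?thesis by (rule that)
 qed
 have "y [^] k : Q"
 proof (rule ccontr)
 assume "y [^] k ~: Q"
 then obtain q r where q: "q : Q" "r : carrier R" "x = q \<oplus> r \<otimes> y [^] k"
 using av[of "y [^] k"] yc by auto
 have qc: "q : carrier R" "y [^] k : carrier R" using q Qc yc by auto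
 \<comment> \<open>Multiplying x = q + r y^k by y and using that y x is in Q puts r into the colon
   at k + 1, hence into the one at k. Then r y^k, and with it x, would lie in Q.\<close>
 have "y [^] Suc k \<otimes> r = y \<otimes> x \<ominus> y \<otimes> q"
 unfolding q(3) nat_pow_Suc using yc qc q(2) by algebra
 then have "y [^] Suc k \<otimes> r : Q" using mx[OF y] Qc q yc by auto
 moreover have "?C k <= ?C (Suc k)"
 proof
 fix z assume z: "z : ?C k"
 then have "y \<otimes> (y [^] k \<otimes> z) : Q" using Qc(7) yc by auto
 moreover have "y \<otimes> (y [^] k \<otimes> z) = y [^] Suc k \<otimes> z" using z yc qc by (simp add: nat_pow_Suc m_ac)
 ultimately show "z : ?C (Suc k)" using z by auto
 qed
 ultimately have "r : ?C k" using k[of "Suc k"] q(2) by blast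
 then have "y [^] k \<otimes> r : Q" by auto
 then have "r \<otimes> y [^] k : Q" using q(2) qc m_comm by auto
 then show False using Q(2) q Qc(3) by auto
 qed
 then show ?thesis by blast
 qed
 obtain A where A: "A <= carrier R" "finite A" "mI = Idl A" using finetely_gen[OF m_ideal] by auto
 then have "EX k. mp k <= Q" using ipow_nilpotent[OF A(2,1) Q(1)] nil idl_mem[OF A(1)] by auto
 then obtain k where "mp k <= Q" by blast
 then have "\<bb> <+> mp k <= Q" using add_ideals_minimal[OF Q(1)] Q(3) by auto
 then show False using sub Q(2) by blast
qed

end

section \<open>Leading monomials\<close>

declare nat_pow_Suc [simp del]

text \<open>The minimal elements of A serve as B. Were there infinitely many, a sequence of distinct
  ones would have a subsequence nondecreasing in every coordinate, and its first two terms would be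
  comparable.\<close>

lemma finite_dickson:
 assumes Y: "finite Y" and A: "!!al. al : A ==> set_mset al <= (Y :: nat set)"
 shows "EX B<=A. finite B & (\<forall>al\<in>A. \<exists>bt\<in>B. bt \<subseteq># al)"
proof -
 let ?B = "{bt\<in>A. \<forall>bt'\<in>A. \<not> bt' \<subset># bt}"
 have "\<exists>bt\<in>?B. bt \<subseteq># al" if "al : A" for al
 using that
 proof (induct "size al" arbitrary: al rule: less_induct)
 case less
 show ?case
 proof (cases "al : ?B")
 case False
 then obtain bt where b: "bt : A" "bt \<subset># al" using less by auto
 then have "size bt < size al" by (simp add: mset_subset_size)
 then obtain gm where "gm : ?B" "gm \<subseteq># bt" using less(1) b by meson
 then show ?thesis using b by (meson subset_mset.less_imp_le subset_mset.order_trans)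
 qed auto
 qed
 moreover have "finite ?B"
 proof (rule ccontr)
 assume "infinite ?B"
 then obtain f :: "nat => nat multiset" where f: "inj f" "range f <= ?B"
 using infinite_countable_subset by blast
 \<comment> \<open>The subsequence is refined one coordinate at a time, by induction on the finite
   set of coordinates.\<close>
 have "\<exists>r::nat=>nat. strict_mono r & (\<forall>i\<in>Z. ALL a b. a <= b --> count (f (r a)) i <= count (f (r b)) i)"
 if "finite Z" for Z
 using that
 proof (induct Z)
 case empty
 then show ?case by (auto intro!: exI[of _ id] strict_monoI)
 next
 case (insert i Z)
 then obtain r where r: "strict_mono (r::nat=>nat)" "\<forall>i\<in>Z. ALL a b. a <= b --> count (f (r a)) i <= count (f (r b)) i" by blast
 let ?s = "%k. count (f (r k)) i"
 have "\<exists>t::nat=>nat. strict_mono t & (ALL a b. a <= b --> ?s (t a) <= ?s (t b))"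
 \<comment> \<open>Either the coordinate tends to infinity and an increasing choice exists, or it
   stays below a bound infinitely often and so takes one value infinitely often.\<close>
 proof (cases "ALL v. EX k. \<forall>l\<ge>k. v < ?s l")
 case True
 have "\<exists>t::nat=>nat. ALL n. t n < t (Suc n) & ?s (t n) <= ?s (t (Suc n))"
 proof (rule dependent_nat_choice[where P="%_ _. True" and Q="%_ a b. a < b & ?s a <= ?s b", simplified])
 fix a show "\<exists>b>a. ?s a <= ?s b"
 using True[rule_format, of "?s a"] by (metis less_imp_le lessI linorder_le_cases order.strict_trans2)
 qed
 then obtain t where t: "!!n. t n < t (Suc n)" "!!n. ?s (t n) <= ?s (t (Suc n))" by blast
 then show ?thesis using lift_Suc_mono_le[of "%n. ?s (t n)"] by (auto simp: strict_mono_Suc_iff)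
 next
 case False
 then obtain v where v: "ALL k. \<exists>l\<ge>k. ?s l <= v" by (auto simp: not_less)
 have "infinite {l. ?s l <= v}" using v by (auto simp: infinite_nat_iff_unbounded_le)
 moreover have "{l. ?s l <= v} = (\<Union>w\<in>{..v}. {l. ?s l = w})" by auto
 ultimately obtain w where w: "infinite {l. ?s l = w}" by (metis finite_UN finite_atMost)
 from infinite_enumerate[OF w] obtain t where "strict_mono (t::nat=>nat)" "ALL n. t n : {l. ?s l = w}"
 by (elim exE conjE) rule
 then show ?thesis by - (rule exI[of _ t], simp)
 qed
 then obtain t where t: "strict_mono (t::nat=>nat)" "ALL a b. a <= b --> ?s (t a) <= ?s (t b)" by (elim exE conjE) rule
 have "strict_mono (r \<circ> t)" using r(1) t(1) by (simp add: strict_mono_o)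
 moreover have "\<forall>j\<in>insert i Z. ALL a b. a <= b --> count (f ((r \<circ> t) a)) j <= count (f ((r \<circ> t) b)) j"
 proof (intro ballI allI impI)
 fix j a b :: nat assume j: "j : insert i Z" and ab: "a <= b"
 then have "t a <= t b" using strict_mono_less_eq[OF t(1)] by simp
 then show "count (f ((r \<circ> t) a)) j <= count (f ((r \<circ> t) b)) j"
 using j r(2)[rule_format, of j "t a" "t b"] t(2)[rule_format, OF ab] by auto
 qed
 ultimately show ?case by blast
 qed
 from this[OF Y] obtain r where r: "strict_mono (r::nat=>nat)"
 "\<forall>i\<in>Y. ALL a b. a <= b --> count (f (r a)) i <= count (f (r b)) i" by blast
 have fA: "f k : ?B" for k using f(2) by auto
 have "f (r 0) \<subseteq># f (r 1)"
 proof (rule mset_subset_eqI)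
 fix i show "count (f (r 0)) i <= count (f (r 1)) i"
 proof (cases "i : Y")
 case False
 then have "i \<notin># f (r 0)" using A fA by blast
 then show ?thesis by (simp add: not_in_iff)
 qed (use r(2) in auto)
 qed
 moreover have "f (r 0) ~= f (r 1)" using f(1) r(1) by (metis injD strict_mono_eq zero_neq_one)
 ultimately show False using fA by (auto simp: subset_mset.less_le)
 qed
 ultimately show ?thesis by (intro exI[of _ ?B]) auto
qed

text \<open>R/I has length at least k, expressed by a strict chain of k inclusions of ideals
  starting at I. As a predicate it needs no value for infinite length.\<close>

primrec colen_ge :: "('a, 'b) ring_scheme => nat => 'a set => bool" where
 "colen_ge R 0 I \<longleftrightarrow> ideal I R"
| "colen_ge R (Suc k) I \<longleftrightarrow> ideal I R & (EX J. I \<subset> J & colen_ge R k J)"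

lemma colen_ge_ideal: "colen_ge R k I ==> ideal I R"
 by (cases k) auto

lemma colen_ge_antimono: "colen_ge R k I' ==> I <= I' ==> ideal I R ==> colen_ge R k I"
proof (cases k)
 case (Suc l)
 moreover assume "colen_ge R k I'" "I <= I'" "ideal I R"
 ultimately obtain J where "I' \<subset> J" "colen_ge R l J" by auto
 moreover have "I \<subset> J" using \<open>I <= I'\<close> \<open>I' \<subset> J\<close> by (rule order.strict_trans1)
 ultimately show ?thesis using Suc \<open>ideal I R\<close> by auto
qed simp

text \<open>Additivity of length along 0 -> R/(I : x) -> R/I -> R/(I + xR) -> 0, stated for chains:
  J |-> I + xJ sends a strict chain of ideals above (I : x) to a strict chain between I and I + xR,
  where the other chain continues.\<close>

lemma colen_ge_superadd:
 assumes R: "cring R" and x: "x : carrier R" and I: "ideal I R"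
 and a: "colen_ge R a (I <+{R} PIdl\<^bsub>R\<^esub> x)"
 and J: "colen_ge R b J" "!!r. r : carrier R ==> x *{R} r : I ==> r : J"
 shows "colen_ge R (a + b) I"
proof -
 interpret cring R by fact
 define E where "E J = I <+{R} {x *{R} r | r. r : J}" for J
 have idE: "ideal (E J) R" if J: "ideal J R" for J
 proof -
 have "ideal {x *{R} r | r. r : J} R"
 proof (rule idealI')
 show "0{R} : {x *{R} r | r. r : J}" using ideal_closed(2)[OF J] x by force
 fix u v assume u: "u : {x *{R} r | r. r : J}"
 then obtain r where r: "r : J" "u = x *{R} r" by auto
 { assume "v : {x *{R} r | r. r : J}"
 then obtain r' where r': "r' : J" "v = x *{R} r'" by auto
 have "u +{R} v = x *{R} (r +{R} r')" unfolding r r'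
 using x ideal_closed(8)[OF J r(1)] ideal_closed(8)[OF J r'(1)] by (simp add: r_distr)
 then show "u +{R} v : {x *{R} r | r. r : J}"
 using ideal_closed(3)[OF J r(1) r'(1)] by auto }
 { assume v: "v : carrier R"
 have "v *{R} u = x *{R} (v *{R} r)" unfolding r using x v r ideal_closed(8)[OF J] m_lcomm by auto
 then show "v *{R} u : {x *{R} r | r. r : J}" using ideal_closed(7)[OF J] r v by auto }
 qed (use x ideal_closed(8)[OF J] in auto)
 then show ?thesis unfolding E_def by (rule add_ideals[OF I])
 qed
 have *: "colen_ge R (a + b) (E J)"
 if "colen_ge R b J" "!!r. r : carrier R ==> x *{R} r : I ==> r : J" for b J
 using that
 proof (induct b arbitrary: J)
 case 0
 have "{x *{R} r | r. r : J} <= PIdl\<^bsub>R\<^esub> x"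
 using ideal_closed(8)[of J] 0 x m_comm unfolding cgenideal_def by auto
 then have "E J <= I <+{R} PIdl\<^bsub>R\<^esub> x" unfolding E_def by (intro set_add_mono) auto
 then show ?case using colen_ge_antimono[OF a] idE 0 by simp
 next
 case (Suc b)
 then obtain J' where J': "J \<subset> J'" "colen_ge R b J'" by auto
 have Jid: "ideal J R" "ideal J' R" using Suc(2) colen_ge_ideal[OF J'(2)] by auto
 have "colen_ge R (a + b) (E J')" using Suc(1)[OF J'(2)] Suc(3) J'(1) by blast
 moreover have "E J \<subset> E J'"
 proof -
 have "E J <= E J'" unfolding E_def using J'(1) by (intro set_add_mono) auto
 moreover obtain j where j: "j : J'" "j ~: J" using J'(1) by auto
 have jc: "j : carrier R" using j ideal_closed(8)[OF Jid(2)] by auto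
 have "0{R} +{R} x *{R} j : E J'" unfolding E_def mem_set_add_iff
 using j ideal_closed(2)[OF I] by blast
 moreover have "0{R} +{R} x *{R} j ~: E J"
 proof
 assume "0{R} +{R} x *{R} j : E J"
 then obtain i r where ir: "i : I" "r : J" "0{R} +{R} x *{R} j = i +{R} x *{R} r"
 unfolding E_def mem_set_add_iff by blast
 have c: "i : carrier R" "r : carrier R" using ir ideal_closed(8)[OF I] ideal_closed(8)[OF Jid(1)] by auto
 \<comment> \<open>If x j = i + x r, then j - r lies in (I : x), hence in J, and so does j.\<close>
 have "x *{R} (j -{R} r) = (0{R} +{R} x *{R} j) -{R} x *{R} r" using c jc x by algebra
 also have "... = i" unfolding ir(3) using c x by algebra
 finally have "j -{R} r : J" using Suc(3)[of "j -{R} r"] ir c jc by auto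
 then have "(j -{R} r) +{R} r : J" using ir ideal_closed(3)[OF Jid(1)] by auto
 moreover have "(j -{R} r) +{R} r = j" using c jc by algebra
 ultimately show False using j by simp
 qed
 ultimately show ?thesis by blast
 qed
 ultimately show ?case using idE[OF Jid(1)] by auto
 qed
 have "I <= E J" unfolding E_def mem_set_add_iff
 proof
 fix i assume i: "i : I"
 have "x *{R} 0{R} : {x *{R} r | r. r : J}" using ideal_closed(2)[OF colen_ge_ideal[OF J(1)]] by blast
 moreover have "i = i +{R} x *{R} 0{R}" using i x ideal_closed(8)[OF I] by simp
 ultimately show "i : I <+{R} {x *{R} r | r. r : J}" using i unfolding mem_set_add_iff by blast
 qed
 then show ?thesis using colen_ge_antimono[OF *[OF J]] I by blast
qed

section \<open>Leading monomials relative to generators of the maximal ideal\<close>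

locale noeth_local_gens = noeth_local R mI for R :: "'a ring" (structure) and mI +
 fixes y :: "nat => 'a" and Y
 assumes finY: "finite Y" and yc: "y ` Y <= carrier R" and m_gens: "mI = Idl (y ` Y)"
begin

abbreviation mm :: "nat multiset => 'a" where "mm al \<equiv> mon R y al"

text \<open>\<open>al < bt\<close> is the multiset extension of the order on indices. It is total
  and translation invariant, which makes it a monomial order within a fixed degree.\<close>

definition later :: "nat multiset => nat multiset set" where
 "later al = {bt : multisets_of_size Y (size al). al < bt}"

definition upper :: "nat multiset => 'a set" where
 "upper al = Idl (mm ` later al) <+> mp (Suc (size al))"

text \<open>al is an initial monomial of I, ordering first by degree and then by the multiset order;
  its coefficient is normalised to 1, as coefficients outside mI are units. If \<open>mm al\<close>
  itself lies in \<open>upper al\<close>, even the zero ideal qualifies; excluding this is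
  quasi-regularity of the generators.\<close>

definition lead :: "'a set => nat multiset => bool" where
 "lead I al \<longleftrightarrow> (\<exists>f\<in>I. f \<ominus> mm al : upper al)"

lemma mm_closed: "set_mset al <= Y ==> mm al : carrier R"
 using yc by (intro mon_closed) auto

lemma mms_carrier: "U <= multisets_of_size Y t ==> mm ` U <= carrier R"
 using mm_closed by (auto simp: multisets_of_size_def)

lemma later_sub: "later al <= multisets_of_size Y (size al)"
 by (auto simp: later_def)

lemma upper_ideal: "ideal (upper al) R"
 unfolding upper_def by (intro add_ideals mp_ideal idl_ideal mms_carrier[OF later_sub])

lemmas upper_closed = ideal_closed[OF upper_ideal]

lemma mp_monomials: "mp n = Idl (mm ` multisets_of_size Y n)"
 unfolding m_gens by (rule ipow_idl[OF yc])

lemma mm_mem: "set_mset al <= Y ==> mm al : mp (size al)"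
 unfolding mp_monomials by (rule idl_mem[OF mms_carrier]) (auto simp: multisets_of_size_def)

lemma upper_mult:
 assumes a: "set_mset al <= Y" and g: "set_mset gm <= Y" and x: "x : upper al"
 shows "x \<otimes> mm gm : upper (al + gm)"
proof -
 note gc = mm_closed[OF g]
 have lc: "mm ` later al <= carrier R" "mm ` later (al + gm) <= carrier R" using mms_carrier later_sub by blast+
 obtain u v where uv: "u : Idl (mm ` later al)" "v : mp (Suc (size al))" "x = u \<oplus> v"
 using x unfolding upper_def mem_set_add_iff by blast
 have c: "u : carrier R" "v : carrier R" using uv idl_carrier[OF lc(1)] mp_closed(8) by auto
 have "mm gm \<otimes> u : Idl (mm ` later (al + gm))"
 proof (rule idl_mult_mem[OF idl_ideal[OF lc(2)] lc(1) gc _ uv(1)])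
 fix z assume "z : mm ` later al"
 then obtain bt where b: "bt : later al" "z = mm bt" by auto
 then have "bt + gm : later (al + gm)" using g
 by (auto simp: later_def multisets_of_size_def)
 moreover have "mm gm \<otimes> z = mm (bt + gm)"
 proof -
 have "set_mset bt <= Y" using b by (auto simp: later_def multisets_of_size_def)
 then have "mm (bt + gm) = mm bt \<otimes> mm gm" using g yc by (intro mon_add) auto
 then show ?thesis using b gc mm_closed[OF \<open>set_mset bt <= Y\<close>] m_comm by simp
 qed
 ultimately show "mm gm \<otimes> z : Idl (mm ` later (al + gm))" using idl_mem[OF lc(2)] by simp
 qed
 moreover have "v \<otimes> mm gm : mp (Suc (size (al + gm)))"
 using ipow_mult_mem[OF m_ideal uv(2) mm_mem[OF g]] by simp
 moreover have "x \<otimes> mm gm = mm gm \<otimes> u \<oplus> v \<otimes> mm gm" unfolding uv(3) using c gc by algebra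
 ultimately show ?thesis unfolding upper_def mem_set_add_iff by blast
qed

lemma lead_add:
 assumes "set_mset al <= Y" "set_mset gm <= Y" "f : carrier R" "f \<ominus> mm al : upper al"
 shows "f \<otimes> mm gm \<ominus> mm (al + gm) : upper (al + gm)"
proof -
 have c: "mm al : carrier R" "mm gm : carrier R" using mm_closed assms by auto
 have m: "mm (al + gm) = mm al \<otimes> mm gm" using assms yc by (intro mon_add) auto
 have "(f \<ominus> mm al) \<otimes> mm gm = f \<otimes> mm gm \<ominus> mm (al + gm)" unfolding m using c assms(3) by algebra
 then show ?thesis using upper_mult[OF assms(1,2,4)] by simp
qed

lemma lead_mono: "I <= J ==> lead I al ==> lead J al"
 by (auto simp: lead_def)

lemma lead_superset:
 assumes I: "ideal I R" and "lead I bt" "set_mset al <= Y" "bt \<subseteq># al"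
 shows "lead I al"
proof -
 obtain f where f: "f : I" "f \<ominus> mm bt : upper bt" using assms(2) by (auto simp: lead_def)
 have sub: "set_mset bt <= Y" "set_mset (al - bt) <= Y" "bt + (al - bt) = al"
 using assms by (auto dest: mset_subset_eqD in_diffD)
 have "f \<otimes> mm (al - bt) \<ominus> mm al : upper al"
 using lead_add[OF sub(1,2) ideal_closed(8)[OF I f(1)] f(2)] sub(3) by simp
 moreover have "f \<otimes> mm (al - bt) : I" using ideal_closed(6)[OF I f(1)] mm_closed sub by auto
 ultimately show ?thesis by (auto simp: lead_def)
qed

text \<open>One pass of division in degree t, reducing elements of I by elements of H with the same
  initial monomials. The monomials still to be treated form a final segment U of degree t, and each
  step removes its least element.\<close>

lemma reduction_aux:
 assumes I: "ideal I R" and H: "ideal H R" and HI: "H <= I"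
 and l: "!!al. al : multisets_of_size Y t ==> lead I al ==> \<exists>g\<in>H. g \<ominus> mm al : upper al"
 and U: "U <= multisets_of_size Y t" "!!al. al : U ==> later al <= U"
 and f: "f : I" "f : Idl (mm ` U) <+> mp (Suc t)"
 shows "\<exists>h\<in>H. f \<ominus> h : mp (Suc t)"
proof -
 have "finite U" using U(1) finY finite_multisets_of_size finite_subset by blast
 then show ?thesis using U f
 proof (induct "card U" arbitrary: U f)
 case 0
 then have "U = {}" by simp
 then have "f : {\<zero>} <+> mp (Suc t)" using 0 by (simp add: idl_empty)
 then obtain v where "v : mp (Suc t)" "f = \<zero> \<oplus> v" unfolding mem_set_add_iff by blast
 then have "f \<ominus> \<zero> : mp (Suc t)" using mp_closed(8)[of v "Suc t"] by (simp add: minus_eq)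
 then show ?case using ideal_closed(2)[OF H] by blast
 next
 case (Suc k)
 then have ne: "U ~= {}" by auto
 define al where "al = Min U"
 have aU: "al : U" "!!bt. bt : U ==> al <= bt" using ne Suc(3) by (auto simp: al_def)
 let ?V = "U - {al}"
 have cV: "k = card ?V" "finite ?V" "?V <= multisets_of_size Y t" using Suc aU by auto
 have upV: "later bt <= ?V" if b: "bt : ?V" for bt
 proof -
 have "later bt <= U" using Suc(5) b by auto
 moreover have "al < bt" using aU(2)[of bt] b by auto
 then have "al ~: later bt" by (auto simp: later_def)
 ultimately show ?thesis by auto
 qed
 have sa: "size al = t" "set_mset al <= Y" using aU Suc(4) by (auto simp: multisets_of_size_def)
 have lV: "later al = ?V"
 using Suc(5)[OF aU(1)] aU(2) Suc(4) sa by (auto simp: later_def order_le_less)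
 then have up: "upper al = Idl (mm ` ?V) <+> mp (Suc t)" unfolding upper_def sa by simp
 have Vc: "mm ` ?V <= carrier R" by (rule mms_carrier[OF cV(3)])
 have ac: "mm al : carrier R" using mm_closed sa by auto
 obtain w v where wv: "w : Idl (mm ` U)" "v : mp (Suc t)" "f = w \<oplus> v"
 using Suc(7) unfolding mem_set_add_iff by blast
 have "mm ` U = insert (mm al) (mm ` ?V)" using aU by auto
 then obtain u e where ue: "u : carrier R" "e : Idl (mm ` ?V)" "w = mm al \<otimes> u \<oplus> e"
 using wv(1) idl_insert[OF ac Vc] by auto
 have c: "e : carrier R" "v : carrier R" using ue idl_carrier[OF Vc] wv mp_closed(8) by auto
 have ev: "e \<oplus> v : upper al" unfolding up mem_set_add_iff using ue wv by blast
 have fe: "f = mm al \<otimes> u \<oplus> (e \<oplus> v)" unfolding wv ue using c ue(1) ac by algebra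
 have fc: "f : carrier R" using fe c ue ac by auto
 show ?case
 \<comment> \<open>A coefficient in mI pushes the term into degree t + 1. Any other coefficient is a
   unit, so al is an initial monomial of I and a multiple of the matching element of H cancels the
   term.\<close>
 proof (cases "u : mI")
 case True
 then have "mm al \<otimes> u : mp (size al + 1)"
 using ipow_mult_mem[OF m_ideal mm_mem[OF sa(2)], of u 1] ipow_1[OF m_ideal] by auto
 then have "mm al \<otimes> u : upper al" using sa add_ideals_sub(2)[OF idl_ideal[OF Vc] mp_ideal] by (auto simp: up)
 then have "f : Idl (mm ` ?V) <+> mp (Suc t)" unfolding up[symmetric] fe using ev upper_closed(3) by auto
 then show ?thesis using Suc(1)[OF cV upV Suc(6)] by auto
 next
 case False
 then have uu: "u : Units R" using unitI ue by auto
 note iu = Units_inv_closed[OF uu]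
 have "f \<otimes> inv u \<ominus> mm al = mm al \<otimes> (u \<otimes> inv u) \<oplus> (e \<oplus> v) \<otimes> inv u \<ominus> mm al"
 unfolding fe using c ue(1) ac iu by algebra
 also have "... = mm al \<otimes> \<one> \<oplus> (e \<oplus> v) \<otimes> inv u \<ominus> mm al" by (simp only: Units_r_inv[OF uu])
 also have "... = (e \<oplus> v) \<otimes> inv u" using c ac iu by algebra
 finally have "f \<otimes> inv u \<ominus> mm al : upper al" using upper_closed(6)[OF ev iu] by simp
 then have "lead I al" using ideal_closed(6)[OF I Suc(6) iu] by (auto simp: lead_def)
 then obtain g where g: "g : H" "g \<ominus> mm al : upper al" using l aU Suc(4) by blast
 have gc: "g : carrier R" using g ideal_closed(8)[OF H] by auto
 let ?f = "f \<ominus> g \<otimes> u"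
 have "?f = (e \<oplus> v) \<ominus> (g \<ominus> mm al) \<otimes> u" unfolding fe using c gc ue(1) ac by algebra
 then have 1: "?f : Idl (mm ` ?V) <+> mp (Suc t)"
 unfolding up[symmetric] using upper_closed(4)[OF ev] upper_closed(6)[OF g(2) ue(1)] by simp
 have gu: "g \<otimes> u : H" using ideal_closed(6)[OF H g(1) ue(1)] .
 then have "?f : I" using HI Suc(6) ideal_closed(4)[OF I] by auto
 then obtain h where h: "h : H" "?f \<ominus> h : mp (Suc t)" using Suc(1)[OF cV upV _ 1] by auto
 have hc: "h : carrier R" using h ideal_closed(8)[OF H] by auto
 have "f \<ominus> (g \<otimes> u \<oplus> h) = ?f \<ominus> h" using fc gc hc ue(1) by algebra
 then show ?thesis using h ideal_closed(3)[OF H gu h(1)] by metis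
 qed
 qed
qed

lemma reduction:
 assumes I: "ideal I R" and H: "ideal H R" and HI: "H <= I"
 and l: "!!al. al : multisets_of_size Y t ==> lead I al ==> \<exists>g\<in>H. g \<ominus> mm al : upper al"
 and f: "f : I" "f : mp t"
 shows "\<exists>h\<in>H. f \<ominus> h : mp (Suc t)"
proof (rule reduction_aux[OF I H HI l, where U = "multisets_of_size Y t"])
 have "mp t <= mp t <+> mp (Suc t)" by (rule add_ideals_sub[OF mp_ideal mp_ideal])
 then show "f : Idl (mm ` multisets_of_size Y t) <+> mp (Suc t)" using f(2) mp_monomials by auto
 show "later al <= multisets_of_size Y t" if "al : multisets_of_size Y t" for al
 using that by (auto simp: later_def multisets_of_size_def)
qed (use f in auto)

text \<open>By Dickson the initial monomials of \<cc> have finitely many minimal ones, and k bounds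
  their degrees. In degree t >= k the reducers are g y^(al - bt) with g in \<cc> and al - bt of
  degree at least t - k, so they lie in \<cc> mI^(t - k); \<open>krull\<close> removes the
  remainder.\<close>

lemma artin_rees:
 assumes c: "ideal \<cc> R"
 shows "EX k. \<forall>s\<ge>k. \<cc> \<inter> mp s <= \<cc> \<cdot> mp (s - k)"
proof -
 obtain B where B: "B <= {al. set_mset al <= Y & lead \<cc> al}" "finite B"
 "\<forall>al\<in>{al. set_mset al <= Y & lead \<cc> al}. \<exists>bt\<in>B. bt \<subseteq># al"
 using finite_dickson[OF finY, of "{al. set_mset al <= Y & lead \<cc> al}"] by auto
 \<comment> \<open>The inserted 0 covers the case without initial monomials.\<close>
 define k where "k = Max (insert 0 (size ` B))"
 have k: "size bt <= k" if "bt : B" for bt using that B(2) unfolding k_def by (intro Max_ge) auto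
 have idp: "ideal (\<cc> \<cdot> mp n) R" for n by (rule ideal_prod_is_ideal[OF c mp_ideal])
 have sub: "\<cc> \<cdot> mp n <= \<cc>" for n using ideal_prod_inter[OF c mp_ideal] by blast
 have step: "\<exists>h\<in>\<cc> \<cdot> mp (t - k). f \<ominus> h : mp (Suc t)" if t: "t \<ge> k" and f: "f : \<cc>" "f : mp t" for t f
 proof (rule reduction[OF c idp sub _ f])
 fix al assume a: "al : multisets_of_size Y t" "lead \<cc> al"
 then obtain bt where b: "bt : B" "bt \<subseteq># al" using B(3) by (auto simp: multisets_of_size_def)
 then obtain g where g: "g : \<cc>" "g \<ominus> mm bt : upper bt" using B(1) by (auto simp: lead_def)
 have s: "set_mset bt <= Y" "set_mset (al - bt) <= Y" "bt + (al - bt) = al"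
 using a b B(1) by (auto simp: multisets_of_size_def dest: in_diffD)
 have "size (al - bt) \<ge> t - k" using k[OF b(1)] a b by (auto simp: size_Diff_submset multisets_of_size_def)
 then have "mm (al - bt) : mp (t - k)" using mm_mem[OF s(2)] ipow_antimono[OF m_ideal] by blast
 then have "g \<otimes> mm (al - bt) : \<cc> \<cdot> mp (t - k)" by (rule ideal_prod.prod[OF g(1)])
 moreover have "g \<otimes> mm (al - bt) \<ominus> mm al : upper al"
 using lead_add[OF s(1,2) ideal_closed(8)[OF c g(1)] g(2)] s(3) by simp
 ultimately show "\<exists>g\<in>\<cc> \<cdot> mp (t - k). g \<ominus> mm al : upper al" by blast
 qed
 have "f : \<cc> \<cdot> mp (s - k)" if s: "s \<ge> k" and f: "f : \<cc>" "f : mp s" for s f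
 proof (rule krull[OF idp])
 have fc: "f : carrier R" using ideal_closed(8)[OF c f(1)] .
 then show "f : carrier R" .
 note idc = ideal_closed[OF idp]
 have approx: "\<exists>h\<in>\<cc> \<cdot> mp (s - k). f \<ominus> h : mp (s + n)" for n
 proof (induct n)
 case 0
 have "f \<ominus> \<zero> : mp (s + 0)" using f fc by (simp add: minus_eq)
 then show ?case using idc(2) by blast
 next
 case (Suc n)
 then obtain h where h: "h : \<cc> \<cdot> mp (s - k)" "f \<ominus> h : mp (s + n)" by blast
 have "f \<ominus> h : \<cc>" using h sub f ideal_closed(4)[OF c] by blast
 then obtain h' where h': "h' : \<cc> \<cdot> mp (s + n - k)" "f \<ominus> h \<ominus> h' : mp (Suc (s + n))"
 using step[of "s + n" "f \<ominus> h"] h s by auto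
 have "h' : \<cc> \<cdot> mp (s - k)"
 using h'(1) ideal_prod_mono[of \<cc> \<cc> "mp (s + n - k)" "mp (s - k)"] ipow_antimono[OF m_ideal, of "s - k" "s + n - k"]
 by auto
 moreover have "f \<ominus> (h \<oplus> h') = f \<ominus> h \<ominus> h'" using fc idc(8)[OF h(1)] idc(8)[OF h'(1)] by algebra
 ultimately show ?case using h h' idc(3) by (metis add_Suc_right)
 qed
 fix n
 obtain h where h: "h : \<cc> \<cdot> mp (s - k)" "f \<ominus> h : mp (s + n)" using approx by blast
 have "f = h \<oplus> (f \<ominus> h)" using fc idc(8)[OF h(1)] by algebra
 moreover have "f \<ominus> h : mp n" using h ipow_antimono[OF m_ideal, of n "s + n"] by auto
 ultimately show "f : \<cc> \<cdot> mp (s - k) <+> mp n" using h unfolding mem_set_add_iff by blast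
 qed
 then show ?thesis by blast
qed

text \<open>The number of standard monomials of degree below s, used as an upper bound for the
  length of R/I when mI^s lies in I.\<close>

definition colen :: "nat => 'a set => nat" where
 "colen s I = card {al. set_mset al <= Y & size al < s & \<not> lead I al}"

lemma finite_small: "finite {al. set_mset al <= Y & size al < s}"
proof -
 have "{al. set_mset al <= Y & size al < s} = (\<Union>n\<in>{..<s}. multisets_of_size Y n)"
 by (auto simp: multisets_of_size_def)
 then show ?thesis using finY by auto
qed

text \<open>If I contains mI^s and J above I had the same initial monomials below degree s,
  \<open>reduction\<close> would bring every element of J into I. So a strictly larger ideal has
  strictly more initial monomials.\<close>

lemma colen_less:
 assumes I: "ideal I R" and J: "ideal J R" and IJ: "I \<subset> J" and s: "mp s <= I"
 shows "colen s J < colen s I"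
proof -
 have "\<exists>al. set_mset al <= Y & size al < s & lead J al & \<not> lead I al"
 proof (rule ccontr)
 assume no: "\<not> ?thesis"
 have "J <= I"
 proof
 fix f assume f: "f : J"
 have fc: "f : carrier R" using f ideal_closed(8)[OF J] by auto
 have "\<exists>h\<in>I. f \<ominus> h : mp t" if "t <= s" for t
 using that
 proof (induct t)
 case 0
 have "f \<ominus> \<zero> : mp 0" using fc by (simp add: ipow_0)
 then show ?case using ideal_closed(2)[OF I] by blast
 next
 case (Suc t)
 then obtain h where h: "h : I" "f \<ominus> h : mp t" by auto
 have hc: "h : carrier R" using h ideal_closed(8)[OF I] by auto
 have "f \<ominus> h : J" using f h IJ ideal_closed(4)[OF J] by blast
 moreover have "\<exists>g\<in>I. g \<ominus> mm al : upper al" if "al : multisets_of_size Y t" "lead J al" for al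
 proof -
 have "set_mset al <= Y" "size al < s" using that Suc(2) by (auto simp: multisets_of_size_def)
 then have "lead I al" using no that(2) by blast
 then show ?thesis by (simp add: lead_def)
 qed
 ultimately obtain h' where h': "h' : I" "f \<ominus> h \<ominus> h' : mp (Suc t)"
 using reduction[OF J I _ _ _ h(2)] IJ by blast
 have "f \<ominus> (h \<oplus> h') = f \<ominus> h \<ominus> h'" using fc hc ideal_closed(8)[OF I h'(1)] by algebra
 then show ?case using h h' ideal_closed(3)[OF I] by metis
 qed
 then obtain h where h: "h : I" "f \<ominus> h : mp s" by auto
 then have "(f \<ominus> h) \<oplus> h : I" using s ideal_closed(3)[OF I] by blast
 moreover have "(f \<ominus> h) \<oplus> h = f" using fc ideal_closed(8)[OF I h(1)] by algebra
 ultimately show "f : I" by simp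
 qed
 then show False using IJ by auto
 qed
 then obtain al where a: "set_mset al <= Y" "size al < s" "lead J al" "\<not> lead I al" by blast
 have "{al. set_mset al <= Y & size al < s & \<not> lead J al} \<subset> {al. set_mset al <= Y & size al < s & \<not> lead I al}"
 using a IJ lead_mono[of I J] by blast
 then show ?thesis unfolding colen_def
 by (intro psubset_card_mono finite_subset[OF _ finite_small[of s]]) auto
qed

lemma colen_ge_le: "colen_ge R k I ==> mp s <= I ==> k <= colen s I"
proof (induct k arbitrary: I)
 case (Suc k)
 then obtain J where J: "I \<subset> J" "colen_ge R k J" by auto
 have id: "ideal I R" "ideal J R" using Suc(2) J colen_ge_ideal by auto
 have "k <= colen s J" using Suc(1) J Suc(3) by blast
 also have "... < colen s I" by (rule colen_less[OF id J(1) Suc(3)])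
 finally show ?case by simp
qed simp

end

section \<open>Chains of primes and quasi-regularity\<close>

context noeth_local_gens
begin

lemma prime_sub_m: "primeideal P R ==> P <= mI"
proof
 fix x assume P: "primeideal P R" and x: "x : P"
 interpret P: primeideal P R by fact
 note Pc = ideal_closed[OF P.is_ideal]
 show "x : mI"
 proof (rule ccontr)
 assume "x ~: mI"
 then have "x : Units R" using unitI Pc(8)[OF x] by auto
 then have "\<one> : P" using Pc(6)[OF x, of "inv x"] by simp
 then show False using P.one_imp_carrier P.I_notcarr by auto
 qed
qed

text \<open>Artin-Rees for P + xR writes the part of x r in mI^s as p' + x t with t in mI^(s - c).
  Then x (r - t) lies in P, and primality removes the factor x.\<close>

lemma colon_shift:
 assumes P: "primeideal P R" and x: "x : carrier R" "x ~: P"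
 shows "EX c. \<forall>s\<ge>c. \<forall>r\<in>carrier R. x \<otimes> r : P <+> mp s --> r : P <+> mp (s - c)"
proof -
 interpret P: primeideal P R by fact
 note Pid = P.is_ideal
 note Pc = ideal_closed[OF Pid]
 have xid: "ideal (PIdl x) R" by (rule cgenideal_ideal[OF x(1)])
 have cid: "ideal (P <+> PIdl x) R" by (rule add_ideals[OF Pid xid])
 obtain c where c: "!!s. s \<ge> c ==> (P <+> PIdl x) \<inter> mp s <= (P <+> PIdl x) \<cdot> mp (s - c)"
 using artin_rees[OF cid] by blast
 have prod: "\<exists>p\<in>P. \<exists>t\<in>mp n. f = p \<oplus> x \<otimes> t" if f: "f : (P <+> PIdl x) \<cdot> mp n" for f n
 using f
 proof (induct f rule: ideal_prod.induct)
 case (prod i j)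
 then obtain p q where pq: "p : P" "q : PIdl x" "i = p \<oplus> q" unfolding mem_set_add_iff by blast
 then obtain r where r: "r : carrier R" "q = r \<otimes> x" unfolding cgenideal_def by blast
 have cc: "p : carrier R" "j : carrier R" using pq(1) Pc(8) mp_closed(8)[OF prod(2)] by auto
 have "i \<otimes> j = p \<otimes> j \<oplus> x \<otimes> (r \<otimes> j)" unfolding pq r using cc r x by algebra
 then show ?case using Pc(6)[OF pq(1) cc(2)] mp_closed(7)[OF prod(2) r(1)] by blast
 next
 case (sum f f')
 then obtain p t p' t' where *: "p : P" "t : mp n" "f = p \<oplus> x \<otimes> t" "p' : P" "t' : mp n" "f' = p' \<oplus> x \<otimes> t'"
 by blast
 have cc: "p : carrier R" "p' : carrier R" "t : carrier R" "t' : carrier R"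
 using * Pc(8) mp_closed(8) by blast+
 have "f \<oplus> f' = (p \<oplus> p') \<oplus> x \<otimes> (t \<oplus> t')" unfolding * using cc x by algebra
 then show ?case using Pc(3)[OF *(1,4)] mp_closed(3)[OF *(2,5)] by blast
 qed
 have "r : P <+> mp (s - c)" if s: "s \<ge> c" and r: "r : carrier R" and xr: "x \<otimes> r : P <+> mp s" for s r
 proof -
 obtain p f where pf: "p : P" "f : mp s" "x \<otimes> r = p \<oplus> f" using xr unfolding mem_set_add_iff by blast
 have cc: "p : carrier R" "f : carrier R" using Pc(8)[OF pf(1)] mp_closed(8)[OF pf(2)] by auto
 have "f = (p \<oplus> f) \<ominus> p" using cc by algebra
 also have "... = \<ominus> p \<oplus> r \<otimes> x" unfolding pf(3)[symmetric] using cc r x by algebra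
 finally have fe: "f = \<ominus> p \<oplus> r \<otimes> x" .
 have "r \<otimes> x : PIdl x" using r unfolding cgenideal_def by blast
 then have "f : P <+> PIdl x" unfolding mem_set_add_iff using fe Pc(5)[OF pf(1)] by blast
 then have "f : (P <+> PIdl x) \<cdot> mp (s - c)" using c[OF s] pf(2) by blast
 then obtain p' t where pt: "p' : P" "t : mp (s - c)" "f = p' \<oplus> x \<otimes> t" using prod by blast
 have tc: "p' : carrier R" "t : carrier R" using Pc(8)[OF pt(1)] mp_closed(8)[OF pt(2)] by auto
 have "x \<otimes> (r \<ominus> t) = (p \<oplus> f) \<ominus> x \<otimes> t" unfolding pf(3)[symmetric] using r tc x by algebra
 also have "... = p \<oplus> p'" unfolding pt(3) using cc tc x by algebra
 finally have "x \<otimes> (r \<ominus> t) : P" using Pc(3)[OF pf(1) pt(1)] by simp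
 then have "r \<ominus> t : P" using P.I_prime[of x "r \<ominus> t"] x r tc by auto
 moreover have "r = (r \<ominus> t) \<oplus> t" using r tc by algebra
 ultimately show ?thesis unfolding mem_set_add_iff using pt(2) by blast
 qed
 then show ?thesis by blast
qed

text \<open>Induction along the chain: passing from P 0 to P 1 lowers the exponent in the polynomial
  bound for the lengths by one, and a bound of exponent 0 is impossible as long as a further prime
  follows.\<close>

lemma growth_chain:
 assumes "!!i. i <= l ==> primeideal (P i) R" "!!i. i < l ==> P i \<subset> P (Suc i)"
 and "!!s k. s \<ge> 1 ==> colen_ge R k (P 0 <+> mp s) ==> k <= C * s ^ e"
 shows "l <= e"
 using assms
proof (induct l arbitrary: e P C)
 case (Suc l)
 let ?P = "P 0"
 have prime: "primeideal ?P R" "primeideal (P 1) R" using Suc(2)[of 0] Suc(2)[of 1] by auto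
 have sub: "?P \<subset> P 1" using Suc(3)[of 0] by auto
 interpret P0: primeideal ?P R by fact
 interpret P1: primeideal "P 1" R by fact
 note Pid = P0.is_ideal
 obtain x where x: "x : P 1" "x ~: ?P" using sub by auto
 have xc: "x : carrier R" using ideal_closed(8)[OF P1.is_ideal x(1)] .
 have xid: "ideal (PIdl x) R" by (rule cgenideal_ideal[OF xc])
 let ?Q = "?P <+> PIdl x"
 have Qid: "ideal ?Q R" by (rule add_ideals[OF Pid xid])
 have QP1: "?Q <= P 1"
 by (rule add_ideals_minimal[OF P1.is_ideal]) (use sub cgenideal_minimal[OF P1.is_ideal x(1)] in auto)
 obtain c where c: "!!s r. s \<ge> c ==> r : carrier R ==> x \<otimes> r : ?P <+> mp s ==> r : ?P <+> mp (s - c)"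
 using colon_shift[OF prime(1) xc x(2)] by blast
 \<comment> \<open>By \<open>colon_shift\<close> a factor x costs at most c in the exponent of mI,
   and by \<open>colen_ge_superadd\<close> each such factor contributes the length k once
   more.\<close>
 have iter: "colen_ge R (j * k) (?P <+> mp (S + j * Suc c))"
 if S: "colen_ge R k (?Q <+> mp S)" for S j k
 proof (induct j)
 case 0
 then show ?case using add_mp_ideal[OF Pid] by simp
 next
 case (Suc j)
 let ?s = "S + Suc j * Suc c"
 let ?I = "?P <+> mp ?s"
 have Iid: "ideal ?I R" by (rule add_mp_ideal[OF Pid])
 have "?I <+> PIdl x <= ?Q <+> mp S"
 proof (rule add_ideals_minimal[OF add_mp_ideal[OF Qid]])
 show "?I <= ?Q <+> mp S"
 by (intro set_add_mono add_ideals_sub[OF Pid xid] ipow_antimono[OF m_ideal]) simp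
 show "PIdl x <= ?Q <+> mp S"
 using add_ideals_sub(2)[OF Pid xid] add_ideals_sub(1)[OF Qid mp_ideal[of S]] by (rule subset_trans)
 qed
 then have 1: "colen_ge R k (?I <+> PIdl x)" by (rule colen_ge_antimono[OF S _ add_ideals[OF Iid xid]])
 have "r : ?P <+> mp (S + j * Suc c)" if r: "r : carrier R" "x \<otimes> r : ?I" for r
 proof -
 have "r : ?P <+> mp (?s - c)" using c[OF _ r] by simp
 moreover have "mp (?s - c) <= mp (S + j * Suc c)" by (rule ipow_antimono[OF m_ideal]) simp
 ultimately show ?thesis using set_add_mono[OF subset_refl[of ?P]] by blast
 qed
 from colen_ge_superadd[OF is_cring xc Iid 1 Suc this] show ?case by (simp add: add.commute)
 qed
 show ?case
 proof (cases e)
 case 0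
 \<comment> \<open>For e = 0 the lengths would be bounded by C, but \<open>iter\<close> with j = C +
   1 and k = 1 exceeds C.\<close>
 have "?Q <+> mp 1 <= mI"
 proof (rule add_ideals_minimal[OF m_ideal])
 show "?Q <= mI" using QP1 prime_sub_m[OF prime(2)] by (rule subset_trans)
 qed (use ipow_1[OF m_ideal] in simp)
 then have "?Q <+> mp 1 \<subset> carrier R" using one_notin m_closed_rules(1) by blast
 then have "colen_ge R 1 (?Q <+> mp 1)" using oneideal add_mp_ideal[OF Qid, of 1] by auto
 from iter[OF this, of "Suc C"] have "colen_ge R (Suc C) (?P <+> mp (1 + Suc C * Suc c))" by simp
 then have "Suc C <= C * (1 + Suc C * Suc c) ^ e" using Suc(4)[of "1 + Suc C * Suc c" "Suc C"] by simp
 then show ?thesis using 0 by simp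
 next
 case e: (Suc e')
 have "l <= e'"
 \<comment> \<open>The bound for P 1 comes from \<open>iter\<close> with j = s: the exponent s + s
   (c + 1) equals (c + 2) s, and dividing s k <= C ((c + 2) s)^e by s leaves the constant C (c +
   2)^e and the exponent e - 1.\<close>
 proof (rule Suc(1)[of "%i. P (Suc i)" "C * (Suc (Suc c)) ^ e" e'])
 show "primeideal (P (Suc i)) R" if "i <= l" for i using Suc(2) that by auto
 show "P (Suc i) \<subset> P (Suc (Suc i))" if "i < l" for i using Suc(3) that by auto
 fix s k :: nat assume s: "s \<ge> 1" and k: "colen_ge R k (P (Suc 0) <+> mp s)"
 have "?Q <+> mp s <= P (Suc 0) <+> mp s" using QP1 by (intro set_add_mono) auto
 then have "colen_ge R k (?Q <+> mp s)" by (rule colen_ge_antimono[OF k _ add_mp_ideal[OF Qid]])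
 from Suc(4)[OF _ iter[OF this, of s]] s have "s * k <= C * (s + s * Suc c) ^ e" by auto
 also have "s + s * Suc c = Suc (Suc c) * s" by simp
 also have "C * (Suc (Suc c) * s) ^ e = s * (C * Suc (Suc c) ^ e * s ^ e')"
 by (simp add: e power_mult_distrib mult_ac del: mult_Suc mult_Suc_right)
 finally show "k <= C * Suc (Suc c) ^ e * s ^ e'" using s by simp
 qed
 then show ?thesis using e by simp
 qed
qed simp

text \<open>A monomial not divisible by bt has at some index i an exponent j <
  \<open>count bt i\<close>. For fixed i and j at most s^d choices remain for the other d exponents,
  and the pairs (i, j) number \<open>size bt\<close>.\<close>

lemma card_avoiding:
 assumes b: "set_mset bt <= Y" and d: "card Y = Suc d"
 shows "card {al. set_mset al <= Y & size al < s & \<not> bt \<subseteq># al} <= size bt * s ^ d"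
proof -
 let ?D = "%i j. {al. set_mset al <= Y & size al < s & count al i = j}"
 have D: "card (?D i j) <= s ^ d" if i: "i : Y" for i j
 proof -
 let ?f = "%al. restrict (count al) (Y - {i})"
 have "inj_on ?f (?D i j)"
 proof (rule inj_onI)
 fix al al' assume a: "al : ?D i j" "al' : ?D i j" "?f al = ?f al'"
 show "al = al'"
 proof (rule multiset_eqI)
 fix l
 consider "l = i" | "l : Y - {i}" | "l ~: Y" using i by auto
 then show "count al l = count al' l"
 proof cases
 case 2
 then show ?thesis using fun_cong[OF a(3), of l] by simp
 next
 case 3
 then have "l \<notin># al" "l \<notin># al'" using a by auto
 then show ?thesis by (simp add: not_in_iff)
 qed (use a in auto)
 qed
 qed
 moreover have "?f ` ?D i j <= (Y - {i}) \<rightarrow>\<^sub>E {..<s}"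
 proof -
 have "count al l < s" if "size al < s" for al :: "nat multiset" and l
 using that count_le_size[of al l] by linarith
 then show ?thesis by (simp add: image_subset_iff restrict_PiE_iff Pi_iff)
 qed
 moreover have "finite ((Y - {i}) \<rightarrow>\<^sub>E {..<s})" using finY by (auto intro: finite_PiE)
 ultimately have "card (?D i j) <= card ((Y - {i}) \<rightarrow>\<^sub>E {..<s})" by (rule card_inj_on_le)
 also have "... = s ^ d" using finY i d by (simp add: card_PiE)
 finally show ?thesis .
 qed
 have "{al. set_mset al <= Y & size al < s & \<not> bt \<subseteq># al} <= (\<Union>i\<in>set_mset bt. \<Union>j\<in>{..<count bt i}. ?D i j)"
 proof
 fix al assume a: "al : {al. set_mset al <= Y & size al < s & \<not> bt \<subseteq># al}"
 then obtain i where "count al i < count bt i" by (auto simp: subseteq_mset_def not_le)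
 moreover have "i \<in># bt" using calculation by (metis count_eq_zero_iff less_nat_zero_code)
 ultimately show "al \<in> (\<Union>i\<in>set_mset bt. \<Union>j\<in>{..<count bt i}. ?D i j)" using a by auto
 qed
 moreover have "finite (\<Union>i\<in>set_mset bt. \<Union>j\<in>{..<count bt i}. ?D i j)"
 by (intro finite_UN_I finite_subset[OF _ finite_small[of s]]) auto
 ultimately have "card {al. set_mset al <= Y & size al < s & \<not> bt \<subseteq># al} <= card (\<Union>i\<in>set_mset bt. \<Union>j\<in>{..<count bt i}. ?D i j)"
 by (intro card_mono)
 also have "... <= (\<Sum>i\<in>set_mset bt. \<Sum>j\<in>{..<count bt i}. card (?D i j))"
 by (rule order_trans[OF card_UN_le]) (auto intro!: sum_mono card_UN_le)
 also have "... <= (\<Sum>i\<in>set_mset bt. \<Sum>j\<in>{..<count bt i}. s ^ d)"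
 using b D by (intro sum_mono) auto
 also have "... = size bt * s ^ d" by (simp add: size_multiset_overloaded_eq sum_distrib_right)
 finally show ?thesis .
qed

text \<open>If y^bt were congruent to later terms, every ideal would have bt as an initial monomial.
  The lengths of R/(P 0 + mI^s) would then grow at most like s^(|Y| - 1), too slowly for a chain of
  |Y| inclusions of primes.\<close>

theorem chain_imp_quasi_regular:
 assumes P: "!!i. i <= card Y ==> primeideal (P i) R" "!!i. i < card Y ==> P i \<subset> P (Suc i)"
 and a: "set_mset bt <= Y"
 shows "mm bt ~: upper bt"
proof
 assume b: "mm bt : upper bt"
 have bc: "mm bt : carrier R" by (rule mm_closed[OF a])
 have lead0: "lead I bt" if I: "ideal I R" for I
 proof -
 have "\<zero> \<ominus> mm bt : upper bt" using upper_closed(4)[OF upper_closed(2) b] .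
 then show ?thesis using ideal_closed(2)[OF I] by (auto simp: lead_def)
 qed
 show False
 proof (cases "card Y")
 case 0
 \<comment> \<open>Without generators \<open>upper {#}\<close> is mI, and the assumption says that 1
   lies in it.\<close>
 then have "Y = {}" using finY by simp
 then have "bt = {#}" using a by simp
 then have "\<one> : upper {#}" using b by simp
 moreover have "later {#} = {}" by (auto simp: later_def multisets_of_size_def)
 then have "upper {#} = {\<zero>} <+> mI" by (simp add: upper_def idl_empty ipow_1[OF m_ideal])
 moreover have "{\<zero>} <+> mI <= mI" using m_closed_rules(2) by (intro add_ideals_minimal m_ideal) auto
 ultimately show False using one_notin by blast
 next
 case (Suc d)
 have Pid: "ideal (P 0) R" using P(1)[of 0] primeideal.axioms(1) by auto
 have "card Y <= d"
 proof (rule growth_chain[of "card Y" P "size bt"])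
 show "primeideal (P i) R" if "i <= card Y" for i using P(1) that .
 show "P i \<subset> P (Suc i)" if "i < card Y" for i using P(2) that .
 fix s k :: nat assume s: "s \<ge> 1" and k: "colen_ge R k (P 0 <+> mp s)"
 let ?I = "P 0 <+> mp s"
 have Iid: "ideal ?I R" by (rule add_mp_ideal[OF Pid])
 have "k <= colen s ?I" using colen_ge_le[OF k] add_ideals_sub(2)[OF Pid mp_ideal] by simp
 also have "... <= card {al. set_mset al <= Y & size al < s & \<not> bt \<subseteq># al}"
 unfolding colen_def
 proof (rule card_mono)
 show "finite {al. set_mset al <= Y & size al < s & \<not> bt \<subseteq># al}"
 by (rule finite_subset[OF _ finite_small[of s]]) auto
 show "{al. set_mset al <= Y & size al < s & \<not> lead ?I al} <= {al. set_mset al <= Y & size al < s & \<not> bt \<subseteq># al}"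
 using lead_superset[OF Iid lead0[OF Iid]] by blast
 qed
 also have "... <= size bt * s ^ d" by (rule card_avoiding[OF a Suc])
 finally show "k <= size bt * s ^ d" .
 qed
 then show False using Suc by simp
 qed
qed

end

section \<open>Complete filtered rings\<close>

lemma (in cring) minus_self [simp]: "x : carrier R ==> x \<ominus> x = \<zero>"
 by (simp add: minus_eq r_neg)

text \<open>The common ground of power series rings and completions. The filtration is a sequence of
  ideals rather than the powers of one, because for a completion the kernels of the projections are
  what is at hand.\<close>

locale complete_filtered = pcring B for B :: "'b ring" (structure) +
 fixes K :: "nat => 'b set"
 assumes K_ideal: "ideal (K n) B"
 and K_0: "K 0 = carrier B"
 and K_Suc: "K (Suc n) <= K n"
 and K_mult: "x : K i ==> y : K j ==> x \<otimes> y : K (i + j)"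
 and K_sep: "x : carrier B ==> (!!n. x : K n) ==> x = \<zero>"
 and K_complete: "(!!n. a n : carrier B) ==> (!!n. a (Suc n) \<ominus> a n : K n) ==>
 \<exists>x\<in>carrier B. ALL n. x \<ominus> a n : K n"
begin

lemmas K_closed = ideal_closed[OF K_ideal]

lemma K_antimono: "m <= n ==> K n <= K m"
 by (rule lift_Suc_antimono_le[of K, OF K_Suc])

lemma unit_one_minus_K:
 assumes e: "e : K 1"
 shows "\<one> \<ominus> e : Units B"
proof -
 have ec: "e : carrier B" by (rule K_closed(8)[OF e])
 \<comment> \<open>The partial sums of the geometric series in e.\<close>
 define a where "a n = rec_nat \<zero> (%_ z. \<one> \<oplus> e \<otimes> z) n" for n :: nat
 have a0: "a 0 = \<zero>" and aS: "a (Suc n) = \<one> \<oplus> e \<otimes> a n" for n by (simp_all add: a_def)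
 have ac: "a n : carrier B" for n by (induct n) (simp_all add: a0 aS ec)
 have step: "a (Suc n) \<ominus> a n : K n" for n
 proof (induct n)
 case 0
 then show ?case using ac K_0 by simp
 next
 case (Suc n)
 have c: "a n : carrier B" "a (Suc n) : carrier B" using ac by auto
 have "a (Suc (Suc n)) \<ominus> a (Suc n) = (\<one> \<oplus> e \<otimes> a (Suc n)) \<ominus> (\<one> \<oplus> e \<otimes> a n)" using aS by metis
 also have "... = e \<otimes> (a (Suc n) \<ominus> a n)" using c ec by algebra
 also have "... : K (1 + n)" by (rule K_mult[OF e Suc])
 finally show ?case by simp
 qed
 obtain x where x: "x : carrier B" "!!n. x \<ominus> a n : K n"
 using K_complete[of a] ac step by blast
 have "(\<one> \<ominus> e) \<otimes> x \<ominus> \<one> = \<zero>"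
 proof (rule K_sep)
 show "(\<one> \<ominus> e) \<otimes> x \<ominus> \<one> : carrier B" using x ec by simp
 fix n
 have c: "a n : carrier B" "a (Suc n) : carrier B" using ac by auto
 have "(\<one> \<ominus> e) \<otimes> x \<ominus> \<one> = (\<one> \<ominus> e) \<otimes> (x \<ominus> a n) \<ominus> ((\<one> \<oplus> e \<otimes> a n) \<ominus> a n)"
 using x(1) c ec by algebra
 also have "(\<one> \<oplus> e \<otimes> a n) \<ominus> a n : K n" using step[of n] aS by simp
 then have "(\<one> \<ominus> e) \<otimes> (x \<ominus> a n) \<ominus> ((\<one> \<oplus> e \<otimes> a n) \<ominus> a n) : K n"
 using K_closed(4,7) x(2)[of n] ec by auto
 finally show "(\<one> \<ominus> e) \<otimes> x \<ominus> \<one> : K n" .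
 qed
 moreover have "(\<one> \<ominus> e) \<otimes> x : carrier B" using x ec by simp
 ultimately have "(\<one> \<ominus> e) \<otimes> x = \<one>" by simp
 then show ?thesis using x ec m_comm unfolding Units_def by auto
qed

lemma unit_mod_K:
 assumes "f : carrier B" "g : carrier B" "f \<otimes> g \<ominus> \<one> : K 1"
 shows "f : Units B"
proof -
 have "\<one> \<ominus> (\<ominus> (f \<otimes> g \<ominus> \<one>)) : Units B" by (rule unit_one_minus_K) (rule K_closed(5)[OF assms(3)])
 moreover have "\<one> \<ominus> (\<ominus> (f \<otimes> g \<ominus> \<one>)) = f \<otimes> g" using assms(1,2) by algebra
 ultimately have u: "f \<otimes> g : Units B" by simp
 have "f \<otimes> (g \<otimes> inv (f \<otimes> g)) = (f \<otimes> g) \<otimes> inv (f \<otimes> g)" using assms u Units_inv_closed by (simp only: m_assoc)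
 also have "... = \<one>" by (rule Units_r_inv[OF u])
 finally have 1: "f \<otimes> (g \<otimes> inv (f \<otimes> g)) = \<one>" .
 have c: "g \<otimes> inv (f \<otimes> g) : carrier B" using assms u by simp
 then have "(g \<otimes> inv (f \<otimes> g)) \<otimes> f = \<one>" using 1 m_comm[OF assms(1) c] by simp
 then show ?thesis using 1 c assms(1) unfolding Units_def by blast
qed

lemma idl_insert_prod:
 assumes a: "a : carrier B" and A: "A <= carrier B" and Q: "ideal Q B" and x: "x : (Idl (insert a A)) \<cdot> Q"
 shows "\<exists>g\<in>Q. \<exists>h\<in>(Idl A) \<cdot> Q. x = a \<otimes> g \<oplus> h"
 using x
proof (induct x rule: ideal_prod.induct)
 case (prod i j)
 then obtain r y where ry: "r : carrier B" "y : Idl A" "i = a \<otimes> r \<oplus> y" using idl_insert[OF a A] by auto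
 have c: "y : carrier B" "j : carrier B" using ry idl_carrier[OF A] ideal_closed(8)[OF Q prod(2)] by auto
 have "i \<otimes> j = a \<otimes> (r \<otimes> j) \<oplus> y \<otimes> j" unfolding ry using a c ry(1) by algebra
 then show ?case using ideal_closed(7)[OF Q prod(2) ry(1)] ideal_prod.prod[OF ry(2) prod(2)] by blast
next
 case (sum s t)
 note pid = ideal_prod_is_ideal[OF idl_ideal[OF A] Q]
 obtain g h g' h' where *: "g : Q" "h : (Idl A) \<cdot> Q" "s = a \<otimes> g \<oplus> h" "g' : Q" "h' : (Idl A) \<cdot> Q" "t = a \<otimes> g' \<oplus> h'"
 using sum by blast
 have c: "g : carrier B" "g' : carrier B" "h : carrier B" "h' : carrier B"
 using * ideal_closed(8)[OF Q] ideal_closed(8)[OF pid] by auto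
 have "s \<oplus> t = a \<otimes> (g \<oplus> g') \<oplus> (h \<oplus> h')" unfolding * using c a by algebra
 then show ?case using ideal_closed(3)[OF Q *(1,4)] ideal_closed(3)[OF pid *(2,5)] by blast
qed

text \<open>The coefficients are collected generator by generator. Each coefficient series converges
  because its n-th term lies in \<open>K n\<close>; the induction runs over the finitely many
  generators.\<close>

lemma series_in_idl:
 assumes "finite A" "A <= carrier B" "!!n. r n : (Idl A) \<cdot> K n"
 "s 0 = \<zero>" "!!n. s (Suc n) = s n \<oplus> r n"
 shows "\<exists>x\<in>Idl A. ALL n. x \<ominus> s n : K n"
 using assms
proof (induct A arbitrary: r s)
 case empty
 have "r n : {\<zero>} \<cdot> K n" for n using empty(2) by (simp add: idl_empty)
 then have "r n = \<zero>" for n using ideal_prod_inter[OF zeroideal K_ideal] by blast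
 then have "s n = \<zero>" for n by (induct n) (simp_all add: empty)
 then show ?case using K_closed(2) by (auto simp: idl_empty minus_eq)
next
 case (insert a A)
 have ac: "a : carrier B" "A <= carrier B" using insert by auto
 note pid = ideal_prod_is_ideal[OF idl_ideal[OF ac(2)] K_ideal]
 have "EX g h. g : K n & h : (Idl A) \<cdot> K n & r n = a \<otimes> g \<oplus> h" for n
 using idl_insert_prod[OF ac K_ideal insert(5)[of n]] by blast
 then obtain g h where gh: "!!n. g n : K n" "!!n. h n : (Idl A) \<cdot> K n" "!!n. r n = a \<otimes> g n \<oplus> h n"
 by metis
 have gc: "g n : carrier B" "h n : carrier B" for n
 using K_closed(8)[OF gh(1)] ideal_closed(8)[OF pid gh(2)] by auto
 define G where "G n = rec_nat \<zero> (%n z. z \<oplus> g n) n" for n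
 define H where "H n = rec_nat \<zero> (%n z. z \<oplus> h n) n" for n
 have G: "G 0 = \<zero>" "G (Suc n) = G n \<oplus> g n" for n by (simp_all add: G_def)
 have H: "H 0 = \<zero>" "H (Suc n) = H n \<oplus> h n" for n by (simp_all add: H_def)
 have Gc: "G n : carrier B" for n by (induct n) (simp_all add: G gc)
 have Hc: "H n : carrier B" for n by (induct n) (simp_all add: H gc)
 have "G (Suc n) \<ominus> G n : K n" for n
 proof -
 have c: "G n : carrier B" "g n : carrier B" using Gc gc by auto
 have "G (Suc n) \<ominus> G n = g n" unfolding G using c by algebra
 then show ?thesis using gh by simp
 qed
 then obtain t where t: "t : carrier B" "!!n. t \<ominus> G n : K n" using K_complete[of G] Gc by blast
 obtain x where x: "x : Idl A" "!!n. x \<ominus> H n : K n" using insert(3)[OF ac(2) gh(2) H] by blast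
 have xc: "x : carrier B" using x idl_carrier[OF ac(2)] by auto
 have s: "s n = a \<otimes> G n \<oplus> H n" for n
 proof (induct n)
 case 0
 then show ?case using ac insert(6) by (simp add: G H)
 next
 case (Suc n)
 have c: "G n : carrier B" "H n : carrier B" "g n : carrier B" "h n : carrier B" using Gc Hc gc by auto
 show ?case unfolding insert(7) Suc gh(3) G H using c ac(1) by algebra
 qed
 have "(a \<otimes> t \<oplus> x) \<ominus> s n : K n" for n
 proof -
 have c: "G n : carrier B" "H n : carrier B" using Gc Hc by auto
 have "(a \<otimes> t \<oplus> x) \<ominus> s n = a \<otimes> (t \<ominus> G n) \<oplus> (x \<ominus> H n)" unfolding s using c ac(1) t(1) xc by algebra
 then show ?thesis using K_closed(3)[OF K_closed(7)[OF t(2) ac(1)] x(2)] by simp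
 qed
 moreover have "a \<otimes> t \<oplus> x : Idl (insert a A)" using idl_insert[OF ac] t(1) x(1) by blast
 ultimately show ?case by blast
qed

text \<open>Peeling off one order at a time writes f as a series whose n-th term lies in (Idl A) (K
  n), and \<open>series_in_idl\<close> sums it inside the ideal.\<close>

lemma idl_by_approximation:
 assumes A: "finite A" "A <= carrier B"
 and Q: "Q <= carrier B"
 and step: "!!f n. f : Q ==> f : K (Suc n) ==> \<exists>f'\<in>Q. f' : K (Suc (Suc n)) & f \<ominus> f' : (Idl A) \<cdot> K n"
 and f: "f : Q" "f : K 1"
 shows "f : Idl A"
proof -
 have "EX F. F 0 = f & (ALL n. (F n : Q & F n : K (Suc n)) & (F n \<ominus> F (Suc n) : (Idl A) \<cdot> K n))"
 proof -
 have "EX F. ALL n. ((F n : Q & F n : K (Suc n)) & (n = 0 --> F n = f)) & (F n \<ominus> F (Suc n) : (Idl A) \<cdot> K n)"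
 proof (rule dependent_nat_choice)
 show "EX x. (x : Q & x : K (Suc 0)) & (0 = 0 --> x = f)" using f by auto
 fix x n assume "(x : Q & x : K (Suc n)) & (n = 0 --> x = f)"
 then show "EX y. ((y : Q & y : K (Suc (Suc n))) & (Suc n = 0 --> y = f)) & x \<ominus> y : (Idl A) \<cdot> K n"
 using step[of x n] by auto
 qed
 then show ?thesis by auto
 qed
 then obtain F where F: "F 0 = f" "!!n. F n : Q" "!!n. F n : K (Suc n)" "!!n. F n \<ominus> F (Suc n) : (Idl A) \<cdot> K n"
 by auto
 have Fc: "F n : carrier B" for n using F(2) Q by auto
 have fc: "f : carrier B" using f Q by auto
 have "f \<ominus> F (Suc n) = f \<ominus> F n \<oplus> (F n \<ominus> F (Suc n))" for n
 proof -
 have c: "F n : carrier B" "F (Suc n) : carrier B" using Fc by auto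
 show ?thesis using c fc by algebra
 qed
 moreover have "f \<ominus> F 0 = \<zero>" using F fc by simp
 ultimately obtain x where x: "x : Idl A" "!!n. x \<ominus> (f \<ominus> F n) : K n"
 using series_in_idl[OF A F(4), of "%n. f \<ominus> F n"] by blast
 have xc: "x : carrier B" using x idl_carrier[OF A(2)] by auto
 have "x \<ominus> f = \<zero>"
 proof (rule K_sep)
 show "x \<ominus> f : carrier B" using xc fc by simp
 fix n
 have c: "F n : carrier B" using Fc by auto
 have "x \<ominus> f = (x \<ominus> (f \<ominus> F n)) \<ominus> F n" using c xc fc by algebra
 moreover have "F n : K n" using F(3) K_Suc by blast
 ultimately show "x \<ominus> f : K n" using K_closed(4)[OF x(2)] by simp
 qed
 then have "x = f" using xc fc by simp
 then show ?thesis using x by simp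
qed

end

text \<open>Surjectivity on each graded piece is lifted by successive approximation, with the limit
  taken in the source.\<close>

lemma filtered_surj:
 assumes P: "complete_filtered P KP" and B: "complete_filtered B KB"
 and h: "\<theta> : ring_hom P B"
 and sub: "!!n x. x : KP n ==> \<theta> x : KB n"
 and app: "!!n t. t : KB n ==> \<exists>g\<in>KP n. t -{B} \<theta> g : KB (Suc n)"
 and t: "t : carrier B"
 shows "\<exists>g\<in>carrier P. \<theta> g = t"
proof -
 interpret P: complete_filtered P KP by fact
 interpret B: complete_filtered B KB by fact
 interpret h: ring_hom_cring P B \<theta> by unfold_locales (rule h)
 have minus: "\<theta> (a -{P} b) = \<theta> a -{B} \<theta> b" if "a : carrier P" "b : carrier P" for a b
 using that by (simp add: P.minus_eq B.minus_eq)
 have "EX G. ALL n. ((G n : carrier P & t -{B} \<theta> (G n) : KB n)) & (G (Suc n) -{P} G n : KP n)"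
 proof (rule dependent_nat_choice)
 show "EX x. x : carrier P & t -{B} \<theta> x : KB 0" using t by (intro exI[of _ "0{P}"]) (simp add: B.K_0)
 fix x n assume x: "x : carrier P & t -{B} \<theta> x : KB n"
 then obtain g where g: "g : KP n" "t -{B} \<theta> x -{B} \<theta> g : KB (Suc n)" using app by blast
 have gc: "g : carrier P" by (rule P.K_closed(8)[OF g(1)])
 have xc: "x : carrier P" "\<theta> x : carrier B" "\<theta> g : carrier B" using x gc by auto
 have "t -{B} \<theta> (x +{P} g) = t -{B} \<theta> x -{B} \<theta> g" using xc gc t by (simp add: B.minus_eq B.minus_add B.a_assoc)
 moreover have "(x +{P} g) -{P} x = g" using xc(1) gc by algebra
 ultimately show "EX y. (y : carrier P & t -{B} \<theta> y : KB (Suc n)) & y -{P} x : KP n"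
 using g xc gc by (intro exI[of _ "x +{P} g"]) simp
 qed
 then obtain G where G: "!!n. G n : carrier P" "!!n. t -{B} \<theta> (G n) : KB n" "!!n. G (Suc n) -{P} G n : KP n"
 by blast
 then obtain g where g: "g : carrier P" "!!n. g -{P} G n : KP n" using P.K_complete[of G] by blast
 have "t -{B} \<theta> g = 0{B}"
 proof (rule B.K_sep)
 show "t -{B} \<theta> g : carrier B" using t g by simp
 fix n
 have c: "\<theta> g : carrier B" "\<theta> (G n) : carrier B" using g G by auto
 have "t -{B} \<theta> g = (t -{B} \<theta> (G n)) -{B} (\<theta> g -{B} \<theta> (G n))" using c t by algebra
 also have "\<theta> g -{B} \<theta> (G n) = \<theta> (g -{P} G n)" using minus g(1) G(1) by simp
 finally show "t -{B} \<theta> g : KB n" using B.K_closed(4)[OF G(2) sub[OF g(2)]] by simp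
 qed
 then show ?thesis using g t by (auto intro!: bexI[of _ g])
qed

lemma quotient_cosets:
 assumes "cring R" "ideal Q R"
 shows "carrier (R Quot Q) = (%a. Q +>{R} a) ` carrier R"
 and "a : carrier R ==> b : carrier R ==> (Q +>{R} a) *{R Quot Q} (Q +>{R} b) = Q +>{R} (a *{R} b)"
 and "a : carrier R ==> b : carrier R ==> (Q +>{R} a) +{R Quot Q} (Q +>{R} b) = Q +>{R} (a +{R} b)"
 and "1{R Quot Q} = Q +>{R} 1{R}"
 and "0{R Quot Q} = Q +>{R} 0{R}"
 and "a : carrier R ==> b : carrier R ==> Q +>{R} a = Q +>{R} b \<longleftrightarrow> a -{R} b : Q"
 and "a : carrier R ==> x : Q +>{R} a \<longleftrightarrow> x : carrier R & x -{R} a : Q"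
proof -
 interpret cring R by fact
 interpret ideal Q R by fact
 note hom = rcos_ring_hom
 show "carrier (R Quot Q) = (%a. Q +>{R} a) ` carrier R" by (auto simp: FactRing_simps)
 show "a : carrier R ==> b : carrier R ==> (Q +>{R} a) *{R Quot Q} (Q +>{R} b) = Q +>{R} (a *{R} b)"
 using ring_hom_mult[OF hom] by simp
 show "a : carrier R ==> b : carrier R ==> (Q +>{R} a) +{R Quot Q} (Q +>{R} b) = Q +>{R} (a +{R} b)"
 using ring_hom_add[OF hom] by simp
 show "1{R Quot Q} = Q +>{R} 1{R}" using ring_hom_one[OF hom] by simp
 show "0{R Quot Q} = Q +>{R} 0{R}" using ring_hom_zero[OF hom ring_axioms quotient_is_ring] by simp
 show "a : carrier R ==> b : carrier R ==> Q +>{R} a = Q +>{R} b \<longleftrightarrow> a -{R} b : Q"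
 using quotient_eq_iff_same_a_r_cos[OF is_ideal] by simp
 show "a : carrier R ==> x : Q +>{R} a \<longleftrightarrow> x : carrier R & x -{R} a : Q"
 proof -
 assume a: "a : carrier R"
 show "x : Q +>{R} a \<longleftrightarrow> x : carrier R & x -{R} a : Q"
 proof (cases "x : carrier R")
 case True
 then show ?thesis using a_rcos_module_minus[OF ring_axioms a True] by simp
 next
 case False
 then show ?thesis using a_elemrcos_carrier[OF a] by blast
 qed
 qed
qed

text \<open>Elements of the completion are handled through coherent sequences of representatives
  instead of sequences of cosets.\<close>

definition compl_seq :: "'a ring => 'a set => (nat => 'a) => bool" where
 "compl_seq R I r \<longleftrightarrow> (ALL n. r n : carrier R) & (ALL n. r (Suc n) -{R} r n : ideal_power R I n)"

definition compl_cl :: "'a ring => 'a set => (nat => 'a) => nat => 'a set" where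
 "compl_cl R I r = (%n. ideal_power R I n +>{R} r n)"

definition compl_ker :: "'a ring => 'a set => nat => (nat => 'a set) set" where
 "compl_ker R I n = {f : carrier (completion R I). f n = ideal_power R I n}"

section \<open>The adic completion as a complete filtered ring\<close>

locale completion_of = pcring R for R :: "'a ring" (structure) + fixes I
 assumes I_ideal: "ideal I R"
begin

abbreviation "Ip n \<equiv> ideal_power R I n"
abbreviation "C \<equiv> completion R I"
abbreviation "cl \<equiv> compl_cl R I"
abbreviation "sq \<equiv> compl_seq R I"
abbreviation "ker \<equiv> compl_ker R I"
abbreviation "\<iota> \<equiv> to_completion R I"

lemmas Ip_ideal = ipow_ideal[OF I_ideal]
lemmas Ip_closed = ideal_closed[OF Ip_ideal]
lemmas cosets = quotient_cosets[OF is_cring Ip_ideal]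

lemma sqD: "sq r ==> r n : carrier R" "sq r ==> r (Suc n) \<ominus> r n : Ip n"
 by (auto simp: compl_seq_def)

lemma sq_ge:
 assumes r: "sq r" and "m <= n"
 shows "r n \<ominus> r m : Ip m"
 using assms(2)
proof (induct n rule: dec_induct)
 case base
 then show ?case using sqD(1)[OF r] Ip_closed(2) by simp
next
 case (step n)
 have c: "r m : carrier R" "r n : carrier R" "r (Suc n) : carrier R" using sqD(1)[OF r] by auto
 have "r (Suc n) \<ominus> r m = (r (Suc n) \<ominus> r n) \<oplus> (r n \<ominus> r m)" using c by algebra
 moreover have "r (Suc n) \<ominus> r n : Ip m" using sqD(2)[OF r, of n] ipow_antimono[OF I_ideal step(1)] by auto
 ultimately show ?case using Ip_closed(3) step by simp
qed

lemma cl_eq_iff: "sq r ==> sq s ==> cl r = cl s \<longleftrightarrow> (ALL n. r n \<ominus> s n : Ip n)"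
 by (simp add: compl_cl_def fun_eq_iff cosets(6) sqD)

lemma compl_carrier: "f : carrier C \<longleftrightarrow> (EX r. sq r & f = cl r)"
proof
 assume "f : carrier C"
 then have f: "!!n. f n : carrier (R Quot Ip n)" "!!n. f (Suc n) <= f n" by (auto simp: completion_def)
 have "EX r. r : carrier R & f n = Ip n +> r" for n using f(1)[of n] cosets(1) by auto
 then obtain r where r: "!!n. r n : carrier R" "!!n. f n = Ip n +> r n" by metis
 have "r (Suc n) \<ominus> r n : Ip n" for n
 proof -
 have "r (Suc n) \<ominus> r (Suc n) : Ip (Suc n)" using Ip_closed(2) r(1) by simp
 then have "r (Suc n) : f (Suc n)" using cosets(7)[OF r(1)] r by simp
 then have "r (Suc n) : Ip n +> r n" using f(2) r(2) by blast
 then show ?thesis using cosets(7)[OF r(1)] by simp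
 qed
 then show "EX r. sq r & f = cl r" using r by (intro exI[of _ r]) (auto simp: compl_seq_def compl_cl_def)
next
 assume "EX r. sq r & f = cl r"
 then obtain r where r: "sq r" "f = cl r" by auto
 note rc = sqD(1)[OF r(1)]
 have "f n : carrier (R Quot Ip n)" for n unfolding r compl_cl_def cosets(1) using rc by blast
 moreover have "f (Suc n) <= f n" for n
 proof
 fix x assume "x : f (Suc n)"
 then have x: "x : carrier R" "x \<ominus> r (Suc n) : Ip (Suc n)"
 unfolding r compl_cl_def cosets(7)[OF rc] by auto
 have c: "r n : carrier R" "r (Suc n) : carrier R" using rc by auto
 have "x \<ominus> r n = (x \<ominus> r (Suc n)) \<oplus> (r (Suc n) \<ominus> r n)" using x(1) c by algebra
 moreover have "x \<ominus> r (Suc n) : Ip n" using x(2) ipow_antimono[OF I_ideal, of n "Suc n"] by auto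
 ultimately have "x \<ominus> r n : Ip n" using Ip_closed(3) sqD(2)[OF r(1)] by simp
 then show "x : f n" unfolding r compl_cl_def cosets(7)[OF rc] using x by simp
 qed
 ultimately show "f : carrier C" by (simp add: completion_def)
qed

lemma cl_carrier: "sq r ==> cl r : carrier C"
 using compl_carrier by blast

lemma sq_const: "a : carrier R ==> sq (%_. a)"
 using Ip_closed(2) by (simp add: compl_seq_def)

lemma sq_add: assumes "sq r" "sq s" shows "sq (%n. r n \<oplus> s n)"
 unfolding compl_seq_def
proof (intro conjI allI)
 fix n
 have c: "r n : carrier R" "r (Suc n) : carrier R" "s n : carrier R" "s (Suc n) : carrier R"
 using sqD(1)[OF assms(1)] sqD(1)[OF assms(2)] by auto
 show "r n \<oplus> s n : carrier R" using c by simp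
 have "(r (Suc n) \<oplus> s (Suc n)) \<ominus> (r n \<oplus> s n) = (r (Suc n) \<ominus> r n) \<oplus> (s (Suc n) \<ominus> s n)" using c by algebra
 then show "(r (Suc n) \<oplus> s (Suc n)) \<ominus> (r n \<oplus> s n) : Ip n"
 using Ip_closed(3) sqD(2)[OF assms(1)] sqD(2)[OF assms(2)] by simp
qed

lemma sq_mult: assumes "sq r" "sq s" shows "sq (%n. r n \<otimes> s n)"
 unfolding compl_seq_def
proof (intro conjI allI)
 fix n
 have c: "r n : carrier R" "r (Suc n) : carrier R" "s n : carrier R" "s (Suc n) : carrier R"
 using sqD(1)[OF assms(1)] sqD(1)[OF assms(2)] by auto
 show "r n \<otimes> s n : carrier R" using c by simp
 have "(r (Suc n) \<otimes> s (Suc n)) \<ominus> (r n \<otimes> s n) = (r (Suc n) \<ominus> r n) \<otimes> s (Suc n) \<oplus> r n \<otimes> (s (Suc n) \<ominus> s n)"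
 using c by algebra
 then show "(r (Suc n) \<otimes> s (Suc n)) \<ominus> (r n \<otimes> s n) : Ip n"
 using Ip_closed(3) Ip_closed(6)[OF sqD(2)[OF assms(1)] c(4)] Ip_closed(7)[OF sqD(2)[OF assms(2)] c(1)] by simp
qed

lemma cl_mult: "sq r ==> sq s ==> cl r *{C} cl s = cl (%n. r n \<otimes> s n)"
 by (simp add: completion_def compl_cl_def cosets(2) sqD)

lemma cl_add: "sq r ==> sq s ==> cl r +{C} cl s = cl (%n. r n \<oplus> s n)"
 by (simp add: completion_def compl_cl_def cosets(3) sqD)

lemma cl_one: "1{C} = cl (%_. \<one>)"
 by (simp add: completion_def compl_cl_def cosets(4))

lemma cl_zero: "0{C} = cl (%_. \<zero>)"
 by (simp add: completion_def compl_cl_def cosets(5))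

lemma completion_cring: "cring C"
proof (intro cringI abelian_groupI comm_monoidI)
 note sqs = sq_add sq_mult sq_const
 note cls = cl_add cl_mult cl_one cl_zero
 fix f g h assume "f : carrier C" "g : carrier C" "h : carrier C"
 then obtain r s t where *: "sq r" "sq s" "sq t" "f = cl r" "g = cl s" "h = cl t"
 unfolding compl_carrier by blast
 note c = sqD(1)[OF *(1)] sqD(1)[OF *(2)] sqD(1)[OF *(3)]
 show "f +{C} g +{C} h = f +{C} (g +{C} h)" using * c by (simp add: cl_add sq_add a_assoc)
 show "f *{C} g *{C} h = f *{C} (g *{C} h)" using * c by (simp add: cl_mult sq_mult m_assoc)
 show "(f +{C} g) *{C} h = f *{C} h +{C} g *{C} h"
 using * c by (simp add: cl_mult sq_mult cl_add sq_add l_distr)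
next
 fix f g assume "f : carrier C" "g : carrier C"
 then obtain r s where *: "sq r" "sq s" "f = cl r" "g = cl s"
 unfolding compl_carrier by blast
 note c = sqD(1)[OF *(1)] sqD(1)[OF *(2)]
 show "f +{C} g = g +{C} f" using * c by (simp add: cl_add a_comm)
 show "f *{C} g = g *{C} f" using * c by (simp add: cl_mult m_comm)
 show "f +{C} g : carrier C" using * by (simp add: cl_add sq_add cl_carrier)
 show "f *{C} g : carrier C" using * by (simp add: cl_mult sq_mult cl_carrier)
next
 show "0{C} : carrier C" "1{C} : carrier C"
 unfolding cl_zero cl_one by (simp_all add: cl_carrier sq_const)
 fix f assume "f : carrier C"
 then obtain r where *: "sq r" "f = cl r" unfolding compl_carrier by blast
 note c = sqD(1)[OF *(1)]
 show "0{C} +{C} f = f" unfolding cl_zero using * c by (simp add: cl_add sq_const)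
 show "1{C} *{C} f = f" unfolding cl_one using * c by (simp add: cl_mult sq_const)
 \<comment> \<open>The negative is taken as a product with -1, so that coherence follows from
   \<open>sq_mult\<close>.\<close>
 have m: "sq (%n. \<ominus> \<one> \<otimes> r n)" using sq_mult[OF sq_const[of "\<ominus> \<one>"] *(1)] by simp
 have "cl (%n. \<ominus> \<one> \<otimes> r n) +{C} f = cl (%n. \<ominus> \<one> \<otimes> r n \<oplus> r n)" using * m by (simp add: cl_add)
 also have "(%n. \<ominus> \<one> \<otimes> r n \<oplus> r n) = (%_. \<zero>)" using c by (simp add: l_minus l_neg)
 finally show "\<exists>y\<in>carrier C. y +{C} f = 0{C}" using cl_carrier[OF m] cl_zero by auto
qed

sublocale C: pcring C
 by (rule pcring.intro[OF completion_cring])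

lemma cl_minus:
 assumes "sq r" "sq s" shows "sq (%n. r n \<ominus> s n)" "cl r -{C} cl s = cl (%n. r n \<ominus> s n)"
proof -
 note c = sqD(1)[OF assms(1)] sqD(1)[OF assms(2)]
 have m: "sq (%n. \<ominus> \<one> \<otimes> s n)" using sq_mult[OF sq_const[of "\<ominus> \<one>"] assms(2)] by simp
 have e: "(%n. r n \<ominus> s n) = (%n. r n \<oplus> \<ominus> \<one> \<otimes> s n)" using c by (simp add: l_minus minus_eq)
 show s: "sq (%n. r n \<ominus> s n)" unfolding e by (rule sq_add[OF assms(1) m])
 have "cl r = cl (%n. r n \<ominus> s n) +{C} cl s"
 using c assms s by (simp add: cl_add minus_eq a_assoc l_neg)
 then show "cl r -{C} cl s = cl (%n. r n \<ominus> s n)"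
 using cl_carrier[OF s] cl_carrier[OF assms(2)] by (simp add: C.minus_eq C.a_assoc C.r_neg)
qed

lemma \<iota>_eq: "\<iota> a = cl (%_. a)"
 by (simp add: to_completion_def compl_cl_def)

lemma \<iota>_hom: "\<iota> : ring_hom R C"
 by (rule ring_hom_memI) (auto simp: \<iota>_eq cl_carrier sq_const cl_mult cl_add cl_one)

lemma ker_iff: "sq r ==> cl r : ker n \<longleftrightarrow> r n : Ip n"
proof -
 assume r: "sq r"
 have "Ip n +> r n = Ip n \<longleftrightarrow> Ip n +> r n = Ip n +> \<zero>"
 using Ip_closed(1) by (simp add: a_rcos_zero Ip_ideal Ip_closed(2))
 also have "... \<longleftrightarrow> r n : Ip n" using cosets(6)[OF sqD(1)[OF r], of \<zero>] sqD(1)[OF r] by (simp add: minus_eq)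
 finally show ?thesis using cl_carrier[OF r] by (simp add: compl_ker_def compl_cl_def)
qed

lemma kerE:
 assumes "f : ker n" obtains r where "sq r" "f = cl r" "r n : Ip n"
proof -
 obtain r where "sq r" "f = cl r" using assms compl_carrier unfolding compl_ker_def by blast
 then show ?thesis using that assms ker_iff by blast
qed

lemma ker_ideal: "ideal (ker n) C"
proof (rule C.idealI')
 show "ker n <= carrier C" by (auto simp: compl_ker_def)
 show "0{C} : ker n" unfolding cl_zero using ker_iff sq_const Ip_closed(2) by simp
 fix f g assume f: "f : ker n"
 then obtain r where r: "sq r" "f = cl r" "r n : Ip n" by (rule kerE)
 { assume "g : ker n"
 then obtain s where s: "sq s" "g = cl s" "s n : Ip n" by (rule kerE)
 show "f +{C} g : ker n" using r s Ip_closed(3) by (simp add: cl_add ker_iff sq_add) }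
 { assume "g : carrier C"
 then obtain s where s: "sq s" "g = cl s" using compl_carrier by blast
 show "g *{C} f : ker n" using r s Ip_closed(7) by (simp add: cl_mult ker_iff sq_mult sqD) }
qed

lemma \<iota>_ker: "a : carrier R ==> \<iota> a : ker n \<longleftrightarrow> a : Ip n"
 unfolding \<iota>_eq by (simp add: ker_iff sq_const)

sublocale CF: complete_filtered C ker
proof (intro complete_filtered.intro complete_filtered_axioms.intro C.pcring_axioms)
 show "ideal (ker n) C" for n by (rule ker_ideal)
 show "ker 0 = carrier C"
 proof -
 have "cl r : ker 0" if "sq r" for r using that ker_iff sqD(1) by (simp add: ipow_0)
 then show ?thesis using compl_carrier by (auto simp: compl_ker_def[of R I 0])
 qed
 show "ker (Suc n) <= ker n" for n
 proof
 fix f assume "f : ker (Suc n)"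
 then obtain r where r: "sq r" "f = cl r" "r (Suc n) : Ip (Suc n)" by (rule kerE)
 have c: "r n : carrier R" "r (Suc n) : carrier R" using sqD(1)[OF r(1)] by auto
 have "r (Suc n) : Ip n" using r(3) ipow_antimono[OF I_ideal, of n "Suc n"] by auto
 moreover have "r n = r (Suc n) \<ominus> (r (Suc n) \<ominus> r n)" using c by algebra
 ultimately have "r n : Ip n" using Ip_closed(4) sqD(2)[OF r(1), of n] by metis
 then show "f : ker n" using r ker_iff by simp
 qed
 show "f *{C} g : ker (a + b)" if f: "f : ker a" and g: "g : ker b" for f g a b
 proof -
 obtain r where r: "sq r" "f = cl r" "r a : Ip a" using f by (rule kerE)
 obtain s where s: "sq s" "g = cl s" "s b : Ip b" using g by (rule kerE)
 have *: "r' (n + k) : Ip n" if "sq r'" "r' n : Ip n" for r' n k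
 proof -
 have c: "r' n : carrier R" "r' (n + k) : carrier R" using sqD(1)[OF that(1)] by auto
 have "r' (n + k) = (r' (n + k) \<ominus> r' n) \<oplus> r' n" using c by algebra
 then show ?thesis using Ip_closed(3)[OF sq_ge[OF that(1), of n "n + k"] that(2)] by simp
 qed
 have "r (a + b) \<otimes> s (a + b) : Ip (a + b)"
 using ipow_mult_mem[OF I_ideal *[OF r(1,3), of b] *[OF s(1,3), of a]] by (simp add: add.commute)
 then show ?thesis using r s by (simp add: cl_mult ker_iff sq_mult)
 qed
 show "f = 0{C}" if f: "f : carrier C" "!!n. f : ker n" for f
 proof -
 obtain r where r: "sq r" "f = cl r" using f(1) compl_carrier by blast
 have "r n \<ominus> \<zero> : Ip n" for n using f(2)[of n] r ker_iff sqD(1)[OF r(1)] by (simp add: minus_eq)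
 then show ?thesis unfolding cl_zero r using cl_eq_iff[OF r(1) sq_const[of \<zero>]] by simp
 qed
 show "\<exists>x\<in>carrier C. ALL n. x -{C} a n : ker n"
 if a: "!!n. a n : carrier C" "!!n. a (Suc n) -{C} a n : ker n" for a
 proof -
 have "EX r. sq r & a n = cl r" for n using a(1) compl_carrier by blast
 then obtain r where r: "!!n. sq (r n)" "!!n. a n = cl (r n)" by metis
 have d: "r (Suc n) n \<ominus> r n n : Ip n" for n
 using a(2)[of n] ker_iff[OF cl_minus(1)[OF r(1)[of "Suc n"] r(1)[of n]]] cl_minus(2)[OF r(1)[of "Suc n"] r(1)[of n]] r(2)
 by simp
 \<comment> \<open>The limit is the diagonal of the representing sequences.\<close>
 let ?x = "%n. r n n"
 have sx: "sq ?x" unfolding compl_seq_def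
 proof (intro conjI allI)
 fix n
 show "r n n : carrier R" using sqD(1)[OF r(1)] .
 have c: "r (Suc n) (Suc n) : carrier R" "r (Suc n) n : carrier R" "r n n : carrier R" using sqD(1)[OF r(1)] by auto
 have "r (Suc n) (Suc n) \<ominus> r n n = (r (Suc n) (Suc n) \<ominus> r (Suc n) n) \<oplus> (r (Suc n) n \<ominus> r n n)" using c by algebra
 then show "r (Suc n) (Suc n) \<ominus> r n n : Ip n" using Ip_closed(3)[OF sqD(2)[OF r(1)[of "Suc n"], of n] d[of n]] by simp
 qed
 have "cl ?x -{C} a n : ker n" for n
 unfolding r(2) cl_minus(2)[OF sx r(1)] ker_iff[OF cl_minus(1)[OF sx r(1)]]
 using sqD(1)[OF r(1)] Ip_closed(2) by simp
 then show ?thesis using cl_carrier[OF sx] by blast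
 qed
qed

text \<open>For a finitely generated ideal the kernel of the projection to R/I is generated by the
  image of I: an element of \<open>ker (Suc n)\<close> agrees modulo
  \<open>ker (Suc (Suc n))\<close> with the image of an element of I I^n, so successive
  approximation stays inside the ideal.\<close>

lemma ker_idl:
 assumes A: "finite A" "A <= carrier R" "I = Idl A"
 shows "ker 1 = idl C (\<iota> ` A)"
proof
 have ic: "\<iota> ` A <= carrier C" using A ring_hom_closed[OF \<iota>_hom] by auto
 have "\<iota> ` A <= ker 1"
 using A idl_mem[OF A(2)] \<iota>_ker[of _ 1] ipow_1[OF I_ideal] by auto
 then show "idl C (\<iota> ` A) <= ker 1" by (rule C.genideal_minimal[OF ker_ideal])
 interpret h: ring_hom_cring R C \<iota> by (intro ring_hom_cring.intro ring_hom_cring_axioms.intro is_cring completion_cring \<iota>_hom)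
 show "ker 1 <= idl C (\<iota> ` A)"
 proof
 fix f assume f: "f : ker 1"
 have img: "\<iota> x : (idl C (\<iota> ` A)) \<cdot>\<^bsub>C\<^esub> ker n" if x: "x : I \<cdot> Ip n" for x n
 proof -
 let ?Q = "(idl C (\<iota> ` A)) \<cdot>\<^bsub>C\<^esub> ker n"
 have Qid: "ideal ?Q C" by (rule C.ideal_prod_is_ideal[OF C.idl_ideal[OF ic] ker_ideal])
 have Ii: "\<iota> i : idl C (\<iota> ` A)" if "i : I" for i
 proof -
 have "ideal {r : carrier R. \<iota> r : idl C (\<iota> ` A)} R"
 by (rule ring_hom_ring.ideal_vimage[OF ring_hom_ringI2[OF ring_axioms C.ring_axioms \<iota>_hom] C.idl_ideal[OF ic]])
 then have "Idl A <= {r : carrier R. \<iota> r : idl C (\<iota> ` A)}"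
 using A(2) C.idl_mem[OF ic] by (intro genideal_minimal) auto
 then show ?thesis using that A(3) by auto
 qed
 show ?thesis using x
 proof (induct x rule: ideal_prod.induct)
 case (prod i j)
 have c: "i : carrier R" "j : carrier R" using prod ideal_closed(8)[OF I_ideal] Ip_closed(8) by auto
 have "\<iota> j : ker n" using \<iota>_ker c prod by auto
 then show ?case using ideal_prod.prod[OF Ii[OF prod(1)], of "\<iota> j" "ker n" C] c by simp
 next
 case (sum s t)
 have "s : carrier R" "t : carrier R"
 using sum(1,3) ideal_closed(8)[OF ideal_prod_is_ideal[OF I_ideal Ip_ideal]] by auto
 then show ?case using C.ideal_closed(3)[OF Qid sum(2,4)] by simp
 qed
 qed
 show "f : idl C (\<iota> ` A)"
 proof (rule CF.idl_by_approximation[of "\<iota> ` A" "carrier C" f])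
 show "finite (\<iota> ` A)" using A by simp
 show "f : carrier C" using f by (simp add: compl_ker_def)
 fix g n assume g: "g : carrier C" "g : ker (Suc n)"
 obtain r where r: "sq r" "g = cl r" "r (Suc n) : Ip (Suc n)" using g(2) by (rule kerE)
 \<comment> \<open>One index further along, the representative determines g modulo
   \<open>ker (Suc (Suc n))\<close> while it still lies in I^(n + 1).\<close>
 let ?v = "r (Suc (Suc n))"
 have vc: "?v : carrier R" "r (Suc n) : carrier R" using sqD(1)[OF r(1)] by auto
 have "?v = (?v \<ominus> r (Suc n)) \<oplus> r (Suc n)" using vc by algebra
 then have "?v : Ip (Suc n)" using Ip_closed(3)[OF sqD(2)[OF r(1)] r(3)] by metis
 then have "?v : I \<cdot> Ip n" using ideal_prod_commute[OF I_ideal Ip_ideal] by (simp add: ipow_Suc)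
 then have 1: "\<iota> ?v : (idl C (\<iota> ` A)) \<cdot>\<^bsub>C\<^esub> ker n" by (rule img)
 have 2: "g -{C} \<iota> ?v : ker (Suc (Suc n))"
 unfolding r(2) \<iota>_eq cl_minus(2)[OF r(1) sq_const[OF vc(1)]] ker_iff[OF cl_minus(1)[OF r(1) sq_const[OF vc(1)]]]
 using vc Ip_closed(2) by simp
 have gc: "g : carrier C" "\<iota> ?v : carrier C" using g vc by auto
 have "g -{C} (g -{C} \<iota> ?v) = \<iota> ?v" using gc by algebra
 then show "\<exists>f'\<in>carrier C. f' : ker (Suc (Suc n)) & g -{C} f' : (idl C (\<iota> ` A)) \<cdot>\<^bsub>C\<^esub> ker n"
 using 1 2 gc by (intro bexI[of _ "g -{C} \<iota> ?v"]) simp_all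
 qed (use ic f in auto)
 qed
qed

end

section \<open>Power series\<close>

lemma finite_submultisets: "finite {a. a \<subseteq># (m :: nat multiset)}"
proof (rule finite_subset)
 show "{a. a \<subseteq># m} <= (\<Union>k\<in>{..size m}. multisets_of_size (set_mset m) k)"
 by (auto simp: multisets_of_size_def size_mset_mono dest: mset_subset_eqD)
qed auto

context abelian_monoid
begin

lemma finsum_Sigma:
 assumes "finite A" "!!a. a : A ==> finite (B a)" "!!a b. a : A ==> b : B a ==> f a b : carrier G"
 shows "(\<Oplus>a\<in>A. \<Oplus>b\<in>B a. f a b) = (\<Oplus>p\<in>Sigma A B. f (fst p) (snd p))"
 using assms
proof (induct A)
 case (insert a A)
 have 1: "(\<Oplus>p\<in>Pair a ` B a. f (fst p) (snd p)) = (\<Oplus>b\<in>B a. f a b)"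
 using insert(5) by (subst finsum_reindex) (auto intro!: inj_onI)
 have "(\<Oplus>a\<in>insert a A. \<Oplus>b\<in>B a. f a b) = (\<Oplus>b\<in>B a. f a b) \<oplus> (\<Oplus>a\<in>A. \<Oplus>b\<in>B a. f a b)"
 using insert by (subst finsum_insert) (auto intro!: finsum_closed)
 also have "... = (\<Oplus>p\<in>Pair a ` B a. f (fst p) (snd p)) \<oplus> (\<Oplus>p\<in>Sigma A B. f (fst p) (snd p))"
 using insert 1 by simp
 also have "... = (\<Oplus>p\<in>Pair a ` B a Un Sigma A B. f (fst p) (snd p))"
 using insert by (subst finsum_Un_disjoint) auto
 also have "Pair a ` B a Un Sigma A B = Sigma (insert a A) B" by auto
 finally show ?case .
qed simp

lemma finsum_single:
 assumes "finite A" "i : A" "f i : carrier G" "!!j. j : A ==> j ~= i ==> f j = \<zero>"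
 shows "(\<Oplus>j\<in>A. f j) = f i"
proof -
 have "(\<Oplus>j\<in>A. f j) = (\<Oplus>j\<in>A. if i = j then f i else \<zero>)"
 by (rule finsum_cong') (use assms in auto)
 also have "... = f i" using finsum_singleton[OF assms(2,1), of "%_. f i"] assms(3) by simp
 finally show ?thesis .
qed

end

text \<open>The single term c X^al; constants, variables and 1 all have this shape.\<close>

definition sterm :: "'a ring => 'a => nat multiset => 'a series" where
 "sterm L c al = (%m. if m = al then c else 0{L})"

text \<open>Series of order at least N; by \<open>ker_power\<close> these are the powers of the
  ideal generated by the variables.\<close>

definition series_ker :: "'a ring => nat => nat => 'a series set" where
 "series_ker L n N = {f : carrier (power_series_ring L n). ALL m. size m < N --> f m = 0{L}}"

section \<open>Ring structure and filtration of the power series ring\<close>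

locale series_over = L: pcring L for L :: "'a ring" (structure) + fixes n :: nat
begin

abbreviation "P \<equiv> power_series_ring L n"
abbreviation "KP \<equiv> series_ker L n"

lemma series_carrier:
 "f : carrier P \<longleftrightarrow> (ALL m. f m : carrier L) & (ALL m. \<not> set_mset m <= {..<n} --> f m = \<zero>)"
 by (simp add: power_series_ring_def)

lemma coeff_closed: "f : carrier P ==> f m : carrier L"
 by (simp add: series_carrier)

lemma coeff_mult: "(f *{P} g) m = (\<Oplus>a\<in>{a. a \<subseteq># m}. f a \<otimes> g (m - a))"
 by (simp add: power_series_ring_def)

lemma coeff_add: "(f +{P} g) m = f m \<oplus> g m"
 by (simp add: power_series_ring_def)

lemma coeff_zero: "0{P} m = \<zero>"
 by (simp add: power_series_ring_def)

lemma one_eq: "1{P} = sterm L \<one> {#}"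
 by (auto simp: power_series_ring_def sterm_def L.indexed_const_def)

lemma const_eq: "L.indexed_const c = sterm L c {#}"
 by (auto simp: sterm_def L.indexed_const_def)

lemma var_eq: "L.indexed_var i = sterm L \<one> {#i#}"
proof
 fix m :: "nat multiset"
 have "i \<in># m & m - {#i#} = {#} \<longleftrightarrow> m = {#i#}" by (metis add_mset_remove_trivial insert_DiffM multi_member_last)
 then show "L.indexed_var i m = sterm L \<one> {#i#} m"
 unfolding L.indexed_var_def L.indexed_pmult_def L.indexed_const_def sterm_def by auto
qed

lemma sterm_closed: "c : carrier L ==> set_mset al <= {..<n} ==> sterm L c al : carrier P"
 by (auto simp: series_carrier sterm_def)

lemma coeff_sterm_mult:
 assumes c: "c : carrier L" and g: "!!m. g m : carrier L"
 shows "(sterm L c al *{P} g) m = (if al \<subseteq># m then c \<otimes> g (m - al) else \<zero>)"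
proof (cases "al \<subseteq># m")
 case True
 have "(\<Oplus>a\<in>{a. a \<subseteq># m}. sterm L c al a \<otimes> g (m - a)) = sterm L c al al \<otimes> g (m - al)"
 by (rule L.finsum_single) (use True c g finite_submultisets in \<open>auto simp: sterm_def\<close>)
 then show ?thesis using True by (simp add: coeff_mult sterm_def)
next
 case False
 have "(\<Oplus>a\<in>{a. a \<subseteq># m}. sterm L c al a \<otimes> g (m - a)) = (\<Oplus>a\<in>{a. a \<subseteq># m}. \<zero>)"
 by (rule L.finsum_cong') (use False c g in \<open>auto simp: sterm_def\<close>)
 then show ?thesis using False by (simp add: coeff_mult)
qed

lemma mult_closed: assumes f: "f : carrier P" and g: "g : carrier P" shows "f *{P} g : carrier P"
 unfolding series_carrier
proof (intro conjI allI impI)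
 fix m
 show "(f *{P} g) m : carrier L" unfolding coeff_mult
 using f g by (intro L.finsum_closed) (auto simp: series_carrier)
 assume m: "\<not> set_mset m <= {..<n}"
 have "(\<Oplus>a\<in>{a. a \<subseteq># m}. f a \<otimes> g (m - a)) = (\<Oplus>a\<in>{a. a \<subseteq># m}. \<zero>)"
 proof (rule L.finsum_cong')
 fix a assume "a : {a. a \<subseteq># m}"
 then have "set_mset m = set_mset a Un set_mset (m - a)"
 by (metis mem_Collect_eq set_mset_union subset_mset.add_diff_inverse)
 then have "f a = \<zero> \<or> g (m - a) = \<zero>" using m f g by (auto simp: series_carrier)
 then show "f a \<otimes> g (m - a) = \<zero>" using f g by (auto simp: series_carrier)
 qed auto
 then show "(f *{P} g) m = \<zero>" by (simp add: coeff_mult)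
qed

lemma mult_comm: assumes f: "f : carrier P" and g: "g : carrier P" shows "f *{P} g = g *{P} f"
proof
 fix m :: "nat multiset"
 let ?A = "{a. a \<subseteq># m}"
 have dd: "m - (m - a) = a" if "a \<subseteq># m" for a :: "nat multiset"
 using that by (metis add_diff_cancel_right' subset_mset.add_diff_inverse)
 have img: "(%a. m - a) ` ?A = ?A"
 proof (intro equalityI subsetI)
 fix a assume "a : ?A"
 then have "a = m - (m - a)" using dd by simp
 then show "a : (%a. m - a) ` ?A" by (rule image_eqI) simp
 qed auto
 have inj: "inj_on (%a. m - a) ?A"
 by (rule inj_on_inverseI[of _ "%a. m - a"]) (simp add: dd)
 have "(\<Oplus>a\<in>?A. f a \<otimes> g (m - a)) = (\<Oplus>a\<in>(%a. m - a) ` ?A. f a \<otimes> g (m - a))" by (simp only: img)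
 also have "... = (\<Oplus>a\<in>?A. f (m - a) \<otimes> g (m - (m - a)))"
 by (rule L.finsum_reindex) (use inj f g in \<open>auto simp: series_carrier\<close>)
 also have "... = (\<Oplus>a\<in>?A. g a \<otimes> f (m - a))"
 proof (rule L.finsum_cong')
 fix a assume "a : ?A"
 then have "m - (m - a) = a" by (metis add_diff_cancel_right' mem_Collect_eq subset_mset.add_diff_inverse)
 then show "f (m - a) \<otimes> g (m - (m - a)) = g a \<otimes> f (m - a)" using f g L.m_comm by (auto simp: series_carrier)
 qed (use f g in \<open>auto simp: series_carrier\<close>)
 finally show "(f *{P} g) m = (g *{P} f) m" by (simp add: coeff_mult)
qed

lemma mult_assoc:
 assumes f: "f : carrier P" and g: "g : carrier P" and h: "h : carrier P"
 shows "(f *{P} g) *{P} h = f *{P} (g *{P} h)"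
proof
 fix m
 let ?S = "%m. {a. a \<subseteq># (m :: nat multiset)}"
 note c = coeff_closed[OF f] coeff_closed[OF g] coeff_closed[OF h]
 have "((f *{P} g) *{P} h) m = (\<Oplus>a\<in>?S m. \<Oplus>b\<in>?S a. f b \<otimes> g (a - b) \<otimes> h (m - a))"
 unfolding coeff_mult
 by (rule L.finsum_cong') (use c finite_submultisets in \<open>auto simp: L.finsum_ldistr intro!: L.finsum_closed\<close>)
 also have "... = (\<Oplus>p\<in>Sigma (?S m) ?S. f (snd p) \<otimes> g (fst p - snd p) \<otimes> h (m - fst p))"
 by (rule L.finsum_Sigma) (use c finite_submultisets in auto)
 \<comment> \<open>Pairs with b <= a <= m are reparametrised by (b, d) with a = b + d and d <= m -
   b.\<close>
 also have "Sigma (?S m) ?S = (%p. (fst p + snd p, fst p)) ` Sigma (?S m) (%b. ?S (m - b))"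
 proof (intro equalityI subsetI)
 fix p assume "p : Sigma (?S m) ?S"
 then obtain a b where p: "p = (a, b)" "a \<subseteq># m" "b \<subseteq># a" by auto
 then have "b \<subseteq># m" "a - b \<subseteq># m - b" "b + (a - b) = a"
 by (auto intro: subset_mset.order_trans simp: subset_eq_diff_conv mset_subset_eq_mono_add_right_cancel)
 then show "p : (%p. (fst p + snd p, fst p)) ` Sigma (?S m) (%b. ?S (m - b))"
 using p by (intro image_eqI[of _ _ "(b, a - b)"]) auto
 next
 fix p assume "p : (%p. (fst p + snd p, fst p)) ` Sigma (?S m) (%b. ?S (m - b))"
 then show "p : Sigma (?S m) ?S"
 by (auto simp: subset_mset.le_diff_conv2 add.commute)
 qed
 also have "(\<Oplus>p\<in>(%p. (fst p + snd p, fst p)) ` Sigma (?S m) (%b. ?S (m - b)). f (snd p) \<otimes> g (fst p - snd p) \<otimes> h (m - fst p)) =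
 (\<Oplus>p\<in>Sigma (?S m) (%b. ?S (m - b)). f (fst p) \<otimes> g (snd p) \<otimes> h (m - (fst p + snd p)))"
 by (subst L.finsum_reindex) (use c in \<open>auto intro!: inj_onI\<close>)
 also have "... = (\<Oplus>p\<in>Sigma (?S m) (%b. ?S (m - b)). f (fst p) \<otimes> (g (snd p) \<otimes> h (m - fst p - snd p)))"
 by (rule L.finsum_cong') (use c in \<open>auto simp: L.m_assoc diff_diff_eq\<close>)
 also have "... = (\<Oplus>b\<in>?S m. \<Oplus>d\<in>?S (m - b). f b \<otimes> (g d \<otimes> h (m - b - d)))"
 by (rule L.finsum_Sigma[symmetric]) (use c finite_submultisets in auto)
 also have "... = (f *{P} (g *{P} h)) m"
 unfolding coeff_mult
 by (rule L.finsum_cong') (use c finite_submultisets in \<open>auto simp: L.finsum_rdistr intro!: L.finsum_closed\<close>)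
 finally show "((f *{P} g) *{P} h) m = (f *{P} (g *{P} h)) m" .
qed

lemma add_closed: "f : carrier P ==> g : carrier P ==> f +{P} g : carrier P"
 by (auto simp: series_carrier coeff_add)

lemma series_cring: "cring P"
proof (intro cringI abelian_groupI comm_monoidI)
 fix f g h assume fgh: "f : carrier P" "g : carrier P" "h : carrier P"
 note c = coeff_closed[OF fgh(1)] coeff_closed[OF fgh(2)] coeff_closed[OF fgh(3)]
 show "f +{P} g +{P} h = f +{P} (g +{P} h)" using c by (intro ext) (simp add: coeff_add L.a_assoc)
 show "f *{P} g *{P} h = f *{P} (g *{P} h)" using fgh by (rule mult_assoc)
 show "(f +{P} g) *{P} h = f *{P} h +{P} g *{P} h"
 proof
 fix m
 have "(\<Oplus>a\<in>{a. a \<subseteq># m}. (f a \<oplus> g a) \<otimes> h (m - a)) = (\<Oplus>a\<in>{a. a \<subseteq># m}. f a \<otimes> h (m - a) \<oplus> g a \<otimes> h (m - a))"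
 by (rule L.finsum_cong') (use c in \<open>auto simp: L.l_distr\<close>)
 also have "... = (\<Oplus>a\<in>{a. a \<subseteq># m}. f a \<otimes> h (m - a)) \<oplus> (\<Oplus>a\<in>{a. a \<subseteq># m}. g a \<otimes> h (m - a))"
 by (rule L.finsum_addf) (use c in auto)
 finally show "((f +{P} g) *{P} h) m = (f *{P} h +{P} g *{P} h) m"
 by (simp add: coeff_mult coeff_add)
 qed
next
 fix f g assume fg: "f : carrier P" "g : carrier P"
 note c = coeff_closed[OF fg(1)] coeff_closed[OF fg(2)]
 show "f +{P} g = g +{P} f" using c by (intro ext) (simp add: coeff_add L.a_comm)
 show "f *{P} g = g *{P} f" using fg by (rule mult_comm)
 show "f +{P} g : carrier P" using fg by (rule add_closed)
 show "f *{P} g : carrier P" using fg by (rule mult_closed)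
next
 show "0{P} : carrier P" by (auto simp: series_carrier coeff_zero)
 show "1{P} : carrier P" unfolding one_eq by (rule sterm_closed) auto
 fix f assume f: "f : carrier P"
 note c = coeff_closed[OF f]
 show "0{P} +{P} f = f" using c by (intro ext) (simp add: coeff_add coeff_zero)
 show "1{P} *{P} f = f" unfolding one_eq using c by (intro ext) (simp add: coeff_sterm_mult)
 have "(%m. \<ominus> f m) +{P} f = 0{P}" using c by (intro ext) (simp add: coeff_add coeff_zero L.l_neg)
 moreover have "(%m. \<ominus> f m) : carrier P" using f by (auto simp: series_carrier)
 ultimately show "\<exists>y\<in>carrier P. y +{P} f = 0{P}" by blast
qed

sublocale P: pcring P
 by (rule pcring.intro[OF series_cring])

lemma coeff_minus:
 assumes "f : carrier P" "g : carrier P" shows "(f -{P} g) m = f m \<ominus> g m"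
proof -
 have c: "(f -{P} g) m : carrier L" "f m : carrier L" "g m : carrier L"
 using assms P.minus_closed coeff_closed by auto
 have "f = (f -{P} g) +{P} g" using assms by algebra
 then have "f m = (f -{P} g) m \<oplus> g m" by (metis coeff_add)
 then show ?thesis using c by (simp add: L.minus_eq L.a_assoc L.r_neg)
qed

lemma coeff_mult_ker:
 assumes f: "f : KP a" and g: "g : KP b" and m: "size m < a + b"
 shows "(f *{P} g) m = \<zero>"
proof -
 have c: "f m : carrier L" "g m : carrier L" for m using f g by (auto simp: series_ker_def series_carrier)
 have "(\<Oplus>a\<in>{a. a \<subseteq># m}. f a \<otimes> g (m - a)) = (\<Oplus>a\<in>{a. a \<subseteq># m}. \<zero>)"
 proof (rule L.finsum_cong')
 fix d assume d: "d : {a. a \<subseteq># m}"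
 then have "size m = size d + size (m - d)" by (metis mem_Collect_eq size_union subset_mset.add_diff_inverse)
 then have "size d < a \<or> size (m - d) < b" using m by linarith
 then show "f d \<otimes> g (m - d) = \<zero>" using f g c by (auto simp: series_ker_def)
 qed auto
 then show ?thesis by (simp add: coeff_mult)
qed

sublocale PF: complete_filtered P KP
proof (intro complete_filtered.intro complete_filtered_axioms.intro P.pcring_axioms)
 have K0: "KP 0 = carrier P" by (auto simp: series_ker_def)
 then show "KP 0 = carrier P" .
 show mult: "f *{P} g : KP (a + b)" if "f : KP a" "g : KP b" for f g a b
 using that coeff_mult_ker[OF that] mult_closed by (auto simp: series_ker_def)
 show "ideal (KP N) P" for N
 proof (rule P.idealI')
 show "KP N <= carrier P" "0{P} : KP N" by (auto simp: series_ker_def coeff_zero)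
 show "f +{P} g : KP N" if "f : KP N" "g : KP N" for f g
 using that add_closed by (auto simp: series_ker_def coeff_add)
 show "g *{P} f : KP N" if "f : KP N" "g : carrier P" for f g
 using mult[of g 0 f N] that K0 by simp
 qed
 show "KP (Suc N) <= KP N" for N by (auto simp: series_ker_def)
 show "f = 0{P}" if "f : carrier P" "!!N. f : KP N" for f
 proof
 fix m show "f m = 0{P} m" using that(2)[of "Suc (size m)"] by (simp add: series_ker_def coeff_zero)
 qed
 show "\<exists>x\<in>carrier P. ALL N. x -{P} a N : KP N"
 if a: "!!N. a N : carrier P" "!!N. a (Suc N) -{P} a N : KP N" for a
 proof -
 \<comment> \<open>Coefficients of degree below N are constant from index N on, so those of degree
   \<open>size m\<close> are read off at index \<open>Suc (size m)\<close>.\<close>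
 let ?x = "%m. a (Suc (size m)) m"
 have x: "?x : carrier P" using a(1) by (auto simp: series_carrier)
 have st: "a N m = a M m" if "size m < M" "M <= N" for N M m
 using that(2)
 proof (induct N rule: dec_induct)
 case (step N)
 have c: "a (Suc N) m : carrier L" "a N m : carrier L" using a(1) coeff_closed by auto
 have "a (Suc N) m \<ominus> a N m = \<zero>"
 using a(2)[of N] step(1) that(1) by (simp add: series_ker_def coeff_minus[OF a(1) a(1)])
 then have "a (Suc N) m = a N m" using c by simp
 then show ?case using step by simp
 qed simp
 have "?x -{P} a N : KP N" for N
 proof -
 have "(?x -{P} a N) m = \<zero>" if "size m < N" for m
 using st[of m "Suc (size m)" N] that coeff_closed[OF a(1)] by (simp add: coeff_minus[OF x a(1)])
 then show ?thesis using x a(1) by (simp add: series_ker_def)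
 qed
 then show ?thesis using x by blast
 qed
qed

abbreviation "Xs \<equiv> L.indexed_var ` {..<n}"

lemma vars_carrier: "Xs <= carrier P"
 by (auto simp: var_eq intro!: sterm_closed)

text \<open>The variables are split off one by one: f = X_k g + f', where f' collects the terms free
  of X_k and g has order at least N.\<close>

lemma ker_Suc_sub: "KP (Suc N) <= (idl P Xs) \<cdot>\<^bsub>P\<^esub> KP N"
proof
 let ?Q = "(idl P Xs) \<cdot>\<^bsub>P\<^esub> KP N"
 have Qid: "ideal ?Q P" by (rule P.ideal_prod_is_ideal[OF P.idl_ideal[OF vars_carrier] PF.K_ideal])
 have main: "f : ?Q" if "f : KP (Suc N)" "!!m. \<not> set_mset m <= {..<k} ==> f m = \<zero>" "k <= n" for k f
 using that
 proof (induct k arbitrary: f)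
 case 0
 have "f = 0{P}"
 proof
 fix m show "f m = 0{P} m" using 0(1,2) by (cases "m = {#}") (auto simp: series_ker_def coeff_zero)
 qed
 then show ?case using P.ideal_closed(2)[OF Qid] by simp
 next
 case (Suc k)
 let ?f = "%m. if k \<in># m then \<zero> else f m" and ?g = "%m. f (add_mset k m)"
 have fc: "f : carrier P" using Suc(2) by (simp add: series_ker_def)
 have gK: "?g : KP N" using Suc(2,4) by (auto simp: series_ker_def series_carrier)
 have fK: "?f : KP (Suc N)" using Suc(2) by (auto simp: series_ker_def series_carrier)
 have c: "f m : carrier L" for m using coeff_closed[OF fc] .
 have feq: "f = (L.indexed_var k *{P} ?g) +{P} ?f"
 proof
 fix m show "f m = ((L.indexed_var k *{P} ?g) +{P} ?f) m"
 using c by (simp add: coeff_add var_eq coeff_sterm_mult)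
 qed
 moreover have "?f : ?Q"
 proof (rule Suc(1)[OF fK])
 fix m assume "\<not> set_mset m <= {..<k}"
 then have "k \<in># m \<or> \<not> set_mset m <= {..<Suc k}" by (auto simp: less_Suc_eq)
 then show "(if k \<in># m then \<zero> else f m) = \<zero>" using Suc(3) by auto
 qed (use Suc(4) in simp)
 moreover have "L.indexed_var k *{P} ?g : ?Q"
 by (rule ideal_prod.prod[OF P.idl_mem[OF vars_carrier] gK]) (use Suc(4) in simp)
 ultimately show ?case by (subst feq) (rule P.ideal_closed(3)[OF Qid])
 qed
 fix f assume "f : KP (Suc N)"
 then show "f : ?Q" using main[of f n] by (simp add: series_ker_def series_carrier)
qed

lemma ker_1: "KP 1 = idl P Xs"
proof
 show "idl P Xs <= KP 1"
 proof (rule P.genideal_minimal[OF PF.K_ideal])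
 show "Xs <= KP 1" using vars_carrier by (auto simp: series_ker_def var_eq sterm_def)
 qed
 show "KP 1 <= idl P Xs"
 using ker_Suc_sub[of 0] P.ideal_prod_inter[OF P.idl_ideal[OF vars_carrier] PF.K_ideal, of 0] by auto
qed

lemma ker_power: "KP N = ideal_power P (idl P Xs) N"
proof (induct N)
 case 0
 then show ?case by (simp add: PF.K_0 P.ipow_0)
next
 case (Suc N)
 have "KP N \<cdot>\<^bsub>P\<^esub> idl P Xs <= KP (Suc N)"
 proof (rule P.ideal_prod_minimal[OF PF.K_ideal])
 fix x y assume "x : KP N" "y : idl P Xs"
 then show "x *{P} y : KP (Suc N)" using PF.K_mult[of x N y 1] ker_1 by simp
 qed
 moreover have "KP (Suc N) <= KP N \<cdot>\<^bsub>P\<^esub> idl P Xs"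
 using ker_Suc_sub P.ideal_prod_commute[OF P.idl_ideal[OF vars_carrier] PF.K_ideal] by simp
 ultimately show ?case unfolding P.ipow_Suc Suc[symmetric] by blast
qed

lemma sterm_mult: "c : carrier L ==> d : carrier L ==> sterm L c al *{P} sterm L d bt = sterm L (c \<otimes> d) (al + bt)"
proof
 fix m assume "c : carrier L" "d : carrier L"
 then have "(sterm L c al *{P} sterm L d bt) m = (if al \<subseteq># m then c \<otimes> sterm L d bt (m - al) else \<zero>)"
 by (intro coeff_sterm_mult) (auto simp: sterm_def)
 also have "... = sterm L (c \<otimes> d) (al + bt) m"
 using \<open>c : carrier L\<close> by (auto simp: sterm_def)
 finally show "(sterm L c al *{P} sterm L d bt) m = sterm L (c \<otimes> d) (al + bt) m" .
qed

lemma const_hom: "L.indexed_const : ring_hom L P"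
proof (rule ring_hom_memI)
 fix x y assume "x : carrier L" "y : carrier L"
 then show "L.indexed_const (x \<otimes> y) = L.indexed_const x *{P} L.indexed_const y"
 unfolding const_eq by (simp add: sterm_mult)
 show "L.indexed_const (x \<oplus> y) = L.indexed_const x +{P} L.indexed_const y"
 unfolding const_eq using \<open>x : carrier L\<close> \<open>y : carrier L\<close> by (intro ext) (auto simp: coeff_add sterm_def)
qed (auto simp: const_eq one_eq intro: sterm_closed)

lemma const_closed: "c : carrier L ==> L.indexed_const c : carrier P"
 by (auto simp: const_eq intro: sterm_closed)

text \<open>Completeness reduces invertibility to the constant term.\<close>

lemma series_unit:
 assumes f: "f : carrier P" and u: "f {#} : Units L"
 shows "f : Units P"
proof (rule PF.unit_mod_K[OF f])
 let ?g = "L.indexed_const (inv (f {#}))"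
 show g: "?g : carrier P" using u by (intro const_closed) simp
 have "(f *{P} ?g) {#} = \<one>"
 proof -
 have "f *{P} ?g = sterm L (inv (f {#})) {#} *{P} f" using P.m_comm[OF f g] by (simp add: const_eq)
 then show ?thesis using coeff_sterm_mult[of "inv (f {#})" f "{#}" "{#}"] u coeff_closed[OF f] by simp
 qed
 moreover have "1{P} {#} = \<one>" by (simp add: one_eq sterm_def)
 ultimately have "(f *{P} ?g -{P} 1{P}) {#} = \<zero>"
 using coeff_minus[OF P.m_closed[OF f g] P.one_closed] by simp
 then show "f *{P} ?g -{P} 1{P} : KP 1" using f g by (simp add: series_ker_def)
qed

lemma one_notin_ker: "\<one> ~= \<zero> ==> 1{P} ~: KP 1"
 by (auto simp: series_ker_def one_eq sterm_def)

lemma mon_vars: "set_mset al <= {..<n} ==> mon P L.indexed_var al = sterm L \<one> al"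
proof (induct al)
 case empty
 then show ?case by (simp add: one_eq)
next
 case (add i al)
 then have "mon P L.indexed_var (add_mset i al) = L.indexed_var i *{P} mon P L.indexed_var al"
 using vars_carrier by (intro P.mon_add_mset) auto
 also have "... = sterm L \<one> {#i#} *{P} sterm L \<one> al" using add by (simp add: var_eq[of i])
 also have "... = sterm L \<one> (add_mset i al)" by (simp add: sterm_mult)
 finally show ?case .
qed

end

section \<open>Frobenius and colons\<close>

context cring
begin

lemma binomial:
 assumes x: "x : carrier R" and y: "y : carrier R"
 shows "(x \<oplus> y) [^] (n::nat) = (\<Oplus>k\<in>{..n}. [(n choose k)] \<cdot> (x [^] k \<otimes> y [^] (n - k)))"
proof (induct n)
 case 0
 then show ?case by simp
next
 case (Suc n)
 let ?t = "%k. x [^] k \<otimes> y [^] (Suc n - k)"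
 \<comment> \<open>\<open>?F1\<close> is the sum shifted by one and padded with 0 at index 0;
   \<open>?F2\<close> extends to the last index by a vanishing binomial coefficient. Pascal's rule
   adds the two termwise.\<close>
 let ?F1 = "%j. if j = 0 then \<zero> else [(n choose (j - 1))] \<cdot> ?t j"
 let ?F2 = "%j. [(n choose j)] \<cdot> ?t j"
 have c: "?t k : carrier R" "x [^] k \<otimes> y [^] (n - k) : carrier R" for k :: nat using x y by auto
 have e1: "x \<otimes> ([(n choose k)] \<cdot> (x [^] k \<otimes> y [^] (n - k))) = ?F1 (Suc k)" for k
 proof -
 have "x \<otimes> (x [^] k \<otimes> y [^] (n - k)) = ?t (Suc k)"
 using x y by (simp add: nat_pow_Suc m_ac)
 then show ?thesis using x c by (simp add: add_pow_rdistr)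
 qed
 have e2: "y \<otimes> ([(n choose k)] \<cdot> (x [^] k \<otimes> y [^] (n - k))) = ?F2 k" if "k <= n" for k
 proof -
 have "y \<otimes> (x [^] k \<otimes> y [^] (n - k)) = ?t k"
 using x y that by (simp add: Suc_diff_le nat_pow_Suc m_ac)
 then show ?thesis using y c by (simp add: add_pow_rdistr)
 qed
 have S: "(\<Oplus>k\<in>{..n}. [(n choose k)] \<cdot> (x [^] k \<otimes> y [^] (n - k))) \<in> carrier R" (is "?S \<in> _")
 using c by (intro finsum_closed) auto
 have "s \<otimes> (x \<oplus> y) = x \<otimes> s \<oplus> y \<otimes> s" if "s : carrier R" for s
 using that x y by algebra
 from this[OF S] have "(x \<oplus> y) [^] Suc n = x \<otimes> ?S \<oplus> y \<otimes> ?S"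
 unfolding nat_pow_Suc Suc .
 also have "x \<otimes> ?S = (\<Oplus>k\<in>{..n}. ?F1 (Suc k))"
 using x c by (subst finsum_rdistr) (auto intro!: finsum_cong' simp: e1 simp del: add_pow_rdistr)
 also have "... = (\<Oplus>j\<in>{..Suc n}. ?F1 j)"
 proof -
 have "(\<Oplus>j\<in>{..Suc n}. ?F1 j) = (\<Oplus>j\<in>{..n}. ?F1 (Suc j)) \<oplus> ?F1 0"
 by (rule finsum_Suc2) (use x y in auto)
 moreover have "(\<Oplus>j\<in>{..n}. ?F1 (Suc j)) \<in> carrier R" by (rule finsum_closed) (use x y in auto)
 ultimately show ?thesis by simp
 qed
 also have "y \<otimes> ?S = (\<Oplus>k\<in>{..n}. ?F2 k)"
 using y c by (subst finsum_rdistr) (auto intro!: finsum_cong' simp: e2 simp del: add_pow_rdistr)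
 also have "... = (\<Oplus>j\<in>{..Suc n}. ?F2 j)"
 proof -
 have "(\<Oplus>j\<in>{..Suc n}. ?F2 j) = ?F2 (Suc n) \<oplus> (\<Oplus>j\<in>{..n}. ?F2 j)"
 by (rule finsum_Suc) (use c in auto)
 moreover have "(\<Oplus>j\<in>{..n}. ?F2 j) \<in> carrier R" by (rule finsum_closed) (use c in auto)
 ultimately show ?thesis by (simp add: binomial_eq_0)
 qed
 also have "(\<Oplus>j\<in>{..Suc n}. ?F1 j) \<oplus> (\<Oplus>j\<in>{..Suc n}. ?F2 j) = (\<Oplus>j\<in>{..Suc n}. ?F1 j \<oplus> ?F2 j)"
 using c by (intro finsum_addf[symmetric]) auto
 also have "... = (\<Oplus>j\<in>{..Suc n}. [(Suc n choose j)] \<cdot> ?t j)"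
 proof (rule finsum_cong')
 fix j assume "j : {..Suc n}"
 show "?F1 j \<oplus> ?F2 j = [(Suc n choose j)] \<cdot> ?t j"
 using x y by (cases j) (simp_all add: add.nat_pow_mult)
 qed (use x y in auto)
 finally show ?case .
qed

lemma frobenius_add:
 assumes p: "Factorial_Ring.prime (p::nat)" and ch: "[p] \<cdot> \<one> = \<zero>" and x: "x : carrier R" and y: "y : carrier R"
 shows "(x \<oplus> y) [^] p = x [^] p \<oplus> y [^] p"
proof -
 let ?t = "%k. [(p choose k)] \<cdot> (x [^] k \<otimes> y [^] (p - k))"
 have pz0: "[p] \<cdot> z = \<zero>" if z: "z : carrier R" for z
 proof -
 have "[p] \<cdot> z = [p] \<cdot> (\<one> \<otimes> z)" using z by simp
 also have "... = ([p] \<cdot> \<one>) \<otimes> z" using z by (simp only: add_pow_ldistr one_closed)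
 finally show ?thesis using z ch by simp
 qed
 have pz: "[(p * j)] \<cdot> z = \<zero>" if z: "z : carrier R" for j :: nat and z
 using pz0[of "[j] \<cdot> z"] add.nat_pow_pow[OF z, of p j] z by (simp add: mult.commute)
 have p0: "p > 0" "p ~= 0" using p prime_gt_0_nat by auto
 have "(\<Oplus>k\<in>{..p}. ?t k) = (\<Oplus>k\<in>{0, p}. ?t k)"
 proof (rule add.finprod_mono_neutral_cong_right)
 show "?t k = \<zero>" if "k : {..p} - {0, p}" for k
 proof -
 have "p dvd (p choose k)" using that p p0 by (intro dvd_choose_prime) auto
 then obtain j where "p choose k = p * j" by (auto elim: dvdE)
 then show ?thesis using pz x y by simp
 qed
 qed (use x y in auto)
 also have "... = ?t 0 \<oplus> ?t p" using p0 x y by (subst finsum_insert) auto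
 also have "... = x [^] p \<oplus> y [^] p" using x y by (simp add: a_comm)
 finally show ?thesis using binomial[OF x y] by simp
qed

lemma frobenius_pow_add:
 assumes p: "Factorial_Ring.prime (p::nat)" and ch: "[p] \<cdot> \<one> = \<zero>" and x: "x : carrier R" and y: "y : carrier R"
 shows "(x \<oplus> y) [^] (p ^ k) = x [^] (p ^ k) \<oplus> y [^] (p ^ k)"
proof (induct k)
 case (Suc k)
 have *: "z [^] (p ^ Suc k) = (z [^] (p ^ k)) [^] p" if "z : carrier R" for z
 using that by (simp add: nat_pow_pow mult.commute)
 show ?case using * x y Suc frobenius_add[OF p ch] by simp
qed (use x y in simp)

end

text \<open>q stands for a power of the characteristic and \<open>rt\<close> for the inverse of c
  |-> c^q on a perfect field. Additivity of the q-th power is assumed for series, and the formulas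
  for coefficients follow from it.\<close>

locale frob_series = series_over L n + L: field L for L :: "'a ring" (structure) and n +
 fixes q :: nat and rt :: "'a => 'a"
 assumes q1: "1 <= q"
 and frobP: "x : carrier P ==> y : carrier P ==> (x +{P} y) ^{P} q = x ^{P} q +{P} y ^{P} q"
 and rt_hom: "rt : ring_hom L L"
 and rt_pow: "c : carrier L ==> rt (c [^] q) = c"
begin

lemma rt_closed: "c : carrier L ==> rt c : carrier L"
 using ring_hom_closed[OF rt_hom] .

lemma rt_zero: "rt \<zero> = \<zero>"
 using ring_hom_zero[OF rt_hom L.ring_axioms L.ring_axioms] .

lemma rt_inj: assumes "c : carrier L" "rt c = \<zero>" shows "c = \<zero>"
proof (rule ccontr)
 assume "c ~= \<zero>"
 then have u: "c : Units L" using assms L.field_Units by auto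
 then have "rt c \<otimes> rt (inv c) = \<one>"
 using ring_hom_mult[OF rt_hom assms(1), of "inv c"] ring_hom_one[OF rt_hom] by simp
 then show False using assms rt_closed[of "inv c"] u by simp
qed

lemma sterm_pow: "c : carrier L ==> set_mset al <= {..<n} ==>
 sterm L c al ^{P} (k::nat) = sterm L (c [^] k) (repeat_mset k al)"
proof (induct k)
 case 0
 then show ?case by (simp add: one_eq)
next
 case (Suc k)
 then show ?case by (simp add: nat_pow_Suc sterm_mult add.commute)
qed

lemma repeat_inj: "repeat_mset q a = repeat_mset q b ==> a = b"
 using q1 by (metis not_one_le_zero repeat_mset_cancel1)

lemma set_mset_repeat: "set_mset (repeat_mset k M) = (if k = 0 then {} else set_mset M)"
 by (auto simp flip: count_greater_zero_iff)

lemma repeat_size_le: "size a <= size (repeat_mset q a)"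
 using q1 by (simp add: size_repeat_mset)

text \<open>Additivity of the q-th power removes one term of f at a time.\<close>

lemma pow_coeff_finite:
 assumes "finite S" "f : carrier P" "!!m. m ~: S ==> f m = \<zero>"
 shows "(ALL a. (f ^{P} q) (repeat_mset q a) = f a [^] q) &
 (ALL m. (ALL a. m ~= repeat_mset q a) --> (f ^{P} q) m = \<zero>)"
 using assms
proof (induct S arbitrary: f)
 case empty
 have "f = 0{P}" using empty(2) by (intro ext) (simp add: coeff_zero)
 moreover have "0{P} ^{P} q = 0{P}" using q1 P.nat_pow_zero[of q] by simp
 moreover have "\<zero> [^] q = \<zero>" using q1 L.nat_pow_zero[of q] by simp
 ultimately show ?case by (metis coeff_zero)
next
 case (insert al S)
 let ?f = "f(al := \<zero>)" and ?t = "sterm L (f al) al"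
 have fc: "f m : carrier L" for m using coeff_closed insert by auto
 have f'c: "?f : carrier P" using insert by (auto simp: series_carrier)
 show ?case
 proof (cases "set_mset al <= {..<n}")
 case False
 then have "f al = \<zero>" using insert(4) by (simp add: series_carrier)
 then have "f m = \<zero>" if "m ~: S" for m using insert(5)[of m] that by (cases "m = al") auto
 then show ?thesis using insert(3)[OF insert(4)] by simp
 next
 case True
 have tc: "?t : carrier P" using sterm_closed[OF fc True] .
 have feq: "f = ?f +{P} ?t" using fc by (intro ext) (auto simp: coeff_add sterm_def)
 have "f ^{P} q = ?f ^{P} q +{P} sterm L (f al [^] q) (repeat_mset q al)"
 by (subst feq) (simp add: frobP[OF f'c tc] sterm_pow[OF fc True])
 then have co: "(f ^{P} q) m = (?f ^{P} q) m \<oplus> (if m = repeat_mset q al then f al [^] q else \<zero>)" for m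
 by (simp add: coeff_add sterm_def)
 have IH: "(ALL a. (?f ^{P} q) (repeat_mset q a) = ?f a [^] q) &
 (ALL m. (ALL a. m ~= repeat_mset q a) --> (?f ^{P} q) m = \<zero>)"
 by (rule insert(3)[OF f'c]) (use insert(5) in auto)
 have z: "\<zero> [^] q = \<zero>" using q1 L.nat_pow_zero[of q] by simp
 show ?thesis
 proof (intro conjI allI impI)
 fix a
 show "(f ^{P} q) (repeat_mset q a) = f a [^] q"
 unfolding co using IH fc z by (cases "a = al") (auto dest: repeat_inj)
 next
 fix m :: "nat multiset" assume "ALL a. m ~= repeat_mset q a"
 then show "(f ^{P} q) m = \<zero>" unfolding co using IH by simp
 qed
 qed
qed

text \<open>Reduction to finite support: a tail of order N has a q-th power of order at least N, so
  coefficients of degree below N are those of the truncation.\<close>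

lemma pow_coeff:
 assumes f: "f : carrier P"
 shows "(f ^{P} q) (repeat_mset q a) = f a [^] q"
 and "(!!a. m ~= repeat_mset q a) ==> (f ^{P} q) m = \<zero>"
proof -
 define tr where "tr N = (%m. if size m < N then f m else \<zero>)" for N
 have tc: "tr N : carrier P" for N using f by (auto simp: series_carrier tr_def)
 have d: "f -{P} tr N : KP N" for N
 using f tc coeff_closed[OF f] by (auto simp: series_ker_def coeff_minus tr_def)
 have fin: "finite (\<Union>k\<in>{..<N}. multisets_of_size {..<n} k)" for N by auto
 have tz: "tr N m = \<zero>" if "m \<notin> (\<Union>k\<in>{..<N}. multisets_of_size {..<n} k)" for N m
 using that f by (auto simp: tr_def series_carrier multisets_of_size_def)
 note tp = pow_coeff_finite[OF fin tc tz]
 have eq: "(f ^{P} q) m = (tr N ^{P} q) m" if "size m < N" for m N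
 proof -
 let ?d = "f -{P} tr N"
 have dc: "?d : carrier P" using f tc by simp
 have "f = tr N +{P} ?d" using f tc[of N] by algebra
 then have "f ^{P} q = tr N ^{P} q +{P} ?d ^{P} q" using frobP[OF tc dc] by metis
 moreover obtain q' where "q = Suc q'" using q1 by (cases q) auto
 then have "?d ^{P} q : KP N" using PF.K_closed(7)[OF d, of "?d ^{P} q'"] dc by (simp add: nat_pow_Suc)
 then have "(?d ^{P} q) m = \<zero>" using that by (simp add: series_ker_def)
 ultimately show ?thesis using coeff_closed[of "tr N ^{P} q"] tc by (simp add: coeff_add)
 qed
 show "(f ^{P} q) (repeat_mset q a) = f a [^] q"
 proof -
 let ?N = "Suc (size (repeat_mset q a))"
 have "(f ^{P} q) (repeat_mset q a) = (tr ?N ^{P} q) (repeat_mset q a)" by (rule eq) simp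
 also have "... = tr ?N a [^] q" using tp[of ?N] by blast
 also have "tr ?N a = f a"
 using repeat_size_le[of a] unfolding tr_def by (simp only: less_Suc_eq_le if_True)
 finally show ?thesis .
 qed
 show "(!!a. m ~= repeat_mset q a) ==> (f ^{P} q) m = \<zero>"
 using eq[of m "Suc (size m)"] tp[of "Suc (size m)"] by simp
qed

text \<open>The monomials with all exponents below q; they form a basis of the power series ring
  over its subring of q-th powers.\<close>

definition small :: "nat multiset => bool" where
 "small bt \<longleftrightarrow> set_mset bt <= {..<n} & (ALL i. count bt i < q)"

text \<open>The bt-th coordinate in the basis of small monomials, after extraction of q-th roots: g
  is the sum over small bt of (\<open>proj bt g\<close>)^q X^bt.\<close>

definition proj :: "nat multiset => 'a series => 'a series" where
 "proj bt g = (%m. rt (g (repeat_mset q m + bt)))"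

lemma proj_closed: assumes g: "g : carrier P" shows "proj bt g : carrier P"
 unfolding series_carrier
proof (intro conjI allI impI)
 fix m
 show "proj bt g m : carrier L" using g by (simp add: proj_def rt_closed series_carrier)
 assume m: "\<not> set_mset m <= {..<n}"
 have "set_mset (repeat_mset q m) = set_mset m"
 using q1 by (simp add: set_mset_repeat)
 then have "\<not> set_mset (repeat_mset q m + bt) <= {..<n}" using m by auto
 then have "g (repeat_mset q m + bt) = \<zero>" using g by (simp add: series_carrier)
 then show "proj bt g m = \<zero>" by (simp add: proj_def rt_zero)
qed

lemma proj_add: "f : carrier P ==> g : carrier P ==> proj bt (f +{P} g) = proj bt f +{P} proj bt g"
 using ring_hom_add[OF rt_hom] coeff_closed by (intro ext) (simp add: proj_def coeff_add)

lemma repeat_sub_iff: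
 assumes "small bt" shows "repeat_mset q b \<subseteq># repeat_mset q m + bt \<longleftrightarrow> b \<subseteq># m"
proof -
 have "q * x <= q * y + r \<longleftrightarrow> x <= y" if "r < q" for x y r :: nat
 proof
 assume "q * x <= q * y + r"
 also have "... < q * Suc y" using that by simp
 finally have "q * x < q * Suc y" .
 then show "x <= y" by (simp only: mult_less_cancel1 less_Suc_eq_le)
 qed (simp add: trans_le_add1)
 then show ?thesis using assms by (auto simp: subseteq_mset_def small_def)
qed

text \<open>Coordinates are linear over q-th powers. In the product only the exponents q a of f^q
  count, and q a <= q m + bt is equivalent to a <= m because bt has exponents below q.\<close>

lemma proj_pow_mult:
 assumes f: "f : carrier P" and s: "s : carrier P" and b: "small bt"
 shows "proj bt (f ^{P} q *{P} s) = f *{P} proj bt s"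
proof
 fix m
 interpret rt: ring_hom_cring L L rt by unfold_locales (rule rt_hom)
 let ?M = "repeat_mset q m + bt"
 have fq: "f ^{P} q : carrier P" using f by simp
 note c = coeff_closed[OF f] coeff_closed[OF s] coeff_closed[OF fq]
 have fin: "finite {a. a \<subseteq># ?M}" "finite {a. a \<subseteq># m}" using finite_submultisets by auto
 have "(f ^{P} q *{P} s) ?M = (\<Oplus>a\<in>{a. a \<subseteq># ?M}. (f ^{P} q) a \<otimes> s (?M - a))" by (rule coeff_mult)
 also have "... = (\<Oplus>a\<in>repeat_mset q ` {a. a \<subseteq># m}. (f ^{P} q) a \<otimes> s (?M - a))"
 proof (rule L.add.finprod_mono_neutral_cong_right)
 show "repeat_mset q ` {a. a \<subseteq># m} <= {a. a \<subseteq># ?M}" using repeat_sub_iff[OF b] by auto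
 fix a assume a: "a : {a. a \<subseteq># ?M} - repeat_mset q ` {a. a \<subseteq># m}"
 then have "a ~= repeat_mset q d" for d using repeat_sub_iff[OF b] by auto
 then have "(f ^{P} q) a = \<zero>" using pow_coeff(2)[OF f] by blast
 then show "(f ^{P} q) a \<otimes> s (?M - a) = 0{L}" using c by simp
 qed (use c fin in auto)
 also have "... = (\<Oplus>a\<in>{a. a \<subseteq># m}. (f ^{P} q) (repeat_mset q a) \<otimes> s (?M - repeat_mset q a))"
 using c by (intro L.finsum_reindex) (auto intro!: inj_onI dest: repeat_inj)
 also have "... = (\<Oplus>a\<in>{a. a \<subseteq># m}. f a [^] q \<otimes> s (repeat_mset q (m - a) + bt))"
 proof (rule L.finsum_cong')
 fix a assume "a : {a. a \<subseteq># m}"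
 then have "?M - repeat_mset q a = repeat_mset q (m - a) + bt"
 by (intro multiset_eqI) (auto simp: right_diff_distrib' subseteq_mset_def)
 then show "(f ^{P} q) (repeat_mset q a) \<otimes> s (?M - repeat_mset q a) = f a [^] q \<otimes> s (repeat_mset q (m - a) + bt)"
 using pow_coeff(1)[OF f] by simp
 qed (use c in auto)
 finally have "rt ((f ^{P} q *{P} s) ?M) = (\<Oplus>a\<in>{a. a \<subseteq># m}. rt (f a [^] q \<otimes> s (repeat_mset q (m - a) + bt)))"
 using c by (simp add: o_def)
 also have "... = (\<Oplus>a\<in>{a. a \<subseteq># m}. f a \<otimes> rt (s (repeat_mset q (m - a) + bt)))"
 proof (rule L.finsum_cong')
 fix a
 show "rt (f a [^] q \<otimes> s (repeat_mset q (m - a) + bt)) = f a \<otimes> rt (s (repeat_mset q (m - a) + bt))"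
 using ring_hom_mult[OF rt_hom, of "f a [^] q" "s (repeat_mset q (m - a) + bt)"] rt_pow[OF c(1)] c
 by simp
 qed (use c rt_closed in auto)
 finally show "proj bt (f ^{P} q *{P} s) m = (f *{P} proj bt s) m"
 by (simp add: proj_def coeff_mult)
qed

text \<open>The ideal generated by the q-th powers of the variables, described through coefficients
  so that non-membership is visible.\<close>

definition low :: "'a series set" where
 "low = {f : carrier P. \<forall>bt. small bt --> f bt = \<zero>}"

lemma low_ideal: "ideal low P"
proof (rule P.idealI')
 show "low <= carrier P" "0{P} : low" by (auto simp: low_def coeff_zero)
 show "f +{P} g : low" if "f : low" "g : low" for f g
 using that add_closed by (auto simp: low_def coeff_add)
 fix f g assume f: "f : low" and g: "g : carrier P"
 have fc: "f : carrier P" using f by (simp add: low_def)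
 have "(g *{P} f) bt = \<zero>" if b: "small bt" for bt
 proof -
 have "small (bt - a)" for a using b unfolding small_def
 by (auto dest: in_diffD intro: le_less_trans[OF diff_le_self])
 then have "(\<Oplus>a\<in>{a. a \<subseteq># bt}. g a \<otimes> f (bt - a)) = (\<Oplus>a\<in>{a. a \<subseteq># bt}. \<zero>)"
 using f coeff_closed[OF g] by (intro L.finsum_cong') (auto simp: low_def)
 then show ?thesis by (simp add: coeff_mult)
 qed
 then show "g *{P} f : low" using fc g by (simp add: low_def)
qed

lemmas low_closed = P.ideal_closed[OF low_ideal]

text \<open>The coordinates of c z^q are z times those of c, and they lie in the ideal of G when c
  z^q lies in the ideal of the q-th powers. A nonzero coefficient of c at a small bt makes a
  coordinate of c a unit, which puts z into the ideal of G.\<close>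

lemma low_or_mem:
 assumes G: "G <= carrier P" and c: "c : carrier P" "z : carrier P"
 and mem: "c *{P} z ^{P} q : idl P ((%g. g ^{P} q) ` G)"
 and z: "z ~: idl P G"
 shows "c : low"
proof -
 have "c bt = \<zero>" if b: "small bt" for bt
 proof (rule ccontr)
 assume ne: "c bt ~= \<zero>"
 note Gid = P.idl_ideal[OF G]
 note Gc = P.ideal_closed[OF Gid]
 \<comment> \<open>The largest ideal whose elements have their bt-th coordinate in the ideal of
   G.\<close>
 let ?J = "{x : carrier P. \<forall>b\<in>carrier P. proj bt (b *{P} x) : idl P G}"
 have Jid: "ideal ?J P"
 proof (rule P.idealI')
 have "proj bt 0{P} = 0{P}" by (intro ext) (simp add: proj_def coeff_zero rt_zero)
 then show "0{P} : ?J" using Gc(2) by simp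
 show "x +{P} y : ?J" if "x : ?J" "y : ?J" for x y
 using that Gc(3) by (auto simp: P.r_distr proj_add)
 show "y *{P} x : ?J" if "x : ?J" "y : carrier P" for x y
 using that by (auto simp: P.m_assoc[symmetric])
 qed auto
 have "(%g. g ^{P} q) ` G <= ?J"
 proof safe
 fix g assume g: "g : G"
 then have gc: "g : carrier P" using G by auto
 then show "g ^{P} q : carrier P" by simp
 fix d assume d: "d : carrier P"
 have "proj bt (d *{P} g ^{P} q) = g *{P} proj bt d"
 using proj_pow_mult[OF gc d b] P.m_comm[OF d, of "g ^{P} q"] gc by simp
 then show "proj bt (d *{P} g ^{P} q) : idl P G"
 using Gc(6)[OF P.idl_mem[OF G g] proj_closed[OF d]] by simp
 qed
 then have "c *{P} z ^{P} q : ?J" using P.genideal_minimal[OF Jid] mem by blast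
 then have "proj bt (1{P} *{P} (c *{P} z ^{P} q)) : idl P G" by blast
 moreover have "1{P} *{P} (c *{P} z ^{P} q) = z ^{P} q *{P} c" using c P.m_comm by simp
 ultimately have 1: "z *{P} proj bt c : idl P G" using proj_pow_mult[OF c(2,1) b] by simp
 have cL: "c bt : carrier L" using coeff_closed[OF c(1)] .
 have "proj bt c {#} = rt (c bt)" by (simp add: proj_def)
 then have "proj bt c {#} ~= \<zero>" using rt_inj[OF cL] ne by auto
 then have "proj bt c {#} : Units L" using L.field_Units coeff_closed[OF proj_closed[OF c(1)]] by auto
 then have u: "proj bt c : Units P" using series_unit proj_closed c by blast
 have "z = (z *{P} proj bt c) *{P} inv\<^bsub>P\<^esub> (proj bt c)" using u c P.Units_closed[OF u] by (simp add: P.m_assoc)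
 then show False using z Gc(6)[OF 1, of "inv\<^bsub>P\<^esub> (proj bt c)"] u by simp
 qed
 then show ?thesis using c by (simp add: low_def)
qed

lemma pow_low: "x : KP 1 ==> x ^{P} q : low"
proof -
 let ?J = "{x : carrier P. x ^{P} q : low}"
 have "ideal ?J P"
 proof (rule P.idealI')
 have "0{P} ^{P} q = 0{P}" using q1 P.nat_pow_zero[of q] by simp
 then show "0{P} : ?J" using low_closed(2) by simp
 show "x +{P} y : ?J" if "x : ?J" "y : ?J" for x y using that low_closed(3) by (auto simp: frobP)
 show "y *{P} x : ?J" if "x : ?J" "y : carrier P" for x y
 using that low_closed(7) by (auto simp: P.nat_pow_distrib)
 qed auto
 moreover have "Xs <= ?J"
 proof
 fix x assume "x : Xs"
 then obtain i where i: "i < n" "x = sterm L \<one> {#i#}" by (auto simp: var_eq)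
 have "x ^{P} q = sterm L \<one> (repeat_mset q {#i#})" unfolding i using i by (subst sterm_pow) auto
 moreover have "\<not> small (repeat_mset q {#i#})" by (auto simp: small_def intro!: exI[of _ i])
 moreover have "x : carrier P" using i sterm_closed by auto
 moreover have "sterm L \<one> (repeat_mset q {#i#}) : carrier P"
 using i by (intro sterm_closed) (auto simp: set_mset_repeat)
 moreover have "\<forall>bt. small bt --> sterm L \<one> (repeat_mset q {#i#}) bt = \<zero>"
 using \<open>\<not> small (repeat_mset q {#i#})\<close> unfolding sterm_def by metis
 ultimately show "x : ?J" by (simp add: low_def)
 qed
 ultimately have "KP 1 <= ?J" unfolding ker_1 by (rule P.genideal_minimal)
 then show "x : KP 1 ==> x ^{P} q : low" by auto
qed

end

section \<open>Frobenius powers in a general system of parameters\<close>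

locale frob_coords = frob_series L n q rt for L :: "'a ring" (structure) and n q rt +
 fixes h :: "nat => 'a series"
 assumes hc: "h ` {..<n} <= carrier P" and h_gens: "idl P (h ` {..<n}) = idl P Xs"
begin

lemma h_ker: "i < n ==> h i : KP 1"
 unfolding ker_1 h_gens[symmetric] using P.idl_mem[OF hc] by auto

lemma mon_h_closed: "set_mset kp <= {..<n} ==> mon P h kp : carrier P"
 using hc by (intro P.mon_closed) auto

lemma mon_h_low:
 assumes k: "set_mset kp <= {..<n}" and i: "count kp i \<ge> q"
 shows "mon P h kp : low"
proof -
 have i': "i < n" using k i q1 by (metis count_inI lessThan_iff not_one_le_zero order.trans subset_iff)
 have hi: "h i : carrier P" using hc i' by auto
 let ?r = "replicate_mset q i"
 have sub: "?r \<subseteq># kp" using i by (simp add: count_le_replicate_mset_subset_eq)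
 then have s: "kp = ?r + (kp - ?r)" by simp
 have m: "set_mset (kp - ?r) <= {..<n}" using k by (auto dest: in_diffD)
 have "mon P h (?r + (kp - ?r)) = mon P h ?r *{P} mon P h (kp - ?r)"
 by (rule P.mon_add) (use hc hi m in \<open>auto split: if_splits\<close>)
 then have "mon P h kp = mon P h ?r *{P} mon P h (kp - ?r)" using s by simp
 moreover have "mon P h (replicate_mset k i) = h i ^{P} k" for k
 proof (induct k)
 case (Suc k)
 have "mon P h (add_mset i (replicate_mset k i)) = h i *{P} mon P h (replicate_mset k i)"
 by (rule P.mon_add_mset) (use hi in \<open>auto split: if_splits\<close>)
 then show ?case using Suc hi by (simp add: nat_pow_Suc P.m_comm)
 qed simp
 ultimately show ?thesis using low_closed(6)[OF pow_low[OF h_ker[OF i']] mon_h_closed[OF m]] by simp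
qed

definition top_exp :: "nat set => nat multiset" where
 "top_exp A = repeat_mset (q - 1) (mset_set A)"

lemma count_top: "finite A ==> count (top_exp A) i = (if i : A then q - 1 else 0)"
 by (simp add: top_exp_def)

lemma top_sub: "A <= {..<n} ==> set_mset (top_exp A) <= {..<n}"
 using finite_subset[of A "{..<n}"] by (auto simp: top_exp_def set_mset_repeat)

text \<open>Every other monomial in h of degree n (q - 1) has an exponent at least q and is
  therefore low. If this one were low as well, all series of order n (q - 1) would be, including the
  monomial with exponent q - 1 at every variable.\<close>

lemma socle: "mon P h (top_exp {..<n}) ~: low"
proof
 assume top: "mon P h (top_exp {..<n}) : low"
 let ?N = "n * (q - 1)" and ?t = "top_exp {..<n}"
 have ts: "size ?t = ?N" "set_mset ?t <= {..<n}" using top_sub by (auto simp: top_exp_def size_repeat_mset)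
 have "mon P h kp : low" if k: "kp : multisets_of_size {..<n} ?N" for kp
 proof (cases "EX i. count kp i \<ge> q")
 case True
 then show ?thesis using mon_h_low k by (auto simp: multisets_of_size_def)
 next
 case False
 then have le: "count kp i <= q - 1" for i using q1 by (metis Suc_diff_1 less_Suc_eq_le not_le less_le_trans zero_less_one)
 have ks: "set_mset kp <= {..<n}" "size kp = ?N" using k by (auto simp: multisets_of_size_def)
 have "size kp = (\<Sum>i<n. count kp i)"
 unfolding size_multiset_overloaded_eq
 using ks(1) by (intro sum.mono_neutral_left) (auto simp: not_in_iff)
 then have sum: "(\<Sum>i<n. (q - 1) - count kp i) = 0"
 using ks(2) le by (subst sum_subtractf_nat) auto
 have "count kp i = count ?t i" for i
 proof (cases "i < n")
 case True
 then have "(q - 1) - count kp i = 0" using sum by simp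
 then show ?thesis using le[of i] True by (simp add: count_top)
 next
 case False
 then have "i \<notin># kp" using ks by auto
 then show ?thesis using False by (simp add: count_top not_in_iff)
 qed
 then have "kp = ?t" by (rule multiset_eqI)
 then show ?thesis using top by simp
 qed
 moreover have "sterm L \<one> ?t : KP ?N" using ts sterm_closed by (auto simp: series_ker_def sterm_def)
 moreover have "KP ?N = idl P (mon P h ` multisets_of_size {..<n} ?N)"
 unfolding ker_power h_gens[symmetric] by (rule P.ipow_idl[OF hc])
 ultimately have "sterm L \<one> ?t : low"
 using P.genideal_minimal[OF low_ideal, of "mon P h ` multisets_of_size {..<n} ?N"] by auto
 moreover have "small ?t" using ts(2) q1 by (auto simp: small_def count_top)
 ultimately show False by (auto simp: low_def sterm_def)
qed

text \<open>Fedder's trick: multiplication by e, the product of the h_j^(q-1) with j in E, turns the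
  relation modulo h_E into one modulo q-th powers, so z outside the ideal forces c e to be low. If c
  were outside (h_E) + m^N, some monomial of degree s < N in the other parameters would occur in c
  with a unit coefficient; completing it to the socle monomial contradicts
  \<open>socle\<close>.\<close>

theorem fedder:
 assumes E: "E <= {..<n}" and A: "A <= carrier P" and c: "c : carrier P" "z : carrier P"
 and mem: "c *{P} z ^{P} q : idl P ((%a. a ^{P} q) ` A Un h ` E)"
 and N: "N <= q"
 shows "z : idl P (A Un h ` E) \<or> c : idl P (h ` E) <+{P} KP N"
proof (rule ccontr)
 assume "\<not> ?thesis"
 then have nz: "z ~: idl P (A Un h ` E)" and nc: "c ~: idl P (h ` E) <+{P} KP N" by auto
 let ?F = "{..<n} - E" and ?W = "idl P (h ` E)"
 let ?e = "mon P h (top_exp E)"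
 have hE: "h ` E <= carrier P" using E hc by auto
 have finE: "finite E" using E finite_subset by blast
 have ec: "?e : carrier P" by (rule mon_h_closed[OF top_sub[OF E]])
 have Wid: "ideal ?W P" by (rule P.idl_ideal[OF hE])
 have lowE: "mon P h (kp + top_exp E) : low" if "set_mset kp <= {..<n}" "j \<in># kp" "j : E" for kp j
 proof (rule mon_h_low[of _ j])
 show "set_mset (kp + top_exp E) <= {..<n}" using that top_sub[OF E] by auto
 have "count kp j > 0" using that(2) by simp
 moreover have "count (kp + top_exp E) j = count kp j + (q - 1)" using that finE by (simp add: count_top)
 ultimately show "q <= count (kp + top_exp E) j" by linarith
 qed
 have mon2: "mon P h (kp + kp') = mon P h kp *{P} mon P h kp'"
 if "set_mset kp <= {..<n}" "set_mset kp' <= {..<n}" for kp kp'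
 using that hc by (intro P.mon_add) auto
 \<comment> \<open>For a generator h_j with j in E, \<open>?e\<close> times h_j is h_j^q times the
   monomial of \<open>top_exp (E - {j})\<close>.\<close>
 have Glow: "?e *{P} x : idl P ((%g. g ^{P} q) ` (A Un h ` E))"
 if x: "x : (%a. a ^{P} q) ` A Un h ` E" for x
 proof -
 let ?Q = "idl P ((%g. g ^{P} q) ` (A Un h ` E))"
 have Gc: "(%g. g ^{P} q) ` (A Un h ` E) <= carrier P" using A hE by auto
 note Qid = P.idl_ideal[OF Gc]
 from x show ?thesis
 proof
 assume "x : (%a. a ^{P} q) ` A"
 then have "x : ?Q" by (intro P.idl_mem[OF Gc]) auto
 then show ?thesis using P.ideal_closed(7)[OF Qid _ ec] by simp
 next
 assume "x : h ` E"
 then obtain j where j: "j : E" "x = h j" by auto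
 have jn: "j < n" "h j : carrier P" using j E hc by auto
 have rest: "set_mset (top_exp (E - {j})) <= {..<n}" using top_sub[of "E - {j}"] E by auto
 have "add_mset j (top_exp E) = replicate_mset q j + top_exp (E - {j})"
 using j q1 finE by (intro multiset_eqI) (auto simp: count_top)
 then have "mon P h (add_mset j (top_exp E)) = mon P h (replicate_mset q j) *{P} mon P h (top_exp (E - {j}))"
 using mon2[of "replicate_mset q j", OF _ rest] jn by (auto split: if_splits)
 moreover have "mon P h (add_mset j (top_exp E)) = h j *{P} ?e"
 using hc jn top_sub[OF E] by (intro P.mon_add_mset) auto
 moreover have "mon P h (replicate_mset k j) = h j ^{P} k" for k
 proof (induct k)
 case (Suc k)
 have "mon P h (add_mset j (replicate_mset k j)) = h j *{P} mon P h (replicate_mset k j)"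
 by (rule P.mon_add_mset) (use jn in \<open>auto split: if_splits\<close>)
 then show ?case using Suc jn by (simp add: nat_pow_Suc P.m_comm)
 qed simp
 ultimately have "?e *{P} x = h j ^{P} q *{P} mon P h (top_exp (E - {j}))"
 using j P.m_comm[OF ec jn(2)] by simp
 moreover have "h j ^{P} q : ?Q" using j by (intro P.idl_mem[OF Gc]) auto
 ultimately show ?thesis using P.ideal_closed(6)[OF Qid _ mon_h_closed[OF rest]] by simp
 qed
 qed
 have gc0: "(%a. a ^{P} q) ` A Un h ` E <= carrier P" using A hE by auto
 have "?e *{P} (c *{P} z ^{P} q) : idl P ((%g. g ^{P} q) ` (A Un h ` E))"
 by (rule P.idl_mult_mem[OF P.idl_ideal gc0 ec Glow mem]) (use A hE in auto)
 moreover have "?e *{P} (c *{P} z ^{P} q) = (c *{P} ?e) *{P} z ^{P} q"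
 proof -
 have zc: "z ^{P} q : carrier P" using c by simp
 show ?thesis using ec c(1) zc by (simp add: P.m_ac)
 qed
 ultimately have C: "c *{P} ?e : low"
 using low_or_mem[of "A Un h ` E" "c *{P} ?e" z] nz A hE c ec by auto
 have KPh: "KP s = idl P (mon P h ` multisets_of_size {..<n} s)" for s
 unfolding ker_power h_gens[symmetric] by (rule P.ipow_idl[OF hc])
 note sumid = P.add_ideals[OF Wid PF.K_ideal]
 have "c : ?W <+{P} KP 0"
 using P.add_ideals_sub(2)[OF Wid PF.K_ideal[of 0]] c PF.K_0 by auto
 \<comment> \<open>s is the order of c modulo (h_E); it is below N by the assumption on c.\<close>
 from this obtain s where s: "s < N" "c : ?W <+{P} KP s" "c ~: ?W <+{P} KP (Suc s)"
 proof -
 assume c0: "c : ?W <+{P} KP 0" and that: "!!s. s < N ==> c : ?W <+{P} KP s ==> c ~: ?W <+{P} KP (Suc s) ==> thesis"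
 have "\<exists>s<M. c : ?W <+{P} KP s & c ~: ?W <+{P} KP (Suc s)" if "c ~: ?W <+{P} KP M" for M
 using that
 proof (induct M)
 case (Suc M)
 then show ?case by (cases "c : ?W <+{P} KP M") (auto intro: less_SucI)
 qed (use c0 in simp)
 then show thesis using nc that by blast
 qed
 \<comment> \<open>The ideal spanned, modulo (h_E) and order s + 1, by the monomials of U. Among the
   sets U of degree s monomials with c in \<open>V U\<close> one of least size is taken
   below.\<close>
 define V where "V U = (?W <+{P} KP (Suc s)) <+{P} idl P (mon P h ` U)" for U
 have Uc: "mon P h ` U <= carrier P" if "U <= multisets_of_size ?F t" for U t
 using that by (auto intro!: mon_h_closed simp: multisets_of_size_def)
 have "KP s <= V (multisets_of_size ?F s)"
 unfolding KPh
 proof (rule P.genideal_minimal)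
 have Vid: "ideal (V (multisets_of_size ?F s)) P"
 unfolding V_def by (intro P.add_ideals sumid P.idl_ideal Uc[of _ s]) simp
 then show "ideal (V (multisets_of_size ?F s)) P" .
 show "mon P h ` multisets_of_size {..<n} s <= V (multisets_of_size ?F s)"
 proof safe
 fix kp assume k: "kp : multisets_of_size {..<n} s"
 show "mon P h kp : V (multisets_of_size ?F s)"
 proof (cases "EX j. j \<in># kp & j : E")
 case False
 then have "kp : multisets_of_size ?F s" using k by (auto simp: multisets_of_size_def)
 then have "mon P h kp : idl P (mon P h ` multisets_of_size ?F s)"
 by (intro P.idl_mem[OF Uc[of _ s]]) auto
 then show ?thesis unfolding V_def
 using P.add_ideals_sub(2)[OF sumid P.idl_ideal[OF Uc[of "multisets_of_size ?F s" s]]] by auto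
 next
 case True
 then obtain j kp' where j: "j : E" "kp = add_mset j kp'" by (meson multi_member_split)
 have k': "set_mset kp' <= {..<n}" "j < n" using k j E by (auto simp: multisets_of_size_def)
 have "mon P h kp = h j *{P} mon P h kp'" unfolding j using hc k' by (intro P.mon_add_mset) auto
 then have "mon P h kp : ?W"
 using P.ideal_closed(6)[OF Wid P.idl_mem[OF hE, of "h j"] mon_h_closed[OF k'(1)]] j by auto
 then show ?thesis unfolding V_def
 using P.add_ideals_sub(1)[OF Wid PF.K_ideal[of "Suc s"]]
 P.add_ideals_sub(1)[OF sumid[of "Suc s"] P.idl_ideal[OF Uc[of "multisets_of_size ?F s" s]]] by auto
 qed
 qed
 qed
 moreover have "?W <= V (multisets_of_size ?F s)" unfolding V_def
 using P.add_ideals_sub(1)[OF Wid PF.K_ideal[of "Suc s"]]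
 P.add_ideals_sub(1)[OF sumid[of "Suc s"] P.idl_ideal[OF Uc[of "multisets_of_size ?F s" s]]] by auto
 moreover have "ideal (V (multisets_of_size ?F s)) P"
 unfolding V_def by (intro P.add_ideals sumid P.idl_ideal Uc[of _ s]) simp
 ultimately have "c : V (multisets_of_size ?F s)"
 using P.add_ideals_minimal s(2) by blast
 then have ex: "EX U. U <= multisets_of_size ?F s & c : V U" by blast
 define U where "U = (ARG_MIN card U. U <= multisets_of_size ?F s & c : V U)"
 have U: "U <= multisets_of_size ?F s" "c : V U"
 and Umin: "!!U'. U' <= multisets_of_size ?F s ==> c : V U' ==> card U <= card U'"
 using arg_min_nat_lemma[of "%U. U <= multisets_of_size ?F s & c : V U" _ card] ex
 unfolding U_def by (metis (no_types, lifting))+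
 have finU: "finite U" using U(1) by (rule finite_subset) auto
 have "U ~= {}"
 proof
 assume "U = {}"
 then have "V U = (?W <+{P} KP (Suc s)) <+{P} {0{P}}" by (simp add: V_def P.idl_empty)
 also have "... <= ?W <+{P} KP (Suc s)"
 by (rule P.add_ideals_minimal[OF sumid]) (use P.ideal_closed(2)[OF sumid[of "Suc s"]] in simp_all)
 finally show False using U s by auto
 qed
 then obtain gm where g: "gm : U" by auto
 let ?U' = "U - {gm}"
 have gF: "set_mset gm <= ?F" "size gm = s" "set_mset gm <= {..<n}" using g U(1) by (auto simp: multisets_of_size_def)
 have U'c: "mon P h ` ?U' <= carrier P" by (rule Uc[of _ s]) (use U in auto)
 have gc: "mon P h gm : carrier P" using mon_h_closed gF by auto
 have ins: "mon P h ` U = insert (mon P h gm) (mon P h ` ?U')" using g by auto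
 from iffD1[OF mem_set_add_iff U(2)[unfolded V_def]]
 obtain wk v where wv: "wk : ?W <+{P} KP (Suc s)" "v : idl P (mon P h ` U)" "c = wk +{P} v"
 by (elim bexE) rule
 obtain w k where wk: "w : ?W" "k : KP (Suc s)" "wk = w +{P} k" using wv(1) unfolding mem_set_add_iff by blast
 obtain u e where ue: "u : carrier P" "e : idl P (mon P h ` ?U')" "v = mon P h gm *{P} u +{P} e"
 using wv(2) unfolding ins P.idl_insert[OF gc U'c] by blast
 have cc: "w : carrier P" "k : carrier P" "e : carrier P"
 using P.ideal_closed(8)[OF Wid wk(1)] PF.K_closed(8)[OF wk(2)] P.idl_carrier[OF U'c] ue by auto
 have ceq: "c = w +{P} k +{P} (mon P h gm *{P} u +{P} e)" using wv wk ue by simp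
 \<comment> \<open>A coefficient in the maximal ideal would push its term to order s + 1, so gm
   could be dropped from U.\<close>
 have uu: "u : Units P"
 proof (rule ccontr)
 assume "u ~: Units P"
 then have "u {#} = \<zero>" using series_unit[OF ue(1)] L.field_Units coeff_closed[OF ue(1)] by auto
 then have "u : KP 1" using ue(1) by (simp add: series_ker_def)
 moreover have "mon P h gm : KP s" unfolding KPh
 by (rule P.idl_mem) (use gF mon_h_closed in \<open>auto simp: multisets_of_size_def\<close>)
 ultimately have gk: "mon P h gm *{P} u : KP (Suc s)" using PF.K_mult[of "mon P h gm" s u 1] by simp
 have "c = (w +{P} (k +{P} mon P h gm *{P} u)) +{P} e" unfolding ceq using cc gc ue(1) by algebra
 moreover have "w +{P} (k +{P} mon P h gm *{P} u) : ?W <+{P} KP (Suc s)"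
 unfolding mem_set_add_iff using wk(1) PF.K_closed(3)[OF wk(2) gk] by blast
 ultimately have "c : V ?U'" unfolding V_def mem_set_add_iff[of c] using ue(2) by blast
 then have "card U <= card ?U'" using Umin[of ?U'] U(1) by auto
 moreover have "card ?U' < card U" using card_Diff1_less[OF finU g] .
 ultimately show False by simp
 qed
 \<comment> \<open>The complement of gm in the top monomial outside E; it exists since the exponents
   of gm are at most s <= q - 1.\<close>
 let ?d = "top_exp ?F - gm"
 have countg: "count gm i <= q - 1" for i
 using count_le_size[of gm i] gF(2) s(1) N by linarith
 have dsub: "set_mset ?d <= {..<n}" using top_sub[of ?F] by (auto dest: in_diffD)
 have gd: "gm + ?d = top_exp ?F"
 proof (rule multiset_eqI)
 fix i show "count (gm + ?d) i = count (top_exp ?F) i"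
 proof (cases "i : ?F")
 case True
 then show ?thesis using countg[of i] by (simp add: count_top)
 next
 case False
 then have "i \<notin># gm" using gF by auto
 then show ?thesis using False by (simp add: count_top not_in_iff)
 qed
 qed
 let ?D = "mon P h ?d"
 have Dc: "?D : carrier P" by (rule mon_h_closed[OF dsub])
 \<comment> \<open>Any monomial of degree at least s other than gm becomes low after this
   multiplication: it involves an index of E, or it exceeds gm in some exponent.\<close>
 have lowF: "mon P h (kp + (?d + top_exp E)) : low"
 if "set_mset kp <= {..<n}" "kp ~= gm" "size kp \<ge> s" for kp
 proof (cases "EX j. j \<in># kp & j : E")
 case True
 then obtain j where "j \<in># kp" "j : E" by auto
 then have "mon P h ((kp + ?d) + top_exp E) : low" using that dsub by (intro lowE[of _ j]) auto
 then show ?thesis by (simp add: add.assoc)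
 next
 case False
 have "\<not> kp \<subseteq># gm"
 proof
 assume k: "kp \<subseteq># gm"
 then have "size kp <= size gm" by (rule size_mset_mono)
 then have "kp = gm" using k that(3) gF(2) by (metis le_antisym mset_subset_size nat_less_le subset_mset.less_le)
 then show False using that by simp
 qed
 then obtain i where i: "count gm i < count kp i" by (auto simp: subseteq_mset_def not_le)
 then have "i \<in># kp" by (metis count_eq_zero_iff less_nat_zero_code)
 then have iF: "i : ?F" using False that(1) by auto
 show ?thesis
 proof (rule mon_h_low[of _ i])
 show "set_mset (kp + (?d + top_exp E)) <= {..<n}" using that dsub top_sub[OF E] by auto
 show "q <= count (kp + (?d + top_exp E)) i" using i iF countg[of i] by (simp add: count_top)
 qed
 qed
 let ?T = "?D *{P} ?e"
 have Tc: "?T : carrier P" using Dc ec by simp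
 have Teq: "mon P h kp *{P} ?T = mon P h (kp + (?d + top_exp E))" if "set_mset kp <= {..<n}" for kp
 using mon2[OF that, of "?d + top_exp E"] mon2[OF dsub top_sub[OF E]] dsub top_sub[OF E] by simp
 have Tcomm: "?T *{P} mon P h kp = mon P h (kp + (?d + top_exp E))" if "set_mset kp <= {..<n}" for kp
 using Teq[OF that] P.m_comm[OF Tc mon_h_closed[OF that]] by simp
 have "?T *{P} w : low"
 proof (rule P.idl_mult_mem[OF low_ideal hE Tc _ wk(1)])
 fix x assume "x : h ` E"
 then obtain j where j: "j : E" "x = h j" by auto
 have jn: "set_mset {#j#} <= {..<n}" "h j : carrier P" using j E hc by auto
 have "mon P h (({#j#} + ?d) + top_exp E) : low" using jn dsub j by (intro lowE[of _ j]) auto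
 then show "?T *{P} x : low" using Tcomm[OF jn(1)] j P.mon_single[of h j, OF jn(2)] by (simp add: add.assoc)
 qed
 moreover have "?T *{P} k : low"
 proof (rule P.idl_mult_mem[OF low_ideal _ Tc _ wk(2)[unfolded KPh]])
 show "mon P h ` multisets_of_size {..<n} (Suc s) <= carrier P"
 by (auto intro!: mon_h_closed simp: multisets_of_size_def)
 fix x assume "x : mon P h ` multisets_of_size {..<n} (Suc s)"
 then obtain kp where k: "set_mset kp <= {..<n}" "size kp = Suc s" "x = mon P h kp" by (auto simp: multisets_of_size_def)
 then have "kp ~= gm" using gF(2) by auto
 then have "mon P h (kp + (?d + top_exp E)) : low" using k by (intro lowF) auto
 then show "?T *{P} x : low" using Tcomm[OF k(1)] k(3) by simp
 qed
 moreover have "?T *{P} e : low"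
 proof (rule P.idl_mult_mem[OF low_ideal U'c Tc _ ue(2)])
 fix x assume "x : mon P h ` ?U'"
 then obtain kp where "kp : U" "kp ~= gm" "x = mon P h kp" by auto
 moreover have "set_mset kp <= {..<n}" "size kp = s" using calculation U(1) by (auto simp: multisets_of_size_def)
 ultimately show "?T *{P} x : low" using Tcomm lowF by auto
 qed
 moreover have "?T *{P} c : low"
 proof -
 have "?D *{P} (c *{P} ?e) : low" by (rule low_closed(7)[OF C Dc])
 moreover have "?D *{P} (c *{P} ?e) = ?T *{P} c" using Dc c ec by (simp add: P.m_ac)
 ultimately show ?thesis by simp
 qed
 ultimately have "?T *{P} c -{P} ?T *{P} w -{P} ?T *{P} k -{P} ?T *{P} e : low"
 using low_closed(4) by blast
 moreover have "?T *{P} c -{P} ?T *{P} w -{P} ?T *{P} k -{P} ?T *{P} e = mon P h gm *{P} ?T *{P} u"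
 proof -
 define t where "t = ?T"
 define g where "g = mon P h gm"
 have tg: "t : carrier P" "g : carrier P" using Tc gc by (auto simp: t_def g_def)
 have "t *{P} (w +{P} k +{P} (g *{P} u +{P} e)) -{P} t *{P} w -{P} t *{P} k -{P} t *{P} e = g *{P} t *{P} u"
 using tg cc ue(1) by algebra
 then show ?thesis unfolding t_def g_def using ceq by simp
 qed
 ultimately have "mon P h (gm + (?d + top_exp E)) *{P} u : low" using Teq gF by simp
 moreover have "gm + (?d + top_exp E) = top_exp {..<n}"
 proof -
 have "gm + (?d + top_exp E) = top_exp ?F + top_exp E" using gd by (metis add.assoc)
 also have "... = top_exp {..<n}"
 using E finE by (intro multiset_eqI) (auto simp: count_top)
 finally show ?thesis .
 qed
 ultimately have 1: "mon P h (top_exp {..<n}) *{P} u : low" by simp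
 have tc: "mon P h (top_exp {..<n}) : carrier P" by (rule mon_h_closed[OF top_sub]) simp
 have "mon P h (top_exp {..<n}) = (mon P h (top_exp {..<n}) *{P} u) *{P} inv\<^bsub>P\<^esub> u"
 using tc uu P.Units_closed[OF uu] by (simp add: P.m_assoc)
 then have "mon P h (top_exp {..<n}) : low" using low_closed(6)[OF 1, of "inv\<^bsub>P\<^esub> u"] uu by simp
 then show False using socle by simp
qed

end

section \<open>Ultraproducts\<close>

text \<open>Transfer to the factors works for finitely many generators, so a membership is first cut
  down to the generators it involves.\<close>

lemma (in cring) idl_finite_subset:
 assumes A: "A <= carrier R" and x: "x : Idl A"
 shows "EX A'. finite A' & A' <= A & x : Idl A'"
proof -
 let ?J = "{x. EX A'. finite A' & A' <= A & x : Idl A'}"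
 have sub: "A' <= A ==> A' <= carrier R" for A' using A by auto
 have "ideal ?J R"
 proof (rule idealI')
 show "?J <= carrier R" using idl_carrier sub by blast
 show "\<zero> : ?J" by (intro CollectI exI[of _ "{}"]) (simp add: idl_empty)
 fix x y assume x: "x : ?J"
 then obtain A1 where 1: "finite A1" "A1 <= A" "x : Idl A1" by blast
 { assume "y : ?J"
 then obtain A2 where 2: "finite A2" "A2 <= A" "y : Idl A2" by blast
 have c: "A1 Un A2 <= carrier R" using sub 1 2 by blast
 have "x : Idl (A1 Un A2)" "y : Idl (A1 Un A2)"
 using 1 2 idl_mono[of A1 "A1 Un A2", OF _ c] idl_mono[of A2 "A1 Un A2", OF _ c] by auto
 then have "x \<oplus> y : Idl (A1 Un A2)" by (rule ideal_closed(3)[OF idl_ideal[OF c]])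
 then show "x \<oplus> y : ?J" using 1 2 by (intro CollectI exI[of _ "A1 Un A2"]) auto }
 { assume "y : carrier R"
 then have "y \<otimes> x : Idl A1" using ideal_closed(7)[OF idl_ideal[OF sub[OF 1(2)]] 1(3)] by simp
 then show "y \<otimes> x : ?J" using 1 by blast }
 qed
 moreover have "A <= ?J"
 proof
 fix a assume a: "a : A"
 then have "a : Idl {a}" using A genideal_self' by auto
 then show "a : ?J" using a by (intro CollectI exI[of _ "{a}"]) auto
 qed
 ultimately have "Idl A <= ?J" by (rule genideal_minimal)
 then show ?thesis using x by blast
qed

text \<open>Q is the maximal ideal of a local ring, stated through units so that the property
  transfers to ultraproducts without quantifying over ideals.\<close>

definition max_gen :: "('a, 'b) ring_scheme => 'a set => bool" where
 "max_gen R Q \<longleftrightarrow> ideal Q R & 1{R} ~: Q & (\<forall>x\<in>carrier R. x ~: Q --> x : Units R)"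

lemma (in cring) max_gen_nonunit:
 assumes "max_gen R Q" shows "Q = carrier R - Units R"
proof -
 have Q: "ideal Q R" "\<one> ~: Q" using assms by (auto simp: max_gen_def)
 have "x ~: Units R" if "x : Q" for x
 using ideal_closed(6)[OF Q(1) that, of "inv x"] Q(2) Units_r_inv[of x] Units_inv_closed[of x] by auto
 then show ?thesis using assms ideal_closed(1)[OF Q(1)] by (auto simp: max_gen_def)
qed

section \<open>Ultraproducts and the transfer of ideal membership\<close>

locale ultra =
 fixes W :: "'w set" and F :: "'w filter" and A :: "'w => 'a ring"
 assumes us: "ultraset W F" and cr: "w : W ==> cring (A w)"
begin

abbreviation "Pr \<equiv> product_ring W A"
abbreviation "U \<equiv> ultraproduct W F A"
abbreviation "ue \<equiv> ultra_elem W F A"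

definition sec :: "('w => 'a) => bool" where
 "sec a \<longleftrightarrow> (\<forall>w\<in>W. a w : carrier (A w))"

lemma ev_W: "\<forall>\<^sub>F w in F. w : W"
 using us by (simp add: ultraset_def)

lemma F_nonbot: "F ~= bot"
 using us by (simp add: ultraset_def)

lemma ultra_dichotomy: "(\<forall>\<^sub>F w in F. Q w) \<or> (\<forall>\<^sub>F w in F. \<not> Q w)"
 using us by (simp add: ultraset_def)

lemma ev_mono:
 assumes "!!w. w : W ==> Q w ==> Q' w" "\<forall>\<^sub>F w in F. Q w" shows "\<forall>\<^sub>F w in F. Q' w"
 using ev_W assms(2) by eventually_elim (rule assms(1))

lemma evI: "(!!w. w : W ==> Q w) ==> \<forall>\<^sub>F w in F. Q w"
 using ev_W by (rule eventually_mono) auto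

lemma Pr_simps:
 "carrier Pr = (\<Pi>\<^sub>E w\<in>W. carrier (A w))"
 "f *{Pr} g = (\<lambda>w\<in>W. f w *{A w} g w)" "f +{Pr} g = (\<lambda>w\<in>W. f w +{A w} g w)"
 "1{Pr} = (\<lambda>w\<in>W. 1{A w})" "0{Pr} = (\<lambda>w\<in>W. 0{A w})"
 by (simp_all add: product_ring_def)

lemma sec_Pr: "sec a ==> restrict a W : carrier Pr"
 by (auto simp: sec_def Pr_simps)

lemma Pr_sec: "f : carrier Pr \<longleftrightarrow> sec f & restrict f W = f"
 by (auto simp: sec_def Pr_simps PiE_iff extensional_restrict extensional_def restrict_def fun_eq_iff split: if_splits)

lemma Pr_cring: "cring Pr"
proof (intro cringI abelian_groupI comm_monoidI)
 fix f g h assume fgh: "f : carrier Pr" "g : carrier Pr" "h : carrier Pr"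
 then have c: "f w : carrier (A w)" "g w : carrier (A w)" "h w : carrier (A w)" if "w : W" for w
 using that by (auto simp: Pr_simps)
 show "f +{Pr} g +{Pr} h = f +{Pr} (g +{Pr} h)" "f *{Pr} g *{Pr} h = f *{Pr} (g *{Pr} h)"
 "(f +{Pr} g) *{Pr} h = f *{Pr} h +{Pr} g *{Pr} h"
 using c cr by (auto simp: Pr_simps restrict_def fun_eq_iff cring.cring_simprules)
next
 fix f g assume fgh: "f : carrier Pr" "g : carrier Pr"
 then have c: "f w : carrier (A w)" "g w : carrier (A w)" if "w : W" for w
 using that by (auto simp: Pr_simps)
 show "f +{Pr} g = g +{Pr} f"
 using c cr cring.cring_simprules(10) by (fastforce simp: Pr_simps restrict_def fun_eq_iff)
 show "f *{Pr} g = g *{Pr} f"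
 using c cr cring.cring_simprules(14) by (fastforce simp: Pr_simps restrict_def fun_eq_iff)
 show "f +{Pr} g : carrier Pr" "f *{Pr} g : carrier Pr"
 using c cr by (auto simp: Pr_simps cring.cring_simprules)
next
 show "0{Pr} : carrier Pr" "1{Pr} : carrier Pr" using cr by (auto simp: Pr_simps cring.cring_simprules)
 fix f assume f: "f : carrier Pr"
 then have c: "f w : carrier (A w)" if "w : W" for w using that by (auto simp: Pr_simps)
 have ext: "f w = undefined" if "w ~: W" for w using f that by (auto simp: Pr_simps PiE_def extensional_def)
 have "1{A w} *{A w} f w = f w" "0{A w} +{A w} f w = f w" if "w : W" for w
 proof -
 interpret Aw: cring "A w" by (rule cr[OF that])
 show "1{A w} *{A w} f w = f w" "0{A w} +{A w} f w = f w" using c[OF that] by simp_all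
 qed
 then show "0{Pr} +{Pr} f = f" "1{Pr} *{Pr} f = f"
 using ext by (simp_all add: Pr_simps restrict_def fun_eq_iff)
 show "\<exists>g\<in>carrier Pr. g +{Pr} f = 0{Pr}"
 using c cr by (intro bexI[of _ "\<lambda>w\<in>W. \<ominus>\<^bsub>A w\<^esub> f w"])
 (auto simp: Pr_simps restrict_def fun_eq_iff cring.cring_simprules)
qed

sublocale Pr: pcring Pr
 by (rule pcring.intro[OF Pr_cring])

abbreviation "Nl \<equiv> ultra_null W F A"

lemma null_ideal: "ideal Nl Pr"
proof (rule Pr.idealI')
 show "Nl <= carrier Pr" by (auto simp: ultra_null_def)
 show "0{Pr} : Nl" unfolding ultra_null_def using Pr.zero_closed
 by (auto simp: Pr_simps intro: evI)
 fix f g assume f: "f : Nl"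
 then have fc: "f : carrier Pr" "\<forall>\<^sub>F w in F. f w = 0{A w}" by (auto simp: ultra_null_def)
 { assume "g : Nl"
 then have gc: "g : carrier Pr" "\<forall>\<^sub>F w in F. g w = 0{A w}" by (auto simp: ultra_null_def)
 have "\<forall>\<^sub>F w in F. (f +{Pr} g) w = 0{A w}"
 using ev_W fc(2) gc(2)
 by eventually_elim (use cr in \<open>auto simp: Pr_simps cring.cring_simprules\<close>)
 then show "f +{Pr} g : Nl" using fc gc by (simp add: ultra_null_def) }
 { assume g: "g : carrier Pr"
 have "\<forall>\<^sub>F w in F. (g *{Pr} f) w = 0{A w}"
 using ev_W fc(2)
 proof eventually_elim
 case (elim w)
 interpret cring "A w" using cr elim by simp
 have "g w : carrier (A w)" using g elim by (auto simp: Pr_simps)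
 then show ?case using elim by (simp add: Pr_simps)
 qed
 then show "g *{Pr} f : Nl" using fc g by (simp add: ultra_null_def) }
qed

lemma U_cring: "cring U"
 unfolding ultraproduct_def by (rule ideal.quotient_is_cring[OF null_ideal Pr_cring])

sublocale U: pcring U
 by (rule pcring.intro[OF U_cring])

lemmas U_cosets = quotient_cosets[OF Pr_cring null_ideal, folded ultraproduct_def]

lemma U_carrier: "x : carrier U \<longleftrightarrow> (EX a. sec a & x = ue a)"
proof
 assume "x : carrier U"
 then obtain f where f: "f : carrier Pr" "x = Nl +>{Pr} f" using U_cosets(1) by auto
 then show "EX a. sec a & x = ue a" using Pr_sec[of f] by (intro exI[of _ f]) (simp add: ultra_elem_def)
next
 assume "EX a. sec a & x = ue a"
 then show "x : carrier U" using sec_Pr unfolding U_cosets(1) ultra_elem_def by blast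
qed

lemma ue_closed: "sec a ==> ue a : carrier U"
 using U_carrier by blast

lemma sec_ops:
 "sec a ==> sec b ==> sec (%w. a w *{A w} b w)" "sec a ==> sec b ==> sec (%w. a w +{A w} b w)"
 "sec (%w. 1{A w})" "sec (%w. 0{A w})"
 using cr by (auto simp: sec_def cring.cring_simprules)

lemma ue_mult: assumes "sec a" "sec b" shows "ue a *{U} ue b = ue (%w. a w *{A w} b w)"
proof -
 have "restrict a W *{Pr} restrict b W = restrict (%w. a w *{A w} b w) W"
 by (auto simp: Pr_simps restrict_def)
 then show ?thesis using U_cosets(2)[OF sec_Pr[OF assms(1)] sec_Pr[OF assms(2)]] by (simp add: ultra_elem_def)
qed

lemma ue_add: assumes "sec a" "sec b" shows "ue a +{U} ue b = ue (%w. a w +{A w} b w)"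
proof -
 have "restrict a W +{Pr} restrict b W = restrict (%w. a w +{A w} b w) W"
 by (auto simp: Pr_simps restrict_def)
 then show ?thesis using U_cosets(3)[OF sec_Pr[OF assms(1)] sec_Pr[OF assms(2)]] by (simp add: ultra_elem_def)
qed

lemma ue_one: "1{U} = ue (%w. 1{A w})" and ue_zero: "0{U} = ue (%w. 0{A w})"
 by (simp_all add: U_cosets(4,5) ultra_elem_def Pr_simps)

lemma Pr_minus: assumes "f : carrier Pr" "g : carrier Pr" "w : W" shows "(f -{Pr} g) w = f w -{A w} g w"
proof -
 interpret Aw: cring "A w" using cr assms by simp
 have "f = (f -{Pr} g) +{Pr} g" using assms(1,2) by algebra
 from arg_cong[OF this, of "%t. t w"] have "f w = (f -{Pr} g) w +{A w} g w"
 unfolding Pr_simps(3)[of "f -{Pr} g" g] restrict_apply'[OF assms(3)] .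
 moreover have "(f -{Pr} g) w : carrier (A w)" "g w : carrier (A w)"
 using assms Pr.minus_closed[OF assms(1,2)] by (auto simp: Pr_simps)
 ultimately show ?thesis by (simp add: Aw.minus_eq Aw.a_assoc Aw.r_neg)
qed

lemma ue_mem_iff: assumes a: "sec a" shows "f : ue a \<longleftrightarrow> f : carrier Pr & (\<forall>\<^sub>F w in F. f w = a w)"
proof -
 have "f : ue a \<longleftrightarrow> f : carrier Pr & f -{Pr} restrict a W : Nl"
 unfolding ultra_elem_def by (rule U_cosets(7)[OF sec_Pr[OF a]])
 also have "... \<longleftrightarrow> f : carrier Pr & (\<forall>\<^sub>F w in F. (f -{Pr} restrict a W) w = 0{A w})"
 using sec_Pr[OF a] by (auto simp: ultra_null_def)
 also have "... \<longleftrightarrow> f : carrier Pr & (\<forall>\<^sub>F w in F. f w = a w)"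
 proof (rule conj_cong[OF refl])
 assume f: "f : carrier Pr"
 have "(f -{Pr} restrict a W) w = 0{A w} \<longleftrightarrow> f w = a w" if w: "w : W" for w
 proof -
 interpret Aw: cring "A w" using cr w by simp
 have "f w : carrier (A w)" "a w : carrier (A w)" using f w a by (auto simp: Pr_simps sec_def)
 then show ?thesis using Pr_minus[OF f sec_Pr[OF a] w] w by simp
 qed
 then show "(\<forall>\<^sub>F w in F. (f -{Pr} restrict a W) w = 0{A w}) \<longleftrightarrow> (\<forall>\<^sub>F w in F. f w = a w)"
 using ev_mono[of "%w. (f -{Pr} restrict a W) w = 0{A w}" "%w. f w = a w"]
 ev_mono[of "%w. f w = a w" "%w. (f -{Pr} restrict a W) w = 0{A w}"] by blast
 qed
 finally show ?thesis .
qed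

lemma ue_eq_iff: assumes a: "sec a" and b: "sec b" shows "ue a = ue b \<longleftrightarrow> (\<forall>\<^sub>F w in F. a w = b w)"
proof
 assume "ue a = ue b"
 moreover have "restrict a W : ue a" using ue_mem_iff[OF a] sec_Pr[OF a] by (auto intro: evI)
 ultimately have "\<forall>\<^sub>F w in F. restrict a W w = b w" using ue_mem_iff[OF b] by simp
 then show "\<forall>\<^sub>F w in F. a w = b w" by (rule ev_mono[rotated]) simp
next
 assume e: "\<forall>\<^sub>F w in F. a w = b w"
 have "f : ue a \<longleftrightarrow> f : ue b" for f
 unfolding ue_mem_iff[OF a] ue_mem_iff[OF b] using e
 by (auto elim: eventually_elim2)
 then show "ue a = ue b" by blast
qed

text \<open>About the representative chosen in \<open>ultra_map\<close> only agreement for almost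
  all indices is known; this makes the choice harmless.\<close>

lemma ue_some: assumes "sec a"
 shows "\<forall>\<^sub>F w in F. (SOME f. f \<in> ue a) w = a w" "sec (SOME f. f \<in> ue a)"
proof -
 have "restrict a W : ue a" using ue_mem_iff[OF assms] sec_Pr[OF assms] by (auto intro: evI)
 then have "(SOME f. f \<in> ue a) \<in> ue a" by (rule someI[of "%f. f \<in> ue a"])
 then show "\<forall>\<^sub>F w in F. (SOME f. f \<in> ue a) w = a w" "sec (SOME f. f \<in> ue a)"
 using ue_mem_iff[OF assms] Pr_sec by auto
qed

text \<open>The theorem of Los for membership in a finitely generated ideal. Splitting off one
  generator at a time moves the existential quantifier over coefficients past the quantifier over
  almost all w.\<close>

lemma los_idl:
 assumes "sec a" "!!g. g : set gs ==> sec g"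
 shows "ue a : idl U (ue ` set gs) \<longleftrightarrow> (\<forall>\<^sub>F w in F. a w : idl (A w) ((%g. g w) ` set gs))"
 using assms
proof (induct gs arbitrary: a)
 case Nil
 have "ue a : idl U (ue ` set []) \<longleftrightarrow> ue a = ue (%w. 0{A w})" by (simp add: U.idl_empty ue_zero)
 also have "... \<longleftrightarrow> (\<forall>\<^sub>F w in F. a w = 0{A w})" using Nil sec_ops(4) by (simp add: ue_eq_iff)
 also have "... \<longleftrightarrow> (\<forall>\<^sub>F w in F. a w : idl (A w) ((%g. g w) ` set []))"
 using ev_mono[of "%w. a w = 0{A w}" "%w. a w : idl (A w) {}"]
 ev_mono[of "%w. a w : idl (A w) {}" "%w. a w = 0{A w}"] cr cring.idl_empty by fastforce
 finally show ?case .
next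
 case (Cons g gs)
 have sg: "sec g" "!!g. g : set gs ==> sec g" using Cons(3) by auto
 have gc: "ue ` set gs <= carrier U" "ue g : carrier U" using sg ue_closed by auto
 have wc: "(%g. g w) ` set gs <= carrier (A w)" "g w : carrier (A w)" if "w : W" for w
 using sg that by (auto simp: sec_def)
 have wi: "a w : idl (A w) ((%g. g w) ` set (g # gs)) \<longleftrightarrow>
 (\<exists>r\<in>carrier (A w). \<exists>y\<in>idl (A w) ((%g. g w) ` set gs). a w = g w *{A w} r +{A w} y)" if "w : W" for w
 using cring.idl_insert[OF cr[OF that] wc(2)[OF that] wc(1)[OF that]] by simp
 have ui: "ue a : idl U (ue ` set (g # gs)) \<longleftrightarrow>
 (\<exists>r\<in>carrier U. \<exists>y\<in>idl U (ue ` set gs). ue a = ue g *{U} r +{U} y)"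
 using U.idl_insert[OF gc(2,1)] by simp
 show ?case
 proof
 assume "ue a : idl U (ue ` set (g # gs))"
 then obtain r y where ry: "r : carrier U" "y : idl U (ue ` set gs)" "ue a = ue g *{U} r +{U} y"
 using ui by blast
 obtain r' where r': "sec r'" "r = ue r'" using ry(1) U_carrier by blast
 obtain y' where y': "sec y'" "y = ue y'" using ry(2) U.idl_carrier[OF gc(1)] U_carrier by blast
 have "\<forall>\<^sub>F w in F. y' w : idl (A w) ((%g. g w) ` set gs)"
 using Cons(1)[OF y'(1) sg(2)] ry(2) y'(2) by simp
 moreover have "\<forall>\<^sub>F w in F. a w = g w *{A w} r' w +{A w} y' w"
 using ry(3) r' y' sg(1) Cons(2) by (simp add: ue_mult ue_add sec_ops ue_eq_iff)
 ultimately show "\<forall>\<^sub>F w in F. a w : idl (A w) ((%g. g w) ` set (g # gs))"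
 using ev_W
 proof eventually_elim
 case (elim w)
 have "r' w : carrier (A w)" using r' elim by (simp add: sec_def)
 then show ?case unfolding wi[OF elim(3)] using elim by blast
 qed
 next
 assume ev: "\<forall>\<^sub>F w in F. a w : idl (A w) ((%g. g w) ` set (g # gs))"
 \<comment> \<open>Coefficients are chosen at every w in W, with arbitrary admissible values where
   the membership fails, so that they form sections.\<close>
 have "EX r y. w : W --> r : carrier (A w) & y : idl (A w) ((%g. g w) ` set gs) &
 (a w : idl (A w) ((%g. g w) ` set (g # gs)) --> a w = g w *{A w} r +{A w} y)" for w
 proof (cases "w : W")
 case True
 interpret Aw: cring "A w" by (rule cr[OF True])
 show ?thesis
 proof (cases "a w : idl (A w) ((%g. g w) ` set (g # gs))")
 case t: True
 then show ?thesis unfolding wi[OF True] by blast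
 next
 case False
 then show ?thesis using Aw.ideal_closed(2)[OF Aw.idl_ideal[OF wc(1)[OF True]]] Aw.zero_closed by blast
 qed
 qed simp
 then obtain r y where ry: "!!w. w : W ==> r w : carrier (A w)"
 "!!w. w : W ==> y w : idl (A w) ((%g. g w) ` set gs)"
 "!!w. w : W ==> a w : idl (A w) ((%g. g w) ` set (g # gs)) ==> a w = g w *{A w} r w +{A w} y w"
 by metis
 have sr: "sec r" using ry(1) by (simp add: sec_def)
 have sy: "sec y" unfolding sec_def
 proof
 fix w assume w: "w : W"
 interpret Aw: cring "A w" by (rule cr[OF w])
 show "y w : carrier (A w)" using ry(2)[OF w] Aw.idl_carrier[OF wc(1)[OF w]] by auto
 qed
 have "\<forall>\<^sub>F w in F. a w = g w *{A w} r w +{A w} y w" using ev by (rule ev_mono[rotated]) (rule ry(3))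
 then have "ue a = ue g *{U} ue r +{U} ue y"
 using sr sy sg(1) Cons(2) by (simp add: ue_mult ue_add sec_ops ue_eq_iff)
 moreover have "ue y : idl U (ue ` set gs)"
 proof -
 have "\<forall>\<^sub>F w in F. y w : idl (A w) ((%g. g w) ` set gs)" by (rule evI) (rule ry(2))
 then show ?thesis using Cons(1)[OF sy sg(2)] by simp
 qed
 ultimately show "ue a : idl U (ue ` set (g # gs))" unfolding ui using ue_closed[OF sr] by blast
 qed
qed

lemma ue_unit: assumes a: "sec a" and u: "\<forall>\<^sub>F w in F. a w : Units (A w)" shows "ue a : Units U"
proof -
 define b where "b w = (if a w : Units (A w) then inv\<^bsub>A w\<^esub> (a w) else 0{A w})" for w
 have inv: "b w : carrier (A w)" "a w : Units (A w) ==> a w *{A w} b w = 1{A w}" if "w : W" for w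
 proof -
 interpret Aw: cring "A w" by (rule cr[OF that])
 show "b w : carrier (A w)" "a w : Units (A w) ==> a w *{A w} b w = 1{A w}" by (auto simp: b_def)
 qed
 have b: "sec b" using inv by (simp add: sec_def)
 have "\<forall>\<^sub>F w in F. a w *{A w} b w = 1{A w}" using u by (rule ev_mono[rotated]) (rule inv(2))
 then have 1: "ue a *{U} ue b = 1{U}" unfolding ue_mult[OF a b] ue_one
 using ue_eq_iff[OF sec_ops(1)[OF a b] sec_ops(3)] by simp
 then have "ue b *{U} ue a = 1{U}" using U.m_comm[OF ue_closed[OF a] ue_closed[OF b]] by simp
 then show ?thesis using 1 ue_closed a b unfolding Units_def by blast
qed

text \<open>Non-membership transfers because the ultrafilter decides every property; inverses in the
  factors are then assembled by \<open>ue_unit\<close>.\<close>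

lemma los_max_gen:
 assumes g: "!!g. g : set gs ==> sec g" and m: "!!w. w : W ==> max_gen (A w) (idl (A w) ((%g. g w) ` set gs))"
 shows "max_gen U (idl U (ue ` set gs))"
 unfolding max_gen_def
proof (intro conjI ballI impI)
 have gc: "ue ` set gs <= carrier U" using g ue_closed by auto
 show "ideal (idl U (ue ` set gs)) U" by (rule U.idl_ideal[OF gc])
 have "\<not> (\<forall>\<^sub>F w in F. 1{A w} : idl (A w) ((%g. g w) ` set gs))"
 proof
 assume "\<forall>\<^sub>F w in F. 1{A w} : idl (A w) ((%g. g w) ` set gs)"
 then have "\<forall>\<^sub>F w in F. False" by (rule ev_mono[rotated]) (use m in \<open>auto simp: max_gen_def\<close>)
 then show False using F_nonbot by simp
 qed
 then show "1{U} ~: idl U (ue ` set gs)" unfolding ue_one using los_idl[OF sec_ops(3) g] by simp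
 fix x assume x: "x : carrier U" "x ~: idl U (ue ` set gs)"
 obtain a where a: "sec a" "x = ue a" using x(1) U_carrier by blast
 have "\<not> (\<forall>\<^sub>F w in F. a w : idl (A w) ((%g. g w) ` set gs))" using los_idl[OF a(1) g] x(2) a(2) by simp
 then have "\<forall>\<^sub>F w in F. a w ~: idl (A w) ((%g. g w) ` set gs)"
 using ultra_dichotomy[of "%w. a w : idl (A w) ((%g. g w) ` set gs)"] by blast
 then have "\<forall>\<^sub>F w in F. a w : Units (A w)"
 by (rule ev_mono[rotated]) (use m a(1) in \<open>auto simp: max_gen_def sec_def\<close>)
 then show "x : Units U" unfolding a(2) by (rule ue_unit[OF a(1)])
qed

end

lemma ultra_map_elem:
 assumes A: "ultra W F A" and B: "ultra W F B"
 and h: "!!w x. w : W ==> x : carrier (A w) ==> h w x : carrier (B w)"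
 and a: "ultra.sec W A a"
 shows "ultra_map W F B h (ultra_elem W F A a) = ultra_elem W F B (%w. h w (a w))"
 and "ultra.sec W B (%w. h w (a w))"
proof -
 interpret A: ultra W F A by fact
 interpret B: ultra W F B by fact
 let ?s = "SOME f. f \<in> ultra_elem W F A a"
 have s: "\<forall>\<^sub>F w in F. ?s w = a w" "A.sec ?s" using A.ue_some[OF a] by auto
 show b: "B.sec (%w. h w (a w))" using a h by (auto simp: A.sec_def B.sec_def)
 have b': "B.sec (%w. h w (?s w))" using s(2) h by (auto simp: A.sec_def B.sec_def)
 have "\<forall>\<^sub>F w in F. h w (?s w) = h w (a w)" using s(1) by (rule eventually_mono) simp
 then show "ultra_map W F B h (ultra_elem W F A a) = ultra_elem W F B (%w. h w (a w))"
 unfolding ultra_map_def using B.ue_eq_iff[OF b' b] by simp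
qed

lemma ultra_map_hom:
 assumes A: "ultra W F A" and B: "ultra W F B"
 and h: "!!w. w : W ==> h w : ring_hom (A w) (B w)"
 shows "ultra_map W F B h : ring_hom (ultraproduct W F A) (ultraproduct W F B)"
proof -
 interpret A: ultra W F A by fact
 interpret B: ultra W F B by fact
 have hc: "!!w x. w : W ==> x : carrier (A w) ==> h w x : carrier (B w)" using ring_hom_closed[OF h] .
 have m: "ultra_map W F B h (A.ue a) = B.ue (%w. h w (a w))" "B.sec (%w. h w (a w))" if "A.sec a" for a
 using ultra_map_elem[OF A B, of h a] hc that by auto
 show ?thesis
 proof (rule ring_hom_memI)
 fix x y assume x: "x : carrier A.U"
 then obtain a where a: "A.sec a" "x = A.ue a" using A.U_carrier by blast
 show "ultra_map W F B h x : carrier B.U" unfolding a m(1)[OF a(1)] by (rule B.ue_closed[OF m(2)[OF a(1)]])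
 assume "y : carrier A.U"
 then obtain b where b: "A.sec b" "y = A.ue b" using A.U_carrier by blast
 note sa = m(2)[OF a(1)] and sb = m(2)[OF b(1)]
 have "ultra_map W F B h (x *{A.U} y) = B.ue (%w. h w (a w *{A w} b w))"
 unfolding a b A.ue_mult[OF a(1) b(1)] by (rule m(1)[OF A.sec_ops(1)[OF a(1) b(1)]])
 also have "... = B.ue (%w. h w (a w) *{B w} h w (b w))"
 using B.ue_eq_iff[OF m(2)[OF A.sec_ops(1)[OF a(1) b(1)]] B.sec_ops(1)[OF sa sb]]
 ring_hom_mult[OF h] a b by (auto simp: A.sec_def intro: A.evI)
 finally show "ultra_map W F B h (x *{A.U} y) = ultra_map W F B h x *{B.U} ultra_map W F B h y"
 unfolding a b m(1)[OF a(1)] m(1)[OF b(1)] B.ue_mult[OF sa sb] .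
 have "ultra_map W F B h (x +{A.U} y) = B.ue (%w. h w (a w +{A w} b w))"
 unfolding a b A.ue_add[OF a(1) b(1)] by (rule m(1)[OF A.sec_ops(2)[OF a(1) b(1)]])
 also have "... = B.ue (%w. h w (a w) +{B w} h w (b w))"
 using B.ue_eq_iff[OF m(2)[OF A.sec_ops(2)[OF a(1) b(1)]] B.sec_ops(2)[OF sa sb]]
 ring_hom_add[OF h] a b by (auto simp: A.sec_def intro: A.evI)
 finally show "ultra_map W F B h (x +{A.U} y) = ultra_map W F B h x +{B.U} ultra_map W F B h y"
 unfolding a b m(1)[OF a(1)] m(1)[OF b(1)] B.ue_add[OF sa sb] .
 next
 show "ultra_map W F B h 1{A.U} = 1{B.U}"
 unfolding A.ue_one m(1)[OF A.sec_ops(3)] B.ue_one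
 using B.ue_eq_iff[OF m(2)[OF A.sec_ops(3)] B.sec_ops(3)] ring_hom_one[OF h] by (auto intro: A.evI)
 qed
qed

lemma hom_idl_image:
 assumes R: "cring R" and S: "cring S" and h: "h : ring_hom R S" and A: "A <= carrier R" and x: "x : idl R A"
 shows "h x : idl S (h ` A)"
proof -
 interpret R: cring R by fact
 interpret S: cring S by fact
 have hA: "h ` A <= carrier S" using A ring_hom_closed[OF h] by auto
 have "ideal {r : carrier R. h r : idl S (h ` A)} R"
 by (rule ring_hom_ring.ideal_vimage[OF ring_hom_ringI2[OF R.ring_axioms S.ring_axioms h] S.idl_ideal[OF hA]])
 then have "idl R A <= {r : carrier R. h r : idl S (h ` A)}"
 using A S.idl_mem[OF hA] by (intro R.genideal_minimal) auto
 then show ?thesis using x by auto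
qed

lemma quot_idl_iff:
 assumes R: "cring R" and Q: "ideal Q R" and A: "A <= carrier R" and x: "x : carrier R"
 shows "Q +>{R} x : idl (R Quot Q) ((%a. Q +>{R} a) ` A) \<longleftrightarrow> x : idl R A <+{R} Q"
proof
 interpret R: cring R by fact
 interpret Q: ideal Q R by fact
 note cq = Q.quotient_is_cring[OF R]
 interpret RQ: cring "R Quot Q" by (rule cq)
 note co = quotient_cosets[OF R Q]
 note sid = R.add_ideals[OF R.idl_ideal[OF A] Q]
 have Ac: "(%a. Q +>{R} a) ` A <= carrier (R Quot Q)" using A co(1) by auto
 { assume "Q +>{R} x : idl (R Quot Q) ((%a. Q +>{R} a) ` A)"
 moreover have "ideal ((%a. Q +>{R} a) ` (idl R A <+{R} Q)) (R Quot Q)"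
 proof (rule RQ.idealI')
 let ?J = "idl R A <+{R} Q"
 note Jc = R.ideal_closed[OF sid]
 show "(%a. Q +>{R} a) ` ?J <= carrier (R Quot Q)" using Jc(1) co(1) by auto
 show "0{R Quot Q} : (%a. Q +>{R} a) ` ?J" using Jc(2) co(5) by auto
 show "u +{R Quot Q} v : (%a. Q +>{R} a) ` ?J" if "u : (%a. Q +>{R} a) ` ?J" "v : (%a. Q +>{R} a) ` ?J" for u v
 using that Jc(3,8) by (auto simp: co(3))
 show "v *{R Quot Q} u : (%a. Q +>{R} a) ` ?J" if "u : (%a. Q +>{R} a) ` ?J" "v : carrier (R Quot Q)" for u v
 using that Jc(7,8) by (auto simp: co(1,2))
 qed
 moreover have "(%a. Q +>{R} a) ` A <= (%a. Q +>{R} a) ` (idl R A <+{R} Q)"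
 using R.idl_mem[OF A] R.add_ideals_sub(1)[OF R.idl_ideal[OF A] Q] by auto
 ultimately have "Q +>{R} x : (%a. Q +>{R} a) ` (idl R A <+{R} Q)"
 using RQ.genideal_minimal by blast
 then obtain y where y: "y : idl R A <+{R} Q" "Q +>{R} x = Q +>{R} y" by auto
 have yc: "y : carrier R" using R.ideal_closed(8)[OF sid y(1)] .
 have "x -{R} y : Q" using co(6)[OF x yc] y(2) by simp
 then have "x -{R} y : idl R A <+{R} Q" using R.add_ideals_sub(2)[OF R.idl_ideal[OF A] Q] by auto
 then have "(x -{R} y) +{R} y : idl R A <+{R} Q" using R.ideal_closed(3)[OF sid] y by auto
 moreover have "(x -{R} y) +{R} y = x" using x yc by algebra
 ultimately show "x : idl R A <+{R} Q" by simp }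
 { assume "x : idl R A <+{R} Q"
 then obtain y z where yz: "y : idl R A" "z : Q" "x = y +{R} z" unfolding mem_set_add_iff by blast
 have c: "y : carrier R" "z : carrier R" using R.idl_carrier[OF A] R.ideal_closed(8)[OF Q] yz by auto
 have "x -{R} y = z" unfolding yz using c by algebra
 then have "Q +>{R} x = Q +>{R} y" using co(6)[OF x c(1)] yz by simp
 moreover have "Q +>{R} y : idl (R Quot Q) ((%a. Q +>{R} a) ` A)"
 by (rule hom_idl_image[OF R cq Q.rcos_ring_hom A yz(1)])
 ultimately show "Q +>{R} x : idl (R Quot Q) ((%a. Q +>{R} a) ` A)" by simp }
qed

section \<open>Hensel and coefficient fields\<close>

context cring
begin

text \<open>Coefficient lists start with the leading term, so the head of \<open>a # p\<close> has
  degree \<open>length p\<close>; the derivative drops the constant term.\<close>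

primrec deriv_list :: "'a list => 'a list" where
 "deriv_list [] = []"
| "deriv_list (a # p) = (if p = [] then [] else ([length p] \<cdot> a) # deriv_list p)"

lemma length_deriv: "length (deriv_list p) = length p - 1"
 by (induct p) auto

lemma set_deriv: "set p <= carrier R ==> set (deriv_list p) <= carrier R"
 by (induct p) auto

lemma pow_taylor:
 assumes "x : carrier R" "h : carrier R"
 shows "\<exists>q\<in>carrier R. (x \<oplus> h) [^] Suc n = x [^] Suc n \<oplus> h \<otimes> ([Suc n] \<cdot> (x [^] n)) \<oplus> h \<otimes> h \<otimes> q"
proof (induct n)
 case 0
 have "(x \<oplus> h) [^] Suc 0 = x [^] Suc 0 \<oplus> h \<otimes> ([Suc 0] \<cdot> (x [^] (0::nat))) \<oplus> h \<otimes> h \<otimes> \<zero>"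
 using assms by (simp add: nat_pow_Suc)
 then show ?case by blast
next
 case (Suc n)
 then obtain q where q: "q : carrier R" "(x \<oplus> h) [^] Suc n = x [^] Suc n \<oplus> h \<otimes> ([Suc n] \<cdot> (x [^] n)) \<oplus> h \<otimes> h \<otimes> q"
 by blast
 define u v where "u = x [^] n" and "v = [Suc n] \<cdot> (x [^] n)"
 have c: "u : carrier R" "v : carrier R" using assms by (auto simp: u_def v_def)
 have vx: "[Suc n] \<cdot> (x [^] Suc n) = v \<otimes> x"
 unfolding v_def nat_pow_Suc using assms by (simp add: add_pow_ldistr del: add.nat_pow_Suc)
 have S: "[Suc (Suc n)] \<cdot> (x [^] Suc n) = v \<otimes> x \<oplus> u \<otimes> x"
 using vx assms by (simp add: add.nat_pow_Suc nat_pow_Suc u_def)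
 have "(x \<oplus> h) [^] Suc (Suc n) = (u \<otimes> x \<oplus> h \<otimes> v \<oplus> h \<otimes> h \<otimes> q) \<otimes> (x \<oplus> h)"
 by (simp only: nat_pow_Suc[of "x \<oplus> h" "Suc n"] q(2)) (simp only: u_def v_def nat_pow_Suc)
 also have "... = u \<otimes> x \<otimes> x \<oplus> h \<otimes> (v \<otimes> x \<oplus> u \<otimes> x) \<oplus> h \<otimes> h \<otimes> (v \<oplus> q \<otimes> x \<oplus> q \<otimes> h)"
 using c q(1) assms by algebra
 also have "u \<otimes> x \<otimes> x = x [^] Suc (Suc n)" by (simp add: nat_pow_Suc u_def)
 finally show ?case unfolding S using c q(1) assms by (intro bexI[of _ "v \<oplus> q \<otimes> x \<oplus> q \<otimes> h"]) auto
qed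

lemma eval_taylor:
 assumes "set p <= carrier R" "x : carrier R" "h : carrier R"
 shows "\<exists>q\<in>carrier R. eval p (x \<oplus> h) = eval p x \<oplus> h \<otimes> eval (deriv_list p) x \<oplus> h \<otimes> h \<otimes> q"
 using assms(1)
proof (induct p)
 case Nil
 have "eval [] (x \<oplus> h) = eval [] x \<oplus> h \<otimes> eval (deriv_list []) x \<oplus> h \<otimes> h \<otimes> \<zero>" using assms by simp
 then show ?case by blast
next
 case (Cons a p)
 show ?case
 proof (cases p)
 case Nil
 have "eval [a] (x \<oplus> h) = eval [a] x \<oplus> h \<otimes> eval (deriv_list [a]) x \<oplus> h \<otimes> h \<otimes> \<zero>" using assms Cons(2) by simp
 then show ?thesis unfolding Nil by blast
 next
 case (Cons b p')
 then obtain n where n: "length p = Suc n" by simp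
 have pc: "set p <= carrier R" "a : carrier R" using Cons.prems by auto
 obtain q where q: "q : carrier R" "eval p (x \<oplus> h) = eval p x \<oplus> h \<otimes> eval (deriv_list p) x \<oplus> h \<otimes> h \<otimes> q"
 using Cons.hyps pc by blast
 obtain r where r: "r : carrier R" "(x \<oplus> h) [^] Suc n = x [^] Suc n \<oplus> h \<otimes> ([Suc n] \<cdot> (x [^] n)) \<oplus> h \<otimes> h \<otimes> r"
 using pow_taylor[OF assms(2,3)] by blast
 define X1 X2 D E where "X1 = x [^] Suc n" and "X2 = [Suc n] \<cdot> (x [^] n)" and "D = eval (deriv_list p) x" and "E = eval p x"
 have c: "X1 : carrier R" "X2 : carrier R" "D : carrier R" "E : carrier R"
 using assms pc set_deriv by (auto simp: X1_def X2_def D_def E_def intro!: eval_in_carrier)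
 have 1: "eval (a # p) (x \<oplus> h) = a \<otimes> (X1 \<oplus> h \<otimes> X2 \<oplus> h \<otimes> h \<otimes> r) \<oplus> (E \<oplus> h \<otimes> D \<oplus> h \<otimes> h \<otimes> q)"
 using q(2) r(2) n by (simp add: X1_def X2_def D_def E_def)
 have "p ~= []" "length (deriv_list p) = n" using n length_deriv[of p] by auto
 then have "eval (deriv_list (a # p)) x = ([Suc n] \<cdot> a) \<otimes> x [^] n \<oplus> D"
 unfolding D_def by (simp del: add.nat_pow_Suc add: n)
 also have "([Suc n] \<cdot> a) \<otimes> x [^] n = a \<otimes> X2"
 unfolding X2_def using pc assms by (simp only: add_pow_ldistr add_pow_rdistr nat_pow_closed)
 finally have 2: "eval (deriv_list (a # p)) x = a \<otimes> X2 \<oplus> D" .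
 have 3: "eval (a # p) x = a \<otimes> X1 \<oplus> E" using n by (simp add: X1_def E_def)
 have "eval (a # p) (x \<oplus> h) = eval (a # p) x \<oplus> h \<otimes> eval (deriv_list (a # p)) x \<oplus> h \<otimes> h \<otimes> (a \<otimes> r \<oplus> q)"
 unfolding 1 2 3 using c q(1) r(1) assms pc by algebra
 then show ?thesis using pc q(1) r(1) by blast
 qed
qed

lemma eval_cong_ideal:
 assumes Q: "ideal Q R" and p: "set p <= carrier R" and x: "x : carrier R" "y : carrier R" "y \<ominus> x : Q"
 shows "eval p y \<ominus> eval p x : Q"
proof -
 let ?h = "y \<ominus> x"
 have hc: "?h : carrier R" using x by simp
 obtain q where q: "q : carrier R" "eval p (x \<oplus> ?h) = eval p x \<oplus> ?h \<otimes> eval (deriv_list p) x \<oplus> ?h \<otimes> ?h \<otimes> q"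
 using eval_taylor[OF p x(1) hc] by blast
 have c: "eval p x : carrier R" "eval (deriv_list p) x : carrier R" using p x set_deriv eval_in_carrier by auto
 have e: "x \<oplus> ?h = y" using x(1,2) by algebra
 define h where "h = ?h"
 have "eval p y = eval p x \<oplus> h \<otimes> eval (deriv_list p) x \<oplus> h \<otimes> h \<otimes> q"
 using q(2) unfolding e by (simp only: h_def)
 moreover have "h : carrier R" using hc by (simp add: h_def)
 ultimately have "eval p y \<ominus> eval p x = h \<otimes> (eval (deriv_list p) x \<oplus> h \<otimes> q)"
 using c q(1) by algebra
 then show ?thesis using ideal_closed(6)[OF Q x(3)] c q(1) hc by (simp add: h_def)
qed

text \<open>One step of division by the monic polynomial \<open>\<one> # p\<close>. The same
  remainder serves all points and all subrings, since it is evaluated both at an approximate and at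
  an exact root.\<close>

lemma eval_monic_reduce:
 assumes "set g <= carrier R" "set p <= carrier R" "a : carrier R" "x : carrier R" "length g = length p + j"
 shows "EX g'. length g' = length g & (ALL K. subring K R --> set g <= K --> set p <= K --> a : K --> set g' <= K) &
 (\<forall>x\<in>carrier R. eval g' x = eval (a # g) x \<ominus> a \<otimes> x [^] j \<otimes> eval (\<one> # p) x)"
proof -
 have gen: "eval (map2 (%u v. u \<ominus> a \<otimes> v) g q) x = eval g x \<ominus> a \<otimes> eval q x"
 if "length g = length q" "set g <= carrier R" "set q <= carrier R" "x : carrier R" for g q x
 using that
 proof (induct g q rule: list_induct2)
 case (Cons u g v q)
 have c: "u : carrier R" "v : carrier R" "x [^] length q : carrier R" "eval g x : carrier R" "eval q x : carrier R"
 using Cons eval_in_carrier by auto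
 have "eval (map2 (%u v. u \<ominus> a \<otimes> v) (u # g) (v # q)) x = (u \<ominus> a \<otimes> v) \<otimes> x [^] length q \<oplus> (eval g x \<ominus> a \<otimes> eval q x)"
 using Cons by simp
 also have "... = (u \<otimes> x [^] length q \<oplus> eval g x) \<ominus> a \<otimes> (v \<otimes> x [^] length q \<oplus> eval q x)"
 using c assms(3) by algebra
 finally show ?case using Cons by simp
 qed (use assms in simp)
 \<comment> \<open>The zeros align p with the leading end of g.\<close>
 let ?q = "p @ replicate j \<zero>"
 let ?g = "map2 (%u v. u \<ominus> a \<otimes> v) g ?q"
 have "eval ?g x = eval (a # g) x \<ominus> a \<otimes> x [^] j \<otimes> eval (\<one> # p) x" if x: "x : carrier R" for x
 proof -
 have rep: "eval (replicate j \<zero>) x = \<zero>" using x by (induct j) simp_all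
 have rc: "set (replicate j \<zero>) <= carrier R" by auto
 have qc: "set ?q <= carrier R" using assms by auto
 have "eval ?q x = eval p x \<otimes> x [^] j"
 using eval_append[OF assms(2) rc x] rep eval_in_carrier[OF assms(2) x] x by simp
 then have 1: "eval ?g x = eval g x \<ominus> a \<otimes> (eval p x \<otimes> x [^] j)" using gen[OF _ assms(1) qc x] assms by simp
 define X1 X2 E G where "X1 = x [^] j" and "X2 = x [^] length p" and "E = eval p x" and "G = eval g x"
 have c: "X1 : carrier R" "X2 : carrier R" "E : carrier R" "G : carrier R"
 using x assms eval_in_carrier by (auto simp: X1_def X2_def E_def G_def)
 have 2: "eval (a # g) x = a \<otimes> (X2 \<otimes> X1) \<oplus> G" "eval (\<one> # p) x = \<one> \<otimes> X2 \<oplus> E"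
 using x assms by (simp_all add: X1_def X2_def E_def G_def nat_pow_mult)
 have "G \<ominus> a \<otimes> (E \<otimes> X1) = (a \<otimes> (X2 \<otimes> X1) \<oplus> G) \<ominus> a \<otimes> X1 \<otimes> (\<one> \<otimes> X2 \<oplus> E)"
 using c assms(3) by algebra
 then show ?thesis unfolding 1 2 by (simp only: X1_def E_def G_def)
 qed
 moreover have "set ?g <= K" if K: "subring K R" "set g <= K" "set p <= K" "a : K" for K
 proof
 fix z assume "z : set ?g"
 then obtain u v where "z = u \<ominus> a \<otimes> v" "(u, v) : set (zip g ?q)" by auto
 then have uv: "z = u \<ominus> a \<otimes> v" "u : set g" "v : set ?q" using set_zip_leftD set_zip_rightD by metis+
 then have "v : K" using K subringE(2)[OF K(1)] by (auto split: if_splits)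
 then show "z : K" using uv K subringE(5,6,7)[OF K(1)] by (auto simp: minus_eq)
 qed
 ultimately show ?thesis using assms(5) by (intro exI[of _ ?g]) auto
qed

lemma simple_extension_subring:
 assumes K: "subring K R" and x: "x : carrier R"
 shows "subring (simple_extension K x) R"
proof (rule subringI)
 let ?S = "simple_extension K x"
 note Kc = subringE[OF K]
 show sc: "?S <= carrier R" by (rule simple_extension_in_carrier[OF Kc(1) x])
 have add: "a \<oplus> b : ?S" if "a : ?S" "b : ?S" for a b
 using that
 proof (induct a arbitrary: b rule: simple_extension.induct)
 case zero
 then show ?case using sc by auto
 next
 case (lin k1 k2)
 from lin(4) show ?case
 proof (cases rule: simple_extension.cases)
 case zero
 then show ?thesis using simple_extension.lin[OF lin(1,3)] sc by auto
 next
 case (lin k3 k4)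
 have c: "k1 : carrier R" "k2 : carrier R" "k3 : carrier R" "k4 : carrier R"
 using \<open>k1 : ?S\<close> \<open>k2 : K\<close> lin sc Kc(1) by auto
 have "k1 \<otimes> x \<oplus> k2 \<oplus> b = (k1 \<oplus> k3) \<otimes> x \<oplus> (k2 \<oplus> k4)" unfolding lin(1) using c x by algebra
 then show ?thesis
 using simple_extension.lin[of "k1 \<oplus> k3" K x "k2 \<oplus> k4"] \<open>!!b. b : ?S ==> k1 \<oplus> b : ?S\<close> lin(2,3) Kc(7) \<open>k2 : K\<close> by simp
 qed
 qed
 have smult: "c \<otimes> a : ?S" if "a : ?S" "c : K" for a c
 using that
 proof (induct a rule: simple_extension.induct)
 case zero
 then show ?case using Kc(1) by auto
 next
 case (lin k1 k2)
 have c: "k1 : carrier R" "k2 : carrier R" "c : carrier R" using lin sc Kc(1) by auto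
 have "c \<otimes> (k1 \<otimes> x \<oplus> k2) = (c \<otimes> k1) \<otimes> x \<oplus> c \<otimes> k2" using c x by algebra
 then show ?case using simple_extension.lin[of "c \<otimes> k1" K x "c \<otimes> k2"] lin Kc(6) by simp
 qed
 show "\<one> : ?S" using simple_extension_incl[OF Kc(1) x] Kc(3) by auto
 show "\<ominus> a : ?S" if a: "a : ?S" for a
 proof -
 have "(\<ominus> \<one>) \<otimes> a : ?S" using smult[OF a, of "\<ominus> \<one>"] Kc(3,5) by auto
 then show ?thesis using a sc by (auto simp: l_minus)
 qed
 show "a \<oplus> b : ?S" if "a : ?S" "b : ?S" for a b using add that .
 show "a \<otimes> b : ?S" if "a : ?S" "b : ?S" for a b
 using that
 proof (induct a rule: simple_extension.induct)
 case zero
 then show ?case using sc by auto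
 next
 case (lin k1 k2)
 have c: "k1 : carrier R" "k2 : carrier R" "b : carrier R" using lin sc Kc(1) by auto
 have "(k1 \<otimes> x \<oplus> k2) \<otimes> b = ((k1 \<otimes> b) \<otimes> x \<oplus> \<zero>) \<oplus> k2 \<otimes> b" using c x by algebra
 moreover have "(k1 \<otimes> b) \<otimes> x \<oplus> \<zero> : ?S" using simple_extension.lin[of "k1 \<otimes> b" K x \<zero>] lin Kc(2) by simp
 ultimately show ?case using add smult lin by simp
 qed
qed

lemma simple_extension_eval:
 assumes "K <= carrier R" "x : carrier R" "a : simple_extension K x"
 shows "EX g. set g <= K & a = eval g x"
 using assms(3)
proof (induct rule: simple_extension.induct)
 case zero
 then show ?case by (intro exI[of _ "[]"]) simp
next
 case (lin k1 k2)
 then obtain g where g: "set g <= K" "k1 = eval g x" by blast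
 have "eval (g @ [k2]) x = eval g x \<otimes> x \<oplus> k2" by (rule eval_append_aux) (use g lin assms in auto)
 then show ?case using g lin by (intro exI[of _ "g @ [k2]"]) auto
qed

text \<open>\<open>algebraic\<close> means that evaluation at x is not injective on polynomials. The
  difference of two polynomials with equal values, padded to equal length and normalised, is a
  nonzero polynomial vanishing at x.\<close>

lemma algebraic_list:
 assumes K: "subring K R" and x: "x : carrier R"
 shows "algebraic K x \<longleftrightarrow> (EX p. p ~= [] & set p <= K & hd p ~= \<zero> & eval p x = \<zero>)"
proof
 assume "algebraic K x"
 then obtain p q where pq: "p : carrier (K[X])" "q : carrier (K[X])" "p ~= q" "eval p x = eval q x"
 unfolding transcendental_def inj_on_def by blast
 have pl: "polynomial K p" "polynomial K q" using pq unfolding univ_poly_carrier by auto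
 then have sK: "set p <= K" "set q <= K" by (auto simp: polynomial_def)
 note Kc = subringE[OF K]
 have sc: "set p <= carrier R" "set q <= carrier R" using sK Kc(1) by auto
 let ?n = "max (length p) (length q)"
 let ?p = "replicate (?n - length p) \<zero> @ p" and ?q = "replicate (?n - length q) \<zero> @ q"
 let ?r = "map2 (%u v. u \<ominus> v) ?p ?q"
 have len: "length ?p = length ?q" by simp
 have pqK: "set ?p <= K" "set ?q <= K" using sK Kc(2) by auto
 have diff: "eval (map2 (%u v. u \<ominus> v) f g) x = eval f x \<ominus> eval g x & set (map2 (%u v. u \<ominus> v) f g) <= K &
 (set (map2 (%u v. u \<ominus> v) f g) <= {\<zero>} --> f = g)"
 if "length f = length g" "set f <= K" "set g <= K" for f g
 using that
 proof (induct f g rule: list_induct2)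
 case (Cons u f v g)
 have "set f <= carrier R" "set g <= carrier R" using Cons(3,4) Kc(1) by auto
 then have c: "u : carrier R" "v : carrier R" "x [^] length g : carrier R" "eval f x : carrier R" "eval g x : carrier R"
 using Cons(3,4) Kc(1) x eval_in_carrier by auto
 have "(u \<ominus> v) \<otimes> x [^] length g \<oplus> (eval f x \<ominus> eval g x) =
 (u \<otimes> x [^] length g \<oplus> eval f x) \<ominus> (v \<otimes> x [^] length g \<oplus> eval g x)"
 using c by algebra
 moreover have "u \<ominus> v : K" using Cons(3,4) Kc(5,7) by (simp add: minus_eq)
 moreover have "u = v" if "u \<ominus> v = \<zero>" using that c(1,2) by simp
 ultimately show ?case using Cons by simp
 qed (use minus_self in simp)
 have "normalize r = [] ==> set r <= {\<zero>}" for r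
 by (induct r) (auto split: if_splits)
 moreover have "\<not> set ?r <= {\<zero>}"
 proof
 assume "set ?r <= {\<zero>}"
 then have "?p = ?q" using diff[OF len pqK] by blast
 then have "normalize ?p = normalize ?q" by (rule arg_cong)
 then have "normalize p = normalize q" unfolding normalize_replicate_zero .
 then show False using pq(3) pl normalize_polynomial by metis
 qed
 ultimately have ne: "normalize ?r ~= []" by blast
 have rK: "set ?r <= K" using diff[OF len pqK] by blast
 then have rc: "set ?r <= carrier R" using Kc(1) by blast
 have "polynomial K (normalize ?r)" by (rule normalize_gives_polynomial[OF rK])
 moreover have "eval (normalize ?r) x = eval ?p x \<ominus> eval ?q x"
 unfolding eval_normalize[OF rc x] using diff[OF len pqK] by blast
 moreover have "... = \<zero>" using pq(4) eval_replicate[OF sc(1) x] eval_replicate[OF sc(2) x] eval_in_carrier[OF sc(2) x] by simp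
 ultimately show "EX p. p ~= [] & set p <= K & hd p ~= \<zero> & eval p x = \<zero>"
 using ne unfolding polynomial_def by (intro exI[of _ "normalize ?r"]) simp
next
 assume "EX p. p ~= [] & set p <= K & hd p ~= \<zero> & eval p x = \<zero>"
 then obtain p where p: "p ~= []" "set p <= K" "hd p ~= \<zero>" "eval p x = \<zero>" by blast
 have "p : carrier (K[X])" "[] : carrier (K[X])"
 using p unfolding univ_poly_carrier[symmetric] polynomial_def by auto
 then show "algebraic K x" using p unfolding transcendental_def inj_on_def by force
qed

end

section \<open>Hensel's lemma\<close>

locale complete_local = complete_filtered B K for B :: "'b ring" (structure) and K +
 assumes K1_unit: "x : carrier B ==> x ~: K 1 ==> x : Units B" and one_K1: "\<one> ~: K 1"
begin

lemma unit_not_K1: "x : Units B ==> x ~: K 1"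
 using K_closed(6)[of x 1 "inv x"] one_K1 by auto

text \<open>Newton iteration with the derivative frozen at the starting point. The error e is
  replaced by -e \<delta> v plus a multiple of h^2, where v inverts the derivative at \<xi> and
  \<delta> in \<open>K 1\<close> measures its change; each step gains one order.\<close>

lemma hensel:
 assumes p: "set p <= carrier B" and xi: "\<xi> : carrier B" and e: "eval p \<xi> : K 1"
 and d: "eval (deriv_list p) \<xi> ~: K 1"
 shows "\<exists>x\<in>carrier B. x \<ominus> \<xi> : K 1 & eval p x = \<zero>"
proof -
 let ?d = "eval (deriv_list p)"
 have dpc: "set (deriv_list p) <= carrier B" by (rule set_deriv[OF p])
 have dc: "?d \<xi> : carrier B" by (rule eval_in_carrier[OF dpc xi])
 have du: "?d \<xi> : Units B" using K1_unit dc d by blast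
 define v where "v = inv (?d \<xi>)"
 have v: "v : carrier B" "?d \<xi> \<otimes> v = \<one>" using du by (auto simp: v_def)
 have "EX a. ALL n. (a n : carrier B & a n \<ominus> \<xi> : K 1 & eval p (a n) : K (Suc n)) & a (Suc n) \<ominus> a n : K (Suc n)"
 proof (rule dependent_nat_choice)
 show "EX x. x : carrier B & x \<ominus> \<xi> : K 1 & eval p x : K (Suc 0)"
 using xi e K_closed(2) by (intro exI[of _ \<xi>]) auto
 fix x n assume x: "x : carrier B & x \<ominus> \<xi> : K 1 & eval p x : K (Suc n)"
 define e where "e = eval p x"
 define h where "h = \<ominus> (e \<otimes> v)"
 have ec: "e : K (Suc n)" "e : carrier B" using x K_closed(8) by (auto simp: e_def)
 have hK: "h : K (Suc n)" unfolding h_def using K_closed(5)[OF K_closed(6)[OF ec(1) v(1)]] .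
 have hc: "h : carrier B" using K_closed(8)[OF hK] .
 obtain q where q: "q : carrier B" "eval p (x \<oplus> h) = eval p x \<oplus> h \<otimes> ?d x \<oplus> h \<otimes> h \<otimes> q"
 using eval_taylor[OF p _ hc] x by blast
 define \<delta> where "\<delta> = ?d x \<ominus> ?d \<xi>"
 have dK: "\<delta> : K 1" unfolding \<delta>_def using eval_cong_ideal[OF K_ideal dpc xi] x by blast
 have c: "\<delta> : carrier B" "?d x : carrier B" using K_closed(8)[OF dK] eval_in_carrier[OF dpc] x by auto
 have dx: "?d x = ?d \<xi> \<oplus> \<delta>" unfolding \<delta>_def using dc c(2) by algebra
 have "eval p x \<oplus> h \<otimes> ?d x = e \<ominus> e \<otimes> (?d \<xi> \<otimes> v) \<ominus> e \<otimes> v \<otimes> \<delta>"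
 unfolding e_def[symmetric] h_def dx using ec dc c v(1) by algebra
 also have "... = \<ominus> (e \<otimes> \<delta> \<otimes> v)" unfolding v(2) using ec c v(1) by algebra
 finally have 1: "eval p x \<oplus> h \<otimes> ?d x : K (Suc (Suc n))"
 using K_closed(5)[OF K_closed(6)[OF K_mult[OF ec(1) dK] v(1)]] by simp
 have "h \<otimes> h : K (Suc n + Suc n)" by (rule K_mult[OF hK hK])
 then have "h \<otimes> h \<otimes> q : K (Suc (Suc n))" using K_antimono[of "Suc (Suc n)" "Suc n + Suc n"] K_closed(6) q(1) by auto
 then have "eval p (x \<oplus> h) : K (Suc (Suc n))" unfolding q(2) using 1 K_closed(3) by blast
 moreover have "(x \<oplus> h) \<ominus> \<xi> : K 1"
 proof -
 have "(x \<oplus> h) \<ominus> \<xi> = (x \<ominus> \<xi>) \<oplus> h" using x hc xi by algebra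
 moreover have "h : K 1" using hK K_antimono[of 1 "Suc n"] by auto
 ultimately show ?thesis using x K_closed(3) by simp
 qed
 moreover have "(x \<oplus> h) \<ominus> x = h" using x hc by algebra
 ultimately show "EX y. (y : carrier B & y \<ominus> \<xi> : K 1 & eval p y : K (Suc (Suc n))) & y \<ominus> x : K (Suc n)"
 using x hc hK by (intro exI[of _ "x \<oplus> h"]) auto
 qed
 then obtain a where a: "!!n. a n : carrier B" "!!n. a n \<ominus> \<xi> : K 1" "!!n. eval p (a n) : K (Suc n)"
 "!!n. a (Suc n) \<ominus> a n : K (Suc n)" by blast
 have "a (Suc n) \<ominus> a n : K n" for n using a(4) K_Suc by blast
 then obtain x where x: "x : carrier B" "!!n. x \<ominus> a n : K n" using K_complete[of a] a(1) by blast
 have "eval p x = \<zero>"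
 proof (rule K_sep)
 show ec: "eval p x : carrier B" by (rule eval_in_carrier[OF p x(1)])
 fix n
 have 1: "eval p x \<ominus> eval p (a n) : K n" by (rule eval_cong_ideal[OF K_ideal p a(1) x])
 have 2: "eval p (a n) : K n" using a(3) K_Suc by blast
 have ac: "eval p (a n) : carrier B" using K_closed(8)[OF 2] .
 have "eval p x = (eval p x \<ominus> eval p (a n)) \<oplus> eval p (a n)" using ec ac by algebra
 then show "eval p x : K n" using K_closed(3)[OF 1 2] by simp
 qed
 moreover have "x \<ominus> \<xi> : K 1"
 proof -
 have c: "a 1 : carrier B" using a(1) .
 have "x \<ominus> \<xi> = (x \<ominus> a 1) \<oplus> (a 1 \<ominus> \<xi>)" using x(1) c xi by algebra
 then show ?thesis using K_closed(3)[OF x(2) a(2)] by simp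
 qed
 ultimately show ?thesis using x(1) by blast
qed

end

section \<open>Coefficient fields\<close>

locale coeff_setup = complete_local B K for B :: "'b ring" (structure) and K +
 fixes k :: "'b set"
 assumes k_subfield: "subfield k B"
 and char_zero: "n \<ge> 1 ==> add_pow B (n::nat) \<one> ~: K 1"
 and residue_alg: "\<xi> : carrier B ==> EX p. p ~= [] & set p <= k & hd p ~= \<zero> & eval p \<xi> : K 1"
begin

lemma k_ring: "subring k B"
 using subfieldE(1)[OF k_subfield] .

text \<open>A monic relation of least degree for x modulo Q. For Q = \<open>K 1\<close> this is the
  minimal polynomial of the residue class, for Q = \<open>{\<zero>}\<close> that of x
  itself.\<close>

lemma monic_min:
 assumes M: "subring M B" and inv: "!!a. a : M ==> a ~= \<zero> ==> inv a : M & a : Units B"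
 and Q: "ideal Q B" "\<one> ~: Q" and x: "x : carrier B"
 and ex: "EX p. p ~= [] & set p <= M & hd p ~= \<zero> & eval p x : Q"
 obtains p where "set p <= M" "eval (\<one> # p) x : Q"
 "!!q. q ~= [] ==> set q <= M ==> hd q ~= \<zero> ==> eval q x : Q ==> length p < length q"
proof -
 let ?Z = "%p. p ~= [] & set p <= M & hd p ~= \<zero> & eval p x : Q"
 obtain p where p: "?Z p" and min: "!!q. ?Z q ==> length p <= length q"
 using ex_has_least_nat[of ?Z _ length] ex by blast
 obtain a p' where ap: "p = a # p'" using p by (cases p) auto
 have a: "a : M" "a ~= \<zero>" using p ap by auto
 note Mc = subringE[OF M]
 have ia: "inv a : M" "a : Units B" using inv a by auto
 let ?q = "map (%c. inv a \<otimes> c) p'"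
 have ev: "eval (map (%c. inv a \<otimes> c) l) x = inv a \<otimes> eval l x" if "set l <= M" for l
 using that
 proof (induct l)
 case (Cons b l)
 have c: "b : carrier B" "inv a : carrier B" "x [^] length l : carrier B" "eval l x : carrier B"
 using Cons Mc(1) ia x by (auto intro!: eval_in_carrier)
 then show ?case using Cons by (simp add: r_distr m_assoc)
 qed (use ia Mc(1) in auto)
 have "eval (map (%c. inv a \<otimes> c) p) x : Q"
 using ev[of p] p ideal_closed(7)[OF Q(1)] ia Mc(1) by auto
 moreover have "map (%c. inv a \<otimes> c) p = \<one> # ?q" using ap ia by simp
 ultimately have "eval (\<one> # ?q) x : Q" by simp
 moreover have "set ?q <= M" using p ap ia Mc(6) by auto
 moreover have "length ?q < length q" if "?Z q" for q using min[OF that] ap by simp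
 ultimately show ?thesis using that by blast
qed

text \<open>In residue characteristic zero the derivative of the minimal polynomial has a nonzero
  leading coefficient and smaller degree, so minimality forbids its value to lie in Q.\<close>

lemma deriv_nonzero:
 assumes M: "subring M B" and p: "set p <= M" and Q: "ideal Q B" "Q <= K 1" and x: "x : carrier B"
 and e: "eval (\<one> # p) x : Q"
 and min: "!!q. q ~= [] ==> set q <= M ==> hd q ~= \<zero> ==> eval q x : Q ==> length p < length q"
 shows "eval (deriv_list (\<one> # p)) x ~: Q"
proof
 assume d: "eval (deriv_list (\<one> # p)) x : Q"
 have ne: "p ~= []"
 proof
 assume "p = []"
 then have "\<one> : Q" using e x by simp
 then show False using Q(2) one_K1 by auto
 qed
 have nat_mult: "add_pow B (n::nat) a : M" if "a : M" for n a
 using that subringE[OF M] by (induct n) (auto simp: add.nat_pow_Suc)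
 have "set (deriv_list q) <= M" if "set q <= M" for q using that nat_mult by (induct q) auto
 then have "set (deriv_list (\<one> # p)) <= M" using p subringE(3)[OF M] by (simp del: deriv_list.simps)
 moreover have "deriv_list (\<one> # p) ~= []" using ne by simp
 moreover have "hd (deriv_list (\<one> # p)) ~= \<zero>"
 proof -
 have "add_pow B (length p) \<one> ~: K 1" using char_zero[of "length p"] ne by (cases p) auto
 then have "add_pow B (length p) \<one> ~= \<zero>" using K_closed(2) by metis
 then show ?thesis using ne by simp
 qed
 ultimately have "length p < length (deriv_list (\<one> # p))" using min d by blast
 then show False unfolding length_deriv by simp
qed

lemma k_inv: "a : k ==> a ~= \<zero> ==> inv a : k & a : Units B"
proof -
 assume a: "a : k" "a ~= \<zero>"
 note i = subfield_m_inv[OF k_subfield, of a]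
 have "inv a : k" "a \<otimes> inv a = \<one>" "inv a \<otimes> a = \<one>" using i a by auto
 moreover have "a : carrier B" "inv a : carrier B" using calculation a subringE(1)[OF k_ring] by auto
 ultimately show "inv a : k & a : Units B" unfolding Units_def by blast
qed

text \<open>Subrings over k that inject into the residue field: the candidates for a coefficient
  field.\<close>

definition clean :: "'b set => bool" where
 "clean M \<longleftrightarrow> subring M B & k <= M & M \<inter> K 1 = {\<zero>}"

lemma k_clean: "clean k"
 using k_ring k_inv unit_not_K1 K_closed(2) subringE(2)[OF k_ring] unfolding clean_def by blast

text \<open>The minimal polynomial of the residue class of a has at a a value in M and in
  \<open>K 1\<close>, which is 0; its nonzero constant term then exhibits the inverse. So clean
  subrings are fields.\<close>

lemma clean_inv:
 assumes M: "clean M" and a: "a : M" "a ~= \<zero>"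
 shows "inv a : M & a : Units B"
proof -
 have Mr: "subring M B" "k <= M" "M \<inter> K 1 = {\<zero>}" using M by (auto simp: clean_def)
 note Mc = subringE[OF Mr(1)]
 have ac: "a : carrier B" using a Mc(1) by auto
 have aK: "a ~: K 1" using a Mr(3) by auto
 have au: "a : Units B" using K1_unit ac aK by auto
 obtain p where p: "set p <= k" "eval (\<one> # p) a : K 1"
 "!!q. q ~= [] ==> set q <= k ==> hd q ~= \<zero> ==> eval q a : K 1 ==> length p < length q"
 using monic_min[OF k_ring k_inv K_ideal one_K1 ac residue_alg[OF ac]] by blast
 have kc: "k <= carrier B" by (rule subringE(1)[OF k_ring])
 have evM: "eval q a : M" if "set q <= M" for q
 using that
 proof (induct q)
 case (Cons b q)
 have "a [^] (n::nat) : M" for n using Mc(3,6) a by (induct n) (auto simp: nat_pow_Suc)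
 then show ?case using Cons Mc(6,7) by simp
 qed (use Mc(2) in simp)
 have "p ~= []"
 proof
 assume "p = []"
 then show False using p(2) ac one_K1 by simp
 qed
 then obtain q c where qc: "p = q @ [c]" by (metis rev_exhaust)
 let ?q = "\<one> # q"
 have qM: "set ?q <= k" "c : k" using p qc subringE(3)[OF k_ring] by auto
 have qcc: "set ?q <= carrier B" "c : carrier B" using qM kc by auto
 have ev: "eval (\<one> # p) a = eval ?q a \<otimes> a \<oplus> c"
 using eval_append_aux[OF qcc(1,2) ac] qc by simp
 have "eval (\<one> # p) a : M" by (rule evM) (use p Mc(3) Mr(2) in auto)
 then have "eval (\<one> # p) a = \<zero>" using p(2) Mr(3) by auto
 then have e0: "eval ?q a \<otimes> a \<oplus> c = \<zero>" using ev by simp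
 have "set ?q <= M" using qM(1) Mr(2) by blast
 then have Ec: "eval ?q a : carrier B" "eval ?q a : M" using eval_in_carrier[OF qcc(1) ac] evM by blast+
 \<comment> \<open>A vanishing constant term would let a be cancelled, leaving a shorter
   relation.\<close>
 have c0: "c ~= \<zero>"
 proof
 assume "c = \<zero>"
 then have "a \<otimes> eval ?q a = \<zero>" using e0 Ec ac m_comm by simp
 then have "inv a \<otimes> (a \<otimes> eval ?q a) = \<zero>" using au by simp
 then have "eval ?q a = \<zero>" using au ac Ec by (simp add: m_assoc[symmetric])
 then have "eval ?q a : K 1" using K_closed(2) by simp
 moreover have "hd ?q ~= \<zero>" using one_K1 K_closed(2) by (metis list.sel(1))
 ultimately have "length p < length ?q" using p(3)[of ?q] qM by blast
 then show False using qc by simp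
 qed
 have ci: "inv c : k" "c : Units B" using k_inv[OF qM(2) c0] by auto
 let ?b = "\<ominus> (inv c \<otimes> eval ?q a)"
 have bM: "?b : M" using Mc(5,6) ci Mr(2) Ec by auto
 have "a \<otimes> ?b = inv c \<otimes> (\<ominus> (eval ?q a \<otimes> a))"
 using ac Ec(1) Units_inv_closed[OF ci(2)] by algebra
 also have "\<ominus> (eval ?q a \<otimes> a) = c" using e0 Ec ac qcc by (simp add: minus_equality a_comm)
 finally have ab: "a \<otimes> ?b = \<one>" using ci by simp
 have bc: "?b : carrier B" using bM Mc(1) by blast
 then have "?b = inv a" using comm_inv_char[OF ac bc ab] by simp
 then show ?thesis using bM au by simp
qed

lemma exists_maximal_clean:
 obtains M where "clean M" "!!M'. clean M' ==> M <= M' ==> M' = M"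
proof -
 have "\<exists>M\<in>{M. clean M}. \<forall>M'\<in>{M. clean M}. M <= M' --> M' = M"
 proof (rule subset_Zorn_nonempty)
 show "{M. clean M} ~= {}" using k_clean by auto
 fix C assume C: "C ~= {}" "subset.chain {M. clean M} C"
 have cl: "clean M" if "M : C" for M using that C(2) by (auto simp: subset_chain_def)
 have tot: "M <= M' \<or> M' <= M" if "M : C" "M' : C" for M M' using that C(2) by (auto simp: subset_chain_def)
 have sr: "subring M B" if "M : C" for M using cl[OF that] by (simp add: clean_def)
 have both: "\<exists>M\<in>C. a \<in> M & b \<in> M" if ab: "a \<in> \<Union>C" "b \<in> \<Union>C" for a b
 proof -
 obtain M M' where "M : C" "M' : C" "a : M" "b : M'" using ab by auto
 then show ?thesis using tot[of M M'] by blast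
 qed
 obtain M0 where M0: "M0 : C" using C(1) by auto
 have "subring (\<Union>C) B"
 proof (rule subringI)
 show "\<Union>C <= carrier B" using subringE(1)[OF sr] by blast
 show "\<one> \<in> \<Union>C" using subringE(3)[OF sr[OF M0]] M0 by blast
 show "\<ominus> a \<in> \<Union>C" if "a \<in> \<Union>C" for a using that subringE(5)[OF sr] by blast
 show "a \<otimes> b \<in> \<Union>C" if "a \<in> \<Union>C" "b \<in> \<Union>C" for a b using both[OF that] subringE(6)[OF sr] by blast
 show "a \<oplus> b \<in> \<Union>C" if "a \<in> \<Union>C" "b \<in> \<Union>C" for a b using both[OF that] subringE(7)[OF sr] by blast
 qed
 moreover have "k <= \<Union>C" using cl[OF M0] M0 by (auto simp: clean_def)
 moreover have "\<Union>C \<inter> K 1 = {\<zero>}" using cl M0 unfolding clean_def by blast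
 ultimately show "\<Union>C \<in> {M. clean M}" by (simp add: clean_def)
 qed
 then show ?thesis using that by auto
qed

text \<open>L is shown to equal a maximal clean subring M. Maximality and Hensel's lemma make M
  surject onto the residue field; uniqueness of a simple root in its residue class puts every
  element of L into M.\<close>

lemma coeff_field:
 defines "L \<equiv> {x. algebraic k x & (EX L'. subfield L' B & k <= L' & x : L')}"
 shows "subfield L B" "x : carrier B ==> \<exists>s\<in>L. x \<ominus> s : K 1" "L \<inter> K 1 = {\<zero>}" "k <= L"
proof -
 obtain M where M: "clean M" and Mmax: "!!M'. clean M' ==> M <= M' ==> M' = M"
 using exists_maximal_clean by blast
 have Mr: "subring M B" "k <= M" "M \<inter> K 1 = {\<zero>}" using M by (auto simp: clean_def)
 note Mc = subringE[OF Mr(1)]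
 note Minv = clean_inv[OF M]
 have evM: "eval q a : M" if "a : M" "set q <= M" for q a
 using that(2)
 proof (induct q)
 case (Cons b q)
 have "a [^] (n::nat) : M" for n using Mc(3,6) that(1) by (induct n) (auto simp: nat_pow_Suc)
 then show ?case using Cons Mc(6,7) by simp
 qed (use Mc(2) in simp)
 have Msf: "subfield M B"
 proof (rule subfieldI[OF subcringI'[OF Mr(1)]])
 have "a : Units (B\<lparr>carrier := M\<rparr>)" if "a : M" "a ~= \<zero>" for a
 proof -
 have "a \<otimes> inv a = \<one>" "inv a \<otimes> a = \<one>" "inv a : M" using Minv[OF that] by auto
 then show ?thesis using that by (auto simp: Units_def)
 qed
 moreover have "\<one> ~= \<zero>" using one_K1 K_closed(2) by metis
 then have "\<zero> ~: Units (B\<lparr>carrier := M\<rparr>)" using Mc(1) by (auto simp: Units_def)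
 ultimately show "Units (B\<lparr>carrier := M\<rparr>) = M - {\<zero>}" by (auto simp: Units_def)
 qed
 \<comment> \<open>A root x, congruent to \<xi>, of the minimal polynomial of the residue class of
   \<xi> over M can be adjoined without meeting \<open>K 1\<close> outside 0, so x already lies in
   M.\<close>
 have surj: "\<exists>s\<in>M. \<xi> \<ominus> s : K 1" if xi: "\<xi> : carrier B" for \<xi>
 proof -
 have ex: "EX p. p ~= [] & set p <= M & hd p ~= \<zero> & eval p \<xi> : K 1"
 using residue_alg[OF xi] Mr(2) by blast
 obtain p where p: "set p <= M" "eval (\<one> # p) \<xi> : K 1"
 "!!q. q ~= [] ==> set q <= M ==> hd q ~= \<zero> ==> eval q \<xi> : K 1 ==> length p < length q"
 using monic_min[OF Mr(1) Minv K_ideal one_K1 xi ex] by blast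
 have d: "eval (deriv_list (\<one> # p)) \<xi> ~: K 1"
 by (rule deriv_nonzero[OF Mr(1) p(1) K_ideal _ xi p(2,3)]) auto
 have pc: "set (\<one> # p) <= carrier B" "set p <= carrier B" using p Mc(1) by auto
 obtain x where x: "x : carrier B" "x \<ominus> \<xi> : K 1" "eval (\<one> # p) x = \<zero>"
 using hensel[OF pc(1) xi p(2) d] by blast
 \<comment> \<open>Induction on the length: subtracting a multiple of the minimal polynomial
   shortens g, keeps the value at \<xi> in \<open>K 1\<close> and does not change the value at
   x.\<close>
 have small: "eval g x = \<zero>" if "set g <= M" "eval g \<xi> : K 1" for g
 using that
 proof (induct "length g" arbitrary: g rule: less_induct)
 case less
 show ?case
 proof (cases g)
 case (Cons a g')
 have aM: "a : M" "a : carrier B" "set g' <= M" "set g' <= carrier B" using less Cons Mc(1) by auto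
 show ?thesis
 proof (cases "a = \<zero>")
 case True
 have "eval g y = eval g' y" if "y : carrier B" for y
 using Cons True that aM eval_in_carrier by simp
 then have "eval g x = eval g' x" "eval g \<xi> = eval g' \<xi>" using x(1) xi by blast+
 moreover have "eval g' x = \<zero>" using less(1)[of g'] less(3) Cons aM(3) calculation by simp
 ultimately show ?thesis by simp
 next
 case False
 then have "length p < length g" using p(3)[of g] less Cons by auto
 then obtain j where j: "length g' = length p + j" using Cons by (auto simp: less_iff_Suc_add)
 obtain h where h: "length h = length g'" "set h <= M"
 "!!y. y : carrier B ==> eval h y = eval (a # g') y \<ominus> a \<otimes> y [^] j \<otimes> eval (\<one> # p) y"
 proof -
 obtain h where h: "length h = length g'"
 "ALL K. subring K B --> set g' <= K --> set p <= K --> a : K --> set h <= K"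
 "\<forall>y\<in>carrier B. eval h y = eval (a # g') y \<ominus> a \<otimes> y [^] j \<otimes> eval (\<one> # p) y"
 using eval_monic_reduce[OF aM(4) pc(2) aM(2) xi j] by (elim exE conjE)
 show ?thesis by (rule that[OF h(1) h(2)[rule_format, OF Mr(1) aM(3) p(1) aM(1)] h(3)[rule_format]])
 qed
 have "set (a # g') <= carrier B" using aM by simp
 then have gc: "eval (a # g') x : carrier B" "eval (a # g') \<xi> : carrier B"
 using eval_in_carrier x(1) xi by blast+
 have "a \<otimes> \<xi> [^] j : carrier B" using aM xi by simp
 then have "a \<otimes> \<xi> [^] j \<otimes> eval (\<one> # p) \<xi> : K 1" using K_closed(7)[OF p(2)] by blast
 moreover have "eval (a # g') \<xi> : K 1" using less(3) unfolding Cons .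
 ultimately have "eval h \<xi> : K 1" unfolding h(3)[OF xi] by (rule K_closed(4)[rotated])
 then have "eval h x = \<zero>" using less(1)[of h] h(1,2) Cons by simp
 moreover have "a \<otimes> x [^] j : carrier B" using aM x(1) by simp
 then have "eval h x = eval (a # g') x" unfolding h(3)[OF x(1)] x(3) using gc(1) by algebra
 ultimately show ?thesis unfolding Cons by simp
 qed
 qed simp
 qed
 let ?S = "simple_extension M x"
 have "clean ?S" unfolding clean_def
 proof (intro conjI)
 show "subring ?S B" by (rule simple_extension_subring[OF Mr(1) x(1)])
 show "k <= ?S" using simple_extension_incl[OF Mc(1) x(1)] Mr(2) by auto
 have "a = \<zero>" if a: "a : ?S" "a : K 1" for a
 proof -
 obtain g where g: "set g <= M" "a = eval g x" using simple_extension_eval[OF Mc(1) x(1) a(1)] by blast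
 have gc: "set g <= carrier B" using g Mc(1) by auto
 have c: "eval g x : carrier B" "eval g \<xi> : carrier B" using eval_in_carrier[OF gc] x xi by auto
 have "eval g x \<ominus> eval g \<xi> : K 1" by (rule eval_cong_ideal[OF K_ideal gc xi x(1,2)])
 moreover have "eval g \<xi> = eval g x \<ominus> (eval g x \<ominus> eval g \<xi>)" using c by algebra
 ultimately have "eval g \<xi> : K 1" using a g K_closed(4) by metis
 then show ?thesis using small g by simp
 qed
 then show "?S \<inter> K 1 = {\<zero>}" using K_closed(2) simple_extension.zero by blast
 qed
 then have "?S = M" using Mmax simple_extension_incl[OF Mc(1) x(1)] by blast
 then have xM: "x : M" using simple_extension_mem[OF Mr(1) x(1)] by simp
 have "\<xi> \<ominus> x = \<ominus> (x \<ominus> \<xi>)" using x(1) xi by algebra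
 then have "\<xi> \<ominus> x : K 1" using K_closed(5)[OF x(2)] by simp
 then show ?thesis using xM by blast
 qed
 have "M <= L"
 proof
 fix x assume x: "x : M"
 then have xc: "x : carrier B" using Mc(1) by auto
 obtain p where p: "p ~= []" "set p <= k" "hd p ~= \<zero>" "eval p x : K 1" using residue_alg[OF xc] by blast
 have "eval p x : M" using evM[OF x] p(2) Mr(2) by blast
 then have "eval p x = \<zero>" using p(4) Mr(3) by blast
 then have "algebraic k x" using algebraic_list[OF k_ring xc] p by blast
 then show "x : L" unfolding L_def using Msf Mr(2) x by blast
 qed
 \<comment> \<open>x and the element s of M in the same residue class are both roots of the minimal
   polynomial of x over k, whose derivative at x is a unit; the Taylor expansion then gives s =
   x.\<close>
 moreover have "L <= M"
 proof
 fix x assume "x : L"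
 then obtain L' where L': "algebraic k x" "subfield L' B" "k <= L'" "x : L'" unfolding L_def by blast
 note Lc = subringE[OF subfieldE(1)[OF L'(2)]]
 have xc: "x : carrier B" using L'(4) Lc(1) by auto
 obtain s where s: "s : M" "x \<ominus> s : K 1" using surj[OF xc] by blast
 have sc: "s : carrier B" using s Mc(1) by auto
 have z: "{\<zero>} <= K 1" "\<one> ~: {\<zero>}" using K_closed(2) one_K1 by auto
 have "EX p. p ~= [] & set p <= k & hd p ~= \<zero> & eval p x : {\<zero>}"
 using algebraic_list[OF k_ring xc] L'(1) by blast
 then obtain p where p: "set p <= k" "eval (\<one> # p) x : {\<zero>}"
 "!!q. q ~= [] ==> set q <= k ==> hd q ~= \<zero> ==> eval q x : {\<zero>} ==> length p < length q"
 using monic_min[OF k_ring k_inv zeroideal z(2) xc] by blast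
 let ?p = "\<one> # p"
 have pk: "set ?p <= k" "set ?p <= carrier B" using p subringE(1,3)[OF k_ring] by auto
 have d0: "eval (deriv_list ?p) x ~: {\<zero>}"
 by (rule deriv_nonzero[OF k_ring p(1) zeroideal z(1) xc p(2,3)])
 have natL: "add_pow B (n::nat) a : L'" if "a : L'" for n a using that Lc by (induct n) (auto simp: add.nat_pow_Suc)
 have "set (deriv_list q) <= L'" if "set q <= L'" for q using that natL by (induct q) auto
 then have dL: "set (deriv_list ?p) <= L'" using pk L'(3) by blast
 have "eval q x : L'" if "set q <= L'" for q
 using that
 proof (induct q)
 case (Cons b q)
 have "x [^] (n::nat) : L'" for n using Lc(3,6) L'(4) by (induct n) (auto simp: nat_pow_Suc)
 then show ?case using Cons Lc(6,7) by simp
 qed (use Lc(2) in simp)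
 then have "eval (deriv_list ?p) x : L' - {\<zero>}" using dL d0 by auto
 then have "eval (deriv_list ?p) x \<otimes> inv (eval (deriv_list ?p) x) = \<one>"
 "inv (eval (deriv_list ?p) x) : L'"
 using subfield_m_inv[OF L'(2)] by auto
 moreover have dc: "eval (deriv_list ?p) x : carrier B" using eval_in_carrier[OF set_deriv[OF pk(2)] xc] .
 ultimately have "eval (deriv_list ?p) x ~: K 1" using K_closed(6)[of "eval (deriv_list ?p) x" 1] one_K1 Lc(1) by fastforce
 define h where "h = s \<ominus> x"
 have hc: "h : carrier B" using sc xc by (simp add: h_def)
 have "h = \<ominus> (x \<ominus> s)" unfolding h_def using sc xc by algebra
 then have hK: "h : K 1" using K_closed(5)[OF s(2)] by simp
 obtain q where q: "q : carrier B" "eval ?p (x \<oplus> h) = eval ?p x \<oplus> h \<otimes> eval (deriv_list ?p) x \<oplus> h \<otimes> h \<otimes> q"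
 using eval_taylor[OF pk(2) xc hc] by blast
 have xh: "x \<oplus> h = s" unfolding h_def using sc xc by algebra
 have px: "eval ?p x = \<zero>" using p(2) by simp
 have "eval ?p s \<ominus> eval ?p x : K 1" by (rule eval_cong_ideal[OF K_ideal pk(2) xc sc]) (use hK in \<open>simp add: h_def\<close>)
 then have "eval ?p s : K 1" using px eval_in_carrier[OF pk(2) sc] by (simp add: minus_eq)
 moreover have "eval ?p s : M" using evM[OF s(1)] pk Mr(2) by blast
 ultimately have ps: "eval ?p s = \<zero>" using Mr(3) by blast
 let ?u = "eval (deriv_list ?p) x \<oplus> h \<otimes> q"
 have "h \<otimes> ?u = \<zero> \<oplus> h \<otimes> eval (deriv_list ?p) x \<oplus> h \<otimes> h \<otimes> q" using hc dc q(1) by algebra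
 also have "... = \<zero>" using q(2) xh px ps by simp
 finally have hu: "h \<otimes> ?u = \<zero>" .
 have "?u ~: K 1"
 proof
 assume "?u : K 1"
 then have "?u \<ominus> h \<otimes> q : K 1" using K_closed(4) K_closed(6)[OF hK q(1)] by blast
 moreover have "?u \<ominus> h \<otimes> q = eval (deriv_list ?p) x" using hc dc q(1) by algebra
 ultimately show False using \<open>eval (deriv_list ?p) x ~: K 1\<close> by simp
 qed
 then have uu: "?u : Units B" using K1_unit hc dc q(1) by simp
 then have "h = (h \<otimes> ?u) \<otimes> inv ?u" using hc Units_closed[OF uu] by (simp add: m_assoc)
 then have "h = \<zero>" using hu uu by simp
 then have "s = x" using xh xc by simp
 then show "x : M" using s by simp
 qed
 ultimately have "L = M" by blast
 then show "subfield L B" "x : carrier B ==> \<exists>s\<in>L. x \<ominus> s : K 1" "L \<inter> K 1 = {\<zero>}" "k <= L"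
 using Msf surj Mr by auto
qed

end

section \<open>Tensor products over the coefficient field\<close>

lemma (in cring) eq_minusI:
 assumes "x \<oplus> y = z" "x : carrier R" "y : carrier R"
 shows "x = z \<ominus> y"
proof -
 have "x = (x \<oplus> y) \<ominus> y" using assms(2,3) by algebra
 then show ?thesis by (simp only: assms(1))
qed

lemma (in cring) minus_rules:
 assumes "x : carrier R" "y : carrier R"
 shows "x \<oplus> y \<ominus> x = y" "x \<ominus> y \<oplus> y = x"
 and "z : carrier R ==> (x \<ominus> y) \<otimes> z = x \<otimes> z \<ominus> y \<otimes> z"
 and "z : carrier R ==> w : carrier R ==> x \<ominus> y \<ominus> (z \<ominus> w) = (x \<ominus> z) \<ominus> (y \<ominus> w)"
 using assms by algebra+

section \<open>The ring of formal sums of pairs\<close>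

lemma pair_monoid_ring_mult_of:
 "frag_of (a, b) *{pair_monoid_ring A B} frag_of (a', b') = frag_of (a *{A} a', b *{B} b')"
 by (simp add: pair_monoid_ring_def)

text \<open>The laws are linear in each argument and are therefore checked on basis pairs, where
  they are the laws of A and B.\<close>

lemma pair_monoid_ring_cring:
 assumes "cring A" "cring B"
 shows "cring (pair_monoid_ring A B)"
proof -
 interpret A: cring A by fact
 interpret B: cring B by fact
 let ?P = "pair_monoid_ring A B"
 let ?S = "carrier A \<times> carrier B"
 have pc: "x : carrier ?P \<longleftrightarrow> Poly_Mapping.keys x <= ?S" for x by (simp add: pair_monoid_ring_def)
 have opr: "x +{?P} y = x + y" "0{?P} = 0" for x y by (simp_all add: pair_monoid_ring_def)
 have pd: "x - y : carrier ?P" "x + y : carrier ?P" "- x : carrier ?P" if "x : carrier ?P" "y : carrier ?P" for x y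
 using that keys_diff[of x y] keys_add[of x y] unfolding pc by auto
 have p0: "0 : carrier ?P" and pof: "s : ?S ==> frag_of s : carrier ?P" for s
 unfolding pc by auto
 have ind: "Q x" if "x : carrier ?P" "Q 0" "!!a b. a : carrier A ==> b : carrier B ==> Q (frag_of (a, b))"
 "!!x y. x : carrier ?P ==> y : carrier ?P ==> Q x ==> Q y ==> Q (x - y)" for Q x
 proof -
 have "x : carrier ?P & Q x"
 proof (rule frag_induction[of x ?S "%x. x : carrier ?P & Q x"])
 show "Poly_Mapping.keys x <= ?S" using that(1) pc by blast
 show "0 : carrier ?P & Q 0" using p0 that(2) by blast
 show "frag_of s : carrier ?P & Q (frag_of s)" if "s : ?S" for s
 using that pof \<open>!!a b. a : carrier A ==> b : carrier B ==> Q (frag_of (a, b))\<close> by (cases s) auto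
 show "x - y : carrier ?P & Q (x - y)" if "x : carrier ?P & Q x" "y : carrier ?P & Q y" for x y
 using that pd(1) \<open>!!x y. x : carrier ?P ==> y : carrier ?P ==> Q x ==> Q y ==> Q (x - y)\<close> by blast
 qed
 then show ?thesis by blast
 qed
 define t where "t = (%x y. x *{?P} y)"
 have tof: "t (frag_of (a, b)) (frag_of (a', b')) = frag_of (a *{A} a', b *{B} b')" for a b a' b'
 unfolding t_def by (rule pair_monoid_ring_mult_of)
 have tl: "t (x - y) z = t x z - t y z" "t 0 z = 0" "t (x + y) z = t x z + t y z" for x y z
 unfolding t_def pair_monoid_ring_def by (simp_all add: frag_extend_diff frag_extend_add)
 have tr1: "t (frag_of s) (x - y) = t (frag_of s) x - t (frag_of s) y" "t (frag_of s) 0 = 0" for s x y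
 unfolding t_def pair_monoid_ring_def by (simp_all add: frag_extend_diff split_beta)
 have tr: "t z (x - y) = t z x - t z y & t z 0 = 0" if "z : carrier ?P" for x y z
 by (rule ind[OF that]) (simp_all add: tl tr1)
 have tc: "t x y : carrier ?P" if "x : carrier ?P" "y : carrier ?P" for x y
 proof (rule ind[OF that(1)])
 show "t 0 y : carrier ?P" using p0 tl by simp
 show "t (x - x') y : carrier ?P" if "t x y : carrier ?P" "t x' y : carrier ?P" for x x'
 using that pd tl by simp
 show "t (frag_of (a, b)) y : carrier ?P" if ab: "a : carrier A" "b : carrier B" for a b
 by (rule ind[OF \<open>y : carrier ?P\<close>]) (use ab tr1 tof pd pof p0 in auto)
 qed
 have comm: "t x y = t y x" if "x : carrier ?P" "y : carrier ?P" for x y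
 proof (rule ind[OF that(1)])
 show "t 0 y = t y 0" using tl tr[OF that(2)] by simp
 show "t (x - x') y = t y (x - x')" if "t x y = t y x" "t x' y = t y x'" for x x'
 using that tl tr[OF \<open>y : carrier ?P\<close>] by simp
 show "t (frag_of (a, b)) y = t y (frag_of (a, b))" if ab: "a : carrier A" "b : carrier B" for a b
 by (rule ind[OF \<open>y : carrier ?P\<close>]) (use ab tr1 tl tof A.m_comm B.m_comm in auto)
 qed
 have assoc: "t (t x y) z = t x (t y z)" if xyz: "x : carrier ?P" "y : carrier ?P" "z : carrier ?P" for x y z
 proof (rule ind[OF xyz(1)])
 show "t (t 0 y) z = t 0 (t y z)" using tl by simp
 show "t (t (x - x') y) z = t (x - x') (t y z)" if "t (t x y) z = t x (t y z)" "t (t x' y) z = t x' (t y z)" for x x'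
 using that tl by simp
 show "t (t (frag_of (a, b)) y) z = t (frag_of (a, b)) (t y z)" if ab: "a : carrier A" "b : carrier B" for a b
 proof (rule ind[OF xyz(2)])
 show "t (t (frag_of (a, b)) 0) z = t (frag_of (a, b)) (t 0 z)" using tl tr1 by simp
 show "t (t (frag_of (a, b)) (y - y')) z = t (frag_of (a, b)) (t (y - y') z)"
 if "t (t (frag_of (a, b)) y) z = t (frag_of (a, b)) (t y z)" "t (t (frag_of (a, b)) y') z = t (frag_of (a, b)) (t y' z)" for y y'
 using that tl tr1 by simp
 show "t (t (frag_of (a, b)) (frag_of (a', b'))) z = t (frag_of (a, b)) (t (frag_of (a', b')) z)"
 if ab': "a' : carrier A" "b' : carrier B" for a' b'
 by (rule ind[OF xyz(3)]) (use ab ab' tr1 tof A.m_assoc B.m_assoc in auto)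
 qed
 qed
 have one: "t (frag_of (1{A}, 1{B})) x = x" if "x : carrier ?P" for x
 by (rule ind[OF that]) (use tr1 tof in auto)
 have o: "1{?P} = frag_of (1{A}, 1{B})" by (simp add: pair_monoid_ring_def)
 show ?thesis
 proof (intro cringI abelian_groupI comm_monoidI)
 show "\<exists>y\<in>carrier ?P. y +{?P} x = 0{?P}" if "x : carrier ?P" for x
 using pd(3)[OF that that] opr by (intro bexI[of _ "- x"]) simp_all
 qed (use p0 pof pd(2) tl(3) tc comm assoc one in \<open>simp_all add: opr o t_def[symmetric] add.assoc add.commute\<close>)
qed

section \<open>Base change from a subfield\<close>

locale base_change = A: pcring A + F: field F
 for A :: "'r ring" and F :: "'k ring" +
 fixes S :: "'r set" and u :: "'r => 'k"
 assumes S_subfield: "subfield S A" and u_hom: "u : ring_hom A F"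
begin

abbreviation "P \<equiv> pair_monoid_ring A F"
abbreviation "TI \<equiv> tensor_ideal S (%c. c) u A F"
abbreviation "T \<equiv> tensor_ring S (%c. c) u A F"
abbreviation "te \<equiv> tensor_elem S (%c. c) u A F"

sublocale P: cring P
 by (rule pair_monoid_ring_cring[OF A.is_cring F.is_cring])

lemma P_carrier: "x : carrier P \<longleftrightarrow> Poly_Mapping.keys x <= carrier A \<times> carrier F"
 by (simp add: pair_monoid_ring_def)

lemma P_of: "a : carrier A ==> b : carrier F ==> frag_of (a, b) : carrier P"
 by (simp add: P_carrier)

lemma P_diff: "x : carrier P ==> y : carrier P ==> x - y : carrier P"
 using keys_diff[of x y] unfolding P_carrier by auto

lemma P_minus: "x : carrier P ==> y : carrier P ==> x -{P} y = x - y"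
proof -
 assume c: "x : carrier P" "y : carrier P"
 have "(x - y) +{P} y = x" by (simp add: pair_monoid_ring_def)
 then show ?thesis using P.eq_minusI P_diff[OF c] c(2) by metis
qed

lemma P_ops: "x +{P} y = x + y" "0{P} = 0" "1{P} = frag_of (1{A}, 1{F})"
 by (simp_all add: pair_monoid_ring_def)

lemma P_induct:
 assumes "x : carrier P" "Q 0" "!!a b. a : carrier A ==> b : carrier F ==> Q (frag_of (a, b))"
 "!!x y. x : carrier P ==> y : carrier P ==> Q x ==> Q y ==> Q (x - y)"
 shows "Q x"
proof -
 have "x : carrier P & Q x"
 by (rule frag_induction[of x "carrier A \<times> carrier F" "%x. x : carrier P & Q x"])
 (use assms P_diff P_of P.zero_closed P_carrier P_ops(2) in auto)
 then show ?thesis by blast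
qed

lemma S_sub: "S <= carrier A"
 using subringE(1)[OF subfieldE(1)[OF S_subfield]] .

lemma u_closed: "a : carrier A ==> u a : carrier F"
 using ring_hom_closed[OF u_hom] .

lemma relations_closed: "tensor_relations S (%c. c) u A F <= carrier P"
 unfolding tensor_relations_def using P_diff P_of S_sub u_closed by (auto dest!: subsetD[OF S_sub])

lemma TI_ideal: "ideal TI P"
 unfolding tensor_ideal_def by (rule P.genideal_ideal[OF relations_closed])

lemma TI_rel: "x : tensor_relations S (%c. c) u A F ==> x : TI"
 unfolding tensor_ideal_def using P.genideal_self[OF relations_closed] by blast

lemmas cosets = quotient_cosets[OF P.is_cring TI_ideal]

sublocale T: pcring T
 unfolding tensor_ring_def pcring_def by (rule ideal.quotient_is_cring[OF TI_ideal P.is_cring])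

lemma te_eq: "te a b = TI +>{P} frag_of (a, b)"
 by (simp add: tensor_elem_def)

lemma te_closed [simp]: "a : carrier A ==> b : carrier F ==> te a b : carrier T"
 unfolding te_eq tensor_ring_def cosets(1) using P_of by blast

lemma te_mult:
 assumes "a : carrier A" "b : carrier F" "a' : carrier A" "b' : carrier F"
 shows "te a b *{T} te a' b' = te (a *{A} a') (b *{F} b')"
 unfolding te_eq tensor_ring_def using assms P_of by (simp add: cosets(2) pair_monoid_ring_mult_of)

lemma te_one: "1{T} = te 1{A} 1{F}"
 unfolding te_eq tensor_ring_def cosets(4) P_ops ..

lemma te_add_left:
 assumes "a : carrier A" "a' : carrier A" "b : carrier F"
 shows "te (a +{A} a') b = te a b +{T} te a' b"
proof -
 have c: "frag_of (a, b) : carrier P" "frag_of (a', b) : carrier P" "frag_of (a +{A} a', b) : carrier P"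
 using assms P_of by auto
 have "frag_of (a +{A} a', b) - frag_of (a, b) - frag_of (a', b) : TI"
 by (rule TI_rel) (use assms in \<open>unfold tensor_relations_def, blast\<close>)
 then have "frag_of (a +{A} a', b) - (frag_of (a, b) + frag_of (a', b)) : TI"
 by (simp add: diff_diff_eq)
 then have "TI +>{P} frag_of (a +{A} a', b) = TI +>{P} (frag_of (a, b) +{P} frag_of (a', b))"
 using cosets(6)[OF c(3) P.a_closed[OF c(1,2)]] P_minus[OF c(3) P.a_closed[OF c(1,2)]] by (simp add: P_ops)
 then show ?thesis unfolding te_eq tensor_ring_def cosets(3)[OF c(1,2)] .
qed

lemma te_add_right:
 assumes "a : carrier A" "b : carrier F" "b' : carrier F"
 shows "te a (b +{F} b') = te a b +{T} te a b'"
proof -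
 have c: "frag_of (a, b) : carrier P" "frag_of (a, b') : carrier P" "frag_of (a, b +{F} b') : carrier P"
 using assms P_of by auto
 have "frag_of (a, b +{F} b') - frag_of (a, b) - frag_of (a, b') : TI"
 by (rule TI_rel) (use assms in \<open>unfold tensor_relations_def, blast\<close>)
 then have "frag_of (a, b +{F} b') - (frag_of (a, b) + frag_of (a, b')) : TI"
 by (simp add: diff_diff_eq)
 then have "TI +>{P} frag_of (a, b +{F} b') = TI +>{P} (frag_of (a, b) +{P} frag_of (a, b'))"
 using cosets(6)[OF c(3) P.a_closed[OF c(1,2)]] P_minus[OF c(3) P.a_closed[OF c(1,2)]] by (simp add: P_ops)
 then show ?thesis unfolding te_eq tensor_ring_def cosets(3)[OF c(1,2)] .
qed

lemma te_scalar:
 assumes "a : carrier A" "b : carrier F" "s : S"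
 shows "te (s *{A} a) b = te a (u s *{F} b)"
proof -
 have s: "s : carrier A" using assms S_sub by blast
 have c: "frag_of (s *{A} a, b) : carrier P" "frag_of (a, u s *{F} b) : carrier P"
 using assms P_of u_closed s by auto
 have "frag_of (s *{A} a, b) - frag_of (a, u s *{F} b) : TI"
 by (rule TI_rel) (use assms in \<open>unfold tensor_relations_def, blast\<close>)
 then show ?thesis unfolding te_eq using cosets(6)[OF c] P_minus[OF c] by simp
qed

lemma te_left_hom: "(%a. te a 1{F}) : ring_hom A T"
 by (rule ring_hom_memI) (simp_all add: te_mult te_add_left te_one)

lemma te_right_hom: "(%b. te 1{A} b) : ring_hom F T"
 by (rule ring_hom_memI) (simp_all add: te_mult te_add_right te_one)

lemma T_induct:
 assumes x: "x : carrier T" and 0: "Q 0{T}" and te: "!!a b. a : carrier A ==> b : carrier F ==> Q (te a b)"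
 and diff: "!!x y. x : carrier T ==> y : carrier T ==> Q x ==> Q y ==> Q (x -{T} y)"
 shows "Q x"
proof -
 obtain x' where x': "x' : carrier P" "x = TI +>{P} x'" using x unfolding tensor_ring_def cosets(1) by auto
 have cT: "TI +>{P} y : carrier T" if "y : carrier P" for y
 using that unfolding tensor_ring_def cosets(1) by blast
 have "Q (TI +>{P} x')"
 proof (rule P_induct[OF x'(1)])
 show "Q (TI +>{P} 0)" using 0 unfolding tensor_ring_def cosets(5) P_ops .
 show "Q (TI +>{P} frag_of (a, b))" if "a : carrier A" "b : carrier F" for a b
 using te[OF that] unfolding te_eq .
 fix y z assume yz: "y : carrier P" "z : carrier P" "Q (TI +>{P} y)" "Q (TI +>{P} z)"
 have "(TI +>{P} (y - z)) +{T} (TI +>{P} z) = TI +>{P} y"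
 unfolding tensor_ring_def cosets(3)[OF P_diff[OF yz(1,2)] yz(2)] P_ops by simp
 then have "TI +>{P} (y - z) = (TI +>{P} y) -{T} (TI +>{P} z)"
 using T.eq_minusI cT yz P_diff by blast
 then show "Q (TI +>{P} (y - z))" using diff[OF cT[OF yz(1)] cT[OF yz(2)] yz(3,4)] by simp
 qed
 then show ?thesis using x'(2) by simp
qed

text \<open>An S-linear map l from A to F extends to the tensor product by a \<otimes> b |-> l(a) b,
  first on the free abelian group and then on the quotient.\<close>

lemma functional:
 assumes l: "!!a. a : carrier A ==> l a : carrier F"
 and ladd: "!!a b. a : carrier A ==> b : carrier A ==> l (a +{A} b) = l a +{F} l b"
 and lscal: "!!s a. s : S ==> a : carrier A ==> l (s *{A} a) = u s *{F} l a"
 obtains \<Phi> where "!!x y. x : carrier T ==> y : carrier T ==> \<Phi> (x +{T} y) = \<Phi> x +{F} \<Phi> y"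
 "!!a b. a : carrier A ==> b : carrier F ==> \<Phi> (te a b) = l a *{F} b"
 "!!x. x : carrier T ==> \<Phi> x : carrier F"
proof -
 let ?S = "carrier A \<times> carrier F"
 have "comm_group (add_monoid F)" by (rule F.a_comm_group)
 moreover have "(%(a, b). l a *{F} b) ` ?S <= carrier (add_monoid F)" using l by auto
 ultimately obtain h where h: "h : hom (free_Abelian_group ?S) (add_monoid F)"
 and hof: "!!x. x : ?S ==> h (frag_of x) = (%(a, b). l a *{F} b) x"
 using comm_group.free_Abelian_group_universal by blast
 have hc: "h x : carrier F" if "x : carrier P" for x
 using h that unfolding hom_def P_carrier by auto
 have hadd: "h (x + y) = h x +{F} h y" if "x : carrier P" "y : carrier P" for x y
 using h that unfolding hom_def P_carrier by auto
 have h0: "h 0 = 0{F}" using hadd[of 0 0] hc[of 0] P.zero_closed P_ops(2) F.add.l_cancel_one' by (metis add_0)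
 have hdiff: "h (x - y) = h x -{F} h y" if xy: "x : carrier P" "y : carrier P" for x y
 proof -
 have "h (x - y) +{F} h y = h x" using hadd[OF P_diff[OF xy] xy(2)] by simp
 then show ?thesis using F.eq_minusI hc P_diff xy by blast
 qed
 \<comment> \<open>The relations generate an ideal, not just a subgroup, so \<open>h\<close> has to
   vanish on all their multiples; N is the largest ideal inside the kernel of
   \<open>h\<close>.\<close>
 define N where "N = {x : carrier P. \<forall>g\<in>carrier P. h (g *{P} x) = 0{F}}"
 have N_ideal: "ideal N P"
 proof (rule P.idealI')
 show "N <= carrier P" by (auto simp: N_def)
 show "0{P} : N" using h0 by (simp add: N_def P_ops(2)[symmetric])
 show "x +{P} y : N" if "x : N" "y : N" for x y
 using that hadd unfolding N_def by (auto simp: P.r_distr P_ops(1)[symmetric])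
 show "a *{P} x : N" if "a : carrier P" "x : N" for a x
 using that unfolding N_def by (auto simp: P.m_assoc[symmetric])
 qed
 have mdiff: "g *{P} (x - y) = g *{P} x - g *{P} y" if "g : carrier P" "x : carrier P" "y : carrier P" for g x y
 proof -
 have "g *{P} (x -{P} y) = g *{P} x -{P} g *{P} y" using that by algebra
 then show ?thesis using that P_minus by simp
 qed
 have N_I: "x : N" if x: "x : carrier P" and z: "!!a b. a : carrier A ==> b : carrier F ==> h (frag_of (a, b) *{P} x) = 0{F}" for x
 proof -
 have "h (g *{P} x) = 0{F}" if "g : carrier P" for g
 proof (rule P_induct[OF that])
 show "h (0 *{P} x) = 0{F}" using P.l_null[OF x] h0 unfolding P_ops(2) by simp
 fix y w assume a: "y : carrier P" "w : carrier P" "h (y *{P} x) = 0{F}" "h (w *{P} x) = 0{F}"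
 have "(y - w) *{P} x = y *{P} x - w *{P} x"
 using mdiff[OF x a(1,2)] P.m_comm x a P_diff by simp
 then show "h ((y - w) *{P} x) = 0{F}" using hdiff x a by simp
 qed (rule z)
 then show ?thesis using x by (simp add: N_def)
 qed
 have hm: "h (frag_of (a, b) *{P} frag_of (a', b')) = l (a *{A} a') *{F} (b *{F} b')"
 if "a : carrier A" "b : carrier F" "a' : carrier A" "b' : carrier F" for a b a' b'
 unfolding pair_monoid_ring_mult_of using that by (simp add: hof)
 have rel: "tensor_relations S (%c. c) u A F <= N"
 proof
 fix x assume x: "x : tensor_relations S (%c. c) u A F"
 have xc: "x : carrier P" using x relations_closed by blast
 have three: "h (frag_of (a, b) *{P} (frag_of p - frag_of q - frag_of r)) =
 h (frag_of (a, b) *{P} frag_of p) -{F} h (frag_of (a, b) *{P} frag_of q) -{F} h (frag_of (a, b) *{P} frag_of r)"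
 if "a : carrier A" "b : carrier F" "p : ?S" "q : ?S" "r : ?S" for a b p q r
 proof -
 have c: "frag_of (a, b) : carrier P" "frag_of p : carrier P" "frag_of q : carrier P" "frag_of r : carrier P"
 using that P_of by auto
 then show ?thesis by (simp add: mdiff hdiff P_diff)
 qed
 from x consider
 (1) a a' b where "x = frag_of (a +{A} a', b) - frag_of (a, b) - frag_of (a', b)" "a : carrier A" "a' : carrier A" "b : carrier F"
 | (2) a b b' where "x = frag_of (a, b +{F} b') - frag_of (a, b) - frag_of (a, b')" "a : carrier A" "b : carrier F" "b' : carrier F"
 | (3) a b s where "x = frag_of (s *{A} a, b) - frag_of (a, u s *{F} b)" "a : carrier A" "b : carrier F" "s : S"
 unfolding tensor_relations_def by blast
 then show "x : N"
 proof cases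
 case 1
 show ?thesis
 proof (rule N_I[OF xc])
 fix c d assume cd: "c : carrier A" "d : carrier F"
 define p q r where "p = l (c *{A} a)" and "q = l (c *{A} a')" and "r = d *{F} b"
 have pq: "p : carrier F" "q : carrier F" "r : carrier F" using cd 1 l by (auto simp: p_def q_def r_def)
 have "h (frag_of (c, d) *{P} x) = (p +{F} q) *{F} r -{F} p *{F} r -{F} q *{F} r"
 unfolding 1(1) using cd 1 by (simp add: three hm A.r_distr ladd p_def q_def r_def)
 also have "... = 0{F}" using pq by algebra
 finally show "h (frag_of (c, d) *{P} x) = 0{F}" .
 qed
 next
 case 2
 show ?thesis
 proof (rule N_I[OF xc])
 fix c d assume cd: "c : carrier A" "d : carrier F"
 define p where "p = l (c *{A} a)"
 have pq: "p : carrier F" using cd 2 l by (auto simp: p_def)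
 have "h (frag_of (c, d) *{P} x) = p *{F} (d *{F} (b +{F} b')) -{F} p *{F} (d *{F} b) -{F} p *{F} (d *{F} b')"
 unfolding 2(1) using cd 2 by (simp add: three hm p_def)
 also have "... = 0{F}" using pq cd 2 by algebra
 finally show "h (frag_of (c, d) *{P} x) = 0{F}" .
 qed
 next
 case 3
 have s: "s : carrier A" "u s : carrier F" using 3 S_sub u_closed by auto
 show ?thesis
 proof (rule N_I[OF xc])
 fix c d assume cd: "c : carrier A" "d : carrier F"
 define p v where "p = l (c *{A} a)" and "v = u s"
 have pq: "p : carrier F" "v : carrier F" using cd 3 l s by (auto simp: p_def v_def)
 have "c *{A} (s *{A} a) = s *{A} (c *{A} a)" using cd s 3 by algebra
 then have "l (c *{A} (s *{A} a)) = v *{F} p" using lscal[OF 3(4)] cd 3 by (simp add: p_def v_def)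
 moreover have "frag_of (c, d) : carrier P" "frag_of (s *{A} a, b) : carrier P" "frag_of (a, u s *{F} b) : carrier P"
 using cd s 3 P_of by auto
 ultimately have "h (frag_of (c, d) *{P} x) = v *{F} p *{F} (d *{F} b) -{F} p *{F} (d *{F} (v *{F} b))"
 unfolding 3(1) using cd s 3 by (simp add: mdiff hdiff hm p_def[symmetric] v_def)
 also have "... = 0{F}" using pq cd 3 by algebra
 finally show "h (frag_of (c, d) *{P} x) = 0{F}" .
 qed
 qed
 qed
 have TIN: "TI <= N" unfolding tensor_ideal_def by (rule P.genideal_minimal[OF N_ideal rel])
 define \<Phi> where "\<Phi> = (%x. h (SOME y. y \<in> carrier P & x = TI +>{P} y))"
 have Phi: "\<Phi> (TI +>{P} y) = h y" if y: "y : carrier P" for y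
 proof -
 let ?z = "SOME z. z \<in> carrier P & TI +>{P} y = TI +>{P} z"
 have z: "?z : carrier P" "TI +>{P} y = TI +>{P} ?z"
 using someI[of "%z. z : carrier P & TI +>{P} y = TI +>{P} z" y] y by blast+
 then have "y - ?z : N" using cosets(6)[OF y z(1)] P_minus[OF y z(1)] TIN by auto
 then have "h (1{P} *{P} (y - ?z)) = 0{F}" unfolding N_def by blast
 then have "h y -{F} h ?z = 0{F}" using P_diff[OF y z(1)] hdiff[OF y z(1)] by simp
 then have "h y = h ?z" using hc y z(1) by simp
 then show ?thesis by (simp add: \<Phi>_def)
 qed
 show thesis
 proof
 show "\<Phi> (te a b) = l a *{F} b" if "a : carrier A" "b : carrier F" for a b
 unfolding te_eq using that P_of Phi by (simp add: hof)
 show "\<Phi> x : carrier F" if "x : carrier T" for x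
 using that Phi hc unfolding tensor_ring_def cosets(1) by auto
 show "\<Phi> (x +{T} y) = \<Phi> x +{F} \<Phi> y" if xy: "x : carrier T" "y : carrier T" for x y
 proof -
 obtain x' y' where "x' : carrier P" "y' : carrier P" "x = TI +>{P} x'" "y = TI +>{P} y'"
 using xy unfolding tensor_ring_def cosets(1) by auto
 then show ?thesis unfolding tensor_ring_def using Phi hadd by (simp add: cosets(3) P_ops(1)[symmetric])
 qed
 qed
qed

text \<open>Modulo N an element of A may be replaced by a scalar from S, which moves across the
  tensor sign.\<close>

lemma residue:
 assumes N: "ideal N A" and S: "!!x. x : carrier A ==> \<exists>s\<in>S. x -{A} s : N" and t: "t : carrier T"
 shows "\<exists>c\<in>carrier F. t -{T} te 1{A} c : idl T ((%a. te a 1{F}) ` N)"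
proof -
 note Nc = A.ideal_closed[OF N]
 let ?J = "idl T ((%a. te a 1{F}) ` N)"
 have sub: "(%a. te a 1{F}) ` N <= carrier T" using Nc(1) by auto
 note J = T.genideal_ideal[OF sub]
 note Jc = T.ideal_closed[OF J]
 show ?thesis
 proof (rule T_induct[OF t])
 have "te 1{A} 0{F} = 0{T}" by (rule ring_hom_zero[OF te_right_hom F.ring_axioms T.ring_axioms])
 then show "\<exists>c\<in>carrier F. 0{T} -{T} te 1{A} c : ?J" using Jc(2) by (intro bexI[of _ "0{F}"]) auto
 next
 fix a b assume ab: "a : carrier A" "b : carrier F"
 obtain s where s: "s : S" "a -{A} s : N" using S[OF ab(1)] by blast
 have sc: "s : carrier A" "u s : carrier F" using s S_sub u_closed by auto
 define n where "n = a -{A} s"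
 have nc: "n : carrier A" using ab sc by (simp add: n_def)
 have "a = s *{A} 1{A} +{A} n" unfolding n_def using ab sc by algebra
 then have "te a b = te 1{A} (u s *{F} b) +{T} te n b"
 using te_add_left[of "s *{A} 1{A}" n b] te_scalar[of "1{A}" b s] ab sc nc s by simp
 moreover have "te n b = te n 1{F} *{T} te 1{A} b" using te_mult[of n "1{F}" "1{A}" b] nc ab by simp
 moreover have "te n 1{F} *{T} te 1{A} b : ?J"
 by (rule Jc(6)) (use T.genideal_self[OF sub] s ab in \<open>auto simp: n_def\<close>)
 ultimately show "\<exists>c\<in>carrier F. te a b -{T} te 1{A} c : ?J"
 using ab sc nc T.minus_rules(1)[OF te_closed T.m_closed[OF te_closed te_closed]] by (intro bexI[of _ "u s *{F} b"]) auto
 next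
 fix x y assume xy: "x : carrier T" "y : carrier T"
 "\<exists>c\<in>carrier F. x -{T} te 1{A} c : ?J" "\<exists>c\<in>carrier F. y -{T} te 1{A} c : ?J"
 obtain c d where cd: "c : carrier F" "d : carrier F" "x -{T} te 1{A} c : ?J" "y -{T} te 1{A} d : ?J"
 using xy(3,4) by blast
 have "te 1{A} (c -{F} d) = te 1{A} c -{T} te 1{A} d"
 proof -
 have "te 1{A} ((c -{F} d) +{F} d) = te 1{A} (c -{F} d) +{T} te 1{A} d" using cd by (simp add: te_add_right)
 moreover have "(c -{F} d) +{F} d = c" using F.minus_rules(2) cd by blast
 ultimately have "te 1{A} (c -{F} d) +{T} te 1{A} d = te 1{A} c" by simp
 then show ?thesis by (rule T.eq_minusI) (use cd in simp_all)
 qed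
 then have "x -{T} y -{T} te 1{A} (c -{F} d) = (x -{T} te 1{A} c) -{T} (y -{T} te 1{A} d)"
 using T.minus_rules(4)[OF xy(1,2) te_closed te_closed] cd by simp
 then show "\<exists>c\<in>carrier F. x -{T} y -{T} te 1{A} c : ?J"
 using Jc(4)[OF cd(3,4)] xy cd by (intro bexI[of _ "c -{F} d"]) auto
 qed
qed

definition subspace :: "'r set => bool" where
 "subspace W \<longleftrightarrow> W <= carrier A & 0{A} : W & (\<forall>x\<in>W. \<forall>y\<in>W. x -{A} y : W) & (\<forall>s\<in>S. \<forall>x\<in>W. s *{A} x : W)"

lemma subspace_add:
 assumes "subspace W" "x : W" "y : W" shows "x +{A} y : W"
proof -
 have c: "x : carrier A" "y : carrier A" using assms by (auto simp: subspace_def)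
 have "x -{A} (0{A} -{A} y) : W" using assms by (simp add: subspace_def)
 moreover have "x -{A} (0{A} -{A} y) = x +{A} y" using c by algebra
 ultimately show ?thesis by simp
qed

text \<open>Zorn's lemma gives a subspace W that contains V and is maximal without z. Then A is the
  sum of W and the line through z, and the functional is u applied to the coefficient of z.\<close>

lemma separating_functional:
 assumes V: "subspace V" and z: "z : carrier A" "z ~: V"
 obtains l where "!!a. a : carrier A ==> l a : carrier F"
 "!!a b. a : carrier A ==> b : carrier A ==> l (a +{A} b) = l a +{F} l b"
 "!!s a. s : S ==> a : carrier A ==> l (s *{A} a) = u s *{F} l a"
 "!!a. a : V ==> l a = 0{F}" "l z = 1{F}"
proof -
 let ?C = "{W. subspace W & V <= W & z ~: W}"
 have "\<exists>W\<in>?C. \<forall>W'\<in>?C. W <= W' --> W' = W"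
 proof (rule subset_Zorn_nonempty)
 show "?C ~= {}" using V z by blast
 fix C assume C: "C ~= {}" "subset.chain ?C C"
 have CC: "subspace W" "V <= W" "z ~: W" if "W : C" for W using C(2) that by (auto simp: subset_chain_def)
 have tot: "W <= W' \<or> W' <= W" if "W : C" "W' : C" for W W' using that C(2) by (auto simp: subset_chain_def)
 obtain W0 where W0: "W0 : C" using C(1) by blast
 have "subspace (\<Union>C)"
 unfolding subspace_def
 proof (intro conjI ballI)
 show "\<Union>C <= carrier A" using CC(1) unfolding subspace_def by blast
 show "0{A} \<in> \<Union>C" using CC(1)[OF W0] W0 unfolding subspace_def by blast
 fix x assume "x \<in> \<Union>C"
 then obtain W where W: "W : C" "x : W" by blast
 show "s *{A} x \<in> \<Union>C" if "s \<in> S" for s using CC(1)[OF W(1)] W that unfolding subspace_def by blast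
 fix y assume "y \<in> \<Union>C"
 then obtain W' where W': "W' : C" "y : W'" by blast
 consider "W <= W'" | "W' <= W" using tot W W' by blast
 then show "x -{A} y \<in> \<Union>C"
 proof cases
 case 1 then show ?thesis using CC(1)[OF W'(1)] W W' unfolding subspace_def by blast
 next
 case 2 then show ?thesis using CC(1)[OF W(1)] W W' unfolding subspace_def by blast
 qed
 qed
 then show "\<Union>C \<in> ?C" using CC W0 by blast
 qed
 then obtain W where W: "subspace W" "V <= W" "z ~: W"
 and max: "!!W'. subspace W' ==> V <= W' ==> z ~: W' ==> W <= W' ==> W' = W" by auto
 have Wd: "W <= carrier A" "0{A} : W" "!!x y. x : W ==> y : W ==> x -{A} y : W" "!!s x. s : S ==> x : W ==> s *{A} x : W"
 using W(1) by (auto simp: subspace_def)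
 note Sr = subringE[OF subfieldE(1)[OF S_subfield]]
 have Sc: "s : carrier A" if "s : S" for s using that Sr(1) by blast
 have ex: "\<exists>s\<in>S. a -{A} s *{A} z : W" if a: "a : carrier A" for a
 proof (cases "a : W")
 case True
 have "a -{A} 0{A} *{A} z = a" using a z by simp
 then show ?thesis using True Sr(2) by metis
 next
 case False
 let ?W = "{w +{A} s *{A} a | w s. w : W & s : S}"
 have sub: "subspace ?W"
 unfolding subspace_def
 proof (intro conjI ballI)
 show "?W <= carrier A" using Wd(1) Sc a by auto
 have "0{A} = 0{A} +{A} 0{A} *{A} a" using a by simp
 then show "0{A} : ?W" using Wd(2) Sr(2) by blast
 fix x assume "x : ?W"
 then obtain w s where ws: "x = w +{A} s *{A} a" "w : W" "s : S" by blast
 have c: "w : carrier A" "s : carrier A" using ws Wd(1) Sc by auto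
 show "r *{A} x : ?W" if r: "r : S" for r
 proof -
 have "r *{A} x = r *{A} w +{A} (r *{A} s) *{A} a" unfolding ws using c a Sc[OF r] by algebra
 then show ?thesis using Wd(4)[OF r ws(2)] Sr(6)[OF r ws(3)] by blast
 qed
 fix y assume "y : ?W"
 then obtain w' s' where ws': "y = w' +{A} s' *{A} a" "w' : W" "s' : S" by blast
 have c': "w' : carrier A" "s' : carrier A" using ws' Wd(1) Sc by auto
 have "x -{A} y = (w -{A} w') +{A} (s +{A} (\<ominus>\<^bsub>A\<^esub> s')) *{A} a" unfolding ws ws' using c c' a by algebra
 then show "x -{A} y : ?W" using Wd(3)[OF ws(2) ws'(2)] Sr(7)[OF ws(3) Sr(5)[OF ws'(3)]] by blast
 qed
 have inW: "w : ?W" if "w : W" for w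
 proof -
 have "w = w +{A} 0{A} *{A} a" using a that Wd(1) by auto
 then show ?thesis using that Sr(2) by blast
 qed
 have "a = 0{A} +{A} 1{A} *{A} a" using a by simp
 then have "a : ?W" using Wd(2) Sr(3) by blast
 then have "z : ?W" using max[OF sub] inW W(2) False by blast
 then obtain w s where ws: "z = w +{A} s *{A} a" "w : W" "s : S" by blast
 have c: "w : carrier A" "s : carrier A" using ws Wd(1) Sc by auto
 have "s ~= 0{A}" using ws c a W(3) by auto
 then have i: "inv\<^bsub>A\<^esub> s : S" "s *{A} inv\<^bsub>A\<^esub> s = 1{A}" using A.subfield_m_inv[OF S_subfield, of s] ws(3) by auto
 define v where "v = inv\<^bsub>A\<^esub> s"
 have v: "v : S" "v : carrier A" "s *{A} v = 1{A}" using i Sc by (auto simp: v_def)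
 have "a -{A} v *{A} z = 0{A} -{A} v *{A} w +{A} (1{A} -{A} s *{A} v) *{A} a" unfolding ws using c a v(2) by algebra
 also have "... = 0{A} -{A} v *{A} w" unfolding v(3) using c a v(2) by algebra
 also have "... : W" using Wd(2,3,4) v(1) ws(2) by blast
 finally show ?thesis using v(1) by blast
 qed
 have uniq: "s = s'" if ss: "s : S" "s' : S" "a : carrier A" "a -{A} s *{A} z : W" "a -{A} s' *{A} z : W" for s s' a
 proof (rule ccontr)
 assume ne: "s ~= s'"
 have c: "s : carrier A" "s' : carrier A" using ss Sc by auto
 define r where "r = s +{A} (\<ominus>\<^bsub>A\<^esub> s')"
 have r: "r : S" "r : carrier A" unfolding r_def using Sr(5,7) ss Sc by auto
 have "r ~= 0{A}" using ne c A.r_right_minus_eq by (simp add: r_def A.minus_eq[symmetric])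
 then have i: "inv\<^bsub>A\<^esub> r : S" "inv\<^bsub>A\<^esub> r *{A} r = 1{A}" using A.subfield_m_inv[OF S_subfield, of r] r(1) by auto
 have "(a -{A} s' *{A} z) -{A} (a -{A} s *{A} z) : W" using Wd(3) ss by blast
 moreover have "(a -{A} s' *{A} z) -{A} (a -{A} s *{A} z) = r *{A} z" unfolding r_def using ss(3) c z by algebra
 ultimately have "inv\<^bsub>A\<^esub> r *{A} (r *{A} z) : W" using Wd(4)[OF i(1)] by simp
 moreover have "inv\<^bsub>A\<^esub> r *{A} (r *{A} z) = z" using i Sc[OF i(1)] r(2) z by (simp add: A.m_assoc[symmetric])
 ultimately show False using W(3) by simp
 qed
 define \<sigma> where "\<sigma> = (%a. SOME s. s \<in> S & a -{A} s *{A} z \<in> W)"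
 have sig: "\<sigma> a : S" "a -{A} \<sigma> a *{A} z : W" if "a : carrier A" for a
 using someI_ex[of "%s. s : S & a -{A} s *{A} z : W"] ex[OF that] unfolding \<sigma>_def by blast+
 have sigI: "\<sigma> a = s" if "a : carrier A" "s : S" "a -{A} s *{A} z : W" for a s
 using uniq[OF sig(1)[OF that(1)] that(2,1) sig(2)[OF that(1)] that(3)] .
 show thesis
 proof
 show "u (\<sigma> a) : carrier F" if "a : carrier A" for a using u_closed Sc sig(1)[OF that] by blast
 show "u (\<sigma> (a +{A} b)) = u (\<sigma> a) +{F} u (\<sigma> b)" if ab: "a : carrier A" "b : carrier A" for a b
 proof -
 have c: "\<sigma> a : carrier A" "\<sigma> b : carrier A" using Sc sig(1) ab by auto
 have "(a +{A} b) -{A} (\<sigma> a +{A} \<sigma> b) *{A} z = (a -{A} \<sigma> a *{A} z) +{A} (b -{A} \<sigma> b *{A} z)" using ab c z by algebra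
 then have "\<sigma> (a +{A} b) = \<sigma> a +{A} \<sigma> b"
 using sigI[of "a +{A} b" "\<sigma> a +{A} \<sigma> b"] ab subspace_add[OF W(1) sig(2)[OF ab(1)] sig(2)[OF ab(2)]] Sr(7)[OF sig(1) sig(1)] by simp
 then show ?thesis using ring_hom_add[OF u_hom] c by simp
 qed
 show "u (\<sigma> (s *{A} a)) = u s *{F} u (\<sigma> a)" if sa: "s : S" "a : carrier A" for s a
 proof -
 have c: "\<sigma> a : carrier A" "s : carrier A" using Sc sig(1) sa by auto
 have "(s *{A} a) -{A} (s *{A} \<sigma> a) *{A} z = s *{A} (a -{A} \<sigma> a *{A} z)" using sa c z by algebra
 then have "\<sigma> (s *{A} a) = s *{A} \<sigma> a"
 using sigI[of "s *{A} a" "s *{A} \<sigma> a"] sa c Wd(4)[OF sa(1) sig(2)[OF sa(2)]] Sr(6)[OF sa(1) sig(1)[OF sa(2)]] by simp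
 then show ?thesis using ring_hom_mult[OF u_hom] c by simp
 qed
 show "u (\<sigma> a) = 0{F}" if a: "a : V" for a
 proof -
 have c: "a : carrier A" "a : W" using a W(2) Wd(1) by auto
 have "a -{A} 0{A} *{A} z = a" using c z by simp
 then have "\<sigma> a = 0{A}" using sigI[OF c(1) Sr(2)] c by simp
 then show ?thesis using ring_hom_zero[OF u_hom A.ring_axioms F.ring_axioms] by simp
 qed
 have "z -{A} 1{A} *{A} z = 0{A}" using z by simp
 then have "\<sigma> z = 1{A}" using sigI[OF z(1) Sr(3)] Wd(2) by simp
 then show "u (\<sigma> z) = 1{F}" using ring_hom_one[OF u_hom] by simp
 qed
qed

text \<open>Faithful flatness of A -> A \<otimes> F in elementary form: a functional with value 0 on
  N and 1 at z extends to the tensor product, vanishes on the extension of N because N is an ideal,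
  and is 1 at z \<otimes> 1.\<close>

lemma te_reflect:
 assumes N: "ideal N A" and z: "z : carrier A" "te z 1{F} : idl T ((%a. te a 1{F}) ` N)"
 shows "z : N"
proof (rule ccontr)
 assume zN: "z ~: N"
 note Nc = A.ideal_closed[OF N]
 have "subspace N" unfolding subspace_def using Nc(1,2,4,7) S_sub by blast
 then obtain l where l: "!!a. a : carrier A ==> l a : carrier F"
 "!!a b. a : carrier A ==> b : carrier A ==> l (a +{A} b) = l a +{F} l b"
 "!!s a. s : S ==> a : carrier A ==> l (s *{A} a) = u s *{F} l a"
 "!!a. a : N ==> l a = 0{F}" "l z = 1{F}"
 using separating_functional[OF _ z(1) zN] by blast
 obtain \<Phi> where f: "!!x y. x : carrier T ==> y : carrier T ==> \<Phi> (x +{T} y) = \<Phi> x +{F} \<Phi> y"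
 "!!a b. a : carrier A ==> b : carrier F ==> \<Phi> (te a b) = l a *{F} b"
 "!!x. x : carrier T ==> \<Phi> x : carrier F"
 using functional[of l] l(1-3) by blast
 have f0: "\<Phi> 0{T} = 0{F}" using f(1)[of "0{T}" "0{T}"] f(3)[of "0{T}"] F.add.l_cancel_one' by simp
 have fd: "\<Phi> (x -{T} y) = \<Phi> x -{F} \<Phi> y" if xy: "x : carrier T" "y : carrier T" for x y
 proof -
 have "x -{T} y +{T} y = x" by (rule T.minus_rules(2)[OF xy])
 then have "\<Phi> (x -{T} y) +{F} \<Phi> y = \<Phi> x" using f(1)[of "x -{T} y" y] xy by simp
 then show ?thesis using F.eq_minusI f(3) xy by blast
 qed
 define Q where "Q = {t : carrier T. \<forall>g\<in>carrier T. \<Phi> (g *{T} t) = 0{F}}"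
 have "ideal Q T"
 proof (rule T.idealI')
 show "Q <= carrier T" by (auto simp: Q_def)
 show "0{T} : Q" using f0 by (simp add: Q_def)
 show "x +{T} y : Q" if "x : Q" "y : Q" for x y using that f(1) unfolding Q_def by (auto simp: T.r_distr)
 show "a *{T} x : Q" if "a : carrier T" "x : Q" for a x
 using that unfolding Q_def by (auto simp: T.m_assoc[symmetric])
 qed
 moreover have "(%a. te a 1{F}) ` N <= Q"
 proof
 fix x assume "x : (%a. te a 1{F}) ` N"
 then obtain a where a: "a : N" "a : carrier A" "x = te a 1{F}" using Nc(1) by blast
 have "\<Phi> (g *{T} x) = 0{F}" if "g : carrier T" for g
 proof (rule T_induct[OF that])
 show "\<Phi> (0{T} *{T} x) = 0{F}" using a f0 by simp
 show "\<Phi> (te b c *{T} x) = 0{F}" if "b : carrier A" "c : carrier F" for b c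
 using that a l(4)[OF Nc(7)[OF a(1) that(1)]] by (simp add: te_mult f(2))
 show "\<Phi> ((p -{T} q) *{T} x) = 0{F}"
 if pq: "p : carrier T" "q : carrier T" "\<Phi> (p *{T} x) = 0{F}" "\<Phi> (q *{T} x) = 0{F}" for p q
 proof -
 have xc: "x : carrier T" using a by simp
 have "(p -{T} q) *{T} x = p *{T} x -{T} q *{T} x" by (rule T.minus_rules(3)[OF pq(1,2) xc])
 then show ?thesis using fd pq xc by simp
 qed
 qed
 then show "x : Q" using a by (simp add: Q_def)
 qed
 ultimately have "te z 1{F} : Q" using T.genideal_minimal z(2) by blast
 then have "\<Phi> (1{T} *{T} te z 1{F}) = 0{F}" unfolding Q_def by blast
 then show False using z(1) l(5) by (simp add: f(2))
qed

end

section \<open>The scalar extension\<close>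

lemma hom_ipow:
 assumes R: "pcring R" and S: "pcring S" and h: "h : ring_hom R S" and I: "ideal I R" and Q: "ideal Q S"
 and hI: "!!x. x : I ==> h x : Q" and x: "x : ideal_power R I n"
 shows "h x : ideal_power S Q n"
proof -
 interpret R: pcring R by fact
 interpret S: pcring S by fact
 note In = R.ideal_closed[OF R.ipow_ideal[OF I]] and Qn = S.ideal_closed[OF S.ipow_ideal[OF Q]]
 note Ic = R.ideal_closed[OF I]
 show ?thesis using x
 proof (induct n arbitrary: x)
 case 0
 then show ?case using ring_hom_closed[OF h] by (simp add: R.ipow_0 S.ipow_0)
 next
 case (Suc n)
 from Suc(2) have "x : ideal_power R I n \<cdot>\<^bsub>R\<^esub> I" by (simp add: R.ipow_Suc)
 then have "x : carrier R & h x : ideal_power S Q (Suc n)"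
 proof (induct x rule: ideal_prod.induct)
 case (prod i j)
 have c: "i : carrier R" "j : carrier R" using prod In(8) Ic(8) by auto
 have "h i *{S} h j : ideal_power S Q n \<cdot>\<^bsub>S\<^esub> Q"
 by (rule ideal_prod.prod[OF Suc(1)[OF prod(1)] hI[OF prod(2)]])
 then show ?case using ring_hom_mult[OF h c] c by (simp add: S.ipow_Suc)
 next
 case (sum s t)
 then show ?case using ring_hom_add[OF h, of s t] Qn(3) by simp
 qed
 then show ?case by blast
 qed
qed

lemma hom_minus:
 assumes "ring R" "ring S" "h : ring_hom R S" "a : carrier R" "b : carrier R"
 shows "h (a -{R} b) = h a -{S} h b"
proof -
 interpret ring_hom_ring R S h by (rule ring_hom_ringI2[OF assms(1-3)])
 show ?thesis using assms(4,5) by (simp add: R.minus_eq S.minus_eq)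
qed

section \<open>Descent through a completion\<close>

context completion_of
begin

lemma rep_ideal:
 assumes N: "ideal N R"
 shows "ideal {f : carrier C. EX r. sq r & f = cl r & r n : N} C" (is "ideal ?Z C")
proof (rule C.idealI')
 note Nc = ideal_closed[OF N]
 show "?Z <= carrier C" by blast
 show "0{C} : ?Z" using cl_zero sq_const[of \<zero>] Nc(2) cl_carrier by auto
 show "f +{C} g : ?Z" if fg: "f : ?Z" "g : ?Z" for f g
 proof -
 obtain r s where "sq r" "f = cl r" "r n : N" "sq s" "g = cl s" "s n : N" using fg by blast
 then show ?thesis using cl_add[of r s] sq_add[of r s] Nc(3) cl_carrier[OF sq_add[of r s]] by auto
 qed
 show "g *{C} f : ?Z" if fg: "g : carrier C" "f : ?Z" for f g
 proof -
 obtain r where r: "sq r" "f = cl r" "r n : N" using fg(2) by blast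
 obtain s where s: "sq s" "g = cl s" using fg(1) compl_carrier by blast
 have "s n \<otimes> r n : N" using Nc(7)[OF r(3) sqD(1)[OF s(1)]] .
 then show ?thesis using cl_mult[OF s(1) r(1)] sq_mult[OF s(1) r(1)] r s cl_carrier[OF sq_mult[OF s(1) r(1)]] by auto
 qed
qed

text \<open>The completion modulo \<open>ker n\<close> is R modulo I^n, so memberships modulo
  \<open>ker n\<close> can be read on representatives at index n.\<close>

lemma reflect_step:
 assumes A: "A <= carrier R" and z: "z : carrier R" "\<iota> z : idl C (\<iota> ` A) <+{C} ker n"
 shows "z : Idl A <+> Ip n"
proof -
 let ?N = "Idl A <+> Ip n"
 have N: "ideal ?N R" by (rule add_ideals[OF idl_ideal[OF A] Ip_ideal])
 note Nc = ideal_closed[OF N]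
 let ?Z = "{f : carrier C. EX r. sq r & f = cl r & r n : ?N}"
 note Z = rep_ideal[OF N, of n]
 have "\<iota> ` A <= ?Z"
 proof
 fix f assume "f : \<iota> ` A"
 then obtain a where a: "a : A" "f = cl (%_. a)" unfolding \<iota>_eq by blast
 then have "a : ?N" "sq (%_. a)" using idl_mem[OF A] add_ideals_sub(1)[OF idl_ideal[OF A] Ip_ideal] sq_const A by blast+
 then show "f : ?Z" using a cl_carrier by blast
 qed
 then have 1: "idl C (\<iota> ` A) <= ?Z" by (rule C.genideal_minimal[OF Z])
 have "ker n <= ?Z"
 proof
 fix f assume "f : ker n"
 then obtain r where "sq r" "f = cl r" "r n : Ip n" by (rule kerE)
 then show "f : ?Z" using add_ideals_sub(2)[OF idl_ideal[OF A] Ip_ideal] cl_carrier by blast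
 qed
 with 1 have "\<iota> z : ?Z" using C.add_ideals_minimal[OF Z] z(2) by blast
 then obtain r where r: "sq r" "cl (%_. z) = cl r" "r n : ?N" unfolding \<iota>_eq by blast
 have "z \<ominus> r n : Ip n" using r(2) cl_eq_iff[OF sq_const[OF z(1)] r(1)] by blast
 then have "(z \<ominus> r n) \<oplus> r n : ?N" using Nc(3) r(3) add_ideals_sub(2)[OF idl_ideal[OF A] Ip_ideal] by blast
 then show ?thesis using minus_rules(2)[OF z(1) sqD(1)[OF r(1)]] by simp
qed

lemma ipow_sub_ker:
 assumes "ideal Q C" "Q <= ker 1" shows "ideal_power C Q n <= ker n"
proof (induct n)
 case 0
 then show ?case using CF.K_0 by (simp add: C.ipow_0)
next
 case (Suc n)
 have "x *{C} y : ker (Suc n)" if "x : ideal_power C Q n" "y : Q" for x y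
 using CF.K_mult[of x n y 1] that Suc assms(2) by auto
 then show ?case unfolding C.ipow_Suc by (rule C.ideal_prod_minimal[OF ker_ideal])
qed

end

section \<open>The completed scalar extension of a local ring\<close>

locale coeff_extension = noeth_local R mI + F: field F
 for R :: "'a ring" (structure) and mI and F :: "'k ring" +
 fixes k :: "'a set" and u :: "'a => 'k"
 assumes k_subfield: "subfield k R" and rationals: "contains_rationals R"
 and residue_algebraic: "x : carrier (R Quot mI) ==> ring.algebraic (R Quot mI) ((%a. mI +> a) ` k) x"
 and u_hom: "u : ring_hom R F" and u_kernel: "a_kernel R F u = mI"
begin

sublocale completion_of R mI
 by (intro completion_of.intro completion_of_axioms.intro pcring_axioms m_ideal)

lemma Ip_1: "Ip 1 = mI"
 using ipow_1[OF m_ideal] by simp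

sublocale CL: complete_local C ker
proof
 fix x assume x: "x : carrier C" "x ~: ker 1"
 obtain r where r: "sq r" "x = cl r" using x(1) compl_carrier by blast
 have rc: "r 1 : carrier R" using sqD(1)[OF r(1)] .
 have "r 1 ~: mI" using ker_iff[OF r(1)] r(2) x(2) Ip_1 by auto
 then have U: "r 1 : Units R" using unitI rc by blast
 let ?v = "inv (r 1)"
 have v: "?v : carrier R" "r 1 \<otimes> ?v = \<one>" using U by auto
 note c = sq_const[OF v(1)] sq_const[OF one_closed]
 have "cl r *{C} cl (%_. ?v) -{C} 1{C} = cl (%n. r n \<otimes> ?v \<ominus> \<one>)"
 unfolding cl_one cl_mult[OF r(1) c(1)] by (rule cl_minus(2)[OF sq_mult[OF r(1) c(1)] c(2)])
 moreover have "cl (%n. r n \<otimes> ?v \<ominus> \<one>) : ker 1"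
 using ker_iff[OF cl_minus(1)[OF sq_mult[OF r(1) c(1)] c(2)], of 1] v(2) Ip_closed(2) by simp
 ultimately show "x : Units C" using CF.unit_mod_K[OF x(1) cl_carrier[OF c(1)]] r(2) by simp
next
 show "1{C} ~: ker 1" unfolding cl_one using ker_iff[OF sq_const[OF one_closed], of 1] Ip_1 one_notin by simp
qed

sublocale iota: ring_hom_cring R C \<iota>
 by (intro ring_hom_cring.intro ring_hom_cring_axioms.intro is_cring C.is_cring \<iota>_hom)

lemma nat_unit: "n \<ge> 1 ==> add_pow R (n::nat) \<one> : Units R"
proof -
 assume n: "n \<ge> 1"
 obtain f where f: "f : ring_hom rat_ring R" using rationals unfolding contains_rationals_def by blast
 have cl: "f q : carrier R" for q using ring_hom_closed[OF f] by (simp add: rat_ring_def)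
 have fm: "f (p * q) = f p \<otimes> f q" and fa: "f (p + q) = f p \<oplus> f q" for p q
 using ring_hom_mult[OF f, of p q] ring_hom_add[OF f, of p q] by (simp_all add: rat_ring_def)
 have f1: "f 1 = \<one>" using ring_hom_one[OF f] by (simp add: rat_ring_def)
 have f0: "f 0 = \<zero>" using fa[of 0 0] cl[of 0] by (metis add.l_cancel_one' add_0)
 have fn: "f (of_nat m) = add_pow R m \<one>" for m by (induct m) (simp_all add: f0 fa f1 add.nat_pow_Suc add.m_comm cl del: of_nat_Suc add: of_nat_Suc)
 have "add_pow R n \<one> \<otimes> f (1 / of_nat n) = \<one>" using fm[of "of_nat n" "1 / of_nat n"] n f1 fn by simp
 then show ?thesis using unit_factor[of "add_pow R n \<one>" "f (1 / of_nat n)"] cl by simp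
qed

text \<open>An algebraic relation over k in the residue field lifts coefficientwise; its leading
  coefficient stays outside \<open>ker 1\<close> because it is a unit.\<close>

lemma residue_iota:
 assumes xi: "\<xi> : carrier C"
 shows "EX p. p ~= [] & set p <= \<iota> ` k & hd p ~= 0{C} & C.eval p \<xi> : ker 1"
proof -
 let ?Q = "R Quot mI" and ?q = "%a. mI +> a"
 interpret mm: ideal mI R by (rule m_ideal)
 interpret Q: cring ?Q by (rule mm.quotient_is_cring[OF is_cring])
 interpret q: ring_hom_ring R ?Q ?q by (rule mm.rcos_ring_hom_ring)
 note co = quotient_cosets[OF is_cring m_ideal]
 obtain r where r: "sq r" "\<xi> = cl r" using xi compl_carrier by blast
 define a where "a = r 1"
 have a: "a : carrier R" using sqD(1)[OF r(1)] by (simp add: a_def)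
 have sub: "subring (?q ` k) ?Q" by (rule q.img_is_subring[OF subfieldE(1)[OF k_subfield]])
 have qa: "?q a : carrier ?Q" using a by simp
 obtain p where p: "p ~= []" "set p <= ?q ` k" "hd p ~= 0{?Q}" "Q.eval p (?q a) = 0{?Q}"
 using residue_algebraic[OF qa] Q.algebraic_list[OF sub qa] by blast
 have kc: "k <= carrier R" by (rule subringE(1)[OF subfieldE(1)[OF k_subfield]])
 have "p : lists (?q ` k)" using p(2) by (simp add: in_lists_conv_set subset_iff)
 then obtain l where l: "set l <= k" "p = map ?q l" unfolding lists_image by (auto simp: in_lists_conv_set)
 have lc: "set l <= carrier R" using l kc by auto
 have ln: "l ~= []" using p l by auto
 have "?q (eval l a) = Q.eval (map ?q l) (?q a)" by (rule q.eval_hom'[OF a lc])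
 also have "... = ?q \<zero>" using p(4) unfolding l(2) co(5) .
 finally have "?q (eval l a) = ?q \<zero>" .
 then have e: "eval l a : mI" using co(6)[OF eval_in_carrier[OF lc a] zero_closed] eval_in_carrier[OF lc a] by (simp add: minus_eq)
 have hk: "hd l : k" using l ln by auto
 have "hd p = ?q (hd l)" using l(2) ln by (simp add: hd_map)
 then have "hd l ~= \<zero>" using p(3) co(5) by metis
 then have "hd l : Units R" using subfield_m_inv[OF k_subfield, of "hd l"] hk kc unfolding Units_def by auto
 then have "hd l ~: mI" using nonunit by blast
 then have "\<iota> (hd l) ~: ker 1" using \<iota>_ker[of "hd l" 1] hk kc Ip_1 by auto
 then have "hd (map \<iota> l) ~= 0{C}" using CF.K_closed(2) ln by (auto simp: hd_map)
 moreover have "C.eval (map \<iota> l) \<xi> : ker 1"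
 proof -
 have mc: "set (map \<iota> l) <= carrier C" using lc by auto
 have "\<xi> -{C} \<iota> a : ker 1"
 unfolding \<iota>_eq r(2) cl_minus(2)[OF r(1) sq_const[OF a]]
 using ker_iff[OF cl_minus(1)[OF r(1) sq_const[OF a]], of 1] a Ip_closed(2) by (simp add: a_def)
 then have "C.eval (map \<iota> l) \<xi> -{C} C.eval (map \<iota> l) (\<iota> a) : ker 1"
 using C.eval_cong_ideal[OF CF.K_ideal mc _ xi] a by simp
 moreover have "C.eval (map \<iota> l) (\<iota> a) = \<iota> (eval l a)" using iota.ring.eval_hom'[OF a lc] by simp
 moreover have "\<iota> (eval l a) : ker 1" using \<iota>_ker[OF eval_in_carrier[OF lc a], of 1] e Ip_1 by simp
 ultimately show ?thesis
 using CF.K_closed(3)[of _ 1] C.minus_rules(2)[OF C.eval_in_carrier[OF mc xi] C.eval_in_carrier[OF mc]] a by fastforce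
 qed
 ultimately show ?thesis using l ln by (intro exI[of _ "map \<iota> l"]) auto
qed

sublocale CS: coeff_setup C ker "\<iota> ` k"
proof (intro coeff_setup.intro coeff_setup_axioms.intro CL.complete_local_axioms)
 have "1{C} ~= 0{C}" using CL.one_K1 CF.K_closed(2) by metis
 then show "subfield (\<iota> ` k) C" by (rule iota.ring.img_is_subfield(2)[OF k_subfield])
 show "add_pow C n 1{C} ~: ker 1" if n: "1 <= n" for n :: nat
 proof -
 have "add_pow C m 1{C} = \<iota> (add_pow R m \<one>)" for m :: nat
 by (induct m) (simp_all add: add.nat_pow_Suc C.add.nat_pow_Suc)
 moreover have "\<iota> (add_pow R n \<one>) ~: ker 1"
 using \<iota>_ker[of "add_pow R n \<one>" 1] nonunit nat_unit[OF n] Ip_1 Units_closed by auto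
 ultimately show ?thesis by simp
 qed
 show "EX p. p ~= [] & set p <= \<iota> ` k & hd p ~= 0{C} & C.eval p \<xi> : ker 1" if "\<xi> : carrier C" for \<xi>
 by (rule residue_iota[OF that])
qed

definition ks :: "(nat => 'a set) set" where
 "ks = {x. C.algebraic (\<iota> ` k) x & (EX L'. subfield L' C & \<iota> ` k <= L' & x : L')}"

definition uh :: "(nat => 'a set) => 'k" where
 "uh f = the_elem (u ` f 1)"

lemmas ks_field = CS.coeff_field[folded ks_def]

sublocale u: ring_hom_cring R F u
 by (intro ring_hom_cring.intro ring_hom_cring_axioms.intro is_cring F.is_cring u_hom)

lemma u_zero_iff: "a : carrier R ==> u a = 0{F} \<longleftrightarrow> a : mI"
 unfolding u_kernel[symmetric] a_kernel_def' by simp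

lemma uh_cl: "sq r ==> uh (cl r) = u (r 1)"
proof -
 assume r: "sq r"
 have rc: "r 1 : carrier R" using sqD(1)[OF r] .
 have "cl r 1 = Ip 1 +> r 1" by (simp add: compl_cl_def)
 then have m: "x : cl r 1 \<longleftrightarrow> x : carrier R & x \<ominus> r 1 : mI" for x using cosets(7)[OF rc, of x 1] Ip_1 by simp
 have "u x = u (r 1)" if "x : cl r 1" for x
 proof -
 have x: "x : carrier R" "x \<ominus> r 1 : mI" using m that by auto
 then have "u x -{F} u (r 1) = 0{F}"
 using u_zero_iff[of "x \<ominus> r 1"] hom_minus[OF ring_axioms F.ring_axioms u_hom x(1) rc] rc by simp
 then show ?thesis using x(1) rc by simp
 qed
 moreover have "r 1 : cl r 1" using m rc ideal_closed(2)[OF m_ideal] by simp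
 ultimately have "u ` cl r 1 = {u (r 1)}" by blast
 then show ?thesis by (simp add: uh_def)
qed

lemma uh_hom: "uh : ring_hom C F"
proof (rule ring_hom_memI)
 show "uh x : carrier F" if "x : carrier C" for x using that uh_cl sqD(1) unfolding compl_carrier by auto
 fix x y assume "x : carrier C" "y : carrier C"
 then obtain r s where rs: "sq r" "x = cl r" "sq s" "y = cl s" unfolding compl_carrier by blast
 then have c: "r 1 : carrier R" "s 1 : carrier R" using sqD(1) by auto
 show "uh (x *{C} y) = uh x *{F} uh y" using rs c by (simp add: cl_mult uh_cl sq_mult)
 show "uh (x +{C} y) = uh x +{F} uh y" using rs c by (simp add: cl_add uh_cl sq_add)
next
 show "uh 1{C} = 1{F}" unfolding cl_one using uh_cl[OF sq_const[OF one_closed]] by simp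
qed

sublocale BC: base_change C F ks uh
 by (intro base_change.intro base_change_axioms.intro C.pcring_axioms F.field_axioms ks_field(1) uh_hom)

abbreviation "T \<equiv> BC.T"

lemma te_hom: "(%a. BC.te (\<iota> a) 1{F}) : ring_hom R T"
 using ring_hom_trans[OF \<iota>_hom BC.te_left_hom] by (simp add: comp_def)

definition J :: "((nat => 'a set) \<times> 'k \<Rightarrow>\<^sub>0 int) set set" where
 "J = idl T ((%a. BC.te (\<iota> a) 1{F}) ` mI)"

lemma te_m_closed: "(%a. BC.te (\<iota> a) 1{F}) ` mI <= carrier T"
 using ring_hom_closed[OF te_hom] ideal_closed(1)[OF m_ideal] by blast

sublocale D: completion_of T J
 by (intro completion_of.intro completion_of_axioms.intro BC.T.pcring_axioms) (simp add: J_def BC.T.idl_ideal[OF te_m_closed])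

text \<open>\<open>\<rho>\<close> and \<open>kp\<close> are the local forms of
  \<open>R_to_Rhat_ku\<close> and \<open>K_to_Rhat_ku\<close>.\<close>

definition \<rho> where "\<rho> a = D.\<iota> (BC.te (\<iota> a) 1{F})"
definition kp where "kp c = D.\<iota> (BC.te 1{C} c)"

lemma rho_hom: "\<rho> : ring_hom R D.C"
 using ring_hom_trans[OF te_hom D.\<iota>_hom] unfolding \<rho>_def comp_def .

lemma kappa_hom: "kp : ring_hom F D.C"
 using ring_hom_trans[OF BC.te_right_hom D.\<iota>_hom] unfolding kp_def comp_def .

lemma rho_closed [simp]: "a : carrier R ==> \<rho> a : carrier D.C"
 by (rule ring_hom_closed[OF rho_hom])

lemma kappa_closed [simp]: "c : carrier F ==> kp c : carrier D.C"
 by (rule ring_hom_closed[OF kappa_hom])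

lemma finite_m_gens: obtains A where "A <= carrier R" "finite A" "mI = Idl A"
 using finetely_gen[OF m_ideal] by blast

lemma J_gens:
 assumes A: "A <= carrier R" "mI = Idl A"
 shows "J = idl T ((%a. BC.te (\<iota> a) 1{F}) ` A)"
proof -
 let ?f = "%a. BC.te (\<iota> a) 1{F}"
 have fA: "?f ` A <= carrier T" using ring_hom_closed[OF te_hom] A(1) by blast
 show ?thesis unfolding J_def
 proof (rule BC.T.idl_eqI[OF te_m_closed fA])
 show "?f ` mI <= idl T (?f ` A)"
 using hom_idl_image[OF is_cring BC.T.is_cring te_hom A(1)] A(2) by blast
 show "?f ` A <= idl T (?f ` mI)"
 using BC.T.idl_mem[OF te_m_closed] idl_mem[OF A(1)] A(2) by blast
 qed
qed

text \<open>As mI is finitely generated, \<open>ker 1\<close> is its extension to the completion, so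
  J may be computed from either.\<close>

lemma J_ker: "J = idl T ((%a. BC.te a 1{F}) ` ker 1)"
proof -
 obtain A where A: "A <= carrier R" "finite A" "mI = Idl A" by (rule finite_m_gens)
 let ?g = "%a. BC.te a 1{F}"
 have k: "ker 1 = idl C (\<iota> ` A)" by (rule ker_idl[OF A(2,1,3)])
 have iA: "\<iota> ` A <= carrier C" using A(1) by auto
 have kc: "?g ` ker 1 <= carrier T" using CF.K_closed(8) BC.te_closed F.one_closed by blast
 have gA: "?g ` \<iota> ` A <= carrier T" using iA by auto
 have "idl T (?g ` ker 1) = idl T (?g ` \<iota> ` A)"
 proof (rule BC.T.idl_eqI[OF kc gA])
 show "?g ` ker 1 <= idl T (?g ` \<iota> ` A)"
 using hom_idl_image[OF C.is_cring BC.T.is_cring BC.te_left_hom iA] k by blast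
 show "?g ` \<iota> ` A <= idl T (?g ` ker 1)"
 using BC.T.idl_mem[OF kc] C.idl_mem[OF iA] k by blast
 qed
 then show ?thesis using J_gens[OF A(1,3)] by (simp add: image_image)
qed

lemma one_notin_J: "1{T} ~: J"
proof
 assume "1{T} : J"
 then have "BC.te 1{C} 1{F} : idl T ((%a. BC.te a 1{F}) ` ker 1)" using J_ker BC.te_one by simp
 then have "1{C} : ker 1" by (rule BC.te_reflect[OF CF.K_ideal C.one_closed])
 then show False using CL.one_K1 by simp
qed

lemma T_residue: "t : carrier T ==> \<exists>c\<in>carrier F. t -{T} BC.te 1{C} c : J"
 unfolding J_ker by (rule BC.residue[OF CF.K_ideal ks_field(2)])

lemma D_Ip_1: "D.Ip 1 = J"
 using BC.T.ipow_1[OF D.I_ideal] by simp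

lemma D_residue:
 assumes x: "x : carrier D.C"
 shows "\<exists>c\<in>carrier F. x -{D.C} kp c : D.ker 1"
proof -
 obtain r where r: "D.sq r" "x = D.cl r" using x D.compl_carrier by blast
 obtain c where c: "c : carrier F" "r 1 -{T} BC.te 1{C} c : J" using T_residue[OF D.sqD(1)[OF r(1)]] by blast
 have tc: "BC.te 1{C} c : carrier T" using c by simp
 note s = D.sq_const[OF tc]
 have "x -{D.C} kp c : D.ker 1"
 unfolding kp_def D.\<iota>_eq r(2) D.cl_minus(2)[OF r(1) s]
 using D.ker_iff[OF D.cl_minus(1)[OF r(1) s], of 1] c(2) D_Ip_1 by simp
 then show ?thesis using c by blast
qed

sublocale DL: complete_local D.C D.ker
proof
 fix x assume x: "x : carrier D.C" "x ~: D.ker 1"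
 \<comment> \<open>Modulo \<open>D.ker 1\<close> every element is a constant from F, here a nonzero
   one; its inverse lifts by completeness.\<close>
 obtain c where c: "c : carrier F" "x -{D.C} kp c : D.ker 1" using D_residue[OF x(1)] by blast
 have "c ~= 0{F}"
 proof
 assume "c = 0{F}"
 then have "kp c = 0{D.C}" using ring_hom_zero[OF kappa_hom F.ring_axioms D.C.ring_axioms] by simp
 then show False using c(2) x by (simp add: D.C.minus_eq)
 qed
 then obtain d where d: "d : carrier F" "c *{F} d = 1{F}"
 using F.field_Units c(1) unfolding Units_def by blast
 have kd: "kp c *{D.C} kp d = 1{D.C}"
 using ring_hom_mult[OF kappa_hom c(1) d(1)] ring_hom_one[OF kappa_hom] d(2) by simp
 define p q where "p = kp c" and "q = kp d"
 have pq: "p : carrier D.C" "q : carrier D.C" using c d by (auto simp: p_def q_def)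
 have "(x -{D.C} p) *{D.C} q = x *{D.C} q -{D.C} p *{D.C} q"
 by (rule D.C.minus_rules(3)[OF x(1) pq])
 then have "x *{D.C} q -{D.C} 1{D.C} : D.ker 1"
 using D.CF.K_closed(6)[OF c(2) pq(2)] kd by (simp add: p_def[symmetric] q_def[symmetric])
 then show "x : Units D.C" using D.CF.unit_mod_K[OF x(1) pq(2)] by simp
next
 show "1{D.C} ~: D.ker 1"
 unfolding D.cl_one using D.ker_iff[OF D.sq_const[OF BC.T.one_closed], of 1] D_Ip_1 one_notin_J by simp
qed

lemma D_max_ideal: "max_ideal D.C = D.ker 1"
proof -
 interpret K: ideal "D.ker 1" D.C by (rule D.CF.K_ideal)
 have mx: "maximalideal (D.ker 1) D.C"
 proof (rule maximalidealI)
 show "ideal (D.ker 1) D.C" by (rule D.CF.K_ideal)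
 show "carrier D.C ~= D.ker 1" using DL.one_K1 by blast
 fix Q assume Q: "ideal Q D.C" "D.ker 1 <= Q" "Q <= carrier D.C"
 show "Q = D.ker 1 \<or> Q = carrier D.C"
 proof (rule ccontr)
 assume n: "\<not> (Q = D.ker 1 \<or> Q = carrier D.C)"
 then obtain x where x: "x : Q" "x ~: D.ker 1" using Q(2) by blast
 then have U: "x : Units D.C" using DL.K1_unit Q(3) by blast
 then have "x *{D.C} inv\<^bsub>D.C\<^esub> x : Q" using D.C.ideal_closed(6)[OF Q(1) x(1)] by blast
 then have "1{D.C} : Q" using U by simp
 then show False using n ideal.one_imp_carrier[OF Q(1)] by blast
 qed
 qed
 show ?thesis unfolding max_ideal_def
 proof (rule the_equality[where P = "%M. maximalideal M D.C"])
 show "maximalideal (D.ker 1) D.C" by (rule mx)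
 fix M assume M: "maximalideal M D.C"
 interpret M: maximalideal M D.C by (rule M)
 have "M <= D.ker 1"
 proof
 fix x assume x: "x : M"
 show "x : D.ker 1"
 proof (rule ccontr)
 assume "x ~: D.ker 1"
 then have U: "x : Units D.C" using DL.K1_unit M.a_subset x by blast
 then have "x *{D.C} inv\<^bsub>D.C\<^esub> x : M" using D.C.ideal_closed(6)[OF M.is_ideal x] by blast
 then have "1{D.C} : M" using U by simp
 then show False using M.one_imp_carrier M.I_notcarr by blast
 qed
 qed
 then have "M = D.ker 1 \<or> D.ker 1 = carrier D.C"
 using M.I_maximal[OF D.CF.K_ideal] D.CF.K_closed(1) by blast
 then show "M = D.ker 1" using DL.one_K1 D.C.one_closed by blast
 qed
qed

lemma D_ker_gens:
 assumes A: "A <= carrier R" "finite A" "mI = Idl A"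
 shows "D.ker 1 = idl D.C (\<rho> ` A)"
proof -
 let ?f = "%a. BC.te (\<iota> a) 1{F}"
 have fA: "?f ` A <= carrier T" using ring_hom_closed[OF te_hom] A(1) by blast
 have "D.ker 1 = idl D.C (D.\<iota> ` ?f ` A)"
 by (rule D.ker_idl) (use fA A(2) J_gens[OF A(1,3)] in auto)
 then show ?thesis by (simp add: image_image \<rho>_def)
qed

text \<open>Three descents in a row: from the completed tensor product to T modulo J^n, from T to
  the completion of R by \<open>te_reflect\<close>, and from there to R modulo mI^n.\<close>

lemma rho_reflect:
 assumes I: "ideal \<bb> R" and z: "z : carrier R"
 and m: "\<rho> z : idl D.C (\<rho> ` \<bb>) <+{D.C} D.ker n"
 shows "z : \<bb> <+> Ip n"
proof -
 let ?f = "%a. BC.te (\<iota> a) 1{F}" and ?g = "%a. BC.te a 1{F}"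
 note bc = ideal_closed[OF I]
 have fb: "?f ` \<bb> <= carrier T" using ring_hom_closed[OF te_hom] bc(1) by blast
 have ib: "\<iota> ` \<bb> <= carrier C" using bc(1) by auto
 have "?f z : idl T (?f ` \<bb>) <+{T} D.Ip n"
 proof (rule D.reflect_step[OF fb])
 show "?f z : carrier T" using z by simp
 show "D.\<iota> (?f z) : idl D.C (D.\<iota> ` ?f ` \<bb>) <+{D.C} D.ker n" using m by (simp add: \<rho>_def image_image)
 qed
 define N where "N = idl C (\<iota> ` \<bb>) <+{C} ker n"
 have N: "ideal N C" unfolding N_def by (rule C.add_ideals[OF C.idl_ideal[OF ib] CF.K_ideal])
 have Ns: "idl C (\<iota> ` \<bb>) <= N" "ker n <= N"
 unfolding N_def by (rule C.add_ideals_sub[OF C.idl_ideal[OF ib] CF.K_ideal])+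
 have gN: "?g ` N <= carrier T" using C.ideal_closed(8)[OF N] BC.te_closed F.one_closed by blast
 note G = BC.T.idl_ideal[OF gN]
 have "?f ` \<bb> <= idl T (?g ` N)"
 using BC.T.idl_mem[OF gN] C.idl_mem[OF ib] Ns(1) by blast
 then have 1: "idl T (?f ` \<bb>) <= idl T (?g ` N)" by (rule BC.T.genideal_minimal[OF G])
 \<comment> \<open>J^n lies in the extension of \<open>ker n\<close>, so \<open>te_reflect\<close>
   can be applied to the single ideal N of the completion of R.\<close>
 have kn: "D.Ip n <= idl T (?g ` ker n)"
 proof (induct n)
 case 0
 have c: "?g ` ker 0 <= carrier T" using CF.K_closed(8) BC.te_closed F.one_closed by blast
 have "?g 1{C} : idl T (?g ` ker 0)" using BC.T.idl_mem[OF c] CF.K_0 by blast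
 then have "1{T} : idl T (?g ` ker 0)" by (simp add: BC.te_one)
 then show ?case using ideal.one_imp_carrier[OF BC.T.idl_ideal[OF c]] by (simp add: BC.T.ipow_0)
 next
 case (Suc n)
 have c: "?g ` ker n <= carrier T" for n using CF.K_closed(8) BC.te_closed F.one_closed by blast
 note cs = c[of "Suc n"]
 have "x *{T} y : idl T (?g ` ker (Suc n))" if xy: "x : D.Ip n" "y : J" for x y
 proof (rule BC.T.idl_mult_mem2[OF BC.T.idl_ideal[OF cs] c c])
 show "x : idl T (?g ` ker n)" "y : idl T (?g ` ker 1)" using Suc xy J_ker by auto
 fix a b assume "a : ?g ` ker n" "b : ?g ` ker 1"
 then obtain a' b' where ab: "a' : ker n" "b' : ker 1" "a = ?g a'" "b = ?g b'" by blast
 have "a *{T} b = ?g (a' *{C} b')" using ab CF.K_closed(8) by (simp add: BC.te_mult)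
 moreover have "a' *{C} b' : ker (Suc n)" using CF.K_mult[OF ab(1,2)] by simp
 ultimately show "a *{T} b : idl T (?g ` ker (Suc n))" using BC.T.idl_mem[OF cs] by blast
 qed
 then show ?case unfolding BC.T.ipow_Suc by (rule BC.T.ideal_prod_minimal[OF BC.T.idl_ideal[OF cs]])
 qed
 have "idl T (?g ` ker n) <= idl T (?g ` N)"
 by (rule BC.T.idl_mono[OF image_mono[OF Ns(2)] gN])
 then have "?f z : idl T (?g ` N)"
 using BC.T.add_ideals_minimal[OF G 1] kn \<open>?f z : idl T (?f ` \<bb>) <+{T} D.Ip n\<close> by blast
 then have "\<iota> z : N" by (rule BC.te_reflect[OF N iota.hom_closed[OF z]])
 then have "z : Idl \<bb> <+> Ip n" unfolding N_def by (rule reflect_step[OF bc(1) z])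
 moreover have "Idl \<bb> = \<bb>" using genideal_minimal[OF I subset_refl] idl_mem[OF bc(1)] by blast
 ultimately show ?thesis by simp
qed

end

context coeff_extension
begin

text \<open>By \<open>filtered_surj\<close> it is enough to reach \<open>D.ker N\<close> modulo
  \<open>D.ker (Suc N)\<close>. That quotient is spanned by the monomials in the images of the
  variables, with coefficients that may be taken constant.\<close>

lemma theta_surj:
 assumes h: "\<theta> : ring_hom (power_series_ring F n) D.C"
 and hc: "!!c. c : carrier F ==> \<theta> (F.indexed_const c) = kp c"
 and gen: "D.ker 1 = idl D.C ((%i. \<theta> (F.indexed_var i)) ` {..<n})"
 and t: "t : carrier D.C"
 shows "\<exists>g\<in>carrier (power_series_ring F n). \<theta> g = t"
proof -
 interpret S: series_over F n by unfold_locales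
 interpret th: ring_hom_cring S.P D.C \<theta>
 by (intro ring_hom_cring.intro ring_hom_cring_axioms.intro S.P.is_cring D.C.is_cring h)
 let ?x = "%i. \<theta> (F.indexed_var i)"
 have xc: "?x ` {..<n} <= carrier D.C" using S.vars_carrier by auto
 have KP_ker: "\<theta> x : D.ker N" if "x : S.KP N" for x N
 proof -
 have "\<theta> x : ideal_power D.C (D.ker 1) N"
 proof (rule hom_ipow[OF S.P.pcring_axioms D.C.pcring_axioms h S.PF.K_ideal D.CF.K_ideal])
 show "\<theta> y : D.ker 1" if y: "y : S.KP 1" for y
 using hom_idl_image[OF S.P.is_cring D.C.is_cring h S.vars_carrier] y S.ker_1 gen by (simp add: image_image)
 show "x : ideal_power S.P (S.KP 1) N" using that S.ker_power S.ker_1 by simp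
 qed
 then show ?thesis using D.ipow_sub_ker[OF D.CF.K_ideal subset_refl] by blast
 qed
 have app: "\<exists>g\<in>S.KP N. d -{D.C} \<theta> g : D.ker (Suc N)" if d: "d : D.ker N" for d N
 proof -
 \<comment> \<open>Closure under multiplication by a ring element a holds because a is a constant
   modulo \<open>D.ker 1\<close>, and \<open>D.ker 1\<close> raises the order.\<close>
 let ?Z = "{t : carrier D.C. \<exists>g\<in>S.KP N. t -{D.C} \<theta> g : D.ker (Suc N)}"
 have Z: "ideal ?Z D.C"
 proof (rule D.C.idealI')
 show "?Z <= carrier D.C" by blast
 have "0{D.C} -{D.C} \<theta> 0{S.P} = 0{D.C}" by (simp add: D.C.minus_eq)
 then show "0{D.C} : ?Z" using S.PF.K_closed(2)[of N] D.CF.K_closed(2)[of "Suc N"] by (auto intro!: bexI[of _ "0{S.P}"])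
 fix x y assume xy: "x : ?Z" "y : ?Z"
 then obtain g h' where g: "g : S.KP N" "x -{D.C} \<theta> g : D.ker (Suc N)" "h' : S.KP N" "y -{D.C} \<theta> h' : D.ker (Suc N)" by blast
 have c: "x : carrier D.C" "y : carrier D.C" "\<theta> g : carrier D.C" "\<theta> h' : carrier D.C"
 using xy g S.PF.K_closed(8) by auto
 have "x +{D.C} y -{D.C} \<theta> (g +{S.P} h') = (x -{D.C} \<theta> g) +{D.C} (y -{D.C} \<theta> h')"
 using c S.PF.K_closed(8)[OF g(1)] S.PF.K_closed(8)[OF g(3)] D.C.minus_add
 by (simp add: D.C.minus_eq D.C.a_ac)
 then have "x +{D.C} y -{D.C} \<theta> (g +{S.P} h') : D.ker (Suc N)"
 using D.CF.K_closed(3)[OF g(2,4)] by simp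
 then show "x +{D.C} y : ?Z" using D.C.a_closed[OF c(1,2)] S.PF.K_closed(3)[OF g(1,3)] by blast
 next
 fix a x assume ax: "a : carrier D.C" "x : ?Z"
 then obtain g where g: "g : S.KP N" "x -{D.C} \<theta> g : D.ker (Suc N)" by blast
 obtain c where c: "c : carrier F" "a -{D.C} kp c : D.ker 1" using D_residue[OF ax(1)] by blast
 define p q where "p = kp c" and "q = \<theta> g"
 have gc: "g : carrier S.P" using S.PF.K_closed(8)[OF g(1)] .
 have pq: "p : carrier D.C" "q : carrier D.C" "x : carrier D.C" using c gc ax by (auto simp: p_def q_def)
 have fc: "F.indexed_const c : carrier S.P" by (rule S.const_closed[OF c(1)])
 have "\<theta> (F.indexed_const c *{S.P} g) = p *{D.C} q" using fc gc hc[OF c(1)] by (simp add: p_def q_def)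
 moreover have "a *{D.C} x -{D.C} p *{D.C} q = a *{D.C} (x -{D.C} q) +{D.C} (a -{D.C} p) *{D.C} q"
 using pq ax(1) by (simp add: D.C.minus_eq D.C.r_distr D.C.l_distr D.C.r_minus D.C.l_minus D.C.a_assoc D.C.r_neg1)
 moreover have "a *{D.C} (x -{D.C} q) : D.ker (Suc N)"
 using D.CF.K_closed(7)[OF g(2) ax(1)] by (simp add: q_def)
 moreover have "(a -{D.C} p) *{D.C} q : D.ker (Suc N)"
 using D.CF.K_mult[OF c(2) KP_ker[OF g(1)]] by (simp add: p_def q_def)
 ultimately have "a *{D.C} x -{D.C} \<theta> (F.indexed_const c *{S.P} g) : D.ker (Suc N)"
 using D.CF.K_closed(3) by simp
 then show "a *{D.C} x : ?Z" using S.PF.K_closed(7)[OF g(1) fc] ax(1) pq(3) by auto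
 qed
 have mon_th: "mon D.C ?x al = \<theta> (mon S.P F.indexed_var al) & mon S.P F.indexed_var al : carrier S.P" if "set_mset al <= {..<n}" for al
 using that
 proof (induct al)
 case (add i al)
 have v: "F.indexed_var j : carrier S.P" if "j \<in># add_mset i al" for j
 using S.vars_carrier add(2) that by auto
 have xv: "?x j : carrier D.C" if "j \<in># add_mset i al" for j using v[OF that] by simp
 have "mon S.P F.indexed_var (add_mset i al) = F.indexed_var i *{S.P} mon S.P F.indexed_var al"
 "mon D.C ?x (add_mset i al) = ?x i *{D.C} mon D.C ?x al"
 by (rule S.P.mon_add_mset[OF v] D.C.mon_add_mset[OF xv]; assumption)+
 then show ?case using add v[of i] by simp
 qed auto
 have "ideal_power D.C (D.ker 1) N = idl D.C (mon D.C ?x ` multisets_of_size {..<n} N)"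
 unfolding gen by (rule D.C.ipow_idl[OF xc])
 moreover have "mon D.C ?x ` multisets_of_size {..<n} N <= ?Z"
 proof
 fix m assume "m : mon D.C ?x ` multisets_of_size {..<n} N"
 then obtain al where al: "m = mon D.C ?x al" "set_mset al <= {..<n}" "size al = N"
 by (auto simp: multisets_of_size_def)
 have 1: "m = \<theta> (mon S.P F.indexed_var al)" "mon S.P F.indexed_var al : carrier S.P" using mon_th[OF al(2)] al(1) by auto
 have "mon S.P F.indexed_var al : ideal_power S.P (idl S.P S.Xs) N"
 unfolding S.P.ipow_idl[OF S.vars_carrier]
 proof (rule S.P.idl_mem)
 show "mon S.P F.indexed_var ` multisets_of_size {..<n} N <= carrier S.P"
 using mon_th by (auto simp: multisets_of_size_def)
 show "mon S.P F.indexed_var al : mon S.P F.indexed_var ` multisets_of_size {..<n} N"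
 using al by (auto simp: multisets_of_size_def)
 qed
 then have "mon S.P F.indexed_var al : S.KP N" by (simp add: S.ker_power)
 moreover have "m -{D.C} \<theta> (mon S.P F.indexed_var al) : D.ker (Suc N)" using 1 D.CF.K_closed(2) by simp
 moreover have "m : carrier D.C" using 1 by simp
 ultimately show "m : ?Z" by blast
 qed
 ultimately have MZ: "ideal_power D.C (D.ker 1) N <= ?Z" using D.C.genideal_minimal[OF Z] by simp
 obtain r where r: "D.sq r" "d = D.cl r" "r N : D.Ip N" by (rule D.kerE[OF d])
 \<comment> \<open>An element of T with the same class modulo \<open>D.ker (Suc N)\<close>; it lies
   in J^N, so its image lies in the N-th power of \<open>D.ker 1\<close>.\<close>
 let ?j = "r (Suc N)"
 have rc: "r N : carrier T" "?j : carrier T" using D.sqD(1)[OF r(1)] by auto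
 have "(?j -{T} r N) +{T} r N : D.Ip N" by (rule D.Ip_closed(3)[OF D.sqD(2)[OF r(1)] r(3)])
 then have j: "?j : D.Ip N" using BC.T.minus_rules(2)[OF rc(2,1)] by simp
 have "D.\<iota> ?j : ideal_power D.C (D.ker 1) N"
 proof (rule hom_ipow[OF BC.T.pcring_axioms D.C.pcring_axioms D.\<iota>_hom D.I_ideal D.CF.K_ideal _ j])
 show "D.\<iota> x : D.ker 1" if "x : J" for x
 using D.\<iota>_ker[of x 1] that D_Ip_1 BC.T.ideal_closed(8)[OF D.I_ideal] by simp
 qed
 then obtain g where g: "g : S.KP N" "D.\<iota> ?j -{D.C} \<theta> g : D.ker (Suc N)" using MZ by blast
 have "d -{D.C} D.\<iota> ?j : D.ker (Suc N)"
 unfolding D.\<iota>_eq r(2) D.cl_minus(2)[OF r(1) D.sq_const[OF rc(2)]]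
 using D.ker_iff[OF D.cl_minus(1)[OF r(1) D.sq_const[OF rc(2)]], of "Suc N"] rc D.Ip_closed(2) by simp
 then have "(d -{D.C} D.\<iota> ?j) +{D.C} (D.\<iota> ?j -{D.C} \<theta> g) : D.ker (Suc N)" using D.CF.K_closed(3) g(2) by blast
 moreover have "(d -{D.C} D.\<iota> ?j) +{D.C} (D.\<iota> ?j -{D.C} \<theta> g) = d -{D.C} \<theta> g"
 proof -
 have c: "d : carrier D.C" "D.\<iota> ?j : carrier D.C" "\<theta> g : carrier D.C"
 using D.CF.K_closed(8)[OF d] ring_hom_closed[OF D.\<iota>_hom rc(2)] S.PF.K_closed(8)[OF g(1)] by auto
 then show ?thesis by (simp add: D.C.minus_eq D.C.a_assoc D.C.r_neg1)
 qed
 ultimately show ?thesis using g(1) by auto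
 qed
 show ?thesis
 by (rule filtered_surj[OF S.PF.complete_filtered_axioms D.CF.complete_filtered_axioms h KP_ker app t])
qed

end

section \<open>Presentations of regular rings\<close>

lemma hom_set_add:
 assumes "h : ring_hom R S" "I <= carrier R" "J <= carrier R" "!!x. x : I ==> h x : I'" "!!x. x : J ==> h x : J'" "x : I <+{R} J"
 shows "h x : I' <+{S} J'"
proof -
 obtain a b where ab: "a : I" "b : J" "x = a +{R} b" using assms(6) unfolding mem_set_add_iff by blast
 then have "h x = h a +{S} h b" using ring_hom_add[OF assms(1)] assms(2,3) by blast
 then show ?thesis unfolding mem_set_add_iff using assms(4,5) ab by blast
qed

lemma hom_surj_idl:
 assumes R: "cring R" and S: "cring S" and h: "h : ring_hom R S" and A: "A <= carrier R"
 and surj: "!!t. t : carrier S ==> \<exists>x\<in>carrier R. h x = t" and t: "t : idl S (h ` A)"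
 shows "\<exists>g\<in>idl R A. h g = t"
proof -
 interpret R: cring R by fact
 interpret S: cring S by fact
 note Q = R.ideal_closed[OF R.idl_ideal[OF A]]
 let ?Z = "h ` idl R A"
 have "ideal ?Z S"
 proof (rule S.idealI')
 show "?Z <= carrier S" using Q(1) ring_hom_closed[OF h] by blast
 show "0{S} : ?Z" using Q(2) ring_hom_zero[OF h R.ring_axioms S.ring_axioms] by (metis imageI)
 show "x +{S} y : ?Z" if xy: "x : ?Z" "y : ?Z" for x y
 proof -
 obtain a b where "a : idl R A" "b : idl R A" "x = h a" "y = h b" using xy by blast
 then show ?thesis using ring_hom_add[OF h] Q(3,8) by (metis imageI)
 qed
 show "a *{S} x : ?Z" if ax: "a : carrier S" "x : ?Z" for a x
 proof -
 obtain b c where "b : idl R A" "c : carrier R" "x = h b" "a = h c" using ax surj[OF ax(1)] by blast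
 then show ?thesis using ring_hom_mult[OF h] Q(7,8) by (metis imageI)
 qed
 qed
 moreover have "h ` A <= ?Z" using R.idl_mem[OF A] by blast
 ultimately have "idl S (h ` A) <= ?Z" by (rule S.genideal_minimal)
 then show ?thesis using t by blast
qed

section \<open>Exchange of generators in a local ring\<close>

context cring
begin

lemma unit_solve:
 assumes "r : Units R" "a : carrier R" "x = a \<otimes> r \<oplus> w" "w : carrier R"
 shows "a = (x \<ominus> w) \<otimes> inv r"
proof -
 have c: "r : carrier R" "inv r : carrier R" "r \<otimes> inv r = \<one>" using assms(1) by auto
 have "(x \<ominus> w) \<otimes> inv r = (a \<otimes> r) \<otimes> inv r" unfolding assms(3) using assms(2,4) c(1) by (simp add: minus_eq a_assoc r_neg)
 then show ?thesis using assms(2) c by (simp add: m_assoc)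
qed

text \<open>Steinitz exchange over a local ring: if all coefficients of x at U lie in the maximal
  ideal, then x lies in Z; otherwise a unit coefficient allows its generator to be replaced by
  x.\<close>

lemma exchange:
 assumes Q: "max_gen R Q" and Z: "ideal Z R" "h ` W <= Z"
 and U: "finite U" "W \<inter> U = {}" "h ` (W Un U) <= carrier R" "!!v q. v : U ==> q : Q ==> h v \<otimes> q : Z"
 and x: "x : Idl (h ` (W Un U))"
 shows "x : Z \<or> (\<exists>v\<in>U. h v : Idl (insert x (h ` (W Un U - {v}))))"
 using U x
proof (induct U arbitrary: x)
 case empty
 then show ?case using genideal_minimal[OF Z] by auto
next
 case (insert v U)
 note Zc = ideal_closed[OF Z(1)]
 have vc: "h v : carrier R" and hc: "h ` (W Un U) <= carrier R" using insert(5) by auto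
 have vn: "v ~: W" "v ~: U" using insert(2,4) by auto
 have im: "h ` (W Un insert v U) = insert (h v) (h ` (W Un U))" by auto
 obtain r w where rw: "r : carrier R" "w : Idl (h ` (W Un U))" "x = h v \<otimes> r \<oplus> w"
 using insert(7) idl_insert[OF vc hc] unfolding im by blast
 have wc: "w : carrier R" using rw(2) idl_carrier[OF hc] by blast
 have xc: "x : carrier R" using rw vc wc by simp
 show ?case
 proof (cases "r : Q")
 case False
 then have U: "r : Units R" using Q rw(1) by (auto simp: max_gen_def)
 let ?B = "insert x (h ` (W Un U))"
 have Bc: "?B <= carrier R" using xc hc by simp
 note I = ideal_closed[OF idl_ideal[OF Bc]]
 have "w : Idl ?B" using rw(2) idl_mono[OF _ Bc] by blast
 then have "(x \<ominus> w) \<otimes> inv r : Idl ?B" using I(4,6) idl_mem[OF Bc, of x] U by simp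
 then have "h v : Idl ?B" using unit_solve[OF U vc rw(3) wc] by simp
 moreover have "W Un insert v U - {v} = W Un U" using vn by auto
 ultimately show ?thesis by auto
 next
 case True
 then have hr: "h v \<otimes> r : Z" using insert(6) by simp
 have "w : Z \<or> (\<exists>v\<in>U. h v : Idl (insert w (h ` (W Un U - {v}))))"
 using insert(3)[OF _ hc _ rw(2)] insert(4,6) by simp
 then show ?thesis
 proof
 assume "w : Z"
 then show ?thesis using Zc(3)[OF hr] rw(3) by simp
 next
 assume "\<exists>v\<in>U. h v : Idl (insert w (h ` (W Un U - {v})))"
 then obtain v' where v': "v' : U" "h v' : Idl (insert w (h ` (W Un U - {v'})))" by blast
 let ?B = "insert x (h ` (W Un insert v U - {v'}))"
 have Bc: "?B <= carrier R" using xc insert(5) by auto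
 note I = ideal_closed[OF idl_ideal[OF Bc]]
 have "v : W Un insert v U - {v'}" using v'(1) vn by auto
 then have "h v : Idl ?B" using idl_mem[OF Bc] by blast
 then have "x \<ominus> h v \<otimes> r : Idl ?B" using I(4,6) idl_mem[OF Bc, of x] rw(1) by simp
 moreover have "x \<ominus> h v \<otimes> r = w" unfolding rw(3) using minus_rules(1)[OF _ wc] vc rw(1) by simp
 moreover have "h ` (W Un U - {v'}) <= Idl ?B" using idl_mem[OF Bc] by auto
 ultimately have "Idl (insert w (h ` (W Un U - {v'}))) <= Idl ?B"
 by (intro genideal_minimal[OF idl_ideal[OF Bc]]) simp
 then show ?thesis using v' by blast
 qed
 qed
qed

text \<open>Terms with coefficient in Q are absorbed into Z. The least al with a unit coefficient is
  solved for, and after the absorption only f and larger terms remain.\<close>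

lemma leading_term:
 fixes g :: "'i::linorder => 'a"
 assumes Q: "max_gen R Q" and Z: "ideal Z R"
 and M: "finite M" "g ` M <= carrier R" "!!al q. al : M ==> q : Q ==> g al \<otimes> q : Z"
 and f: "f : carrier R" "f : Idl (g ` M) <+> Z"
 shows "f : Z \<or> (\<exists>al\<in>M. g al : Idl (insert f (g ` {bt : M. al < bt})) <+> Z)"
 using M f
proof (induct M arbitrary: f rule: finite_linorder_min_induct)
 case empty
 have "{\<zero>} <+> Z <= Z" by (rule add_ideals_minimal[OF Z]) (use ideal_closed(2)[OF Z] in auto)
 then show ?case using empty idl_empty by auto
next
 case (insert a M)
 note Zc = ideal_closed[OF Z]
 have ac: "g a : carrier R" and gc: "g ` M <= carrier R" using insert(4) by auto
 obtain b z where bz: "b : Idl (insert (g a) (g ` M))" "z : Z" "f = b \<oplus> z"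
 using insert(7) unfolding mem_set_add_iff by auto
 obtain r w where rw: "r : carrier R" "w : Idl (g ` M)" "b = g a \<otimes> r \<oplus> w"
 using bz(1) idl_insert[OF ac gc] by blast
 have c: "w : carrier R" "z : carrier R" using rw(2) idl_carrier[OF gc] bz(2) Zc(8) by blast+
 have fe: "f = g a \<otimes> r \<oplus> (w \<oplus> z)" unfolding bz(3) rw(3) using ac rw(1) c by (simp add: a_assoc)
 show ?case
 proof (cases "r : Q")
 case False
 then have U: "r : Units R" using Q rw(1) by (auto simp: max_gen_def)
 let ?B = "insert f (g ` M)"
 have Bc: "?B <= carrier R" using insert(6) gc by simp
 note S = ideal_closed[OF add_ideals[OF idl_ideal[OF Bc] Z]]
 note sub = add_ideals_sub[OF idl_ideal[OF Bc] Z]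
 have "w : Idl ?B" using rw(2) idl_mono[OF _ Bc] by blast
 then have "w \<oplus> z : Idl ?B <+> Z" using S(3) sub bz(2) by blast
 moreover have "f : Idl ?B <+> Z" using sub idl_mem[OF Bc] by blast
 ultimately have "(f \<ominus> (w \<oplus> z)) \<otimes> inv r : Idl ?B <+> Z" using S(4,6) U by simp
 then have "g a : Idl ?B <+> Z" using unit_solve[OF U ac fe] c by simp
 moreover have "{bt : insert a M. a < bt} = M" using insert(2) by auto
 ultimately show ?thesis by auto
 next
 case True
 then have hr: "g a \<otimes> r : Z" using insert(5) by simp
 have wM: "w : Idl (g ` M) <+> Z" using add_ideals_sub(1)[OF idl_ideal[OF gc] Z] rw(2) by blast
 have "w : Z \<or> (\<exists>al\<in>M. g al : Idl (insert w (g ` {bt : M. al < bt})) <+> Z)"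
 using insert(3)[OF gc _ c(1) wM] insert(5) by simp
 then show ?thesis
 proof
 assume "w : Z"
 then show ?thesis using Zc(3) hr bz(2) fe by simp
 next
 assume "\<exists>al\<in>M. g al : Idl (insert w (g ` {bt : M. al < bt})) <+> Z"
 then obtain al where al: "al : M" "g al : Idl (insert w (g ` {bt : M. al < bt})) <+> Z" by blast
 let ?B = "insert f (g ` {bt : insert a M. al < bt})"
 have Bc: "?B <= carrier R" using insert(4,6) by auto
 note S = ideal_closed[OF add_ideals[OF idl_ideal[OF Bc] Z]]
 note sub = add_ideals_sub[OF idl_ideal[OF Bc] Z]
 have "f \<ominus> (g a \<otimes> r \<oplus> z) : Idl ?B <+> Z" using S(4) sub idl_mem[OF Bc, of f] Zc(3)[OF hr bz(2)] by blast
 moreover have "f \<ominus> (g a \<otimes> r \<oplus> z) = w"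
 proof -
 have "f = (g a \<otimes> r \<oplus> z) \<oplus> w" unfolding fe using ac rw(1) c by (simp add: a_ac)
 then show ?thesis using minus_rules(1)[of "g a \<otimes> r \<oplus> z" w] ac rw(1) c by simp
 qed
 moreover have "g ` {bt : M. al < bt} <= Idl ?B <+> Z" using sub idl_mem[OF Bc] by blast
 ultimately have "Idl (insert w (g ` {bt : M. al < bt})) <= Idl ?B <+> Z"
 by (intro genideal_minimal[OF add_ideals[OF idl_ideal[OF Bc] Z]]) simp
 then have "g al : Idl ?B <+> Z" using add_ideals_minimal[OF add_ideals[OF idl_ideal[OF Bc] Z] _ sub(2)] al(2) by blast
 then show ?thesis using al(1) by blast
 qed
 qed
qed

end

lemma (in series_over) ker_max_gen:
 assumes "field L" shows "max_gen P (KP 1)"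
proof -
 interpret field L by fact
 have "f : Units P" if f: "f : carrier P" "f ~: KP 1" for f
 proof (rule series_unit[OF f(1)])
 have "f {#} ~= \<zero>" using f by (auto simp: series_ker_def)
 then show "f {#} : Units L" using f(1) field_Units by (auto simp: series_carrier)
 qed
 then show ?thesis unfolding max_gen_def using PF.K_ideal one_notin_ker one_not_zero by auto
qed

section \<open>The cover of the extended completion by power series\<close>

locale hull_cover = coeff_extension +
 fixes n :: nat and \<theta>
 assumes th_hom: "\<theta> : ring_hom (power_series_ring F n) D.C"
 and th_const: "c : carrier F ==> \<theta> (F.indexed_const c) = kp c"
 and th_gens: "D.ker 1 = idl D.C ((%i. \<theta> (F.indexed_var i)) ` {..<n})"
begin

sublocale S: series_over F n
 by (intro series_over.intro pcring.intro F.is_cring)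

sublocale th: ring_hom_cring S.P D.C \<theta>
 by (intro ring_hom_cring.intro ring_hom_cring_axioms.intro S.P.is_cring D.C.is_cring th_hom)

lemma th_surj: "t : carrier D.C ==> \<exists>g\<in>carrier S.P. \<theta> g = t"
 by (rule theta_surj[OF th_hom th_const th_gens])

lemma th_ker: "x : S.KP N ==> \<theta> x : D.ker N"
proof -
 assume x: "x : S.KP N"
 have "\<theta> x : ideal_power D.C (D.ker 1) N"
 proof (rule hom_ipow[OF S.P.pcring_axioms D.C.pcring_axioms th_hom S.PF.K_ideal D.CF.K_ideal])
 show "\<theta> y : D.ker 1" if y: "y : S.KP 1" for y
 using hom_idl_image[OF S.P.is_cring D.C.is_cring th_hom S.vars_carrier] y S.ker_1 th_gens by (simp add: image_image)
 show "x : ideal_power S.P (S.KP 1) N" using x S.ker_power S.ker_1 by simp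
 qed
 then show ?thesis using D.ipow_sub_ker[OF D.CF.K_ideal subset_refl] by blast
qed

lemma S_max_gen: "max_gen S.P (S.KP 1)"
 by (rule S.ker_max_gen[OF F.field_axioms])

lemma th_ker_1_iff: "x : carrier S.P ==> \<theta> x : D.ker 1 ==> x : S.KP 1"
proof (rule ccontr)
 assume x: "x : carrier S.P" "\<theta> x : D.ker 1" "x ~: S.KP 1"
 then have U: "x : Units S.P" using S_max_gen by (auto simp: max_gen_def)
 then have "\<theta> x *{D.C} \<theta> (inv\<^bsub>S.P\<^esub> x) = 1{D.C}"
 using ring_hom_mult[OF th_hom x(1), of "inv\<^bsub>S.P\<^esub> x"] by simp
 then have "1{D.C} : D.ker 1" using D.CF.K_closed(6)[OF x(2), of "\<theta> (inv\<^bsub>S.P\<^esub> x)"] U by simp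
 then show False using DL.one_K1 by simp
qed

lemma rho_m: "a : mI ==> \<rho> a : D.ker 1"
proof -
 assume a: "a : mI"
 obtain A where A: "A <= carrier R" "finite A" "mI = Idl A" by (rule finite_m_gens)
 show ?thesis using hom_idl_image[OF is_cring D.C.is_cring rho_hom A(1)] a A D_ker_gens[OF A] by blast
qed

text \<open>The lifts f_i of the minimal generators y_i are exchanged for variables one at a time.
  The exchange can fail only if f_j lies in the ideal of the earlier lifts modulo order 2.\<close>

lemma exchange_step:
 assumes y: "y ` {..<d} <= carrier R" "mI = Idl (y ` {..<d})"
 and min: "!!A'. A' <= carrier R ==> finite A' ==> mI = Idl A' ==> d <= card A'"
 and f: "!!i. i < d ==> f i : carrier S.P" "!!i. i < d ==> \<theta> (f i) = \<rho> (y i)"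
 shows "j <= d ==> \<exists>\<sigma> h. inj_on \<sigma> {..<j} & \<sigma> ` {..<j} <= {..<n} & h ` {..<n} <= carrier S.P &
 idl S.P (h ` {..<n}) = S.KP 1 & (\<forall>i<j. h (\<sigma> i) = f i)"
proof (induct j)
 case 0
 show ?case using S.vars_carrier S.ker_1 by (intro exI[of _ "%i. i"] exI[of _ F.indexed_var]) auto
next
 case (Suc j)
 then have j: "j < d" by simp
 from Suc obtain \<sigma> h where h: "inj_on \<sigma> {..<j}" "\<sigma> ` {..<j} <= {..<n}" "h ` {..<n} <= carrier S.P"
 "idl S.P (h ` {..<n}) = S.KP 1" "!!i. i < j ==> h (\<sigma> i) = f i" by auto
 define W where "W = \<sigma> ` {..<j}"
 define V where "V = {..<n} - W"
 have WV: "W Un V = {..<n}" "W \<inter> V = {}" "finite V" using h(2) by (auto simp: W_def V_def)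
 have yj: "y j : carrier R" "y j : mI" using y j idl_mem[OF y(1)] by auto
 have hW: "h ` W <= carrier S.P" using h(3) WV by auto
 have hWf: "h ` W = f ` {..<j}" using h(5) by (auto simp: W_def image_iff)
 define Z where "Z = idl S.P (h ` W) <+{S.P} S.KP 2"
 have Z: "ideal Z S.P" unfolding Z_def by (rule S.P.add_ideals[OF S.P.idl_ideal[OF hW] S.PF.K_ideal])
 have Zs: "idl S.P (h ` W) <= Z" "S.KP 2 <= Z" unfolding Z_def by (rule S.P.add_ideals_sub[OF S.P.idl_ideal[OF hW] S.PF.K_ideal])+
 have hK: "h v : S.KP 1" if "v < n" for v using S.P.idl_mem[OF h(3)] h(4) that by auto
 have fK: "f j : S.KP 1" using th_ker_1_iff f[OF j] rho_m[OF yj(2)] by simp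
 have "f j : Z \<or> (\<exists>v\<in>V. h v : idl S.P (insert (f j) (h ` (W Un V - {v}))))"
 proof (rule S.P.exchange[OF S_max_gen Z _ WV(3,2)])
 show "h ` W <= Z" using S.P.idl_mem[OF hW] Zs by blast
 show "h ` (W Un V) <= carrier S.P" using h(3) WV by simp
 show "f j : idl S.P (h ` (W Un V))" using fK h(4) WV by simp
 show "h v *{S.P} q : Z" if "v : V" "q : S.KP 1" for v q
 proof -
 have "v < n" using that(1) WV(1) by auto
 then have "h v *{S.P} q : S.KP (1 + 1)" using S.PF.K_mult[OF hK that(2)] by blast
 then show ?thesis using Zs(2) by (metis one_add_one subsetD)
 qed
 qed
 then show ?case
 proof
 \<comment> \<open>Through \<theta> and \<open>rho_reflect\<close> this puts y_j into the ideal of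
   the earlier y_i modulo mI^2; Nakayama then removes y_j from the generators, against
   minimality.\<close>
 assume fZ: "f j : Z"
 define \<bb> where "\<bb> = Idl (y ` {..<j})"
 have yjc: "y ` {..<j} <= carrier R" using y(1) j by auto
 have b: "ideal \<bb> R" unfolding \<bb>_def by (rule idl_ideal[OF yjc])
 note bc = ideal_closed[OF b]
 have rb: "\<rho> ` \<bb> <= carrier D.C" using bc(1) by auto
 have "\<theta> (f j) : idl D.C (\<rho> ` \<bb>) <+{D.C} D.ker 2"
 proof (rule hom_set_add[OF th_hom S.P.idl_carrier[OF hW] S.PF.K_closed(1) _ th_ker fZ[unfolded Z_def]])
 fix x assume "x : idl S.P (h ` W)"
 then have 1: "\<theta> x : idl D.C (\<theta> ` h ` W)" by (rule hom_idl_image[OF S.P.is_cring D.C.is_cring th_hom hW])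
 have "\<theta> ` h ` W = \<rho> ` y ` {..<j}" unfolding hWf image_image using f(2) j by (intro image_cong) auto
 moreover have "\<rho> ` y ` {..<j} <= \<rho> ` \<bb>" unfolding \<bb>_def using idl_mem[OF yjc] by (intro image_mono subsetI)
 then have "idl D.C (\<rho> ` y ` {..<j}) <= idl D.C (\<rho> ` \<bb>)" by (rule D.C.idl_mono[OF _ rb])
 ultimately show "\<theta> x : idl D.C (\<rho> ` \<bb>)" using 1 by (simp only: subsetD)
 qed
 then have "y j : \<bb> <+> Ip 2" using rho_reflect[OF b yj(1)] f(2)[OF j] by simp
 then have yjm: "y j : \<bb> <+> mI \<cdot> mI" using ipow_1[OF m_ideal] by (simp add: numeral_2_eq_2 ipow_Suc ipow_0)
 let ?A = "y ` ({..<d} - {j})"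
 have Ac: "?A <= carrier R" using y(1) by auto
 note mmi = ideal_prod_is_ideal[OF m_ideal m_ideal]
 note sub = add_ideals_sub[OF idl_ideal[OF Ac] mmi]
 have "y ` {..<j} <= ?A" using j by auto
 then have "\<bb> <= Idl ?A" unfolding \<bb>_def by (rule idl_mono[OF _ Ac])
 then have "y j : Idl ?A <+> mI \<cdot> mI" using set_add_mono yjm by blast
 moreover have "y i : Idl ?A <+> mI \<cdot> mI" if "i < d" "i ~= j" for i using sub(1) idl_mem[OF Ac] that by blast
 ultimately have "y ` {..<d} <= Idl ?A <+> mI \<cdot> mI" by blast
 then have "mI <= Idl ?A <+> mI \<cdot> mI" using genideal_minimal[OF add_ideals[OF idl_ideal[OF Ac] mmi]] y(2) by blast
 then have "mI <= Idl ?A" by (rule nakayama[OF m_ideal idl_ideal[OF Ac]])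
 moreover have "?A <= y ` {..<d}" by blast
 then have "Idl ?A <= mI" unfolding y(2) by (rule idl_mono[OF _ y(1)])
 ultimately have "d <= card ?A" using min[OF Ac] by auto
 moreover have "card ?A <= card ({..<d} - {j})" by (rule card_image_le) simp
 ultimately show ?case using j by simp
 next
 assume "\<exists>v\<in>V. h v : idl S.P (insert (f j) (h ` (W Un V - {v})))"
 then obtain v where v: "v : V" "h v : idl S.P (insert (f j) (h ` ({..<n} - {v})))" using WV(1) by auto
 have vn: "v < n" "v ~: W" using v(1) by (auto simp: V_def)
 let ?h = "h(v := f j)" and ?s = "\<sigma>(j := v)"
 have im: "?h ` {..<n} = insert (f j) (h ` ({..<n} - {v}))" using vn by auto
 have hc: "?h ` {..<n} <= carrier S.P" unfolding im using h(3) f(1)[OF j] by auto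
 have e1: "idl S.P (?h ` {..<n}) = S.KP 1"
 unfolding h(4)[symmetric]
 proof (rule S.P.idl_eqI[OF hc h(3)])
 show "?h ` {..<n} <= idl S.P (h ` {..<n})" unfolding im using fK h(4) S.P.idl_mem[OF h(3)] by auto
 show "h ` {..<n} <= idl S.P (?h ` {..<n})"
 proof
 fix z assume "z : h ` {..<n}"
 then obtain i where i: "i < n" "z = h i" by auto
 show "z : idl S.P (?h ` {..<n})"
 proof (cases "i = v")
 case True
 then show ?thesis unfolding im using v(2) i by simp
 next
 case False
 then have "z : ?h ` {..<n}" unfolding im using i by auto
 then show ?thesis by (rule S.P.idl_mem[OF hc])
 qed
 qed
 qed
 have e2: "inj_on ?s {..<Suc j}" and e3: "?s ` {..<Suc j} <= {..<n}"
 using h(1,2) vn unfolding W_def by (auto simp: inj_on_def lessThan_Suc image_iff)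
 have e4: "\<forall>i<Suc j. ?h (?s i) = f i"
 using h(5) vn(2) unfolding W_def by (auto simp: less_Suc_eq)
 show ?case by (rule exI[of _ ?s], rule exI[of _ ?h]) (intro conjI e1 e2 e3 e4 hc)
 qed
qed

lemma kernel_ideal: "ideal (a_kernel S.P D.C \<theta>) S.P"
 by (rule th.ring.kernel_is_ideal)

lemma kernel_iff: "x : a_kernel S.P D.C \<theta> \<longleftrightarrow> x : carrier S.P & \<theta> x = 0{D.C}"
 unfolding a_kernel_def' by blast

text \<open>The parameter system given by the chain of primes makes the kernel of \<open>\<theta>\<close> part of a regular
 system of parameters of the power series ring.\<close>
theorem regular_presentation:
 assumes y: "y ` {..<d} <= carrier R" "mI = Idl (y ` {..<d})"
 and min: "!!A'. A' <= carrier R ==> finite A' ==> mI = Idl A' ==> d <= card A'"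
 and chain: "!!i. i <= d ==> primeideal (Q i) R" "!!i. i < d ==> Q i \<subset> Q (Suc i)"
 shows "EX h E. E <= {..<n} & h ` {..<n} <= carrier S.P & idl S.P (h ` {..<n}) = S.KP 1 &
 a_kernel S.P D.C \<theta> = idl S.P (h ` E)"
proof -
 have ym: "y i : carrier R" "y i : mI" if "i < d" for i using y that idl_mem[OF y(1)] by auto
 have "EX g. g : carrier S.P & \<theta> g = \<rho> (y i)" if "i < d" for i
 using th_surj[of "\<rho> (y i)"] ym(1)[OF that] by auto
 then obtain f where f: "!!i. i < d ==> f i : carrier S.P" "!!i. i < d ==> \<theta> (f i) = \<rho> (y i)" by metis
 have "\<exists>\<sigma> h. inj_on \<sigma> {..<d} & \<sigma> ` {..<d} <= {..<n} & h ` {..<n} <= carrier S.P &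
 idl S.P (h ` {..<n}) = S.KP 1 & (\<forall>i<d. h (\<sigma> i) = f i)"
 by (rule exchange_step[OF y min f order_refl])
 then obtain \<sigma> h0 where sh: "inj_on \<sigma> {..<d} & \<sigma> ` {..<d} <= {..<n} & h0 ` {..<n} <= carrier S.P &
 idl S.P (h0 ` {..<n}) = S.KP 1 & (\<forall>i<d. h0 (\<sigma> i) = f i)" by (elim exE)
 note sh1 = sh[THEN conjunct2]
 note sh2 = sh1[THEN conjunct2]
 note sh3 = sh2[THEN conjunct2]
 note h0 = sh[THEN conjunct1] sh1[THEN conjunct1] sh2[THEN conjunct1] sh3[THEN conjunct1] sh3[THEN conjunct2, rule_format]
 define Y where "Y = \<sigma> ` {..<d}"
 define E where "E = {..<n} - Y"
 \<comment> \<open>y reindexed along \<sigma>, so that the generators of mI and the parameters of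
   the power series ring share the index set Y.\<close>
 define y' where "y' = (%v. y (inv_into {..<d} \<sigma> v))"
 have YE: "Y <= {..<n}" "Y Un E = {..<n}" "finite Y" "finite E" "Y \<inter> E = {}" using h0(2) by (auto simp: Y_def E_def)
 have y's: "y' (\<sigma> i) = y i" if "i < d" for i using h0(1) that by (simp add: y'_def)
 then have yY: "y' ` Y = y ` {..<d}" unfolding Y_def image_image by (intro image_cong) auto
 have cY: "card Y = d" using card_image[OF h0(1)] by (simp add: Y_def)
 have thY: "\<theta> (h0 v) = \<rho> (y' v)" if "v : Y" for v using that h0(5) f(2) y's by (auto simp: Y_def)
 have yc': "y' ` Y <= carrier R" "mI = Idl (y' ` Y)" using yY y by simp_all
 interpret G: noeth_local_gens R mI y' Y
 by (intro noeth_local_gens.intro noeth_local_gens_axioms.intro noeth_local_axioms YE(3) yc')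
 have qr: "G.mm bt ~: G.upper bt" if "set_mset bt <= Y" for bt
 by (rule G.chain_imp_quasi_regular[of Q]) (use chain cY that in auto)
 have hcY: "h0 ` Y <= carrier S.P" using h0(3) YE by auto
 have kY: "D.ker 1 = idl D.C (\<theta> ` h0 ` Y)"
 proof -
 have "\<theta> ` h0 ` Y = \<rho> ` y' ` Y" unfolding image_image using thY by (rule image_cong[OF refl])
 then show ?thesis using D_ker_gens[OF yc'(1) _ yc'(2)] YE(3) by simp
 qed
 \<comment> \<open>The parameters at Y already map onto generators of the maximal ideal, so each
   remaining h0 v can be corrected by some g v from their ideal to lie in the kernel.\<close>
 have "\<exists>g\<in>idl S.P (h0 ` Y). \<theta> g = \<theta> (h0 v)" if v: "v < n" for v
 proof -
 have "h0 v : S.KP 1" using S.P.idl_mem[OF h0(3)] h0(4) v by auto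
 then have "\<theta> (h0 v) : idl D.C (\<theta> ` h0 ` Y)" using th_ker kY by auto
 show ?thesis
 proof (rule hom_surj_idl[OF S.P.is_cring D.C.is_cring th_hom hcY])
 show "\<exists>x\<in>carrier S.P. \<theta> x = t" if "t : carrier D.C" for t by (rule th_surj[OF that])
 show "\<theta> (h0 v) : idl D.C (\<theta> ` h0 ` Y)" by fact
 qed
 qed
 then obtain g where g: "!!v. v < n ==> g v : idl S.P (h0 ` Y)" "!!v. v < n ==> \<theta> (g v) = \<theta> (h0 v)" by metis
 define h where "h = (%v. if v : Y then h0 v else h0 v -{S.P} g v)"
 have gc: "g v : carrier S.P" if "v < n" for v using g(1)[OF that] S.P.idl_carrier[OF hcY] by blast
 have h0c: "h0 v : carrier S.P" if "v < n" for v using h0(3) that by auto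
 have hv: "h v : carrier S.P" if "v < n" for v using gc[OF that] h0c[OF that] by (simp add: h_def)
 then have hc: "h ` {..<n} <= carrier S.P" by auto
 have hY: "h ` Y = h0 ` Y" by (auto simp: h_def)
 have hgen: "idl S.P (h ` {..<n}) = S.KP 1"
 unfolding h0(4)[symmetric]
 proof (rule S.P.idl_eqI[OF hc h0(3)])
 note I0 = S.P.ideal_closed[OF S.P.idl_ideal[OF h0(3)]] and I1 = S.P.ideal_closed[OF S.P.idl_ideal[OF hc]]
 have s0: "idl S.P (h0 ` Y) <= idl S.P (h0 ` {..<n})" by (rule S.P.idl_mono[OF image_mono[OF YE(1)] h0(3)])
 have s1: "idl S.P (h0 ` Y) <= idl S.P (h ` {..<n})"
 unfolding hY[symmetric] by (rule S.P.idl_mono[OF image_mono[OF YE(1)] hc])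
 have m0: "h0 v : idl S.P (h0 ` {..<n})" and m1: "h v : idl S.P (h ` {..<n})" if "v < n" for v
 using S.P.idl_mem[OF h0(3)] S.P.idl_mem[OF hc] that by auto
 show "h ` {..<n} <= idl S.P (h0 ` {..<n})"
 proof
 fix x assume "x : h ` {..<n}"
 then obtain v where v: "v < n" "x = h v" by auto
 have "h0 v -{S.P} g v : idl S.P (h0 ` {..<n})" using I0(4)[OF m0[OF v(1)]] g(1)[OF v(1)] s0 by blast
 then show "x : idl S.P (h0 ` {..<n})" using m0[OF v(1)] v(2) by (simp add: h_def)
 qed
 show "h0 ` {..<n} <= idl S.P (h ` {..<n})"
 proof
 fix x assume "x : h0 ` {..<n}"
 then obtain v where v: "v < n" "x = h0 v" by auto
 show "x : idl S.P (h ` {..<n})"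
 proof (cases "v : Y")
 case True
 then show ?thesis using m1[OF v(1)] v(2) by (simp add: h_def)
 next
 case False
 have "h v +{S.P} g v : idl S.P (h ` {..<n})" using I1(3)[OF m1[OF v(1)]] g(1)[OF v(1)] s1 by blast
 moreover have "h v +{S.P} g v = h0 v"
 using False S.P.minus_rules(2)[OF h0c[OF v(1)] gc[OF v(1)]] by (simp add: h_def)
 ultimately show ?thesis using v(2) by simp
 qed
 qed
 qed
 have hE: "\<theta> (h v) = 0{D.C}" if v: "v : E" for v
 proof -
 have vn: "v < n" "v ~: Y" using v by (auto simp: E_def)
 have "\<theta> (h0 v -{S.P} g v) = \<theta> (h0 v) -{D.C} \<theta> (g v)"
 by (rule hom_minus[OF S.P.ring_axioms D.C.ring_axioms th_hom h0c[OF vn(1)] gc[OF vn(1)]])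
 then show ?thesis using vn g(2)[OF vn(1)] th.hom_closed[OF h0c[OF vn(1)]] by (simp add: h_def)
 qed
 let ?I = "a_kernel S.P D.C \<theta>"
 note Ic = S.P.ideal_closed[OF kernel_ideal]
 have hEc: "h ` E <= carrier S.P" using hc YE by auto
 have hEI: "idl S.P (h ` E) <= ?I"
 by (rule S.P.genideal_minimal[OF kernel_ideal]) (use hE hEc kernel_iff in auto)
 have hK: "h v : S.KP 1" if "v < n" for v using S.P.idl_mem[OF hc] hgen that by auto
 have monc: "mon S.P h al : carrier S.P" if "set_mset al <= {..<n}" for al
 by (rule S.P.mon_closed) (use that hv in auto)
 have hX: "idl S.P S.Xs = idl S.P (h ` {..<n})" using hgen S.ker_1 by (simp only:)
 have KPm: "S.KP s = idl S.P (mon S.P h ` multisets_of_size {..<n} s)" for s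
 by (rule trans[OF S.ker_power[of s, unfolded hX] S.P.ipow_idl[OF hc]])
 have monc': "mon S.P h ` multisets_of_size {..<n} s <= carrier S.P" for s
 using monc by (auto simp: multisets_of_size_def)
 have monK: "mon S.P h al : S.KP (size al)" if "set_mset al <= {..<n}" for al
 unfolding KPm using S.P.idl_mem[OF monc'] that by (auto simp: multisets_of_size_def)
 have mon_rho: "\<theta> (mon S.P h al) = \<rho> (G.mm al)" if "set_mset al <= Y" for al
 using that
 proof (induct al)
 case empty
 then show ?case using ring_hom_one[OF rho_hom] by simp
 next
 case (add i al)
 have 1: "h j : carrier S.P" "y' j : carrier R" if "j \<in># add_mset i al" for j
 proof -
 have j: "j : Y" using that add(2) by (rule subsetD[rotated])
 then have "j < n" using YE(1) by auto
 then show "h j : carrier S.P" by (rule hv)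
 show "y' j : carrier R" using j yc'(1) by blast
 qed
 have "mon S.P h (add_mset i al) = h i *{S.P} mon S.P h al" by (rule S.P.mon_add_mset[OF 1(1)])
 moreover have "mon R y' (add_mset i al) = y' i \<otimes> mon R y' al" by (rule mon_add_mset[OF 1(2)])
 moreover have "\<theta> (h i) = \<rho> (y' i)" using thY[of i] add(2) by (simp add: h_def)
 moreover have "mon S.P h al : carrier S.P" "mon R y' al : carrier R"
 using monc[of al] add(2) YE(1) G.mm_closed[of al] by auto
 ultimately show ?case using add 1[of i] ring_hom_mult[OF rho_hom, of "y' i" "mon R y' al"] by simp
 qed
 \<comment> \<open>Modulo the product of (h_E) with order s, a kernel element of order s + 1 can be
   replaced by one of order s + 2: otherwise it would have a leading monomial of degree s + 1 in the
   parameters at Y, contradicting quasi-regularity.\<close>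
 have step: "\<exists>f'\<in>?I. f' : S.KP (Suc (Suc s)) & f -{S.P} f' : idl S.P (h ` E) \<cdot>\<^bsub>S.P\<^esub> S.KP s"
 if f: "f : ?I" "f : S.KP (Suc s)" for f s
 proof -
 define B where "B = idl S.P (h ` E) \<cdot>\<^bsub>S.P\<^esub> S.KP s"
 have B: "ideal B S.P" unfolding B_def by (rule S.P.ideal_prod_is_ideal[OF S.P.idl_ideal[OF hEc] S.PF.K_ideal])
 have BE: "B <= idl S.P (h ` E)"
 unfolding B_def by (rule S.P.ideal_prod_minimal[OF S.P.idl_ideal[OF hEc]])
 (rule S.P.ideal_closed(6)[OF S.P.idl_ideal[OF hEc]], assumption, rule S.PF.K_closed(8))
 define Z where "Z = B <+{S.P} S.KP (Suc (Suc s))"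
 have Z: "ideal Z S.P" unfolding Z_def by (rule S.P.add_ideals[OF B S.PF.K_ideal])
 have Zs: "B <= Z" "S.KP (Suc (Suc s)) <= Z" unfolding Z_def by (rule S.P.add_ideals_sub[OF B S.PF.K_ideal])+
 let ?M = "multisets_of_size Y (Suc s)"
 have finM: "finite ?M" by (rule finite_multisets_of_size[OF YE(3)])
 have Mn: "set_mset al <= Y" "size al = Suc s" if "al : ?M" for al using that by (auto simp: multisets_of_size_def)
 have Mc: "mon S.P h ` ?M <= carrier S.P" using monc Mn(1) YE(1) by blast
 note sub = S.P.add_ideals_sub[OF S.P.idl_ideal[OF Mc] Z]
 have "mon S.P h ` multisets_of_size {..<n} (Suc s) <= idl S.P (mon S.P h ` ?M) <+{S.P} Z"
 proof
 fix x assume "x : mon S.P h ` multisets_of_size {..<n} (Suc s)"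
 then obtain al where al: "x = mon S.P h al" "set_mset al <= {..<n}" "size al = Suc s" by (auto simp: multisets_of_size_def)
 show "x : idl S.P (mon S.P h ` ?M) <+{S.P} Z"
 proof (cases "set_mset al <= Y")
 case True
 then have "x : mon S.P h ` ?M" using al by (auto simp: multisets_of_size_def)
 then show ?thesis using S.P.idl_mem[OF Mc] sub(1) by blast
 next
 case False
 then obtain v where v: "v \<in># al" "v : E" using al(2) YE(2) by blast
 then obtain bt where b: "al = add_mset v bt" by (metis mset_add)
 have "h j : carrier S.P" if "j \<in># add_mset v bt" for j using that al(2) b hv by auto
 then have "x = h v *{S.P} mon S.P h bt" unfolding al(1) b by (rule S.P.mon_add_mset)
 moreover have "mon S.P h bt : S.KP s" using monK[of bt] b al(2,3) by auto
 ultimately have "x : B" unfolding B_def using ideal_prod.prod S.P.idl_mem[OF hEc] v(2) by (metis imageI)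
 then show ?thesis using Zs(1) sub(2) by blast
 qed
 qed
 then have "S.KP (Suc s) <= idl S.P (mon S.P h ` ?M) <+{S.P} Z"
 unfolding KPm[of "Suc s"] by (rule S.P.genideal_minimal[OF S.P.add_ideals[OF S.P.idl_ideal[OF Mc] Z]])
 then have fM: "f : idl S.P (mon S.P h ` ?M) <+{S.P} Z" using f(2) by blast
 have fc: "f : carrier S.P" "\<theta> f = 0{D.C}" using f(1) by (auto simp: kernel_iff)
 have "f : Z \<or> (\<exists>al\<in>?M. mon S.P h al : idl S.P (insert f (mon S.P h ` {bt : ?M. al < bt})) <+{S.P} Z)"
 proof (rule S.P.leading_term[OF S_max_gen Z finM Mc _ fc(1) fM])
 fix al q assume a: "al : ?M" "q : S.KP 1"
 have "mon S.P h al : S.KP (Suc s)" using monK[of al] Mn[OF a(1)] YE(1) by auto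
 then have "mon S.P h al *{S.P} q : S.KP (Suc s + 1)" using S.PF.K_mult a(2) by blast
 then show "mon S.P h al *{S.P} q : Z" using Zs(2) by auto
 qed
 \<comment> \<open>\<theta> kills f and the part in (h_E); what remains of the relation descends by
   \<open>rho_reflect\<close> to y^al in \<open>G.upper al\<close>.\<close>
 moreover have False if al: "al : ?M" "mon S.P h al : idl S.P (insert f (mon S.P h ` {bt : ?M. al < bt})) <+{S.P} Z" for al
 proof -
 have a: "set_mset al <= Y" "size al = Suc s" using Mn[OF al(1)] by auto
 let ?L = "{bt : ?M. al < bt}"
 have Ll: "?L = G.later al" using a(2) by (simp add: G.later_def)
 define \<bb> where "\<bb> = Idl (G.mm ` ?L)"
 have Lc: "G.mm ` ?L <= carrier R" using G.mm_closed Mn(1) by auto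
 have b: "ideal \<bb> R" unfolding \<bb>_def by (rule idl_ideal[OF Lc])
 have rb: "\<rho> ` \<bb> <= carrier D.C" using ideal_closed(1)[OF b] by auto
 note Tb = D.C.idl_ideal[OF rb]
 have ic: "insert f (mon S.P h ` ?L) <= carrier S.P" using fc(1) Mc by auto
 have 1: "\<theta> x : idl D.C (\<rho> ` \<bb>)" if "x : idl S.P (insert f (mon S.P h ` ?L))" for x
 proof -
 have "\<theta> x : idl D.C (\<theta> ` insert f (mon S.P h ` ?L))" by (rule hom_idl_image[OF S.P.is_cring D.C.is_cring th_hom ic that])
 moreover have "\<theta> ` insert f (mon S.P h ` ?L) <= idl D.C (\<rho> ` \<bb>)"
 proof -
 have "\<theta> (mon S.P h bt) : idl D.C (\<rho> ` \<bb>)" if "bt : ?L" for bt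
 using mon_rho[OF Mn(1)] that D.C.idl_mem[OF rb] idl_mem[OF Lc] unfolding \<bb>_def by auto
 then show ?thesis using fc(2) D.C.ideal_closed(2)[OF Tb] by auto
 qed
 ultimately show ?thesis using D.C.genideal_minimal[OF Tb] by blast
 qed
 have 2: "\<theta> x : D.ker (Suc (Suc s))" if xZ: "x : Z" for x
 proof -
 obtain p q where pq: "p : B" "q : S.KP (Suc (Suc s))" "x = p +{S.P} q" using xZ unfolding Z_def mem_set_add_iff by blast
 have "\<theta> p = 0{D.C}" "p : carrier S.P" using pq(1) BE hEI by (auto simp: kernel_iff)
 then show ?thesis using pq th_ker[OF pq(2)] S.PF.K_closed(8)[OF pq(2)] by simp
 qed
 have "\<theta> (mon S.P h al) : idl D.C (\<rho> ` \<bb>) <+{D.C} D.ker (Suc (Suc s))"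
 by (rule hom_set_add[OF th_hom S.P.idl_carrier[OF ic] S.P.ideal_closed(1)[OF Z] 1 2 al(2)])
 then have "G.mm al : \<bb> <+> Ip (Suc (Suc s))"
 using rho_reflect[OF b G.mm_closed[OF a(1)]] mon_rho[OF a(1)] by simp
 then have "G.mm al : G.upper al" unfolding G.upper_def \<bb>_def Ll a(2) .
 then show False using qr[OF a(1)] by simp
 qed
 ultimately have "f : Z" by blast
 then obtain p q where pq: "p : B" "q : S.KP (Suc (Suc s))" "f = p +{S.P} q" unfolding Z_def mem_set_add_iff by blast
 have c: "p : carrier S.P" "q : carrier S.P" using S.P.ideal_closed(8)[OF B pq(1)] S.PF.K_closed(8)[OF pq(2)] by auto
 have "p : ?I" using pq(1) BE hEI by blast
 moreover have "q = f -{S.P} p" unfolding pq(3) by (rule S.P.minus_rules(1)[OF c, symmetric])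
 ultimately have "q : ?I" using Ic(4) f(1) by blast
 moreover have "f -{S.P} q = p"
 unfolding pq(3) using S.P.minus_rules(1)[OF c(2,1)] c by (simp add: S.P.a_comm)
 ultimately show ?thesis using pq(1,2) by (intro bexI[of _ q]) (auto simp: B_def)
 qed
 have "?I <= idl S.P (h ` E)"
 proof
 fix x assume x: "x : ?I"
 have "x : S.KP 1" using th_ker_1_iff[of x] x D.CF.K_closed(2) by (simp add: kernel_iff)
 then show "x : idl S.P (h ` E)"
 using S.PF.idl_by_approximation[OF _ hEc Ic(1) step x] YE(4) by blast
 qed
 then have "?I = idl S.P (h ` E)" using hEI by blast
 moreover have "E <= {..<n}" by (simp add: E_def)
 ultimately show ?thesis using hc hgen by blast
qed

end

section \<open>Descent from the ultraproduct\<close>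

lemma hom_mon:
 assumes R: "cring R" and S: "cring S" and h: "h : ring_hom R S" and g: "!!i. i \<in># al ==> g i : carrier R"
 shows "h (mon R g al) = mon S (%i. h (g i)) al & mon R g al : carrier R"
 using g
proof (induct al)
 case empty
 interpret R: cring R by fact
 interpret S: cring S by fact
 show ?case using ring_hom_one[OF h] by simp
next
 case (add i al)
 interpret R: cring R by fact
 interpret S: cring S by fact
 have c: "!!j. j \<in># add_mset i al ==> h (g j) : carrier S" using add(2) ring_hom_closed[OF h] by blast
 have "mon R g (add_mset i al) = g i *{R} mon R g al" by (rule R.mon_add_mset[OF add(2)])
 moreover have "mon S (%i. h (g i)) (add_mset i al) = h (g i) *{S} mon S (%i. h (g i)) al" by (rule S.mon_add_mset[OF c])
 ultimately show ?case using add ring_hom_mult[OF h, of "g i" "mon R g al"] by simp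
qed

lemma hom_idl_sub:
 assumes "cring R" "cring S" "h : ring_hom R S" "A <= carrier R" "B <= idl R A"
 shows "h ` B <= idl S (h ` A)"
 using hom_idl_image[OF assms(1-4)] assms(5) by blast

section \<open>Transfer of monomials and of finite families of generators\<close>

lemma (in ultra) ue_mon:
 assumes "!!i. i \<in># al ==> sec (g i)"
 shows "mon U (%i. ue (g i)) al = ue (%w. mon (A w) (%i. g i w) al) & sec (%w. mon (A w) (%i. g i w) al)"
 using assms
proof (induct al)
 case empty
 have e: "mon (A w) (%i. g i w) {#} = 1{A w}" if "w : W" for w by (rule cring.mon_empty[OF cr[OF that]])
 then have s: "sec (%w. mon (A w) (%i. g i w) {#})" using sec_ops(3) unfolding sec_def by simp
 have "\<forall>\<^sub>F w in F. 1{A w} = mon (A w) (%i. g i w) {#}" by (rule evI) (simp add: e)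
 then have "ue (%w. 1{A w}) = ue (%w. mon (A w) (%i. g i w) {#})" using ue_eq_iff[OF sec_ops(3) s] by blast
 then show ?case using s by (simp add: ue_one)
next
 case (add i al)
 have "mon U (%i. ue (g i)) (add_mset i al) = ue (g i) *{U} mon U (%i. ue (g i)) al"
 by (rule U.mon_add_mset) (use add(2) ue_closed in blast)
 moreover have e: "mon (A w) (%i. g i w) (add_mset i al) = g i w *{A w} mon (A w) (%i. g i w) al" if "w : W" for w
 by (rule cring.mon_add_mset[OF cr[OF that]]) (use add(2) that in \<open>unfold sec_def, blast\<close>)
 moreover have s: "sec (g i)" "sec (%w. mon (A w) (%i. g i w) al)" using add by auto
 moreover have "sec (%w. mon (A w) (%i. g i w) (add_mset i al))"
 using sec_ops(1)[OF s] e unfolding sec_def by simp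
 moreover have "ue (%w. g i w *{A w} mon (A w) (%i. g i w) al) = ue (%w. mon (A w) (%i. g i w) (add_mset i al))"
 using ue_eq_iff[OF sec_ops(1)[OF s] \<open>sec (%w. mon (A w) (%i. g i w) (add_mset i al))\<close>] e by (simp add: evI)
 ultimately show ?case using add(1)[OF add(2)] ue_mult[OF s] by simp
qed

lemma (in ultra) los_idl_fam:
 assumes "finite I" "sec a" "!!i. i : I ==> sec (g i)"
 shows "ue a : idl U ((%i. ue (g i)) ` I) \<longleftrightarrow> (\<forall>\<^sub>F w in F. a w : idl (A w) ((%i. g i w) ` I))"
proof -
 obtain js where js: "set js = I" using finite_list[OF assms(1)] by blast
 have 1: "ue ` set (map g js) = (%i. ue (g i)) ` I" using js by (simp add: image_image)
 have 2: "(%f. f w) ` set (map g js) = (%i. g i w) ` I" for w using js by (simp add: image_image)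
 have "ue a : idl U (ue ` set (map g js)) \<longleftrightarrow> (\<forall>\<^sub>F w in F. a w : idl (A w) ((%f. f w) ` set (map g js)))"
 by (rule los_idl[OF assms(2)]) (use assms(3) js in auto)
 then show ?thesis unfolding 1 2 .
qed

lemma (in ultra) los_sub_fam:
 assumes "finite I" "finite I'" "!!i. i : I ==> sec (g i)" "!!i. i : I' ==> sec (g' i)"
 and "(%i. ue (g i)) ` I <= idl U ((%i. ue (g' i)) ` I')"
 shows "\<forall>\<^sub>F w in F. (%i. g i w) ` I <= idl (A w) ((%i. g' i w) ` I')"
proof -
 have "\<forall>i\<in>I. \<forall>\<^sub>F w in F. g i w : idl (A w) ((%i. g' i w) ` I')"
 proof
 fix i assume i: "i : I"
 have "ue (g i) : idl U ((%i. ue (g' i)) ` I')" using assms(5) i by blast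
 then show "\<forall>\<^sub>F w in F. g i w : idl (A w) ((%i. g' i w) ` I')"
 using los_idl_fam[where g = g', OF assms(2) assms(3)[OF i] assms(4)] by simp
 qed
 then have "\<forall>\<^sub>F w in F. \<forall>i\<in>I. g i w : idl (A w) ((%i. g' i w) ` I')"
 by (rule eventually_ball_finite[OF assms(1)])
 then show ?thesis by (rule eventually_mono) blast
qed

lemma max_gen_iso:
 assumes R: "cring R" and S: "cring S" and h: "h : ring_iso R S" and A: "A <= carrier R" and m: "max_gen R (idl R A)"
 shows "max_gen S (idl S (h ` A))"
proof -
 interpret R: cring R by fact
 interpret S: cring S by fact
 have hh: "h : ring_hom R S" and bij: "bij_betw h (carrier R) (carrier S)" using h by (auto simp: ring_iso_def)
 have surj: "\<exists>x\<in>carrier R. h x = t" if "t : carrier S" for t   proof -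
 have "t : h ` carrier R" using bij that by (simp only: bij_betw_def)
 then show ?thesis by (elim imageE) blast
 qed
 have hA: "h ` A <= carrier S" using A ring_hom_closed[OF hh] by blast
 have hinv: "inv_into (carrier R) h : ring_hom S R"
 using ring_iso_set_sym[OF R.ring_axioms h] by (simp add: ring_iso_def)
 have ii: "inv_into (carrier R) h (h x) = x" if "x : carrier R" for x
 using bij that by (simp add: bij_betw_def inv_into_f_f)
 have "inv_into (carrier R) h ` h ` A = (%x. x) ` A"
 unfolding image_image by (rule image_cong[OF refl]) (use ii A in blast)
 then have "inv_into (carrier R) h ` h ` A = A" by simp
 then have pull: "inv_into (carrier R) h t : idl R A" if "t : idl S (h ` A)" for t
 using hom_idl_image[OF S R hinv hA that] by simp
 show ?thesis unfolding max_gen_def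
 proof (intro conjI ballI impI)
 show "ideal (idl S (h ` A)) S" by (rule S.idl_ideal[OF hA])
 show "1{S} ~: idl S (h ` A)"
 using pull[of "1{S}"] ring_hom_one[OF hinv] m by (auto simp: max_gen_def)
 fix t assume t: "t : carrier S" "t ~: idl S (h ` A)"
 obtain x where x: "x : carrier R" "h x = t" using surj[OF t(1)] by blast
 have "x ~: idl R A" using t(2) hom_idl_image[OF R S hh A] x(2) by blast
 then have U: "x : Units R" using m x(1) by (auto simp: max_gen_def)
 then have "t *{S} h (inv\<^bsub>R\<^esub> x) = 1{S}" "h (inv\<^bsub>R\<^esub> x) : carrier S"
 using ring_hom_mult[OF hh x(1), of "inv\<^bsub>R\<^esub> x"] ring_hom_one[OF hh] x(2) ring_hom_closed[OF hh] by auto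
 then show "t : Units S" using S.unit_factor[of t "h (inv\<^bsub>R\<^esub> x)"] t(1) by simp
 qed
qed

text \<open>Ring homomorphisms out of the power series ring need not be continuous; they are still
 determined modulo each power of the image of the maximal ideal by the constants and variables.\<close>
lemma (in series_over) hom_agree:
 assumes B: "cring B" and s: "s : ring_hom P B" and t: "t : ring_hom P B"
 and c: "!!c. c : carrier L ==> s (L.indexed_const c) = t (L.indexed_const c)"
 and v: "!!i. i < n ==> s (L.indexed_var i) = t (L.indexed_var i)"
 and x: "x : carrier P"
 shows "s x : idl B (insert (t x) (t ` mon P L.indexed_var ` multisets_of_size {..<n} N))"
proof -
 interpret B: cring B by fact
 let ?V = "mon P L.indexed_var ` multisets_of_size {..<n} N"
 have vc: "L.indexed_var i : carrier P" if "i < n" for i using vars_carrier that by auto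
 have mc: "mon P L.indexed_var al : carrier P" if "set_mset al <= {..<n}" for al
 by (rule P.mon_closed) (use that vc in auto)
 have Vc: "?V <= carrier P" using mc by (auto simp: multisets_of_size_def)
 have ms: "s (mon P L.indexed_var al) = t (mon P L.indexed_var al)" if a: "set_mset al <= {..<n}" for al
 proof -
 have vv: "i \<in># al ==> L.indexed_var i : carrier P" for i using a vc by auto
 have "mon B (%i. s (L.indexed_var i)) al = mon B (%i. t (L.indexed_var i)) al"
 by (rule B.mon_cong) (use a v ring_hom_closed[OF t] vc in auto)
 then show ?thesis using hom_mon[OF P.is_cring B s vv] hom_mon[OF P.is_cring B t vv] by simp
 qed
 have st: "s (sterm L a al) = t (sterm L a al)" if a: "a : carrier L" "set_mset al <= {..<n}" for a al
 proof -
 have "sterm L a al = L.indexed_const a *{P} mon P L.indexed_var al"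
 unfolding const_eq mon_vars[OF a(2)] using a(1) by (simp add: sterm_mult)
 then show ?thesis
 using ring_hom_mult[OF s] ring_hom_mult[OF t] const_closed[OF a(1)] mc[OF a(2)] ms[OF a(2)] c[OF a(1)] by simp
 qed
 have part: "(%m. if m : A then x m else \<zero>) : carrier P & s (%m. if m : A then x m else \<zero>) = t (%m. if m : A then x m else \<zero>)"
 if "finite A" "A <= {al. set_mset al <= {..<n}}" for A
 using that
 proof (induct A)
 case empty
 have "(%m. if m : {} then x m else \<zero>) = 0{P}" by (simp add: power_series_ring_def)
 then show ?case using ring_hom_zero[OF s P.ring_axioms B.ring_axioms] ring_hom_zero[OF t P.ring_axioms B.ring_axioms] by simp
 next
 case (insert a A)
 let ?f = "%m. if m : A then x m else \<zero>"
 have xa: "x a : carrier L" "set_mset a <= {..<n}" using x insert(4) by (auto simp: series_carrier)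
 have sc: "sterm L (x a) a : carrier P" by (rule sterm_closed[OF xa])
 have fc: "?f : carrier P" "s ?f = t ?f" using insert by auto
 have "(%m. if m : insert a A then x m else \<zero>) = sterm L (x a) a +{P} ?f"
 proof
 fix m show "(if m : insert a A then x m else \<zero>) = (sterm L (x a) a +{P} ?f) m"
 using insert(2) x by (auto simp: coeff_add sterm_def series_carrier)
 qed
 then show ?case using P.a_closed[OF sc fc(1)] ring_hom_add[OF s sc fc(1)] ring_hom_add[OF t sc fc(1)] st[OF xa] fc(2) by simp
 qed
 let ?A = "{al. set_mset al <= {..<n} & size al < N}"
 \<comment> \<open>The truncation below degree N is a polynomial, on which s and t agree; the tail
   lies in the ideal of the degree N monomials.\<close>
 let ?y = "%m. if m : ?A then x m else \<zero>"
 have "?A <= (\<Union>i<N. multisets_of_size {..<n} i)" by (auto simp: multisets_of_size_def)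
 moreover have "finite (\<Union>i<N. multisets_of_size {..<n} i)" by (intro finite_UN_I finite_multisets_of_size) auto
 ultimately have fin: "finite ?A" by (rule finite_subset)
 have yc: "?y : carrier P" and ys: "s ?y = t ?y" using part[OF fin] by auto
 define k where "k = x -{P} ?y"
 have kc: "k : carrier P" using x yc by (simp add: k_def)
 have kK: "k : KP N"
 unfolding series_ker_def
 proof (intro CollectI conjI allI impI kc)
 fix m :: "nat multiset" assume m: "size m < N"
 have "k m = x m \<ominus> ?y m" unfolding k_def by (rule coeff_minus[OF x yc])
 also have "... = \<zero>" using m x by (cases "set_mset m <= {..<n}") (auto simp: series_carrier)
 finally show "k m = \<zero>" .
 qed
 have kV: "k : idl P ?V" using kK unfolding ker_power P.ipow_idl[OF vars_carrier] .
 have xe: "x = k +{P} ?y" unfolding k_def by (rule P.minus_rules(2)[OF x yc, symmetric])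
 have sV: "s ` ?V = t ` ?V" unfolding image_image
 by (rule image_cong[OF refl]) (use ms in \<open>auto simp: multisets_of_size_def\<close>)
 let ?B = "insert (t x) (t ` ?V)"
 have Bc: "?B <= carrier B" using x Vc ring_hom_closed[OF t] by blast
 note I = B.ideal_closed[OF B.idl_ideal[OF Bc]]
 have tV: "idl B (t ` ?V) <= idl B ?B" by (rule B.idl_mono[OF _ Bc]) blast
 have sk: "s k : idl B ?B" using hom_idl_image[OF P.is_cring B s Vc kV] sV tV by auto
 have tk: "t k : idl B ?B" using hom_idl_image[OF P.is_cring B t Vc kV] tV by auto
 have c': "s k : carrier B" "t k : carrier B" "t ?y : carrier B" using kc yc ring_hom_closed[OF s] ring_hom_closed[OF t] by auto
 have tx: "t x = t k +{B} t ?y" by (subst xe) (rule ring_hom_add[OF t kc yc])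
 have "t ?y = t x -{B} t k" unfolding tx by (rule B.minus_rules(1)[OF c'(2,3), symmetric])
 also have "... : idl B ?B" by (rule I(4)[OF _ tk]) (rule B.idl_mem[OF Bc], simp)
 finally have "s k +{B} t ?y : idl B ?B" by (rule I(3)[OF sk])
 moreover have "s x = s k +{B} s ?y" by (subst xe) (rule ring_hom_add[OF s kc yc])
 ultimately show ?thesis using ys by simp
qed

section \<open>Homomorphisms from K[[n]] into ultraproducts\<close>

locale lef =
 fixes D :: "('a, 'u, 'w) lefschetz_data" and n :: nat
 assumes ld: "lefschetz_data D"
begin

abbreviation "K \<equiv> KK D"

lemma
 shows ldP: "ultraset primes (Pfilter D)" and ldKp: "p : primes ==> algebraically_closed (Kp D p)"
 and ldch: "p : primes ==> has_char (Kp D p) p"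
 and ldK: "field K" and ldU: "ultraset (Uset D) (Ufilter D)"
 and eta_hom: "eta D n : ring_hom (Kser D n) (Dn D n)"
 and eta_const: "c : carrier K ==> eta D n (ring.indexed_const K c) = Dn_const D n c"
 and eta_var: "i < n ==> eta D n (ring.indexed_var K i) = Dn_var D n i"
 and ldW: "ultraset (Wset D) (Wfilter D)" and pw_prime: "w : Wset D ==> Factorial_Ring.prime (pw D w)"
 and ident_iso: "ident D n : ring_iso (Dn D n) (ultraproduct (Wset D) (Wfilter D) (Wser D n))"
 using ld unfolding lefschetz_data_def by auto

lemma Kp_field: "p : primes ==> field (Kp D p)"
 using ldKp algebraically_closed.axioms(1) by blast

lemma Kp_pcring: "p : primes ==> pcring (Kp D p)"
 using Kp_field fieldE(1) pcring.intro by blast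

sublocale K: field K by (rule ldK)
sublocale S: series_over K n by (intro series_over.intro pcring.intro K.is_cring)

sublocale UK: ultra primes "Pfilter D" "Kp D"
 by (intro ultra.intro ldP) (use Kp_pcring pcring_def in blast)

lemma Kps: "p : primes ==> series_over (Kp D p)"
 by (intro series_over.intro Kp_pcring)

lemma Kp_ser_cring: "p : primes ==> cring (power_series_ring (Kp D p) n)"
 using series_over.series_cring[OF Kps] by blast

sublocale UI: ultra primes "Pfilter D" "%p. power_series_ring (Kp D p) n"
 by (intro ultra.intro ldP Kp_ser_cring)

sublocale UD: ultra "Uset D" "Ufilter D" "%_. Kser_inf D n"
 by (intro ultra.intro ldU) (simp add: Kser_inf_def UI.U_cring)

sublocale UW: ultra "Wset D" "Wfilter D" "Wser D n"
 by (intro ultra.intro ldW) (use pw_prime Kp_ser_cring in \<open>auto simp: Wser_def\<close>)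

sublocale US: ultra "Uset D" "Ufilter D" "%_. S.P"
 by (intro ultra.intro ldU S.P.is_cring)

lemma KK_U: "K = UK.U" by (simp add: KK_def)
lemma Dn_U: "Dn D n = UD.U" by (simp add: Dn_def)
lemma inf_U: "Kser_inf D n = UI.U" by (simp add: Kser_inf_def)

text \<open>The coefficientwise map from the ultraproduct of the K_p[[n]] to K[[n]]; it kills
  elements of infinite order.\<close>

definition Th :: "(nat => 'a series) set => (nat => 'a) set series" where
 "Th x = (%al. ultra_map primes (Pfilter D) (Kp D) (%_ f. f al) x)"

lemma sec_coeff: "UI.sec a ==> UK.sec (%p. a p al)"
 using series_over.coeff_closed[OF Kps] unfolding UI.sec_def UK.sec_def by blast

lemma Th_ue: "UI.sec a ==> Th (UI.ue a) = (%al. UK.ue (%p. a p al))"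
 unfolding Th_def
 by (rule ext, rule ultra_map_elem(1)[OF UI.ultra_axioms UK.ultra_axioms]) (use series_over.coeff_closed[OF Kps] in blast)+

lemma ue_finsum:
 assumes "finite I" "!!i. i : I ==> UK.sec (g i)"
 shows "(\<Oplus>\<^bsub>K\<^esub>i\<in>I. UK.ue (g i)) = UK.ue (%p. \<Oplus>\<^bsub>Kp D p\<^esub>i\<in>I. g i p) & UK.sec (%p. \<Oplus>\<^bsub>Kp D p\<^esub>i\<in>I. g i p)"
 using assms
proof (induct I)
 case empty
 have e: "(\<Oplus>\<^bsub>Kp D p\<^esub>i\<in>{}. g i p) = 0{Kp D p}" if p: "p \<in> primes" for p
 proof -
 interpret Kp: cring "Kp D p" using Kp_pcring[OF p] by (simp add: pcring_def)
 show ?thesis by simp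
 qed
 have s: "UK.sec (%p. \<Oplus>\<^bsub>Kp D p\<^esub>i\<in>{}. g i p)" using UK.sec_ops(4) e unfolding UK.sec_def by simp
 have "\<forall>\<^sub>F p in Pfilter D. 0{Kp D p} = (\<Oplus>\<^bsub>Kp D p\<^esub>i\<in>{}. g i p)" by (rule UK.evI) (rule e[symmetric])
 then have "UK.ue (%p. 0{Kp D p}) = UK.ue (%p. \<Oplus>\<^bsub>Kp D p\<^esub>i\<in>{}. g i p)" using UK.ue_eq_iff[OF UK.sec_ops(4) s] by blast
 then show ?case using s by (simp only: K.finsum_empty) (simp add: KK_U UK.ue_zero)
next
 case (insert i I)
 have s: "UK.sec (g i)" "UK.sec (%p. \<Oplus>\<^bsub>Kp D p\<^esub>i\<in>I. g i p)" using insert by auto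
 have e: "(\<Oplus>\<^bsub>Kp D p\<^esub>j\<in>insert i I. g j p) = g i p +{Kp D p} (\<Oplus>\<^bsub>Kp D p\<^esub>j\<in>I. g j p)" if p: "p \<in> primes" for p
 proof -
 interpret Kp: cring "Kp D p" using Kp_pcring[OF p] by (simp add: pcring_def)
 show ?thesis by (rule Kp.finsum_insert) (use insert p in \<open>auto simp: UK.sec_def\<close>)
 qed
 have s': "UK.sec (%p. \<Oplus>\<^bsub>Kp D p\<^esub>j\<in>insert i I. g j p)" using UK.sec_ops(2)[OF s] e unfolding UK.sec_def by simp
 have "(\<Oplus>\<^bsub>K\<^esub>j\<in>insert i I. UK.ue (g j)) = UK.ue (g i) +{K} (\<Oplus>\<^bsub>K\<^esub>j\<in>I. UK.ue (g j))"
 by (rule K.finsum_insert) (use insert UK.ue_closed in \<open>auto simp: KK_U\<close>)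
 also have "... = UK.ue (%p. g i p +{Kp D p} (\<Oplus>\<^bsub>Kp D p\<^esub>j\<in>I. g j p))" using insert UK.ue_add[OF s] by (simp add: KK_U)
 also have "... = UK.ue (%p. \<Oplus>\<^bsub>Kp D p\<^esub>j\<in>insert i I. g j p)"
 proof -
 have "\<forall>\<^sub>F p in Pfilter D. g i p +{Kp D p} (\<Oplus>\<^bsub>Kp D p\<^esub>j\<in>I. g j p) = (\<Oplus>\<^bsub>Kp D p\<^esub>j\<in>insert i I. g j p)"
 by (rule UK.evI) (rule e[symmetric])
 then show ?thesis using UK.ue_eq_iff[OF UK.sec_ops(2)[OF s] s'] by blast
 qed
 finally show ?case using s' by blast
qed

lemma Th_hom: "Th : ring_hom (Kser_inf D n) S.P"
proof (rule ring_hom_memI)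
 fix x assume "x : carrier (Kser_inf D n)"
 then obtain a where a: "UI.sec a" "x = UI.ue a" unfolding inf_U UI.U_carrier by blast
 have "UK.ue (%p. a p m) = 0{K}" if m: "\<not> set_mset m <= {..<n}" for m
 proof -
 have "a p m = 0{Kp D p}" if "p : primes" for p
 using a(1) that m series_over.series_carrier[OF Kps[OF that]] unfolding UI.sec_def by blast
 then have "\<forall>\<^sub>F p in Pfilter D. a p m = 0{Kp D p}" by (rule UK.evI)
 then show ?thesis unfolding KK_U UK.ue_zero using UK.ue_eq_iff[OF sec_coeff[OF a(1)] UK.sec_ops(4)] by blast
 qed
 then show "Th x : carrier S.P" unfolding a(2) Th_ue[OF a(1)] S.series_carrier
 using UK.ue_closed[OF sec_coeff[OF a(1)]] by (simp add: KK_U)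
 fix y assume "y : carrier (Kser_inf D n)"
 then obtain b where b: "UI.sec b" "y = UI.ue b" unfolding inf_U UI.U_carrier by blast
 show "Th (x +{Kser_inf D n} y) = Th x +{S.P} Th y"
 proof
 fix m
 have "UK.ue (%p. (a p +{power_series_ring (Kp D p) n} b p) m) = UK.ue (%p. a p m +{Kp D p} b p m)"
 by (simp add: power_series_ring_def)
 then show "Th (x +{Kser_inf D n} y) m = (Th x +{S.P} Th y) m"
 unfolding a(2) b(2) inf_U UI.ue_add[OF a(1) b(1)] Th_ue[OF UI.sec_ops(2)[OF a(1) b(1)]] Th_ue[OF a(1)] Th_ue[OF b(1)] S.coeff_add
 using UK.ue_add[OF sec_coeff[OF a(1)] sec_coeff[OF b(1)]] by (simp add: KK_U)
 qed
 show "Th (x *{Kser_inf D n} y) = Th x *{S.P} Th y"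
 proof
 fix m :: "nat multiset"
 let ?I = "{c. c \<subseteq># m}"
 have "?I <= (\<Union>i\<le>size m. multisets_of_size (set_mset m) i)"
 using set_mset_mono size_mset_mono by (fastforce simp: multisets_of_size_def)
 moreover have "finite (\<Union>i\<le>size m. multisets_of_size (set_mset m) i)" by (intro finite_UN_I finite_multisets_of_size) auto
 ultimately have fin: "finite ?I" by (rule finite_subset)
 have s: "UK.sec (%p. a p c *{Kp D p} b p (m - c))" for c by (rule UK.sec_ops(1)[OF sec_coeff[OF a(1)] sec_coeff[OF b(1)]])
 have "UK.ue (%p. (a p *{power_series_ring (Kp D p) n} b p) m) = UK.ue (%p. \<Oplus>\<^bsub>Kp D p\<^esub>c\<in>?I. a p c *{Kp D p} b p (m - c))"
 by (simp add: power_series_ring_def)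
 also have "... = (\<Oplus>\<^bsub>K\<^esub>c\<in>?I. UK.ue (%p. a p c *{Kp D p} b p (m - c)))" using ue_finsum[OF fin s] by simp
 also have "... = (\<Oplus>\<^bsub>K\<^esub>c\<in>?I. UK.ue (%p. a p c) *{K} UK.ue (%p. b p (m - c)))"
 using UK.ue_mult[OF sec_coeff[OF a(1)] sec_coeff[OF b(1)]] by (simp add: KK_U)
 finally show "Th (x *{Kser_inf D n} y) m = (Th x *{S.P} Th y) m"
 unfolding a(2) b(2) inf_U UI.ue_mult[OF a(1) b(1)] Th_ue[OF UI.sec_ops(1)[OF a(1) b(1)]] Th_ue[OF a(1)] Th_ue[OF b(1)] S.coeff_mult .
 qed
next
 have "Th 1{Kser_inf D n} = (%m. UK.ue (%p. 1{power_series_ring (Kp D p) n} m))"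
 unfolding inf_U UI.ue_one by (rule Th_ue[OF UI.sec_ops(3)])
 also have "... = 1{S.P}"
 proof
 fix m :: "nat multiset"
 have "1{power_series_ring (Kp D p) n} m = (if m = {#} then 1{Kp D p} else 0{Kp D p})" if "p : primes" for p
 unfolding series_over.one_eq[OF Kps[OF that]] by (simp add: sterm_def)
 moreover have "UK.sec (%p. if m = {#} then 1{Kp D p} else 0{Kp D p})" by (cases "m = {#}") (use UK.sec_ops(3,4) in simp_all)
 moreover have "\<forall>\<^sub>F p in Pfilter D. 1{power_series_ring (Kp D p) n} m = (if m = {#} then 1{Kp D p} else 0{Kp D p})"
 by (rule UK.evI) (rule calculation(1))
 ultimately have "UK.ue (%p. 1{power_series_ring (Kp D p) n} m) = UK.ue (%p. if m = {#} then 1{Kp D p} else 0{Kp D p})"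
 using UK.ue_eq_iff[OF sec_coeff[OF UI.sec_ops(3)]] by blast
 then show "UK.ue (%p. 1{power_series_ring (Kp D p) n} m) = 1{S.P} m"
 unfolding S.one_eq by (simp add: sterm_def KK_U UK.ue_one UK.ue_zero)
 qed
 finally show "Th 1{Kser_inf D n} = 1{S.P}" .
qed

lemma sec_var: "i < n ==> UI.sec (%p. ring.indexed_var (Kp D p) i)"
 unfolding UI.sec_def using series_over.vars_carrier[OF Kps] by (metis imageI lessThan_iff subsetD)

lemma sec_const: "UK.sec a ==> UI.sec (%p. ring.indexed_const (Kp D p) (a p))"
 unfolding UI.sec_def UK.sec_def using series_over.const_closed[OF Kps] by blast

lemma Th_sterm:
 assumes a: "UK.sec a" and al: "set_mset al <= {..<n}" and f: "UI.sec f" "!!p. p : primes ==> f p = sterm (Kp D p) (a p) al"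
 shows "Th (UI.ue f) = sterm K (UK.ue a) al"
proof
 fix m
 have s: "UK.sec (%p. if m = al then a p else 0{Kp D p})" by (cases "m = al") (use a UK.sec_ops(4) in simp_all)
 have "Th (UI.ue f) m = UK.ue (%p. f p m)" using Th_ue[OF f(1)] by simp
 also have "... = UK.ue (%p. if m = al then a p else 0{Kp D p})"
 proof -
 have "\<forall>\<^sub>F p in Pfilter D. f p m = (if m = al then a p else 0{Kp D p})"
 by (rule UK.evI) (simp add: f(2) sterm_def)
 then show ?thesis using UK.ue_eq_iff[OF sec_coeff[OF f(1)] s] by blast
 qed
 also have "... = sterm K (UK.ue a) al m" by (simp add: sterm_def KK_U UK.ue_zero)
 finally show "Th (UI.ue f) m = sterm K (UK.ue a) al m" .
qed

text \<open>\<open>eta\<close> followed by the coefficientwise return to K[[n]], inside the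
  ultrapower. It need not be the diagonal map \<open>diag\<close>, but it agrees with it on
  constants and variables, so \<open>hom_agree\<close> applies in both directions.\<close>

definition tau where "tau = ultra_map (Uset D) (Ufilter D) (%_. S.P) (%_. Th) \<circ> eta D n"
definition diag where "diag x = US.ue (%_. x)"

lemma diag_hom: "diag : ring_hom S.P US.U"
 unfolding diag_def
 by (rule ring_hom_memI) (auto simp: US.ue_mult US.ue_add US.ue_one US.sec_def intro!: US.ue_closed)

lemma Th_U_hom: "ultra_map (Uset D) (Ufilter D) (%_. S.P) (%_. Th) : ring_hom (Dn D n) US.U"
 unfolding Dn_U by (rule ultra_map_hom[OF UD.ultra_axioms US.ultra_axioms Th_hom])

lemma tau_hom: "tau : ring_hom S.P US.U"
 unfolding tau_def using ring_hom_trans[OF _ Th_U_hom] eta_hom by (simp add: Kser_def)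

lemma Th_diag: "x : carrier (Kser_inf D n) ==> ultra_map (Uset D) (Ufilter D) (%_. S.P) (%_. Th) (Dn_diag D n x) = diag (Th x)"
 unfolding Dn_diag_def diag_def
 by (rule ultra_map_elem(1)[OF UD.ultra_axioms US.ultra_axioms]) (use ring_hom_closed[OF Th_hom] in \<open>auto simp: UD.sec_def\<close>)

lemma tau_const: "c : carrier K ==> tau (K.indexed_const c) = diag (K.indexed_const c)"
proof -
 assume c: "c : carrier K"
 then obtain a where a: "UK.sec a" "c = UK.ue a" unfolding KK_U UK.U_carrier by blast
 have "ultra_map primes (Pfilter D) (%p. power_series_ring (Kp D p) n) (%p. ring.indexed_const (Kp D p)) c
 = UI.ue (%p. ring.indexed_const (Kp D p) (a p))"
 unfolding a(2) by (rule ultra_map_elem(1)[OF UK.ultra_axioms UI.ultra_axioms _ a(1)]) (use series_over.const_closed[OF Kps] in blast)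
 moreover have "Th (UI.ue (%p. ring.indexed_const (Kp D p) (a p))) = K.indexed_const c"
 unfolding S.const_eq a(2)
 by (rule Th_sterm[OF a(1) _ sec_const[OF a(1)]]) (use series_over.const_eq[OF Kps] in auto)
 moreover have "UI.ue (%p. ring.indexed_const (Kp D p) (a p)) : carrier (Kser_inf D n)"
 unfolding inf_U by (rule UI.ue_closed[OF sec_const[OF a(1)]])
 ultimately show ?thesis unfolding tau_def comp_def eta_const[OF c] Dn_const_def using Th_diag by simp
qed

lemma tau_var: "i < n ==> tau (K.indexed_var i) = diag (K.indexed_var i)"
proof -
 assume i: "i < n"
 have "Th (UI.ue (%p. ring.indexed_var (Kp D p) i)) = K.indexed_var i"
 unfolding S.var_eq unfolding KK_U UK.ue_one unfolding KK_U[symmetric]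
 by (rule Th_sterm[OF UK.sec_ops(3) _ sec_var[OF i]]) (use i series_over.var_eq[OF Kps] in auto)
 moreover have "UI.ue (%p. ring.indexed_var (Kp D p) i) : carrier (Kser_inf D n)"
 unfolding inf_U by (rule UI.ue_closed[OF sec_var[OF i]])
 ultimately show ?thesis unfolding tau_def comp_def eta_var[OF i] Dn_var_def using Th_diag by simp
qed

definition zeta where "zeta = ident D n \<circ> eta D n"

lemma zeta_hom: "zeta : ring_hom S.P UW.U"
proof -
 have "ident D n : ring_hom (Dn D n) UW.U" using ident_iso by (simp add: ring_iso_def)
 then show ?thesis using ring_hom_trans[OF eta_hom] unfolding zeta_def Kser_def by blast
qed

lemma Dn_cring: "cring (Dn D n)" by (simp add: Dn_U UD.U_cring)

text \<open>The inverse of \<open>ident\<close> and then the coefficientwise map carry the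
  membership to the ultrapower of K[[n]]. There \<open>tau\<close> is traded for \<open>diag\<close>
  at the price of the degree N monomials, and a membership between diagonal elements holds in K[[n]]
  itself.\<close>

theorem descent:
 assumes G: "finite G" "G <= carrier S.P" and x: "x : carrier S.P" "zeta x : idl UW.U (zeta ` G)"
 shows "x : idl S.P G <+{S.P} S.KP N"
proof -
 let ?V = "mon S.P K.indexed_var ` multisets_of_size {..<n} N"
 interpret Dn: cring "Dn D n" by (rule Dn_cring)
 have hinv: "inv_into (carrier (Dn D n)) (ident D n) : ring_hom UW.U (Dn D n)"
 using ring_iso_set_sym[OF Dn.ring_axioms ident_iso] by (simp add: ring_iso_def)
 have ii: "inv_into (carrier (Dn D n)) (ident D n) (zeta y) = eta D n y" if "y : carrier S.P" for y
 using ident_iso ring_hom_closed[OF eta_hom] that by (simp add: zeta_def ring_iso_def bij_betw_def inv_into_f_f Kser_def)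
 have zG: "zeta ` G <= carrier UW.U" using G(2) ring_hom_closed[OF zeta_hom] by blast
 have eG: "eta D n ` G <= carrier (Dn D n)" using G(2) ring_hom_closed[OF eta_hom] by (auto simp: Kser_def)
 have "inv_into (carrier (Dn D n)) (ident D n) ` zeta ` G = eta D n ` G"
 unfolding image_image using ii G(2) by (intro image_cong) auto
 then have "eta D n x : idl (Dn D n) (eta D n ` G)"
 using hom_idl_image[OF UW.U_cring Dn_cring hinv zG x(2)] ii[OF x(1)] by simp
 then have "tau x : idl US.U (tau ` G)"
 using hom_idl_image[OF Dn_cring US.U_cring Th_U_hom eG] unfolding tau_def image_comp comp_def by blast
 moreover
 have vc: "K.indexed_var i : carrier S.P" if "i < n" for i using S.vars_carrier that by auto
 have Vc: "?V <= carrier S.P" by (auto simp: multisets_of_size_def intro!: S.P.mon_closed vc)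
 have finV: "finite ?V" by (intro finite_imageI finite_multisets_of_size) simp
 have GVc: "G Un ?V <= carrier S.P" using G(2) Vc by simp
 have dc: "diag ` (G Un ?V) <= carrier US.U" using GVc ring_hom_closed[OF diag_hom] by blast
 have "tau ` G <= idl US.U (diag ` (G Un ?V))"
 proof
 fix t assume "t : tau ` G"
 then obtain g where g: "g : G" "t = tau g" by blast
 have "tau g : idl US.U (insert (diag g) (diag ` ?V))"
 by (rule S.hom_agree[OF US.U_cring tau_hom diag_hom tau_const tau_var]) (use g G in auto)
 moreover have "idl US.U (insert (diag g) (diag ` ?V)) <= idl US.U (diag ` (G Un ?V))"
 by (rule US.U.idl_mono[OF _ dc]) (use g in blast)
 ultimately show "t : idl US.U (diag ` (G Un ?V))" using g by blast
 qed
 then have "idl US.U (tau ` G) <= idl US.U (diag ` (G Un ?V))"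
 by (rule US.U.genideal_minimal[OF US.U.idl_ideal[OF dc]])
 ultimately have tx: "tau x : idl US.U (diag ` (G Un ?V))" by blast
 have "diag x : idl US.U (insert (tau x) (tau ` ?V))"
 by (rule S.hom_agree[OF US.U_cring diag_hom tau_hom tau_const[symmetric] tau_var[symmetric] x(1)])
 moreover have "tau ` ?V <= idl US.U (diag ` (G Un ?V))"
 proof
 fix t assume "t : tau ` ?V"
 then obtain al where al: "set_mset al <= {..<n}" "mon S.P K.indexed_var al : ?V" "t = tau (mon S.P K.indexed_var al)"
 by (auto simp: multisets_of_size_def)
 have vv: "i \<in># al ==> K.indexed_var i : carrier S.P" for i using al(1) vc by auto
 have "mon US.U (%i. tau (K.indexed_var i)) al = mon US.U (%i. diag (K.indexed_var i)) al"
 by (rule US.U.mon_cong) (use al(1) tau_var ring_hom_closed[OF diag_hom] vc in auto)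
 then have "t = diag (mon S.P K.indexed_var al)"
 using hom_mon[OF S.P.is_cring US.U_cring tau_hom vv] hom_mon[OF S.P.is_cring US.U_cring diag_hom vv] al(3) by simp
 then show "t : idl US.U (diag ` (G Un ?V))" using US.U.idl_mem[OF dc] al(2) by blast
 qed
 then have "idl US.U (insert (tau x) (tau ` ?V)) <= idl US.U (diag ` (G Un ?V))"
 using tx by (intro US.U.genideal_minimal[OF US.U.idl_ideal[OF dc]]) simp
 ultimately have "diag x : idl US.U (diag ` (G Un ?V))" by blast
 \<comment> \<open>All sections are constant here, so holding for almost all indices is holding
   outright.\<close>
 then have "\<forall>\<^sub>F u in Ufilter D. x : idl S.P ((%g. g) ` (G Un ?V))"
 using US.los_idl_fam[of "G Un ?V" "%_. x" "%g _. g"] G(1) finV x(1) GVc unfolding diag_def US.sec_def by blast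
 then have "x : idl S.P (G Un ?V)" using US.F_nonbot by simp
 then have "x : idl S.P G <+{S.P} idl S.P ?V" unfolding S.P.idl_union[OF G(2) Vc] .
 then show ?thesis unfolding S.ker_power S.P.ipow_idl[OF S.vars_carrier] .
qed

end

section \<open>Transfer\<close>

lemma alg_closed_root:
 assumes L: "algebraically_closed L" and q: "0 < q" and c: "c : carrier L"
 shows "\<exists>b\<in>carrier L. b ^{L} (q::nat) = c"
proof -
 interpret algebraically_closed L by fact
 let ?l = "1{L} # replicate (q - 1) 0{L}"
 let ?p = "?l @ [\<ominus>\<^bsub>L\<^esub> c]"
 have lc: "set ?l <= carrier L" by auto
 have pc: "?p : carrier (poly_ring L)"
 unfolding univ_poly_carrier[symmetric] polynomial_def using c by auto
 have "size (roots ?p) = degree ?p" using roots_over_carrier[OF pc] by (simp only: splitted_def)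
 also have "degree ?p = q" using q by simp
 finally have "roots ?p ~= {#}" using q by auto
 then obtain b where "b \<in># roots ?p" by blast
 then have b: "b : carrier L" "eval ?p b = 0{L}" using roots_mem_iff_is_root[OF pc] by (simp_all only: is_root_def)
 have rep: "eval (replicate j 0{L}) b = 0{L}" for j using b(1) by (induct j) simp_all
 have "eval ?l b = b ^{L} (q - 1)" using b(1) rep by simp
 then have "eval ?p b = b ^{L} (q - 1) *{L} b -{L} c"
 using eval_append_aux[OF lc _ b(1), of "\<ominus>\<^bsub>L\<^esub> c"] c by (simp only: minus_eq a_inv_closed)
 also have "b ^{L} (q - 1) *{L} b = b ^{L} q" using nat_pow_Suc[of b "q - 1"] q by simp
 finally show ?thesis using b c by (intro bexI[of _ b]) simp_all
qed

text \<open>On an algebraically closed field of characteristic p the map c |-> c^q is a bijective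
  homomorphism; its inverse is \<open>rt\<close>.\<close>

lemma exists_frob_series:
 assumes L: "algebraically_closed L" and p: "Factorial_Ring.prime (p::nat)" and ch: "has_char L p"
 shows "EX rt. frob_series L n (p ^ m) rt"
proof -
 interpret algebraically_closed L by fact
 interpret S: series_over L n by (intro series_over.intro pcring.intro is_cring)
 let ?q = "p ^ m" and ?f = "%c. c ^{L} (p ^ m)"
 have q: "0 < ?q" using p by (simp add: prime_gt_0_nat)
 have chL: "add_pow L p 1{L} = 0{L}" using ch by (simp add: has_char_def)
 have "add_pow S.P j 1{S.P} = indexed_const (add_pow L j 1{L})" for j :: nat
 proof (induct j)
 case 0
 then show ?case using ring_hom_zero[OF S.const_hom ring_axioms S.P.ring_axioms] by simp
 next
 case (Suc j)
 have "add_pow S.P (Suc j) 1{S.P} = add_pow S.P j 1{S.P} +{S.P} 1{S.P}" by (rule S.P.add.nat_pow_Suc)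
 also have "... = indexed_const (add_pow L j 1{L} +{L} 1{L})"
 using Suc ring_hom_add[OF S.const_hom, of "add_pow L j 1{L}" "1{L}"] ring_hom_one[OF S.const_hom] by simp
 also have "add_pow L j 1{L} +{L} 1{L} = add_pow L (Suc j) 1{L}" by (rule add.nat_pow_Suc[symmetric])
 finally show ?case .
 qed
 then have chP: "add_pow S.P p 1{S.P} = 0{S.P}"
 using chL ring_hom_zero[OF S.const_hom ring_axioms S.P.ring_axioms] by simp
 have fadd: "?f (x +{L} y) = ?f x +{L} ?f y" if "x : carrier L" "y : carrier L" for x y
 by (rule frobenius_pow_add[OF p chL that])
 have pz: "x = 0{L}" if "x : carrier L" "x ^{L} (j::nat) = 0{L}" for x j
 using that
 proof (induct j)
 case (Suc j)
 have "x ^{L} j *{L} x = 0{L}" using Suc(3) nat_pow_Suc[of x j] by simp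
 then show ?case using Suc integral[of "x ^{L} j" x] by auto
 qed simp
 have inj: "inj_on ?f (carrier L)"
 proof (rule inj_onI)
 fix x y assume xy: "x : carrier L" "y : carrier L" "?f x = ?f y"
 have d: "x -{L} y : carrier L" using xy by simp
 have "?f x = ?f (x -{L} y) +{L} ?f y" using fadd[OF d xy(2)] minus_rules(2)[OF xy(1,2)] by simp
 then have "?f (x -{L} y) = ?f x -{L} ?f y" using eq_minusI[of "?f (x -{L} y)" "?f y" "?f x"] d xy by simp
 then have "?f (x -{L} y) = 0{L}" using xy by simp
 then have "x -{L} y = 0{L}" by (rule pz[OF d])
 then show "x = y" using xy by simp
 qed
 have fh: "?f : ring_hom L L"
 by (rule ring_hom_memI) (simp_all add: fadd nat_pow_distrib)
 have "?f ` carrier L = carrier L"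
 proof
 show "carrier L <= ?f ` carrier L" using alg_closed_root[OF L q] by (metis imageI subsetI)
 qed auto
 then have iso: "?f : ring_iso L L" using fh inj by (simp add: ring_iso_def bij_betw_def)
 let ?rt = "inv_into (carrier L) ?f"
 have "frob_series L n ?q ?rt"
 proof (intro frob_series.intro frob_series_axioms.intro S.series_over_axioms field_axioms)
 show "1 <= ?q" using q by (simp only: One_nat_def Suc_le_eq)
 show "?rt : ring_hom L L" using ring_iso_set_sym[OF ring_axioms iso] by (simp add: ring_iso_def)
 show "?rt (c ^{L} ?q) = c" if "c : carrier L" for c using inv_into_f_f[OF inj that] .
 show "(x +{S.P} y) ^{S.P} ?q = x ^{S.P} ?q +{S.P} y ^{S.P} ?q" if "x : carrier S.P" "y : carrier S.P" for x y
 by (rule S.P.frobenius_pow_add[OF p chP that])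
 qed
 then show ?thesis by blast
qed

lemma hom_same_idl:
 assumes R: "cring R" and S: "cring S" and h: "h : ring_hom R S" and A: "A <= carrier R" "B <= carrier R"
 and e: "idl R A = idl R B"
 shows "idl S (h ` A) = idl S (h ` B)"
proof -
 interpret R: cring R by fact
 interpret S: cring S by fact
 have c: "h ` A <= carrier S" "h ` B <= carrier S" using A ring_hom_closed[OF h] by blast+
 have "A <= idl R B" "B <= idl R A" using R.idl_mem[OF A(1)] R.idl_mem[OF A(2)] e by blast+
 then show ?thesis
 by (intro S.idl_eqI[OF c] hom_idl_sub[OF R S h]) (use A in auto)
qed

section \<open>Parameters in the factors\<close>

context lef
begin

abbreviation "vw i \<equiv> (%w. ring.indexed_var (Kp D (pw D w)) i)"

lemma Ws: "w : Wset D ==> series_over (Kp D (pw D w))"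
 using Kps pw_prime by simp

lemma Ws_max_gen: "w : Wset D ==> max_gen (Wser D n w) (idl (Wser D n w) ((%i. vw i w) ` {..<n}))"
 unfolding Wser_def
 using series_over.ker_max_gen[OF Ws, of w n] series_over.ker_1[OF Ws, of w n] Kp_field pw_prime by simp

lemma sec_vw: "i < n ==> UW.sec (vw i)"
 unfolding UW.sec_def Wser_def using series_over.vars_carrier[OF Ws] by (metis imageI lessThan_iff subsetD)

lemma vars_max_gen: "max_gen UW.U (idl UW.U ((%i. UW.ue (vw i)) ` {..<n}))"
proof -
 have "max_gen UW.U (idl UW.U (UW.ue ` set (map vw [0..<n])))"
 proof (rule UW.los_max_gen)
 show "UW.sec g" if "g : set (map vw [0..<n])" for g using that sec_vw by auto
 show "max_gen (Wser D n w) (idl (Wser D n w) ((%g. g w) ` set (map vw [0..<n])))" if "w : Wset D" for w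
 using Ws_max_gen[OF that] by (simp add: image_image atLeast0LessThan)
 qed
 then show ?thesis by (simp add: image_image atLeast0LessThan)
qed

text \<open>The property passes through both ultraproducts in the construction of \<DD>(n) and then
  along \<open>ident\<close>.\<close>

lemma zeta_max_gen: "max_gen UW.U (idl UW.U (zeta ` S.Xs))"
proof -
 let ?v = "%i p. ring.indexed_var (Kp D p) i"
 have "max_gen UI.U (idl UI.U (UI.ue ` set (map ?v [0..<n])))"
 proof (rule UI.los_max_gen)
 show "UI.sec g" if "g : set (map ?v [0..<n])" for g using that sec_var by auto
 show "max_gen (power_series_ring (Kp D p) n) (idl (power_series_ring (Kp D p) n) ((%g. g p) ` set (map ?v [0..<n])))"
 if p: "p : primes" for p
 using series_over.ker_max_gen[OF Kps[OF p] Kp_field[OF p], of n] series_over.ker_1[OF Kps[OF p], of n]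
 by (simp add: image_image atLeast0LessThan)
 qed
 then have 1: "max_gen UI.U (idl UI.U ((%i. UI.ue (?v i)) ` {..<n}))" by (simp add: image_image atLeast0LessThan)
 let ?g = "map (%i _. UI.ue (?v i)) [0..<n]"
 have "max_gen UD.U (idl UD.U (UD.ue ` set ?g))"
 proof (rule UD.los_max_gen)
 show "UD.sec g" if "g : set ?g" for g
 using that UI.ue_closed[OF sec_var] unfolding UD.sec_def by (auto simp: inf_U)
 show "max_gen (Kser_inf D n) (idl (Kser_inf D n) ((%g. g u) ` set ?g))" for u
 using 1 by (simp add: inf_U image_image atLeast0LessThan)
 qed
 then have 2: "max_gen (Dn D n) (idl (Dn D n) ((%i. Dn_var D n i) ` {..<n}))"
 by (simp add: Dn_U image_image atLeast0LessThan Dn_var_def Dn_diag_def)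
 have ev: "eta D n ` S.Xs = (%i. Dn_var D n i) ` {..<n}"
 unfolding image_image by (rule image_cong[OF refl]) (use eta_var in auto)
 have c: "(%i. Dn_var D n i) ` {..<n} <= carrier (Dn D n)"
 unfolding ev[symmetric] using S.vars_carrier ring_hom_closed[OF eta_hom] by (auto simp: Kser_def)
 have "max_gen UW.U (idl UW.U (ident D n ` (%i. Dn_var D n i) ` {..<n}))"
 by (rule max_gen_iso[OF Dn_cring UW.U_cring ident_iso c 2])
 then show ?thesis unfolding ev[symmetric] by (simp only: zeta_def image_image comp_apply)
qed

text \<open>Nothing says that \<open>ident\<close> sends variables to variables, yet both families
  generate the ideal of nonunits.\<close>

lemma vars_eq: "idl UW.U (zeta ` S.Xs) = idl UW.U ((%i. UW.ue (vw i)) ` {..<n})"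
 using UW.U.max_gen_nonunit[OF vars_max_gen] UW.U.max_gen_nonunit[OF zeta_max_gen] by simp

text \<open>A chosen sequence of components in the factors for the image of x.\<close>

definition sx where "sx x = (SOME a. UW.sec a & zeta x = UW.ue a)"

lemma sx: "x : carrier S.P ==> UW.sec (sx x)" "x : carrier S.P ==> UW.ue (sx x) = zeta x"
proof -
 assume "x : carrier S.P"
 then have "zeta x : carrier UW.U" using ring_hom_closed[OF zeta_hom] by blast
 then have "EX a. UW.sec a & zeta x = UW.ue a" by (simp only: UW.U_carrier)
 then have "UW.sec (sx x) & zeta x = UW.ue (sx x)" unfolding sx_def by (rule someI_ex)
 then show "UW.sec (sx x)" "UW.ue (sx x) = zeta x" by auto
qed

lemma sx_idl:
 assumes "finite I" "I <= carrier S.P" "x : carrier S.P"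
 shows "zeta x : idl UW.U (zeta ` I) \<longleftrightarrow> (\<forall>\<^sub>F w in Wfilter D. sx x w : idl (Wser D n w) ((%y. sx y w) ` I))"
proof -
 have "(%y. UW.ue (sx y)) ` I = zeta ` I" by (rule image_cong[OF refl]) (use sx(2) assms(2) in blast)
 moreover have s: "UW.sec (sx y)" if "y : I" for y using sx(1) assms(2) that by blast
 ultimately show ?thesis
 using UW.los_idl_fam[where g = sx, OF assms(1) sx(1)[OF assms(3)] s] unfolding sx(2)[OF assms(3)] by simp
qed

lemma eq_transfer:
 assumes I: "finite I" "!!i. i : I ==> UW.sec (f i)" and I': "finite I'" "!!i. i : I' ==> UW.sec (g i)"
 and e: "idl UW.U ((%i. UW.ue (f i)) ` I) = idl UW.U ((%i. UW.ue (g i)) ` I')"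
 shows "\<forall>\<^sub>F w in Wfilter D. idl (Wser D n w) ((%i. f i w) ` I) = idl (Wser D n w) ((%i. g i w) ` I')"
proof -
 have c: "(%i. UW.ue (f i)) ` I <= carrier UW.U" "(%i. UW.ue (g i)) ` I' <= carrier UW.U" using I I' UW.ue_closed by blast+
 have "\<forall>\<^sub>F w in Wfilter D. (%i. f i w) ` I <= idl (Wser D n w) ((%i. g i w) ` I')"
 by (rule UW.los_sub_fam[where g = f and g' = g, OF I(1) I'(1) I(2) I'(2)]) (use UW.U.idl_mem[OF c(1)] e in auto)
 moreover have "\<forall>\<^sub>F w in Wfilter D. (%i. g i w) ` I' <= idl (Wser D n w) ((%i. f i w) ` I)"
 by (rule UW.los_sub_fam[where g = g and g' = f, OF I'(1) I(1) I'(2) I(2)]) (use UW.U.idl_mem[OF c(2)] e in auto)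
 ultimately have "\<forall>\<^sub>F w in Wfilter D. w : Wset D & (%i. f i w) ` I <= idl (Wser D n w) ((%i. g i w) ` I') &
 (%i. g i w) ` I' <= idl (Wser D n w) ((%i. f i w) ` I)"
 using UW.ev_W by (simp add: eventually_conj)
 then show ?thesis
 proof (rule eventually_mono)
 fix w assume w: "w : Wset D & (%i. f i w) ` I <= idl (Wser D n w) ((%i. g i w) ` I') &
 (%i. g i w) ` I' <= idl (Wser D n w) ((%i. f i w) ` I)"
 then interpret A: cring "Wser D n w" using UW.cr by blast
 show "idl (Wser D n w) ((%i. f i w) ` I) = idl (Wser D n w) ((%i. g i w) ` I')"
 by (rule A.idl_eqI) (use w I(2) I'(2) in \<open>auto simp: UW.sec_def\<close>)
 qed
qed

end

locale presented = lef D n for D :: "('a, 'u, 'w) lefschetz_data" and n +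
 fixes h :: "nat => (nat => 'a) set series" and E and gs bs
 assumes E: "E <= {..<n}" and hc: "h ` {..<n} <= carrier S.P" and hgen: "idl S.P (h ` {..<n}) = S.KP 1"
 and gsc: "set gs <= carrier S.P" and gsE: "idl S.P (set gs) = idl S.P (h ` E)"
 and bs: "w : Wset D ==> length (bs w) = length gs & set (bs w) <= carrier (Wser D n w)"
 and bgs: "i < length gs ==> UW.ue (%w. bs w ! i) = zeta (gs ! i)"
begin

lemma hv: "i < n ==> h i : carrier S.P"
 using hc by auto

text \<open>Both families generate the nonunits of the ultraproduct, and finitely many memberships
  transfer; so for almost all w the components of the h_i are parameters of K_w[[n]].\<close>

lemma h_w: "\<forall>\<^sub>F w in Wfilter D. idl (Wser D n w) ((%i. sx (h i) w) ` {..<n}) = idl (Wser D n w) ((%i. vw i w) ` {..<n})"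
proof (rule eq_transfer)
 have "(%i. UW.ue (sx (h i))) ` {..<n} = zeta ` h ` {..<n}"
 unfolding image_image by (rule image_cong[OF refl]) (use sx(2) hv in auto)
 moreover have "idl UW.U (zeta ` h ` {..<n}) = idl UW.U (zeta ` S.Xs)"
 by (rule hom_same_idl[OF S.P.is_cring UW.U_cring zeta_hom hc S.vars_carrier]) (use hgen S.ker_1 in simp)
 ultimately show "idl UW.U ((%i. UW.ue (sx (h i))) ` {..<n}) = idl UW.U ((%i. UW.ue (vw i)) ` {..<n})"
 using vars_eq by simp
qed (use sx(1) hv sec_vw in auto)

text \<open>This makes almost every approximation a quotient by part of a system of parameters,
  whatever representatives b_iw were chosen.\<close>

lemma bs_w: "\<forall>\<^sub>F w in Wfilter D. idl (Wser D n w) (set (bs w)) = idl (Wser D n w) ((%i. sx (h i) w) ` E)"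
proof -
 have hE: "h ` E <= carrier S.P" using hc E by auto
 have "\<forall>\<^sub>F w in Wfilter D. idl (Wser D n w) ((%i. bs w ! i) ` {..<length gs}) = idl (Wser D n w) ((%i. sx (h i) w) ` E)"
 proof (rule eq_transfer)
 have 1: "(%i. UW.ue (%w. bs w ! i)) ` {..<length gs} = zeta ` set gs"
 proof -
 have "set gs = (%i. gs ! i) ` {..<length gs}" by (auto simp: set_conv_nth)
 then show ?thesis using bgs by (simp add: image_image)
 qed
 have 2: "(%i. UW.ue (sx (h i))) ` E = zeta ` h ` E"
 unfolding image_image by (rule image_cong[OF refl]) (use sx(2) hv E in auto)
 show "idl UW.U ((%i. UW.ue (%w. bs w ! i)) ` {..<length gs}) = idl UW.U ((%i. UW.ue (sx (h i))) ` E)"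
 unfolding 1 2 by (rule hom_same_idl[OF S.P.is_cring UW.U_cring zeta_hom gsc hE gsE])
 show "finite E" using E finite_subset by blast
 show "UW.sec (%w. bs w ! i)" if "i : {..<length gs}" for i
 unfolding UW.sec_def using bs that nth_mem by fastforce
 qed (use sx(1) hv E in auto)
 then show ?thesis
 proof (rule UW.ev_mono[rotated])
 fix w assume w: "w : Wset D"
 have "(%i. bs w ! i) ` {..<length gs} = set (bs w)" using bs[OF w] by (auto simp: set_conv_nth)
 then show "idl (Wser D n w) ((%i. bs w ! i) ` {..<length gs}) = idl (Wser D n w) ((%i. sx (h i) w) ` E) ==>
 idl (Wser D n w) (set (bs w)) = idl (Wser D n w) ((%i. sx (h i) w) ` E)" by simp
 qed
qed

text \<open>There are finitely many monomials of degree N in the h_i, so for almost all w their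
  chosen components are the monomials in the chosen components of the h_i.\<close>

lemma ker_w:
 "\<forall>\<^sub>F w in Wfilter D. series_ker (Kp D (pw D w)) n N <= idl (Wser D n w) ((%y. sx y w) ` mon S.P h ` multisets_of_size {..<n} N)"
proof -
 let ?M = "multisets_of_size {..<n} N"
 have fin: "finite ?M" by (rule finite_multisets_of_size) simp
 have mem: "i < n" if "al : ?M" "i \<in># al" for al i using that by (auto simp: multisets_of_size_def)
 have "\<forall>al\<in>?M. \<forall>\<^sub>F w in Wfilter D. mon (Wser D n w) (%i. sx (h i) w) al = sx (mon S.P h al) w"
 proof
 fix al assume a: "al : ?M"
 have z: "zeta (mon S.P h al) = mon UW.U (%i. zeta (h i)) al & mon S.P h al : carrier S.P"
 by (rule hom_mon[OF S.P.is_cring UW.U_cring zeta_hom]) (use hv mem[OF a] in blast)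
 have s: "UW.sec (sx (h i))" if "i \<in># al" for i using sx(1) hv mem[OF a that] by blast
 have "mon UW.U (%i. zeta (h i)) al = mon UW.U (%i. UW.ue (sx (h i))) al"
 by (rule UW.U.mon_cong) (use sx hv mem[OF a] UW.ue_closed[OF s] in auto)
 also have "... = UW.ue (%w. mon (Wser D n w) (%i. sx (h i) w) al)" using UW.ue_mon[of al "%i. sx (h i)"] s by blast
 finally have "UW.ue (%w. mon (Wser D n w) (%i. sx (h i) w) al) = UW.ue (sx (mon S.P h al))"
 using z sx(2) by simp
 then show "\<forall>\<^sub>F w in Wfilter D. mon (Wser D n w) (%i. sx (h i) w) al = sx (mon S.P h al) w"
 using UW.ue_eq_iff[of "%w. mon (Wser D n w) (%i. sx (h i) w) al" "sx (mon S.P h al)"] UW.ue_mon[of al "%i. sx (h i)"] s sx(1) z by blast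
 qed
 then have "\<forall>\<^sub>F w in Wfilter D. \<forall>al\<in>?M. mon (Wser D n w) (%i. sx (h i) w) al = sx (mon S.P h al) w"
 by (rule eventually_ball_finite[OF fin])
 with h_w UW.ev_W show ?thesis
 proof eventually_elim
 fix w assume w: "idl (Wser D n w) ((%i. sx (h i) w) ` {..<n}) = idl (Wser D n w) ((%i. vw i w) ` {..<n})"
 "w : Wset D" "\<forall>al\<in>?M. mon (Wser D n w) (%i. sx (h i) w) al = sx (mon S.P h al) w"
 interpret Sw: series_over "Kp D (pw D w)" n by (rule Ws[OF w(2)])
 have W: "Wser D n w = Sw.P" by (simp add: Wser_def)
 have sc: "sx (h i) w : carrier Sw.P" if "i < n" for i
 unfolding W[symmetric] using sx(1)[OF hv[OF that]] w(2) unfolding UW.sec_def by blast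
 then have c: "(%i. sx (h i) w) ` {..<n} <= carrier Sw.P" by auto
 have "Sw.KP N = ideal_power Sw.P (idl Sw.P Sw.Xs) N" by (rule Sw.ker_power)
 also have "idl Sw.P Sw.Xs = idl Sw.P ((%i. sx (h i) w) ` {..<n})" using w(1) unfolding W by simp
 also have "ideal_power Sw.P ... N = idl Sw.P (mon Sw.P (%i. sx (h i) w) ` ?M)" by (rule Sw.P.ipow_idl[OF c])
 also have "mon Sw.P (%i. sx (h i) w) ` ?M = (%y. sx y w) ` mon S.P h ` ?M"
 unfolding image_image by (rule image_cong[OF refl]) (use w(3) in \<open>simp add: W\<close>)
 finally show "Sw.KP N <= idl (Wser D n w) ((%y. sx y w) ` mon S.P h ` ?M)" unfolding W by simp
 qed
qed

text \<open>\<open>fedder\<close> gives an alternative for almost every w; the ultrafilter selects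
  one for almost all w, and \<open>descent\<close> brings it back to K[[n]]. In the first case the
  precision N' is arbitrary, since the transferred membership has no error term of its own.\<close>

theorem frobenius_descent:
 assumes A: "finite A" "A <= carrier S.P" and cz: "c : carrier S.P" "z : carrier S.P"
 and mem: "\<forall>\<^sub>F w in Wfilter D. sx c w *{Wser D n w} sx z w ^{Wser D n w} (pw D w ^ m)
 : idl (Wser D n w) ((%a. sx a w ^{Wser D n w} (pw D w ^ m)) ` A Un set (bs w))"
 and N: "N <= m"
 shows "(ALL N'. z : idl S.P (A Un h ` E) <+{S.P} S.KP N') \<or> c : idl S.P (h ` E) <+{S.P} S.KP N"
proof -
 let ?M = "mon S.P h ` multisets_of_size {..<n} N"
 have hE: "h ` E <= carrier S.P" "finite (h ` E)" using hc E finite_subset[OF E] by auto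
 have AE: "finite (A Un h ` E)" "A Un h ` E <= carrier S.P" using A hE by auto
 have Mc: "?M <= carrier S.P" by (auto simp: multisets_of_size_def intro!: S.P.mon_closed hv)
 have finM: "finite ?M" by (intro finite_imageI finite_multisets_of_size) simp
 have EM: "finite (h ` E Un ?M)" "h ` E Un ?M <= carrier S.P" using hE Mc finM by auto
 have "\<forall>\<^sub>F w in Wfilter D. sx z w : idl (Wser D n w) ((%y. sx y w) ` (A Un h ` E)) \<or>
 sx c w : idl (Wser D n w) ((%y. sx y w) ` (h ` E Un ?M))"
 using mem h_w bs_w ker_w[of N] UW.ev_W
 proof eventually_elim
 fix w
 assume mw: "sx c w *{Wser D n w} sx z w ^{Wser D n w} (pw D w ^ m)
 : idl (Wser D n w) ((%a. sx a w ^{Wser D n w} (pw D w ^ m)) ` A Un set (bs w))"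
 and hw: "idl (Wser D n w) ((%i. sx (h i) w) ` {..<n}) = idl (Wser D n w) ((%i. vw i w) ` {..<n})"
 and bw: "idl (Wser D n w) (set (bs w)) = idl (Wser D n w) ((%i. sx (h i) w) ` E)"
 and kw: "series_ker (Kp D (pw D w)) n N <= idl (Wser D n w) ((%y. sx y w) ` ?M)"
 and w: "w : Wset D"
 let ?q = "pw D w ^ m"
 have p: "Factorial_Ring.prime (pw D w)" "pw D w : primes" using pw_prime[OF w] by auto
 obtain rt where rt: "frob_series (Kp D (pw D w)) n ?q rt" using exists_frob_series[OF ldKp[OF p(2)] p(1) ldch[OF p(2)]] by blast
 interpret Fw: frob_series "Kp D (pw D w)" n ?q rt by (rule rt)
 have W: "Wser D n w = Fw.P" by (simp add: Wser_def)
 have sc: "sx y w : carrier Fw.P" if "y : carrier S.P" for y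
 unfolding W[symmetric] using sx(1)[OF that] w unfolding UW.sec_def by blast
 have hwc: "(%i. sx (h i) w) ` {..<n} <= carrier Fw.P" using sc hv by auto
 interpret Cw: frob_coords "Kp D (pw D w)" n ?q rt "%i. sx (h i) w"
 by (intro frob_coords.intro frob_coords_axioms.intro rt hwc) (use hw in \<open>simp add: W\<close>)
 let ?A = "(%a. sx a w) ` A" and ?Aq = "(%a. sx a w ^{Fw.P} ?q) ` A" and ?E = "(%i. sx (h i) w) ` E"
 have Ac: "?A <= carrier Fw.P" "?Aq <= carrier Fw.P" using sc A(2) by auto
 have Ec: "?E <= carrier Fw.P" using hwc E by auto
 have bc: "set (bs w) <= carrier Fw.P" using bs[OF w] W by simp
 have "idl Fw.P (?Aq Un set (bs w)) = idl Fw.P (?Aq Un ?E)"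
 unfolding Fw.P.idl_union[OF Ac(2) bc] Fw.P.idl_union[OF Ac(2) Ec] using bw unfolding W by simp
 then have "sx c w *{Fw.P} sx z w ^{Fw.P} ?q : idl Fw.P ((%a. a ^{Fw.P} ?q) ` ?A Un ?E)"
 using mw unfolding W by (simp add: image_image)
 \<comment> \<open>q = p(w)^m is at least 2^m > m >= N, uniformly in w.\<close>
 moreover have "N <= ?q"
 proof -
 have "m < 2 ^ m" by (rule less_exp)
 also have "(2::nat) ^ m <= ?q" by (rule power_mono) (use prime_ge_2_nat[OF p(1)] in auto)
 finally show ?thesis using N by simp
 qed
 ultimately have "sx z w : idl Fw.P (?A Un ?E) \<or> sx c w : idl Fw.P ?E <+{Fw.P} Fw.KP N"
 by (intro Cw.fedder[OF E Ac(1) sc[OF cz(1)] sc[OF cz(2)]])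
 moreover have "idl Fw.P ?E <+{Fw.P} Fw.KP N <= idl Fw.P (?E Un (%y. sx y w) ` ?M)"
 proof -
 have Mw: "(%y. sx y w) ` ?M <= carrier Fw.P" using sc Mc by blast
 show ?thesis unfolding Fw.P.idl_union[OF Ec Mw] using kw unfolding W by (intro Fw.P.set_add_mono) auto
 qed
 ultimately show "sx z w : idl (Wser D n w) ((%y. sx y w) ` (A Un h ` E)) \<or>
 sx c w : idl (Wser D n w) ((%y. sx y w) ` (h ` E Un ?M))"
 unfolding W image_Un image_image by blast
 qed
 then have or: "\<forall>\<^sub>F w in Wfilter D. \<not> sx z w : idl (Wser D n w) ((%y. sx y w) ` (A Un h ` E)) -->
 sx c w : idl (Wser D n w) ((%y. sx y w) ` (h ` E Un ?M))"
 by (rule eventually_mono) blast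
 consider "\<forall>\<^sub>F w in Wfilter D. sx z w : idl (Wser D n w) ((%y. sx y w) ` (A Un h ` E))"
 | "\<forall>\<^sub>F w in Wfilter D. \<not> sx z w : idl (Wser D n w) ((%y. sx y w) ` (A Un h ` E))"
 using UW.ultra_dichotomy by blast
 then show ?thesis
 proof cases
 case 1
 then have "zeta z : idl UW.U (zeta ` (A Un h ` E))" using sx_idl[OF AE cz(2)] by blast
 then show ?thesis using descent[OF AE cz(2)] by blast
 next
 case 2
 then have "\<forall>\<^sub>F w in Wfilter D. sx c w : idl (Wser D n w) ((%y. sx y w) ` (h ` E Un ?M))"
 using or by eventually_elim blast
 then have "zeta c : idl UW.U (zeta ` (h ` E Un ?M))" using sx_idl[OF EM cz(1)] by blast
 then have c: "c : idl S.P (h ` E Un ?M) <+{S.P} S.KP N" by (rule descent[OF EM cz(1)])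
 have hX: "idl S.P S.Xs = idl S.P (h ` {..<n})" using hgen S.ker_1 by (simp only:)
 \<comment> \<open>The degree N monomials in h generate the series of order N, so the error terms of
   \<open>fedder\<close> and of \<open>descent\<close> coincide.\<close>
 have "S.KP N = idl S.P ?M" by (rule trans[OF S.ker_power[of N, unfolded hX] S.P.ipow_idl[OF hc]])
 then have u: "idl S.P (h ` E Un ?M) = idl S.P (h ` E) <+{S.P} S.KP N"
 using S.P.idl_union[OF hE(1) Mc] by simp
 have Z: "ideal (idl S.P (h ` E) <+{S.P} S.KP N) S.P"
 by (rule S.P.add_ideals[OF S.P.idl_ideal[OF hE(1)] S.PF.K_ideal])
 have "idl S.P (h ` E Un ?M) <+{S.P} S.KP N <= idl S.P (h ` E) <+{S.P} S.KP N"
 by (rule S.P.add_ideals_minimal[OF Z]) (use u S.P.add_ideals_sub(2)[OF S.P.idl_ideal[OF hE(1)] S.PF.K_ideal] in auto)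
 then show ?thesis using c by blast
 qed
qed

end

section \<open>The closure of an ideal\<close>

lemma quot_pow:
 assumes R: "cring R" and Q: "ideal Q R" and x: "x : carrier R"
 shows "(Q +>{R} x) ^{R Quot Q} (k::nat) = Q +>{R} (x ^{R} k)"
proof -
 interpret R: cring R by fact
 interpret q: ring_hom_ring R "R Quot Q" "%a. Q +>{R} a" by (rule ideal.rcos_ring_hom_ring[OF Q])
 show ?thesis using q.hom_nat_pow[OF x, of k] by simp
qed

context presented
begin

definition Qw where "Qw w = idl (Wser D n w) (set (bs w))"
definition Ap where "Ap w = Wser D n w Quot Qw w"

lemma Qw_ideal: "w : Wset D ==> ideal (Qw w) (Wser D n w)"
 unfolding Qw_def using cring.idl_ideal[OF UW.cr] bs by blast

sublocale UA: ultra "Wset D" "Wfilter D" Ap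
 by (intro ultra.intro ldW) (simp add: Ap_def ideal.quotient_is_cring[OF Qw_ideal UW.cr])

definition co :: "('w => 'a series) => 'w => 'a series set" where
 "co a w = Qw w +>{Wser D n w} a w"

definition pr where "pr x = ultra_map (Wset D) (Wfilter D) Ap (%w f. Qw w +>{Wser D n w} f) (zeta x)"
definition Fi where "Fi = ultra_map (Wset D) (Wfilter D) Ap (%w x. x ^{Ap w} pw D w)"
text \<open>Represents the m-th iterate of the non-standard Frobenius before passing to the
  quotients; the exponent p(w)^m varies with w.\<close>

definition fpow :: "nat => ('w => 'a series) => 'w => 'a series" where
 "fpow m a w = a w ^{Wser D n w} (pw D w ^ m)"

lemma coset_closed: "w : Wset D ==> f : carrier (Wser D n w) ==> Qw w +>{Wser D n w} f : carrier (Ap w)"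
 unfolding Ap_def quotient_cosets(1)[OF UW.cr Qw_ideal] by blast

lemma co_sec: "UW.sec a ==> UA.sec (co a)"
 unfolding UW.sec_def UA.sec_def co_def using coset_closed by blast

lemma fpow_sec: "UW.sec a ==> UW.sec (fpow m a)"
 unfolding UW.sec_def fpow_def using monoid.nat_pow_closed[OF ring.is_monoid[OF cring.axioms(1)[OF UW.cr]]] by blast

lemma pr_ue: "x : carrier S.P ==> pr x = UA.ue (co (sx x))"
proof -
 assume x: "x : carrier S.P"
 show ?thesis unfolding pr_def sx(2)[OF x, symmetric] co_def
 by (rule ultra_map_elem(1)[OF UW.ultra_axioms UA.ultra_axioms coset_closed sx(1)[OF x]])
qed

lemma pr_closed: "x : carrier S.P ==> pr x : carrier UA.U"
 using pr_ue UA.ue_closed[OF co_sec[OF sx(1)]] by simp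

lemma Fi_pow: "UW.sec a ==> (Fi ^^ m) (UA.ue (co a)) = UA.ue (co (fpow m a))"
proof (induct m)
 case 0
 have "\<forall>\<^sub>F w in Wfilter D. co a w = co (fpow 0 a) w"
 proof (rule UW.evI)
 fix w assume w: "w : Wset D"
 interpret A: cring "Wser D n w" by (rule UW.cr[OF w])
 have "a w : carrier (Wser D n w)" using 0 w unfolding UW.sec_def by blast
 then show "co a w = co (fpow 0 a) w" by (simp add: co_def fpow_def)
 qed
 then show ?case using UA.ue_eq_iff[OF co_sec[OF 0] co_sec[OF fpow_sec[OF 0]]] by simp
next
 case (Suc m)
 have pc: "x ^{Ap w} pw D w : carrier (Ap w)" if "w : Wset D" "x : carrier (Ap w)" for w x
 using monoid.nat_pow_closed[OF ring.is_monoid[OF cring.axioms(1)[OF UA.cr]]] that by blast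
 note b = co_sec[OF fpow_sec[OF Suc(2)]]
 have "(Fi ^^ Suc m) (UA.ue (co a)) = Fi (UA.ue (co (fpow m a)))" using Suc by simp
 also have "... = UA.ue (%w. co (fpow m a) w ^{Ap w} pw D w)"
 unfolding Fi_def by (rule ultra_map_elem(1)[OF UA.ultra_axioms UA.ultra_axioms pc b])
 also have "... = UA.ue (co (fpow (Suc m) a))"
 proof -
 have s: "UA.sec (%w. co (fpow m a) w ^{Ap w} pw D w)" using b pc unfolding UA.sec_def by blast
 have "\<forall>\<^sub>F w in Wfilter D. co (fpow m a) w ^{Ap w} pw D w = co (fpow (Suc m) a) w"
 proof (rule UW.evI)
 fix w assume w: "w : Wset D"
 interpret A: cring "Wser D n w" by (rule UW.cr[OF w])
 have aw: "a w : carrier (Wser D n w)" using Suc(2) w unfolding UW.sec_def by blast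
 then have "co (fpow m a) w ^{Ap w} pw D w = Qw w +>{Wser D n w} ((a w ^{Wser D n w} (pw D w ^ m)) ^{Wser D n w} pw D w)"
 unfolding co_def fpow_def Ap_def by (intro quot_pow[OF A.is_cring Qw_ideal[OF w]]) simp
 also have "(a w ^{Wser D n w} (pw D w ^ m)) ^{Wser D n w} pw D w = a w ^{Wser D n w} (pw D w ^ Suc m)"
 using A.nat_pow_pow[OF aw, of "pw D w ^ m" "pw D w"] by (simp add: mult.commute)
 finally show "co (fpow m a) w ^{Ap w} pw D w = co (fpow (Suc m) a) w" by (simp only: co_def fpow_def)
 qed
 then show ?thesis using UA.ue_eq_iff[OF s co_sec[OF fpow_sec[OF Suc(2)]]] by blast
 qed
 finally show ?case .
qed

text \<open>The ideal on the right may have infinitely many generators, but one membership involves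
  finitely many, and their preimages form A. Lifting from the quotients to K_w[[n]] adds the
  relations \<open>bs w\<close> to the generators.\<close>

theorem closure_dichotomy:
 assumes B: "B <= carrier S.P" and cz: "c : carrier S.P" "z : carrier S.P"
 and mem: "pr c *{UA.U} (Fi ^^ m) (pr z) : idl UA.U ((%b. (Fi ^^ m) (pr b)) ` B)" and N: "N <= m"
 shows "(EX A<=B. ALL N'. z : idl S.P (A Un h ` E) <+{S.P} S.KP N') \<or> c : idl S.P (h ` E) <+{S.P} S.KP N"
proof -
 let ?f = "%x. co (fpow m (sx x))"
 have s: "UA.sec (?f x)" if "x : carrier S.P" for x by (rule co_sec[OF fpow_sec[OF sx(1)[OF that]]])
 have fe: "(Fi ^^ m) (pr x) = UA.ue (?f x)" if "x : carrier S.P" for x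
 using Fi_pow[OF sx(1)[OF that]] pr_ue[OF that] by simp
 have imB: "(%b. (Fi ^^ m) (pr b)) ` B = (%x. UA.ue (?f x)) ` B" by (rule image_cong[OF refl]) (use fe B in blast)
 have Bc: "(%x. UA.ue (?f x)) ` B <= carrier UA.U" using s UA.ue_closed B by blast
 have prod: "pr c *{UA.U} (Fi ^^ m) (pr z) = UA.ue (%w. co (sx c) w *{Ap w} ?f z w)"
 unfolding fe[OF cz(2)] pr_ue[OF cz(1)] by (rule UA.ue_mult[OF co_sec[OF sx(1)[OF cz(1)]] s[OF cz(2)]])
 obtain A' where A': "finite A'" "A' <= (%x. UA.ue (?f x)) ` B" "pr c *{UA.U} (Fi ^^ m) (pr z) : idl UA.U A'"
 using UA.U.idl_finite_subset[OF Bc] mem unfolding imB by blast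
 obtain A where A: "A <= B" "finite A" "A' = (%x. UA.ue (?f x)) ` A" using finite_subset_image[OF A'(1,2)] by blast
 have AS: "A <= carrier S.P" using A B by blast
 have ps: "UA.sec (%w. co (sx c) w *{Ap w} ?f z w)" by (rule UA.sec_ops(1)[OF co_sec[OF sx(1)[OF cz(1)]] s[OF cz(2)]])
 have sA: "UA.sec (?f x)" if "x : A" for x using s AS that by blast
 have "\<forall>\<^sub>F w in Wfilter D. co (sx c) w *{Ap w} ?f z w : idl (Ap w) ((%x. ?f x w) ` A)"
 using UA.los_idl_fam[where g = ?f, OF A(2) ps sA] A'(3) unfolding prod A(3) by blast
 then have "\<forall>\<^sub>F w in Wfilter D. sx c w *{Wser D n w} sx z w ^{Wser D n w} (pw D w ^ m)
 : idl (Wser D n w) ((%a. sx a w ^{Wser D n w} (pw D w ^ m)) ` A Un set (bs w))"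
 proof (rule UW.ev_mono[rotated])
 fix w assume w: "w : Wset D" and m: "co (sx c) w *{Ap w} ?f z w : idl (Ap w) ((%x. ?f x w) ` A)"
 let ?W = "Wser D n w" and ?q = "pw D w ^ m"
 interpret A: cring ?W by (rule UW.cr[OF w])
 have sc: "sx x w : carrier ?W" if "x : carrier S.P" for x using sx(1)[OF that] w unfolding UW.sec_def by blast
 let ?A = "(%a. sx a w ^{?W} ?q) ` A"
 have Ac: "?A <= carrier ?W" using sc AS by auto
 have bc: "set (bs w) <= carrier ?W" using bs[OF w] by simp
 have xc: "sx z w ^{?W} ?q : carrier ?W" "sx c w : carrier ?W" using sc cz by auto
 have "co (sx c) w *{Ap w} ?f z w = Qw w +>{?W} (sx c w *{?W} sx z w ^{?W} ?q)"
 unfolding co_def fpow_def Ap_def by (rule quotient_cosets(2)[OF A.is_cring Qw_ideal[OF w] xc(2,1)])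
 moreover have "(%x. ?f x w) ` A = (%a. Qw w +>{?W} a) ` ?A" by (simp add: image_image co_def fpow_def)
 ultimately have "sx c w *{?W} sx z w ^{?W} ?q : idl ?W ?A <+{?W} Qw w"
 using quot_idl_iff[OF A.is_cring Qw_ideal[OF w] Ac A.m_closed[OF xc(2,1)]] m unfolding Ap_def by simp
 then show "sx c w *{?W} sx z w ^{?W} ?q : idl ?W (?A Un set (bs w))"
 unfolding A.idl_union[OF Ac bc] Qw_def .
 qed
 from frobenius_descent[OF A(2) AS cz this N] show ?thesis using A(1) by blast
qed

end

section \<open>Chains of primes and generators of a regular ring\<close>

context noeth_local
begin

text \<open>The supremum is attained: otherwise all chains would have length at most d - 1. The
  bottom of a longest chain is a minimal prime, since a smaller prime would prolong the
  chain.\<close>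

lemma krull_dim_chain:
 assumes "krull_dim R = enat d" "maximalideal mI R"
 obtains Q where "!!i. i <= d ==> primeideal (Q i) R" "!!i. i < d ==> Q i \<subset> Q (Suc i)" "minimal_prime (Q (0::nat)) R"
proof -
 let ?C = "%n Q. (ALL i<=n. primeideal (Q i) R) & (\<forall>i<n. Q i \<subset> Q (Suc i))"
 have le: "n <= d" if "?C n Q" for n and Q :: "nat => 'a set"
 proof -
 have "enat n <= krull_dim R" unfolding krull_dim_def by (rule SUP_upper) (use that in blast)
 then show ?thesis using assms(1) by simp
 qed
 have "EX Q. ?C d Q"
 proof (cases d)
 case 0
 then show ?thesis using maximalideal_prime[OF assms(2)] by (intro exI[of _ "%_. mI"]) simp
 next
 case (Suc e)
 show ?thesis
 proof (rule ccontr)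
 assume n: "\<not> ?thesis"
 have "enat m <= enat e" if mC: "m : {n. \<exists>Q :: nat => 'a set. ?C n Q}" for m
 proof -
 obtain Q :: "nat => 'a set" where Q: "?C m Q" using mC by blast
 have "m ~= d" using n Q by blast
 then show ?thesis using le[OF Q] Suc by simp
 qed
 then have "krull_dim R <= enat e" unfolding krull_dim_def by (rule SUP_least)
 then show False using assms(1) Suc by simp
 qed
 qed
 then obtain Q :: "nat => 'a set" where Q: "?C d Q" by blast
 have "minimal_prime (Q 0) R"
 unfolding minimal_prime_def
 proof (intro conjI allI impI)
 show "primeideal (Q 0) R" using Q by blast
 fix I assume I: "primeideal I R" "I <= Q 0"
 show "I = Q 0"
 proof (rule ccontr)
 assume "I ~= Q 0"
 then have lt: "I \<subset> Q 0" using I(2) by blast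
 let ?Q = "%i. case i of 0 => I | Suc j => Q j"
 have C: "?C (Suc d) ?Q"
 proof (intro conjI allI impI)
 show "primeideal (?Q i) R" if "i <= Suc d" for i using that Q I(1) by (cases i) auto
 show "?Q i \<subset> ?Q (Suc i)" if "i < Suc d" for i using that Q lt by (cases i) auto
 qed
 show False using le[OF C] by simp
 qed
 qed
 then show ?thesis using Q that by blast
qed

lemma minimal_generators:
 assumes "max_ideal R = mI"
 obtains y where "y ` {..<embedding_dim R} <= carrier R" "mI = Idl (y ` {..<embedding_dim R})"
 "!!A. A <= carrier R ==> finite A ==> mI = Idl A ==> embedding_dim R <= card A"
proof -
 let ?P = "%d. EX A <= carrier R. finite A & card A = d & Idl A = max_ideal R"
 obtain A0 where "A0 <= carrier R" "finite A0" "mI = Idl A0" using finetely_gen[OF m_ideal] by blast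
 then have "?P (card A0)" using assms by blast
 then have "?P (embedding_dim R)" unfolding embedding_dim_def by (rule LeastI)
 then obtain A where A: "A <= carrier R" "finite A" "card A = embedding_dim R" "Idl A = max_ideal R" by blast
 obtain y where "bij_betw y {0..<card A} A" using ex_bij_betw_nat_finite[OF A(2)] by blast
 then have y: "y ` {..<embedding_dim R} = A" using A(3) by (simp add: bij_betw_def atLeast0LessThan)
 show ?thesis
 proof
 show "y ` {..<embedding_dim R} <= carrier R" "mI = Idl (y ` {..<embedding_dim R})" using y A assms by auto
 show "embedding_dim R <= card B" if "B <= carrier R" "finite B" "mI = Idl B" for B
 unfolding embedding_dim_def by (rule Least_le) (use that assms in blast)
 qed
qed

end

context hull_cover
begin

text \<open>\<theta> sends the relations B to 0 and A into the image of \<bb>, after which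
  \<open>rho_reflect\<close> descends to R.\<close>

lemma lift_reflect:
 assumes I: "ideal \<bb> R" and z: "z : carrier R" and f: "f : carrier S.P" "\<theta> f = \<rho> z"
 and A: "A <= carrier S.P" "!!a. a : A ==> \<theta> a : \<rho> ` \<bb>"
 and B: "B <= carrier S.P" "idl S.P B = a_kernel S.P D.C \<theta>"
 and m: "f : idl S.P (A Un B) <+{S.P} S.KP N"
 shows "z : \<bb> <+> Ip N"
proof -
 have AB: "A Un B <= carrier S.P" using A B by blast
 have rb: "\<rho> ` \<bb> <= carrier D.C" using ideal_closed(1)[OF I] by auto
 note T = D.C.idl_ideal[OF rb]
 have "\<theta> b = 0{D.C}" if "b : B" for b using S.P.idl_mem[OF B(1) that] B(2) by (simp add: kernel_iff)
 then have "\<theta> ` (A Un B) <= idl D.C (\<rho> ` \<bb>)"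
 using A(2) D.C.idl_mem[OF rb] D.C.ideal_closed(2)[OF T] by auto
 then have 1: "idl D.C (\<theta> ` (A Un B)) <= idl D.C (\<rho> ` \<bb>)" by (rule D.C.genideal_minimal[OF T])
 have "\<theta> f : idl D.C (\<rho> ` \<bb>) <+{D.C} D.ker N"
 proof (rule hom_set_add[OF th_hom S.P.idl_carrier[OF AB] S.PF.K_closed(1) _ th_ker m])
 show "\<theta> x : idl D.C (\<rho> ` \<bb>)" if "x : idl S.P (A Un B)" for x
 using hom_idl_image[OF S.P.is_cring D.C.is_cring th_hom AB that] 1 by blast
 qed
 then show ?thesis using rho_reflect[OF I z] f(2) by simp
qed

lemma reflect_all: "ideal \<bb> R ==> z : carrier R ==> (!!N. z : \<bb> <+> Ip N) ==> z : \<bb>"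
 using krull by blast

end

theorem theorem6p3:
 fixes D :: "('a, 'u, 'w) lefschetz_data"
 and \<Lambda> :: "('r, 'a) lefschetz_object"
 and \<aa> :: "'r set"
 assumes "lefschetz_data D"
 and "lefschetz_object D \<Lambda>"
 and "hull_presentation D \<Lambda> \<theta> as bs"
 and "regular_local_ring (base \<Lambda>)"
 and "ideal \<aa> (base \<Lambda>)"
 shows "nonstandard_tight_closure D \<Lambda> \<theta> bs \<aa> = \<aa>"
proof -
 let ?n = "nvars \<Lambda>" and ?R = "base \<Lambda>" and ?M = "max_ideal (base \<Lambda>)"
 interpret L: lef D ?n by (rule lef.intro[OF assms(1)])
 have o1: "noetherian_ring ?R" and o2: "local_ring ?R" and o3: "contains_rationals ?R"
 and o4: "subfield (subf \<Lambda>) ?R"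
 and o5: "!!x. x : carrier (?R Quot ?M) ==> ring.algebraic (?R Quot ?M) ((%a. ?M +>{?R} a) ` subf \<Lambda>) x"
 and o6: "umap \<Lambda> : ring_hom ?R (KK D)" and o7: "a_kernel ?R (KK D) (umap \<Lambda>) = ?M"
 and o9: "idl (Rhat_ku D \<Lambda>) (set (gens \<Lambda>)) = max_ideal (Rhat_ku D \<Lambda>)"
 using assms(2) unfolding lefschetz_object_def Let_def by blast+
 interpret N: noeth_local ?R ?M by (rule noeth_localI[OF o1 o2])
 interpret C: coeff_extension ?R ?M "KK D" "subf \<Lambda>" "umap \<Lambda>"
 by (intro coeff_extension.intro coeff_extension_axioms.intro N.noeth_local_axioms L.ldK o3 o4 o5 o6 o7)
 \<comment> \<open>The constructions of the locales are those of the definitions, up to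
   unfolding.\<close>
 have ks: "kstar \<Lambda> = C.ks" by (simp only: kstar_def C.ks_def Rhat_def to_Rhat_def)
 have uh: "uhat \<Lambda> = C.uh" by (rule ext) (simp only: uhat_def C.uh_def)
 have T: "Rtensor D \<Lambda> = C.T" by (simp only: Rtensor_def ks uh Rhat_def)
 have te: "Rtensor_elem D \<Lambda> = C.BC.te" by (simp only: Rtensor_elem_def ks uh Rhat_def)
 have J: "Rtensor_ideal D \<Lambda> = C.J" by (simp only: Rtensor_ideal_def C.J_def T te to_Rhat_def)
 have ku: "Rhat_ku D \<Lambda> = C.D.C" by (simp only: Rhat_ku_def T J)
 have rho: "R_to_Rhat_ku D \<Lambda> = C.\<rho>" by (rule ext) (simp only: R_to_Rhat_ku_def C.\<rho>_def T J te to_Rhat_def)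
 have kap: "K_to_Rhat_ku D \<Lambda> = C.kp" by (rule ext) (simp only: K_to_Rhat_ku_def C.kp_def T J te Rhat_def)
 have h1: "\<theta> : ring_hom L.S.P C.D.C"
 and h2: "!!c. c : carrier (KK D) ==> \<theta> (ring.indexed_const (KK D) c) = C.kp c"
 and h3: "!!i. i < ?n ==> \<theta> (ring.indexed_var (KK D) i) = gens \<Lambda> ! i"
 and h4: "set as <= carrier L.S.P" and h5: "idl L.S.P (set as) = a_kernel L.S.P C.D.C \<theta>"
 and h6: "!!w. w : Wset D ==> length (bs w) = length as & set (bs w) <= carrier (Wser D ?n w)"
 and h7: "!!i. i < length as ==> L.UW.ue (%w. bs w ! i) = ident D ?n (eta D ?n (as ! i))"
 using assms(3) unfolding hull_presentation_def is_theta_hat_def Let_def Kser_def ku kap by blast+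
 have gi: "set (gens \<Lambda>) = (%i. \<theta> (ring.indexed_var (KK D) i)) ` {..<?n}"
 proof -
 have "set (gens \<Lambda>) = (%i. gens \<Lambda> ! i) ` {..<?n}" by (auto simp: set_conv_nth)
 also have "... = (%i. \<theta> (ring.indexed_var (KK D) i)) ` {..<?n}" by (rule image_cong[OF refl]) (simp add: h3)
 finally show ?thesis .
 qed
 have kg: "C.D.ker 1 = idl C.D.C ((%i. \<theta> (ring.indexed_var (KK D) i)) ` {..<?n})"
 using o9 unfolding ku C.D_max_ideal gi by (rule sym)
 interpret H: hull_cover ?R ?M "KK D" "subf \<Lambda>" "umap \<Lambda>" ?n \<theta>
 by (intro hull_cover.intro hull_cover_axioms.intro C.coeff_extension_axioms h1 h2 kg)
 have mx: "maximalideal ?M ?R"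
 unfolding max_ideal_def by (rule theI') (use o2 in \<open>simp add: local_ring_def\<close>)
 have kd: "krull_dim ?R = enat (embedding_dim ?R)" using assms(4) by (simp add: regular_local_ring_def)
 obtain Q where Q: "!!i. i <= embedding_dim ?R ==> primeideal (Q i) ?R"
 "!!i. i < embedding_dim ?R ==> Q i \<subset> Q (Suc i)" and Q0: "minimal_prime (Q (0::nat)) ?R"
 by (rule N.krull_dim_chain[OF kd mx]) (assumption | rule that)+
 obtain y where y: "y ` {..<embedding_dim ?R} <= carrier ?R" "?M = idl ?R (y ` {..<embedding_dim ?R})"
 and ymin: "!!A. A <= carrier ?R ==> finite A ==> ?M = idl ?R A ==> embedding_dim ?R <= card A"
 by (rule N.minimal_generators[OF refl]) (assumption | rule that)+
 have "EX h E. E <= {..<?n} & h ` {..<?n} <= carrier L.S.P & idl L.S.P (h ` {..<?n}) = L.S.KP 1 &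
 a_kernel L.S.P C.D.C \<theta> = idl L.S.P (h ` E)"
 by (rule H.regular_presentation[of y "embedding_dim ?R" Q]) (fact y ymin Q | rule ymin; assumption | rule Q; assumption)+
 then obtain h E where hE: "E <= {..<?n}" "h ` {..<?n} <= carrier L.S.P" "idl L.S.P (h ` {..<?n}) = L.S.KP 1"
 "a_kernel L.S.P C.D.C \<theta> = idl L.S.P (h ` E)" by (elim exE conjE)
 interpret P: presented D ?n h E as bs
 by (intro presented.intro presented_axioms.intro L.lef_axioms hE(1-3) h4)
 (use h5 hE(4) h6 h7 in \<open>simp_all add: L.zeta_def\<close>)
 have ap: "approx D \<Lambda> bs = P.Ap" by (rule ext) (simp only: approx_def P.Ap_def P.Qw_def)
 have hull: "lefschetz_hull D \<Lambda> bs = P.UA.U" by (simp only: lefschetz_hull_def ap)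
 have Fi: "F_inf D \<Lambda> bs = P.Fi" by (simp only: F_inf_def P.Fi_def ap)
 \<comment> \<open>The lift chosen in \<open>eta_obj\<close>. It need not be additive; what matters
   is its value under \<theta>.\<close>
 define l where "l z = (SOME f. f \<in> carrier (Kser D ?n) & \<theta> f = R_to_Rhat_ku D \<Lambda> z)" for z
 have eta: "eta_obj D \<Lambda> \<theta> bs = (%z. P.pr (l z))"
 by (rule ext) (simp only: eta_obj_def hull_proj_def P.pr_def ap P.Qw_def L.zeta_def comp_apply l_def)
 have l: "l z : carrier L.S.P" "\<theta> (l z) = C.\<rho> z" if z: "z : carrier ?R" for z
 proof -
 have "EX f. f : carrier (Kser D ?n) & \<theta> f = R_to_Rhat_ku D \<Lambda> z"
 unfolding rho Kser_def using H.th_surj[OF C.rho_closed[OF z]] by blast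
 then have "l z : carrier (Kser D ?n) & \<theta> (l z) = R_to_Rhat_ku D \<Lambda> z" unfolding l_def by (rule someI_ex)
 then show "l z : carrier L.S.P" "\<theta> (l z) = C.\<rho> z" unfolding rho Kser_def by blast+
 qed
 note ac = N.ideal_closed[OF assms(5)]
 have la: "l ` \<aa> <= carrier L.S.P" using l(1) ac(8) by blast
 have hEc: "h ` E <= carrier L.S.P" using hE(1,2) by blast
 show ?thesis
 proof (intro subset_antisym subsetI)
 fix z assume "z : nonstandard_tight_closure D \<Lambda> \<theta> bs \<aa>"
 then obtain c m0 where z: "z : carrier ?R" and c: "c : carrier ?R" "!!I. minimal_prime I ?R ==> c ~: I"
 and mem: "!!m. m \<ge> m0 ==> P.pr (l c) *{P.UA.U} (P.Fi ^^ m) (P.pr (l z)) : idl P.UA.U ((%a. (P.Fi ^^ m) (P.pr (l a))) ` \<aa>)"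
 unfolding nonstandard_tight_closure_def Let_def hull eta Fi by blast
 show "z : \<aa>"
 proof (rule ccontr)
 assume nz: "z ~: \<aa>"
 \<comment> \<open>For each N the exponent \<open>max m0 N\<close> is both in the range of the
   hypothesis and at least N.\<close>
 have "c : {0{?R}} <+{?R} ideal_power ?R ?M N" for N
 proof -
 have m: "P.pr (l c) *{P.UA.U} (P.Fi ^^ max m0 N) (P.pr (l z)) : idl P.UA.U ((%b. (P.Fi ^^ max m0 N) (P.pr b)) ` l ` \<aa>)"
 using mem[of "max m0 N"] by (simp add: image_image)
 consider A where "A <= l ` \<aa>" "!!N'. l z : idl L.S.P (A Un h ` E) <+{L.S.P} L.S.KP N'"
 | "l c : idl L.S.P (h ` E) <+{L.S.P} L.S.KP N"
 using P.closure_dichotomy[OF la l(1)[OF c(1)] l(1)[OF z] m max.cobounded2] by blast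
 then show ?thesis
 proof cases
 case 1
 \<comment> \<open>This alternative holds at every precision N', so Krull's theorem puts z into
   \<aa>.\<close>
 have "z : \<aa> <+{?R} ideal_power ?R ?M N'" for N'
 proof (rule H.lift_reflect[OF assms(5) z l(1)[OF z] l(2)[OF z] _ _ hEc hE(4)[symmetric] 1(2)])
 show "A <= carrier L.S.P" using 1(1) la by blast
 show "\<theta> a : C.\<rho> ` \<aa>" if aA: "a : A" for a
 proof -
 obtain b where b: "b : \<aa>" "a = l b" using 1(1) aA by blast
 then show ?thesis using l(2)[OF ac(8)[OF b(1)]] by simp
 qed
 qed
 then have "z : \<aa>" by (rule H.reflect_all[OF assms(5) z])
 then show ?thesis using nz by blast
 next
 case 2
 show ?thesis
 by (rule H.lift_reflect[OF N.zeroideal c(1) l(1)[OF c(1)] l(2)[OF c(1)], of "{}" "h ` E"])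
 (use hEc hE(4) 2 in simp_all)
 qed
 qed
 \<comment> \<open>Lying in every power of the maximal ideal, c is 0 and hence in the minimal prime
   Q 0.\<close>
 then have "c : {0{?R}}" by (rule H.reflect_all[OF N.zeroideal c(1)])
 moreover have "ideal (Q 0) ?R" using Q0 by (simp add: minimal_prime_def primeideal.axioms(1))
 then have "0{?R} : Q 0" by (rule N.ideal_closed(2))
 ultimately show False using c(2)[OF Q0] by simp
 qed
 next
 fix z assume z: "z : \<aa>"
 have zc: "z : carrier ?R" by (rule ac(8)[OF z])
 \<comment> \<open>The multiplier c = 1 witnesses that elements of \<aa> belong to the
   closure.\<close>
 have "1{?R} ~: I" if "minimal_prime I ?R" for I
 proof -
 have "primeideal I ?R" using that by (simp add: minimal_prime_def)
 then show ?thesis using primeideal.I_notcarr ideal.one_imp_carrier primeideal.axioms(1) by blast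
 qed
 moreover have "P.pr (l 1{?R}) *{P.UA.U} (P.Fi ^^ m) (P.pr (l z)) : idl P.UA.U ((%a. (P.Fi ^^ m) (P.pr (l a))) ` \<aa>)" for m
 proof -
 have cl: "(%a. (P.Fi ^^ m) (P.pr (l a))) ` \<aa> <= carrier P.UA.U"
 proof
 fix x assume "x : (%a. (P.Fi ^^ m) (P.pr (l a))) ` \<aa>"
 then obtain a where a: "a : \<aa>" "x = (P.Fi ^^ m) (P.pr (l a))" by blast
 have s: "l a : carrier L.S.P" using la a(1) by blast
 show "x : carrier P.UA.U"
 unfolding a(2) P.pr_ue[OF s] P.Fi_pow[OF L.sx(1)[OF s]] by (rule P.UA.ue_closed[OF P.co_sec[OF P.fpow_sec[OF L.sx(1)[OF s]]]])
 qed
 show ?thesis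
 by (rule P.UA.U.ideal_closed(7)[OF P.UA.U.idl_ideal[OF cl] P.UA.U.idl_mem[OF cl]])
 (use z P.pr_closed[OF l(1)[OF N.one_closed]] in auto)
 qed
 ultimately show "z : nonstandard_tight_closure D \<Lambda> \<theta> bs \<aa>"
 unfolding nonstandard_tight_closure_def Let_def hull eta Fi using zc N.one_closed by blast
 qed
qed

end
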